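(* Let $V$ be a finite dimensional $\Gamma$-graded vector space, $\mathrm U=\mathrm U(\mathfrak{gl}(V))$, and let $\mathscr T(V)$ be the subalgebra of the finite dual $\mathrm U^0$ generated by the matrix coefficients $t_{ba}$ of $V$ and $\overline t_{ba}$ of $V^*$ ($1\le a,b\le\dim V$). Then $\mathscr T(V)$ is a Hopf $(\Gamma,\omega)$-subalgebra of $\mathrm U^0$, with co-multiplication $\Delta$, co-unit $\varepsilon$ and antipode $S$ given by $$\Delta(t_{ba})=\sum_ct_{bc}\otimes t_{ca},\qquad\Delta(\overline t_{ba})=\sum_c\overline t_{bc}\otimes\overline t_{ca},\qquad\varepsilon(t_{ba})=\varepsilon(\overline t_{ba})=\delta_{ab},$$ $$S(t_{ba})=\omega(\gamma_a-\gamma_b,\gamma_a)\,\overline t_{ab},\qquad S(\overline t_{ab})=\omega(\gamma_a,\gamma_a-\gamma_b)\,t_{ba},\qquad\forall a,b.$$ In particular, the subalgebra $T$ generated by the $t_{ba}$ and the subalgebra $\overline T$ generated by the $\overline t_{ba}$ are $(\Gamma,\omega)$-bi-subalgebras of $\mathscr T(V)$, and the homogeneous subspaces $T_r$ and $\overline T_{-r}$ with respect to the $\mathbb Z$-grading are two-sided co-ideals in the sense that $\Delta(T_r)\subset T_r\otimes T_r$ and $\Delta(\overline T_{-r})\subset\overline T_{-r}\otimes\overline T_{-r}$.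
   Context: All vector spaces are over $\mathbb C$. $\Gamma$ is an additive abelian group with a commutative factor $\omega:\Gamma\times\Gamma\to\mathbb C^*$, i.e. $\omega(\alpha,\beta)=\omega(\beta,\alpha)^{-1}$ and $\omega$ is multiplicative in each argument. $d(x)$ is the degree of a homogeneous element; formulas with $d$ are extended linearly. Tensor products of $\Gamma$-graded algebras have multiplication $(a\otimes b)(a'\otimes b')=\omega(d(b),d(a'))aa'\otimes bb'$. In a Hopf $(\Gamma,\omega)$-algebra, $\Delta,\varepsilon$ are degree-$0$ algebra homomorphisms (coassociative, counital) and the antipode satisfies $S(xy)=\omega(d(x),d(y))S(y)S(x)$ and the usual antipode identities. $V=\bigoplus_\alpha V_\alpha$; $\mathfrak{gl}(V)=\mathrm{End}_{\mathbb C}(V)$ graded by $\mathfrak{gl}(V)_\alpha=\bigoplus_\beta\mathrm{Hom}(V_\beta,V_{\alpha+\beta})$ with bracket $[X,Y]=XY-\omega(d(X),d(Y))YX$; $\mathrm U$ is the tensor algebra modulo $XY-\omega(d(X),d(Y))YX=[X,Y]$, a Hopf $(\Gamma,\omega)$-algebra with $\Delta(X)=X\otimes1+1\otimes X$, $\varepsilon(X)=0$, $S(X)=-X$ for $X\in\mathfrak{gl}(V)$. $V^*$, graded by $(V^* )_{-\alpha}=(V_\alpha)^*$, has action $\langle x\cdot f,v\rangle=\omega(d(x),d(f))\langle f,S(x)v\rangle$. The finite dual $\mathrm U^0\subset\mathrm U^*$ is the span of homogeneous functionals (of degree $\gamma$ if they vanish on $\mathrm U_\alpha$ for $\alpha\ne-\gamma$)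 vanishing on a two-sided graded ideal of finite codimension. With $\langle f\otimes g,x\otimes y\rangle=\omega(d(g),d(x))\langle f,x\rangle\langle g,y\rangle$, it is a Hopf $(\Gamma,\omega)$-algebra by $\langle fg,x\rangle=\langle f\otimes g,\Delta(x)\rangle$, unit $\varepsilon$, $\langle\Delta(f),x\otimes y\rangle=\langle f,xy\rangle$, co-unit $f\mapsto f(1)$, $\langle S(f),x\rangle=\langle f,S(x)\rangle$. Let $(b_a)$ be a homogeneous basis of $V$, $\gamma_a=d(b_a)$, and $(\overline b_a)$ the dual basis of $V^*$. The elements $t_{ba},\overline t_{ba}\in\mathrm U^0$, of degrees $\gamma_a-\gamma_b$ and $\gamma_b-\gamma_a$, are defined by $x\cdot b_a=\sum_b\omega(d(x),\gamma_a)\langle t_{ba},x\rangle b_b$ and $x\cdot\overline b_a=\sum_b\omega(d(x),-\gamma_a)\langle\overline t_{ba},x\rangle\overline b_b$ for homogeneous $x\in\mathrm U$ (equivalently, the right $\mathrm U^0$-co-module structures are $b_a\mapsto\sum_bb_b\otimes t_{ba}$, $\overline b_a\mapsto\sum_b\overline b_b\otimes\overline t_{ba}$). $\mathscr T(V)$ is $\mathbb Z$-graded with $t_{ba}$ of degree $1$ and $\overline t_{ba}$ of degree $-1$; thus $T_r$ (resp. $\overline T_{-r}$), $r\ge0$, is spanned by products of $r$ elements $t_{ba}$ (resp. $\overline t_{ba}$). *)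

theory Defs
  imports
    Complex_Main
    "HOL-Library.Poly_Mapping"
    "HOL-Library.Function_Algebras"
    "HOL-Algebra.QuotRing"
    "HOL-Algebra.Module"
begin

section \<open>Graded algebras over the complex numbers\<close>

definition commutative_factor :: "('g::ab_group_add \<Rightarrow> 'g \<Rightarrow> complex) \<Rightarrow> bool" where
  "commutative_factor \<omega> \<longleftrightarrow>
     (\<forall>\<alpha> \<beta>. \<omega> \<alpha> \<beta> \<noteq> 0 \<and> \<omega> \<alpha> \<beta> = inverse (\<omega> \<beta> \<alpha>)) \<and>
     (\<forall>\<alpha> \<beta> \<gamma>. \<omega> (\<alpha> + \<beta>) \<gamma> = \<omega> \<alpha> \<gamma> * \<omega> \<beta> \<gamma> \<and> \<omega> \<alpha> (\<beta> + \<gamma>) = \<omega> \<alpha> \<beta> * \<omega> \<alpha> \<gamma>)"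

text \<open>The complex numbers as an algebra over themselves; as a ring this is also the ground field.\<close>

definition complex_alg :: "(complex, complex) module" where
  "complex_alg = \<lparr>carrier = UNIV, mult = (*), one = 1, zero = 0, add = (+), smult = (*)\<rparr>"

record ('g, 'a) graded = "(complex, 'a) module" +
  grade :: "'g \<Rightarrow> 'a set"

text \<open>The locale \<^locale>\<open>algebra\<close> of HOL-Algebra requires commutativity, so it is of no use here.\<close>

definition complex_algebra :: "(complex, 'a, 'm) module_scheme \<Rightarrow> bool" where
  "complex_algebra M \<longleftrightarrow> ring M \<and> Module.module complex_alg M \<and>
     (\<forall>c. \<forall>x\<in>carrier M. \<forall>y\<in>carrier M.
        c \<odot>\<^bsub>M\<^esub> (x \<otimes>\<^bsub>M\<^esub> y) = (c \<odot>\<^bsub>M\<^esub> x) \<otimes>\<^bsub>M\<^esub> y \<and>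
        c \<odot>\<^bsub>M\<^esub> (x \<otimes>\<^bsub>M\<^esub> y) = x \<otimes>\<^bsub>M\<^esub> (c \<odot>\<^bsub>M\<^esub> y))"

definition alg_hom :: "(complex, 'a, 'm) module_scheme \<Rightarrow> (complex, 'b, 'n) module_scheme \<Rightarrow> ('a \<Rightarrow> 'b) \<Rightarrow> bool" where
  "alg_hom M N h \<longleftrightarrow> h \<in> ring_hom M N \<and> (\<forall>c. \<forall>x\<in>carrier M. h (c \<odot>\<^bsub>M\<^esub> x) = c \<odot>\<^bsub>N\<^esub> h x)"

text \<open>\<open>u\<close> is the family of homogeneous components of \<open>x\<close>.\<close>

definition hdecomp :: "('g, 'a, 'm) graded_scheme \<Rightarrow> 'a \<Rightarrow> ('g \<Rightarrow> 'a) \<Rightarrow> bool" where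
  "hdecomp M x u \<longleftrightarrow> (\<forall>\<alpha>. u \<alpha> \<in> grade M \<alpha>) \<and> finite {\<alpha>. u \<alpha> \<noteq> \<zero>\<^bsub>M\<^esub>} \<and>
     x = finsum M u {\<alpha>. u \<alpha> \<noteq> \<zero>\<^bsub>M\<^esub>}"

definition hpart :: "('g, 'a, 'm) graded_scheme \<Rightarrow> 'g \<Rightarrow> 'a \<Rightarrow> 'a" where
  "hpart M \<alpha> x = (THE u. hdecomp M x u) \<alpha>"

definition hsupp :: "('g, 'a, 'm) graded_scheme \<Rightarrow> 'a \<Rightarrow> 'g set" where
  "hsupp M x = {\<alpha>. hpart M \<alpha> x \<noteq> \<zero>\<^bsub>M\<^esub>}"

definition graded_algebra :: "('g::ab_group_add, 'a, 'm) graded_scheme \<Rightarrow> bool" where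
  "graded_algebra M \<longleftrightarrow> complex_algebra M \<and>
     (\<forall>\<alpha>. submodule (grade M \<alpha>) complex_alg M) \<and>
     (\<forall>x\<in>carrier M. \<exists>!u. hdecomp M x u) \<and>
     \<one>\<^bsub>M\<^esub> \<in> grade M 0 \<and>
     (\<forall>\<alpha> \<beta>. \<forall>x\<in>grade M \<alpha>. \<forall>y\<in>grade M \<beta>. x \<otimes>\<^bsub>M\<^esub> y \<in> grade M (\<alpha> + \<beta>))"

inductive_set lspan :: "(complex, 'a, 'm) module_scheme \<Rightarrow> 'a set \<Rightarrow> 'a set"
  for M :: "(complex, 'a, 'm) module_scheme" and S :: "'a set" where
  zero: "\<zero>\<^bsub>M\<^esub> \<in> lspan M S"
| base: "x \<in> S \<Longrightarrow> x \<in> lspan M S"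
| add: "x \<in> lspan M S \<Longrightarrow> y \<in> lspan M S \<Longrightarrow> x \<oplus>\<^bsub>M\<^esub> y \<in> lspan M S"
| smult: "x \<in> lspan M S \<Longrightarrow> c \<odot>\<^bsub>M\<^esub> x \<in> lspan M S"

inductive_set gen_subalgebra :: "(complex, 'a, 'm) module_scheme \<Rightarrow> 'a set \<Rightarrow> 'a set"
  for M :: "(complex, 'a, 'm) module_scheme" and S :: "'a set" where
  zero: "\<zero>\<^bsub>M\<^esub> \<in> gen_subalgebra M S"
| one: "\<one>\<^bsub>M\<^esub> \<in> gen_subalgebra M S"
| base: "x \<in> S \<Longrightarrow> x \<in> gen_subalgebra M S"
| add: "x \<in> gen_subalgebra M S \<Longrightarrow> y \<in> gen_subalgebra M S \<Longrightarrow> x \<oplus>\<^bsub>M\<^esub> y \<in> gen_subalgebra M S"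
| smult: "x \<in> gen_subalgebra M S \<Longrightarrow> c \<odot>\<^bsub>M\<^esub> x \<in> gen_subalgebra M S"
| mult: "x \<in> gen_subalgebra M S \<Longrightarrow> y \<in> gen_subalgebra M S \<Longrightarrow> x \<otimes>\<^bsub>M\<^esub> y \<in> gen_subalgebra M S"

definition product_span :: "(complex, 'a, 'm) module_scheme \<Rightarrow> 'a set \<Rightarrow> nat \<Rightarrow> 'a set" where
  "product_span M S r =
     lspan M {foldr (\<lambda>x y. x \<otimes>\<^bsub>M\<^esub> y) xs \<one>\<^bsub>M\<^esub> |xs. length xs = r \<and> set xs \<subseteq> S}"

definition list_msum :: "('a, 'm) ring_scheme \<Rightarrow> 'a list \<Rightarrow> 'a" where
  "list_msum M xs = foldr (\<lambda>x y. x \<oplus>\<^bsub>M\<^esub> y) xs \<zero>\<^bsub>M\<^esub>"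


section \<open>Tensor products\<close>

text \<open>
  The tensor product of two complex vector spaces \<open>M\<close>, \<open>N\<close> is realised inside the algebraic dual of
  the space of bilinear forms on \<open>M \<times> N\<close>: \<open>x \<otimes> y\<close> is evaluation of bilinear forms at \<open>(x, y)\<close>
  (the value on functions which are not bilinear being set to \<open>0\<close>), and \<open>M \<otimes> N\<close> is the linear span
  of these elements. Sums of tensors are pointwise sums.
\<close>

type_synonym ('a, 'b) tensor = "('a \<Rightarrow> 'b \<Rightarrow> complex) \<Rightarrow> complex"

definition bilin :: "(complex, 'a, 'm) module_scheme \<Rightarrow> (complex, 'b, 'n) module_scheme \<Rightarrow> ('a \<Rightarrow> 'b \<Rightarrow> complex) set" where
  "bilin M N = {B.
     (\<forall>x\<in>carrier M. \<forall>x'\<in>carrier M. \<forall>y\<in>carrier N. B (x \<oplus>\<^bsub>M\<^esub> x') y = B x y + B x' y) \<and>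
     (\<forall>x\<in>carrier M. \<forall>y\<in>carrier N. \<forall>y'\<in>carrier N. B x (y \<oplus>\<^bsub>N\<^esub> y') = B x y + B x y') \<and>
     (\<forall>c. \<forall>x\<in>carrier M. \<forall>y\<in>carrier N. B (c \<odot>\<^bsub>M\<^esub> x) y = c * B x y \<and> B x (c \<odot>\<^bsub>N\<^esub> y) = c * B x y)}"

definition pure_tensor :: "(complex, 'a, 'm) module_scheme \<Rightarrow> (complex, 'b, 'n) module_scheme \<Rightarrow> 'a \<Rightarrow> 'b \<Rightarrow> ('a, 'b) tensor" where
  "pure_tensor M N x y = (\<lambda>B. if B \<in> bilin M N then B x y else 0)"

definition tensor_sums :: "(complex, 'a, 'm) module_scheme \<Rightarrow> (complex, 'b, 'n) module_scheme \<Rightarrow> ('a \<times> 'b) set \<Rightarrow> ('a, 'b) tensor set" where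
  "tensor_sums M N R = {sum_list (map (\<lambda>(x, y). pure_tensor M N x y) ps) |ps. set ps \<subseteq> R}"

text \<open>For linear subspaces \<open>X\<close> of \<open>M\<close> and \<open>Y\<close> of \<open>N\<close>, the subspace \<open>X \<otimes> Y\<close> of \<open>M \<otimes> N\<close>; scalars can
  be absorbed into the factors.\<close>

definition tensor_sub :: "(complex, 'a, 'm) module_scheme \<Rightarrow> (complex, 'b, 'n) module_scheme \<Rightarrow> 'a set \<Rightarrow> 'b set \<Rightarrow> ('a, 'b) tensor set" where
  "tensor_sub M N X Y = tensor_sums M N (X \<times> Y)"

text \<open>The product is the bilinear extension of
  \<open>(x \<otimes> y) (x' \<otimes> y') = \<omega> (deg y) (deg x') xx' \<otimes> yy'\<close> for homogeneous \<open>y\<close> and \<open>x'\<close>, tested against a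
  bilinear form \<open>B\<close>.\<close>

definition tensor_mult :: "('g \<Rightarrow> 'g \<Rightarrow> complex) \<Rightarrow> ('g, 'a, 'm) graded_scheme \<Rightarrow> ('g, 'b, 'n) graded_scheme
    \<Rightarrow> ('a, 'b) tensor \<Rightarrow> ('a, 'b) tensor \<Rightarrow> ('a, 'b) tensor" where
  "tensor_mult \<omega> M N z w = (\<lambda>B. if B \<in> bilin M N then
     z (\<lambda>x y. w (\<lambda>x' y'. \<Sum>\<beta>\<in>hsupp N y. \<Sum>\<alpha>\<in>hsupp M x'.
       \<omega> \<beta> \<alpha> * B (x \<otimes>\<^bsub>M\<^esub> hpart M \<alpha> x') (hpart N \<beta> y \<otimes>\<^bsub>N\<^esub> y'))) else 0)"

definition tensor_alg :: "('g::ab_group_add \<Rightarrow> 'g \<Rightarrow> complex) \<Rightarrow> ('g, 'a, 'm) graded_scheme \<Rightarrow> ('g, 'b, 'n) graded_scheme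
    \<Rightarrow> ('g, ('a, 'b) tensor) graded" where
  "tensor_alg \<omega> M N = \<lparr>
     carrier = tensor_sub M N (carrier M) (carrier N),
     mult = tensor_mult \<omega> M N,
     one = pure_tensor M N \<one>\<^bsub>M\<^esub> \<one>\<^bsub>N\<^esub>,
     zero = 0,
     add = (+),
     smult = (\<lambda>c z B. c * z B),
     grade = (\<lambda>\<gamma>. tensor_sums M N {(x, y). \<exists>\<alpha>. x \<in> grade M \<alpha> \<and> y \<in> grade N (\<gamma> - \<alpha>)})\<rparr>"

definition trilin :: "(complex, 'a, 'm) module_scheme \<Rightarrow> ('a \<Rightarrow> 'a \<Rightarrow> 'a \<Rightarrow> complex) \<Rightarrow> bool" where
  "trilin M B \<longleftrightarrow> (\<forall>z\<in>carrier M. (\<lambda>x y. B x y z) \<in> bilin M M) \<and> (\<forall>x\<in>carrier M. B x \<in> bilin M M)"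


section \<open>Hopf algebras with a commutative factor\<close>

record ('g, 'a) hopf = "('g, 'a) graded" +
  comult :: "'a \<Rightarrow> ('a, 'a) tensor"
  counit :: "'a \<Rightarrow> complex"
  antipode :: "'a \<Rightarrow> 'a"

text \<open>
  \<open>bialgebra_on \<omega> H A\<close> and \<open>hopf_on \<omega> H A\<close>: the subset \<open>A\<close> of the carrier of \<open>H\<close> is a bialgebra,
  respectively Hopf algebra, for the operations of \<open>H\<close>; for \<open>A = carrier H\<close> these are the axioms
  for \<open>H\<close> itself. Here \<open>A \<otimes> A\<close> is taken inside \<open>H \<otimes> H\<close>. Co-associativity, the co-unit law and the
  antipode law are stated for an arbitrary expression \<open>\<Delta>(x) = \<Sum>\<^sub>i y\<^sub>i \<otimes> z\<^sub>i\<close> given by the list \<open>ps\<close>;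
  the equation \<open>\<Sum>\<^sub>i \<Delta>(y\<^sub>i) \<otimes> z\<^sub>i = \<Sum>\<^sub>i y\<^sub>i \<otimes> \<Delta>(z\<^sub>i)\<close> is tested against trilinear forms, in accordance
  with the model of tensor products used.
\<close>

definition sub_graded :: "('g, 'a, 'm) graded_scheme \<Rightarrow> 'a set \<Rightarrow> ('g, 'a, 'm) graded_scheme" where
  "sub_graded H A = H\<lparr>carrier := A, grade := (\<lambda>\<alpha>. grade H \<alpha> \<inter> A)\<rparr>"

definition expresses :: "('g, 'a) hopf \<Rightarrow> 'a set \<Rightarrow> 'a \<Rightarrow> ('a \<times> 'a) list \<Rightarrow> bool" where
  "expresses H A x ps \<longleftrightarrow> set ps \<subseteq> A \<times> A \<and> comult H x = sum_list (map (\<lambda>(y, z). pure_tensor H H y z) ps)"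

definition bialgebra_on :: "('g::ab_group_add \<Rightarrow> 'g \<Rightarrow> complex) \<Rightarrow> ('g, 'a) hopf \<Rightarrow> 'a set \<Rightarrow> bool" where
  "bialgebra_on \<omega> H A \<longleftrightarrow>
     graded_algebra (sub_graded H A) \<and>
     alg_hom (sub_graded H A) (tensor_alg \<omega> H H) (comult H) \<and>
     comult H ` A \<subseteq> tensor_sub H H A A \<and>
     (\<forall>\<alpha>. comult H ` (grade H \<alpha> \<inter> A) \<subseteq> grade (tensor_alg \<omega> H H) \<alpha>) \<and>
     alg_hom (sub_graded H A) complex_alg (counit H) \<and>
     (\<forall>\<alpha>. \<alpha> \<noteq> 0 \<longrightarrow> (\<forall>x\<in>grade H \<alpha> \<inter> A. counit H x = 0)) \<and>
     (\<forall>x\<in>A. \<forall>ps. expresses H A x ps \<longrightarrow>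
        (\<forall>B. trilin H B \<longrightarrow>
           sum_list (map (\<lambda>(y, z). comult H y (\<lambda>u v. B u v z)) ps) =
           sum_list (map (\<lambda>(y, z). comult H z (\<lambda>u v. B y u v)) ps)) \<and>
        list_msum H (map (\<lambda>(y, z). counit H y \<odot>\<^bsub>H\<^esub> z) ps) = x \<and>
        list_msum H (map (\<lambda>(y, z). counit H z \<odot>\<^bsub>H\<^esub> y) ps) = x)"

definition hopf_on :: "('g::ab_group_add \<Rightarrow> 'g \<Rightarrow> complex) \<Rightarrow> ('g, 'a) hopf \<Rightarrow> 'a set \<Rightarrow> bool" where
  "hopf_on \<omega> H A \<longleftrightarrow> bialgebra_on \<omega> H A \<and>
     antipode H ` A \<subseteq> A \<and>
     (\<forall>x\<in>A. \<forall>y\<in>A. antipode H (x \<oplus>\<^bsub>H\<^esub> y) = antipode H x \<oplus>\<^bsub>H\<^esub> antipode H y) \<and>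
     (\<forall>c. \<forall>x\<in>A. antipode H (c \<odot>\<^bsub>H\<^esub> x) = c \<odot>\<^bsub>H\<^esub> antipode H x) \<and>
     (\<forall>\<alpha>. antipode H ` (grade H \<alpha> \<inter> A) \<subseteq> grade H \<alpha>) \<and>
     (\<forall>\<alpha> \<beta>. \<forall>x\<in>grade H \<alpha> \<inter> A. \<forall>y\<in>grade H \<beta> \<inter> A.
        antipode H (x \<otimes>\<^bsub>H\<^esub> y) = \<omega> \<alpha> \<beta> \<odot>\<^bsub>H\<^esub> (antipode H y \<otimes>\<^bsub>H\<^esub> antipode H x)) \<and>
     (\<forall>x\<in>A. \<forall>ps. expresses H A x ps \<longrightarrow>
        list_msum H (map (\<lambda>(y, z). antipode H y \<otimes>\<^bsub>H\<^esub> z) ps) = counit H x \<odot>\<^bsub>H\<^esub> \<one>\<^bsub>H\<^esub> \<and>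
        list_msum H (map (\<lambda>(y, z). y \<otimes>\<^bsub>H\<^esub> antipode H z) ps) = counit H x \<odot>\<^bsub>H\<^esub> \<one>\<^bsub>H\<^esub>)"

definition bi_subalgebra :: "('g::ab_group_add \<Rightarrow> 'g \<Rightarrow> complex) \<Rightarrow> ('g, 'a) hopf \<Rightarrow> 'a set \<Rightarrow> bool" where
  "bi_subalgebra \<omega> H A \<longleftrightarrow> A \<subseteq> carrier H \<and> bialgebra_on \<omega> H A"

definition hopf_subalgebra :: "('g::ab_group_add \<Rightarrow> 'g \<Rightarrow> complex) \<Rightarrow> ('g, 'a) hopf \<Rightarrow> 'a set \<Rightarrow> bool" where
  "hopf_subalgebra \<omega> H A \<longleftrightarrow> A \<subseteq> carrier H \<and> hopf_on \<omega> H A"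


section \<open>The finite dual\<close>

text \<open>Linear functionals on \<open>H\<close>, extended by \<open>0\<close> outside the carrier.\<close>

definition dual_space :: "(complex, 'a, 'm) module_scheme \<Rightarrow> ('a \<Rightarrow> complex) set" where
  "dual_space H = {f. (\<forall>x. x \<notin> carrier H \<longrightarrow> f x = 0) \<and>
     (\<forall>x\<in>carrier H. \<forall>y\<in>carrier H. f (x \<oplus>\<^bsub>H\<^esub> y) = f x + f y) \<and>
     (\<forall>c. \<forall>x\<in>carrier H. f (c \<odot>\<^bsub>H\<^esub> x) = c * f x)}"

definition dual_grade :: "('g::ab_group_add, 'a, 'm) graded_scheme \<Rightarrow> 'g \<Rightarrow> ('a \<Rightarrow> complex) set" where
  "dual_grade H \<gamma> = {f \<in> dual_space H. \<forall>\<alpha>. \<alpha> \<noteq> - \<gamma> \<longrightarrow> (\<forall>x\<in>grade H \<alpha>. f x = 0)}"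

definition cofinite_graded_ideal :: "('g, 'a, 'm) graded_scheme \<Rightarrow> 'a set \<Rightarrow> bool" where
  "cofinite_graded_ideal H J \<longleftrightarrow> ideal J H \<and> (\<forall>x\<in>J. \<forall>\<alpha>. hpart H \<alpha> x \<in> J) \<and>
     (\<exists>S. finite S \<and> S \<subseteq> carrier H \<and> (\<forall>x\<in>carrier H. \<exists>y\<in>lspan H S. x \<ominus>\<^bsub>H\<^esub> y \<in> J))"

definition finite_dual_carrier :: "('g::ab_group_add, 'a, 'm) graded_scheme \<Rightarrow> ('a \<Rightarrow> complex) set" where
  "finite_dual_carrier H = {sum_list fs |fs. set fs \<subseteq>
     {f. \<exists>\<gamma> J. f \<in> dual_grade H \<gamma> \<and> cofinite_graded_ideal H J \<and> (\<forall>x\<in>J. f x = 0)}}"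

text \<open>\<open>\<langle>f \<otimes> g, x \<otimes> y\<rangle> = \<omega> (deg g) (deg x) f(x) g(y)\<close> for homogeneous \<open>g\<close> and \<open>x\<close>, extended linearly:
  the component of \<open>g\<close> of degree \<open>-\<beta>\<close> sends \<open>y\<close> to the value of \<open>g\<close> at the component of \<open>y\<close> of
  degree \<open>\<beta>\<close>.\<close>

definition pairing :: "('g::ab_group_add \<Rightarrow> 'g \<Rightarrow> complex) \<Rightarrow> ('g, 'a, 'm) graded_scheme
    \<Rightarrow> ('a \<Rightarrow> complex) \<Rightarrow> ('a \<Rightarrow> complex) \<Rightarrow> 'a \<Rightarrow> 'a \<Rightarrow> complex" where
  "pairing \<omega> H f g x y =
     (\<Sum>\<alpha>\<in>hsupp H x. \<Sum>\<beta>\<in>hsupp H y. \<omega> (- \<beta>) \<alpha> * f (hpart H \<alpha> x) * g (hpart H \<beta> y))"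

text \<open>A tensor is a functional on bilinear forms, so \<open>\<langle>f \<otimes> g, w\<rangle>\<close> for a tensor \<open>w\<close> over \<open>H\<close> is
  \<open>w (pairing \<omega> H f g)\<close>, and \<open>\<langle>z, x \<otimes> y\<rangle>\<close> for a tensor \<open>z\<close> over the dual is
  \<open>z (\<lambda>f g. pairing \<omega> H f g x y)\<close>.\<close>

definition finite_dual_alg :: "('g::ab_group_add \<Rightarrow> 'g \<Rightarrow> complex) \<Rightarrow> ('g, 'a) hopf \<Rightarrow> ('g, 'a \<Rightarrow> complex) graded" where
  "finite_dual_alg \<omega> H = \<lparr>
     carrier = finite_dual_carrier H,
     mult = (\<lambda>f g x. if x \<in> carrier H then comult H x (pairing \<omega> H f g) else 0),
     one = (\<lambda>x. if x \<in> carrier H then counit H x else 0),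
     zero = 0,
     add = (+),
     smult = (\<lambda>c f x. c * f x),
     grade = (\<lambda>\<gamma>. finite_dual_carrier H \<inter> dual_grade H \<gamma>)\<rparr>"

definition dual_comult :: "('g::ab_group_add \<Rightarrow> 'g \<Rightarrow> complex) \<Rightarrow> ('g, 'a) hopf
    \<Rightarrow> ('a \<Rightarrow> complex) \<Rightarrow> ('a \<Rightarrow> complex, 'a \<Rightarrow> complex) tensor" where
  "dual_comult \<omega> H f = (THE z. z \<in> carrier (tensor_alg \<omega> (finite_dual_alg \<omega> H) (finite_dual_alg \<omega> H)) \<and>
     (\<forall>x\<in>carrier H. \<forall>y\<in>carrier H. z (\<lambda>g h. pairing \<omega> H g h x y) = f (x \<otimes>\<^bsub>H\<^esub> y)))"

definition finite_dual :: "('g::ab_group_add \<Rightarrow> 'g \<Rightarrow> complex) \<Rightarrow> ('g, 'a) hopf \<Rightarrow> ('g, 'a \<Rightarrow> complex) hopf" where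
  "finite_dual \<omega> H = graded.extend (finite_dual_alg \<omega> H) (hopf.fields
     (dual_comult \<omega> H)
     (\<lambda>f. f \<one>\<^bsub>H\<^esub>)
     (\<lambda>f x. if x \<in> carrier H then f (antipode H x) else 0))"


section \<open>Graded vector spaces and the general linear Lie algebra\<close>

definition vdecomp :: "('g \<Rightarrow> 'v::ab_group_add set) \<Rightarrow> 'v \<Rightarrow> ('g \<Rightarrow> 'v) \<Rightarrow> bool" where
  "vdecomp V v u \<longleftrightarrow> (\<forall>\<alpha>. u \<alpha> \<in> V \<alpha>) \<and> finite {\<alpha>. u \<alpha> \<noteq> 0} \<and> v = (\<Sum>\<alpha> | u \<alpha> \<noteq> 0. u \<alpha>)"

definition vpart :: "('g \<Rightarrow> 'v::ab_group_add set) \<Rightarrow> 'g \<Rightarrow> 'v \<Rightarrow> 'v" where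
  "vpart V \<alpha> v = (THE u. vdecomp V v u) \<alpha>"

definition graded_vector_space :: "(complex \<Rightarrow> 'v \<Rightarrow> 'v) \<Rightarrow> ('g \<Rightarrow> 'v::ab_group_add set) \<Rightarrow> bool" where
  "graded_vector_space scale V \<longleftrightarrow> vector_space scale \<and> (\<forall>\<alpha>. module.subspace scale (V \<alpha>)) \<and>
     (\<forall>v. \<exists>!u. vdecomp V v u)"

text \<open>The basis is indexed by \<open>{1..n}\<close>, so the space has dimension \<open>n\<close>, and \<open>n = 0\<close> is allowed.\<close>

definition homogeneous_basis :: "(complex \<Rightarrow> 'v \<Rightarrow> 'v) \<Rightarrow> ('g \<Rightarrow> 'v::ab_group_add set) \<Rightarrow> nat \<Rightarrow> (nat \<Rightarrow> 'v) \<Rightarrow> (nat \<Rightarrow> 'g) \<Rightarrow> bool" where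
  "homogeneous_basis scale V n e \<gamma> \<longleftrightarrow> inj_on e {1..n} \<and> \<not> module.dependent scale (e ` {1..n}) \<and>
     module.span scale (e ` {1..n}) = UNIV \<and> (\<forall>a\<in>{1..n}. e a \<in> V (\<gamma> a))"

definition gl :: "(complex \<Rightarrow> 'v::ab_group_add \<Rightarrow> 'v) \<Rightarrow> ('v \<Rightarrow> 'v) set" where
  "gl scale = {X. Vector_Spaces.linear scale scale X}"

definition gl_grade :: "(complex \<Rightarrow> 'v \<Rightarrow> 'v) \<Rightarrow> ('g::ab_group_add \<Rightarrow> 'v::ab_group_add set) \<Rightarrow> 'g \<Rightarrow> ('v \<Rightarrow> 'v) set" where
  "gl_grade scale V \<alpha> = {X \<in> gl scale. \<forall>\<beta>. X ` V \<beta> \<subseteq> V (\<alpha> + \<beta>)}"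


section \<open>The enveloping algebra\<close>

text \<open>Words, with concatenation written additively, so that \<open>'x fword \<Rightarrow>\<^sub>0 complex\<close> is the free algebra
  on \<open>'x\<close>.\<close>

datatype 'x fword = Word (letters: "'x list")

instantiation fword :: (type) monoid_add
begin

definition zero_fword :: "'x fword" where
  "zero_fword = Word []"

definition plus_fword :: "'x fword \<Rightarrow> 'x fword \<Rightarrow> 'x fword" where
  "plus_fword v w = Word (letters v @ letters w)"

instance
  by standard (simp_all add: zero_fword_def plus_fword_def)

end

definition free_alg :: "'x set \<Rightarrow> (complex, 'x fword \<Rightarrow>\<^sub>0 complex) module" where
  "free_alg G = \<lparr>carrier = {x. \<forall>w\<in>Poly_Mapping.keys x. set (letters w) \<subseteq> G}, mult = (*), one = 1,
     zero = 0, add = (+), smult = (\<lambda>c x. Poly_Mapping.single 0 c * x)\<rparr>"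

definition gen :: "'x \<Rightarrow> 'x fword \<Rightarrow>\<^sub>0 complex" where
  "gen X = Poly_Mapping.single (Word [X]) 1"

text \<open>The tensor algebra of \<open>gl(V)\<close> is the free algebra on the set \<open>gl(V)\<close> modulo the first two
  families of relations, which make the inclusion of \<open>gl(V)\<close> linear; the third family is
  \<open>XY - \<omega> (deg X) (deg Y) YX = [X, Y]\<close>.\<close>

definition env_relations :: "('g::ab_group_add \<Rightarrow> 'g \<Rightarrow> complex) \<Rightarrow> (complex \<Rightarrow> 'v \<Rightarrow> 'v) \<Rightarrow> ('g \<Rightarrow> 'v::ab_group_add set)
    \<Rightarrow> (('v \<Rightarrow> 'v) fword \<Rightarrow>\<^sub>0 complex) set" where
  "env_relations \<omega> scale V =
     {gen (\<lambda>v. X v + Y v) - gen X - gen Y |X Y. X \<in> gl scale \<and> Y \<in> gl scale} \<union>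
     {gen (\<lambda>v. scale c (X v)) - Poly_Mapping.single 0 c * gen X |c X. X \<in> gl scale} \<union>
     {gen X * gen Y - Poly_Mapping.single 0 (\<omega> \<alpha> \<beta>) * (gen Y * gen X)
        - gen (\<lambda>v. X (Y v) - scale (\<omega> \<alpha> \<beta>) (Y (X v))) |X Y \<alpha> \<beta>.
        X \<in> gl_grade scale V \<alpha> \<and> Y \<in> gl_grade scale V \<beta>}"

definition env_ideal :: "('g::ab_group_add \<Rightarrow> 'g \<Rightarrow> complex) \<Rightarrow> (complex \<Rightarrow> 'v \<Rightarrow> 'v) \<Rightarrow> ('g \<Rightarrow> 'v::ab_group_add set)
    \<Rightarrow> (('v \<Rightarrow> 'v) fword \<Rightarrow>\<^sub>0 complex) set" where
  "env_ideal \<omega> scale V = genideal (free_alg (gl scale)) (env_relations \<omega> scale V)"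

type_synonym 'v env = "(('v \<Rightarrow> 'v) fword \<Rightarrow>\<^sub>0 complex) set"

definition env_class :: "('g::ab_group_add \<Rightarrow> 'g \<Rightarrow> complex) \<Rightarrow> (complex \<Rightarrow> 'v \<Rightarrow> 'v) \<Rightarrow> ('g \<Rightarrow> 'v::ab_group_add set)
    \<Rightarrow> (('v \<Rightarrow> 'v) fword \<Rightarrow>\<^sub>0 complex) \<Rightarrow> 'v env" where
  "env_class \<omega> scale V x = env_ideal \<omega> scale V +>\<^bsub>free_alg (gl scale)\<^esub> x"

definition env_alg :: "('g::ab_group_add \<Rightarrow> 'g \<Rightarrow> complex) \<Rightarrow> (complex \<Rightarrow> 'v \<Rightarrow> 'v) \<Rightarrow> ('g \<Rightarrow> 'v::ab_group_add set)
    \<Rightarrow> ('g, 'v env) graded" where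
  "env_alg \<omega> scale V = (let F = free_alg (gl scale); Q = F Quot env_ideal \<omega> scale V in
     \<lparr>carrier = carrier Q, mult = mult Q, one = one Q, zero = zero Q, add = add Q,
      smult = (\<lambda>c u. \<Union>x\<in>u. env_class \<omega> scale V (c \<odot>\<^bsub>F\<^esub> x)),
      grade = (\<lambda>\<alpha>. env_class \<omega> scale V `
        {x. \<forall>w\<in>Poly_Mapping.keys x. \<exists>ds.
              list_all2 (\<lambda>X d. X \<in> gl_grade scale V d) (letters w) ds \<and> sum_list ds = \<alpha>})\<rparr>)"

definition env_incl :: "('g::ab_group_add \<Rightarrow> 'g \<Rightarrow> complex) \<Rightarrow> (complex \<Rightarrow> 'v \<Rightarrow> 'v) \<Rightarrow> ('g \<Rightarrow> 'v::ab_group_add set)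
    \<Rightarrow> ('v \<Rightarrow> 'v) \<Rightarrow> 'v env" where
  "env_incl \<omega> scale V X = env_class \<omega> scale V (gen X)"

text \<open>Each of the following three structure maps is determined on the carrier by the stated
  conditions; the choice operator only leaves its values outside the carrier unspecified.\<close>

definition env_comult :: "('g::ab_group_add \<Rightarrow> 'g \<Rightarrow> complex) \<Rightarrow> (complex \<Rightarrow> 'v \<Rightarrow> 'v) \<Rightarrow> ('g \<Rightarrow> 'v::ab_group_add set)
    \<Rightarrow> 'v env \<Rightarrow> ('v env, 'v env) tensor" where
  "env_comult \<omega> scale V = (let U = env_alg \<omega> scale V; \<iota> = env_incl \<omega> scale V in
     SOME \<Delta>. alg_hom U (tensor_alg \<omega> U U) \<Delta> \<and>
       (\<forall>X\<in>gl scale. \<Delta> (\<iota> X) = pure_tensor U U (\<iota> X) \<one>\<^bsub>U\<^esub> + pure_tensor U U \<one>\<^bsub>U\<^esub> (\<iota> X)))"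

definition env_counit :: "('g::ab_group_add \<Rightarrow> 'g \<Rightarrow> complex) \<Rightarrow> (complex \<Rightarrow> 'v \<Rightarrow> 'v) \<Rightarrow> ('g \<Rightarrow> 'v::ab_group_add set)
    \<Rightarrow> 'v env \<Rightarrow> complex" where
  "env_counit \<omega> scale V = (SOME \<epsilon>. alg_hom (env_alg \<omega> scale V) complex_alg \<epsilon> \<and>
     (\<forall>X\<in>gl scale. \<epsilon> (env_incl \<omega> scale V X) = 0))"

definition env_antipode :: "('g::ab_group_add \<Rightarrow> 'g \<Rightarrow> complex) \<Rightarrow> (complex \<Rightarrow> 'v \<Rightarrow> 'v) \<Rightarrow> ('g \<Rightarrow> 'v::ab_group_add set)
    \<Rightarrow> 'v env \<Rightarrow> 'v env" where
  "env_antipode \<omega> scale V = (let U = env_alg \<omega> scale V; \<iota> = env_incl \<omega> scale V in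
     SOME S. S \<in> carrier U \<rightarrow> carrier U \<and>
       (\<forall>x\<in>carrier U. \<forall>y\<in>carrier U. S (x \<oplus>\<^bsub>U\<^esub> y) = S x \<oplus>\<^bsub>U\<^esub> S y) \<and>
       (\<forall>c. \<forall>x\<in>carrier U. S (c \<odot>\<^bsub>U\<^esub> x) = c \<odot>\<^bsub>U\<^esub> S x) \<and>
       S \<one>\<^bsub>U\<^esub> = \<one>\<^bsub>U\<^esub> \<and>
       (\<forall>\<alpha> \<beta>. \<forall>x\<in>grade U \<alpha>. \<forall>y\<in>grade U \<beta>. S (x \<otimes>\<^bsub>U\<^esub> y) = \<omega> \<alpha> \<beta> \<odot>\<^bsub>U\<^esub> (S y \<otimes>\<^bsub>U\<^esub> S x)) \<and>
       (\<forall>X\<in>gl scale. S (\<iota> X) = \<ominus>\<^bsub>U\<^esub> \<iota> X))"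

definition env :: "('g::ab_group_add \<Rightarrow> 'g \<Rightarrow> complex) \<Rightarrow> (complex \<Rightarrow> 'v \<Rightarrow> 'v) \<Rightarrow> ('g \<Rightarrow> 'v::ab_group_add set)
    \<Rightarrow> ('g, 'v env) hopf" where
  "env \<omega> scale V = graded.extend (env_alg \<omega> scale V) (hopf.fields
     (env_comult \<omega> scale V) (env_counit \<omega> scale V) (env_antipode \<omega> scale V))"


section \<open>Matrix coefficients of the natural module and its dual\<close>

text \<open>The action on \<open>V\<close>: letters act as the endomorphisms they are, and an element of the enveloping
  algebra acts through any representative in the free algebra.\<close>

definition free_act :: "(complex \<Rightarrow> 'v \<Rightarrow> 'v) \<Rightarrow> (('v \<Rightarrow> 'v) fword \<Rightarrow>\<^sub>0 complex) \<Rightarrow> 'v \<Rightarrow> 'v::ab_group_add" where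
  "free_act scale x v =
     (\<Sum>w\<in>Poly_Mapping.keys x. scale (Poly_Mapping.lookup x w) (foldr (\<lambda>X u. X u) (letters w) v))"

definition nat_act :: "(complex \<Rightarrow> 'v \<Rightarrow> 'v) \<Rightarrow> 'v env \<Rightarrow> 'v \<Rightarrow> 'v::ab_group_add" where
  "nat_act scale u v = free_act scale (SOME x. x \<in> u) v"

text \<open>\<open>\<langle>x \<cdot> f, v\<rangle> = \<omega> (deg x) (deg f) \<langle>f, S(x) v\<rangle>\<close>, extended linearly: the component of \<open>f\<close> of degree
  \<open>-\<beta>\<close> sends a vector to the value of \<open>f\<close> at its component in \<open>V \<beta>\<close>.\<close>

definition dual_act :: "('g::ab_group_add \<Rightarrow> 'g \<Rightarrow> complex) \<Rightarrow> (complex \<Rightarrow> 'v \<Rightarrow> 'v) \<Rightarrow> ('g \<Rightarrow> 'v::ab_group_add set)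
    \<Rightarrow> 'v env \<Rightarrow> ('v \<Rightarrow> complex) \<Rightarrow> 'v \<Rightarrow> complex" where
  "dual_act \<omega> scale V x f v = (let U = env \<omega> scale V in
     \<Sum>\<alpha>\<in>hsupp U x. let w = nat_act scale (antipode U (hpart U \<alpha> x)) v in
       \<Sum>\<beta> | vpart V \<beta> w \<noteq> 0. \<omega> \<alpha> (- \<beta>) * f (vpart V \<beta> w))"

definition dual_basis :: "(complex \<Rightarrow> 'v \<Rightarrow> 'v) \<Rightarrow> nat \<Rightarrow> (nat \<Rightarrow> 'v::ab_group_add) \<Rightarrow> nat \<Rightarrow> 'v \<Rightarrow> complex" where
  "dual_basis scale n e a v = module.representation scale (e ` {1..n}) v (e a)"

text \<open>The matrix coefficients, indexed by \<open>{1..n}\<close>, of a module with basis \<open>e\<close> of degrees \<open>\<gamma>\<close>: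
  \<open>x \<cdot> e\<^sub>a = \<Sum>\<^sub>b \<omega> (deg x) \<gamma>\<^sub>a \<langle>t\<^sub>b\<^sub>a, x\<rangle> e\<^sub>b\<close>. The clause for indices out of range only makes the
  description definite.\<close>

definition matrix_coeffs :: "('g::ab_group_add \<Rightarrow> 'g \<Rightarrow> complex) \<Rightarrow> ('g, 'u) hopf \<Rightarrow> nat
    \<Rightarrow> (complex \<Rightarrow> 'w \<Rightarrow> 'w) \<Rightarrow> ('u \<Rightarrow> 'w \<Rightarrow> 'w) \<Rightarrow> (nat \<Rightarrow> 'w::ab_group_add) \<Rightarrow> (nat \<Rightarrow> 'g)
    \<Rightarrow> nat \<Rightarrow> nat \<Rightarrow> 'u \<Rightarrow> complex" where
  "matrix_coeffs \<omega> U n smul act e \<gamma> = (THE t.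
     (\<forall>a b. if a \<in> {1..n} \<and> b \<in> {1..n} then t b a \<in> carrier (finite_dual \<omega> U) else t b a = 0) \<and>
     (\<forall>a\<in>{1..n}. \<forall>\<alpha>. \<forall>x\<in>grade U \<alpha>.
        act x (e a) = (\<Sum>b\<in>{1..n}. smul (\<omega> \<alpha> (\<gamma> a) * t b a x) (e b))))"

definition coeff_t :: "('g::ab_group_add \<Rightarrow> 'g \<Rightarrow> complex) \<Rightarrow> (complex \<Rightarrow> 'v \<Rightarrow> 'v) \<Rightarrow> ('g \<Rightarrow> 'v::ab_group_add set)
    \<Rightarrow> nat \<Rightarrow> (nat \<Rightarrow> 'v) \<Rightarrow> (nat \<Rightarrow> 'g) \<Rightarrow> nat \<Rightarrow> nat \<Rightarrow> 'v env \<Rightarrow> complex" where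
  "coeff_t \<omega> scale V n e \<gamma> = matrix_coeffs \<omega> (env \<omega> scale V) n scale (nat_act scale) e \<gamma>"

definition coeff_tbar :: "('g::ab_group_add \<Rightarrow> 'g \<Rightarrow> complex) \<Rightarrow> (complex \<Rightarrow> 'v \<Rightarrow> 'v) \<Rightarrow> ('g \<Rightarrow> 'v::ab_group_add set)
    \<Rightarrow> nat \<Rightarrow> (nat \<Rightarrow> 'v) \<Rightarrow> (nat \<Rightarrow> 'g) \<Rightarrow> nat \<Rightarrow> nat \<Rightarrow> 'v env \<Rightarrow> complex" where
  "coeff_tbar \<omega> scale V n e \<gamma> = matrix_coeffs \<omega> (env \<omega> scale V) n (\<lambda>c f v. c * f v)
     (dual_act \<omega> scale V) (dual_basis scale n e) (\<lambda>a. - \<gamma> a)"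

end

theory Submission
  imports Defs
begin

text \<open>
  A functional \<open>f\<close> on a Hopf algebra lies in the finite dual iff it is a sum of homogeneous
  functionals for which \<open>f (xy)\<close> is a finite sum \<open>\<Sum>\<^sub>i a\<^sub>i(x) b\<^sub>i(y)\<close>; the factors can then be chosen among
  translates of \<open>f\<close>, hence in the finite dual again, and this decomposition is \<open>\<Delta>(f)\<close>. It follows that a
  subalgebra generated by a set \<open>Z\<close> of homogeneous functionals is a bialgebra as soon as
  \<open>\<Delta>(Z) \<subseteq> Z \<otimes> Z\<close>, and a Hopf algebra if moreover it contains \<open>S(Z)\<close>.

  All structure on the enveloping algebra \<open>U\<close> (the grading, \<open>\<Delta>\<close>, the co-unit, \<open>S\<close> and the natural action)
  comes from actions of the free algebra on some space in which the defining relations act by zero;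
  the Hopf axioms are then verified by induction on products of elements of \<open>gl(V)\<close>.

  The functions \<open>F\<^sub>b\<^sub>a(x)\<close>, the \<open>b\<close>-th coordinate of \<open>x \<cdot> e\<^sub>a\<close>, multiply like matrices. Up to a scalar \<open>t\<^sub>b\<^sub>a\<close> is
  \<open>F\<^sub>b\<^sub>a\<close>, and the dual coefficient is \<open>F\<^sub>a\<^sub>b \<circ> S\<close>, so that both antipode formulas reduce to \<open>S\<^sup>2 = 1\<close> on \<open>U\<close>.
\<close>

text \<open>Two obstacles shape the proof. A tensor is known only through its values on bilinear
  forms and vanishes on all other functions, so every nested evaluation requires that the inner
  value be bilinear in the outer variables. Conversely, \<open>dual_comult\<close> is a definite
  description, so a tensor over the finite dual has to be recovered from its values at pairs of
  elements of \<open>U\<close>; this is the injectivity \<open>ev_zero\<close>, and its analogue in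
  three factors yields co-associativity. Signs in the dual become constants: a functional of degree
  \<phi> lives in degree - \<phi> alone, so the pairing of functionals of degrees \<phi> and \<psi>
  is the plain product times \<open>\<omega> \<phi> \<psi>\<close>. The scalar in \<open>t0\<close>
  is the one for which these constants cancel in the co-product. The free algebra on the set
  \<open>gl(V)\<close> has inhomogeneous letters, and the zero map has every degree, so degrees make
  sense only modulo the ideal. This is why the grading and the antipode are read off from actions on
  families indexed by degrees.\<close>

declare plus_fun_apply [simp del] zero_fun_apply [simp del]
lemmas fun_app = plus_fun_apply zero_fun_apply

section \<open>Commutative factors\<close>

locale comm_factor =
  fixes \<omega> :: "'g::ab_group_add \<Rightarrow> 'g \<Rightarrow> complex"
  assumes cf: "commutative_factor \<omega>"
begin

lemma om_nz [simp]: "\<omega> a b \<noteq> 0"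
  using cf unfolding commutative_factor_def by blast

lemma om_add: "\<omega> (a + b) c = \<omega> a c * \<omega> b c" "\<omega> c (a + b) = \<omega> c a * \<omega> c b"
  using cf unfolding commutative_factor_def by blast+

lemma om_swap: "\<omega> a b = inverse (\<omega> b a)"
  using cf unfolding commutative_factor_def by blast

lemma om_zero [simp]: "\<omega> 0 a = 1" "\<omega> a 0 = 1"
  using om_add(1)[of 0 0 a] om_add(2)[of a 0 0] by simp_all

lemma om_minus: "\<omega> (- a) b = inverse (\<omega> a b)" "\<omega> b (- a) = inverse (\<omega> b a)"
  using om_add(1)[of a "-a" b] om_add(2)[of b a "-a"] by (simp_all add: inverse_unique)

lemma om_diff: "\<omega> (a - c) b = \<omega> a b * inverse (\<omega> c b)" "\<omega> b (a - c) = \<omega> b a * inverse (\<omega> b c)"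
  using om_add(1)[of a "-c" b] om_add(2)[of b a "-c"] by (simp_all add: om_minus)

lemma om_swap_mult [simp]: "\<omega> a b * \<omega> b a = 1"
  using om_swap[of a b] by simp

end

section \<open>Linear forms on graded algebras\<close>

text \<open>Unlike membership in \<open>dual_space\<close>, this leaves the values outside the
  carrier free, so that arbitrary lambda terms can qualify.\<close>

definition lin :: "(complex, 'a, 'm) module_scheme \<Rightarrow> ('a \<Rightarrow> complex) \<Rightarrow> bool" where
  "lin M f \<longleftrightarrow> (\<forall>x\<in>carrier M. \<forall>y\<in>carrier M. f (x \<oplus>\<^bsub>M\<^esub> y) = f x + f y) \<and>
     (\<forall>c. \<forall>x\<in>carrier M. f (c \<odot>\<^bsub>M\<^esub> x) = c * f x)"

lemma lin_add: "lin M f \<Longrightarrow> x \<in> carrier M \<Longrightarrow> y \<in> carrier M \<Longrightarrow> f (x \<oplus>\<^bsub>M\<^esub> y) = f x + f y"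
  and lin_smult: "lin M f \<Longrightarrow> x \<in> carrier M \<Longrightarrow> f (c \<odot>\<^bsub>M\<^esub> x) = c * f x"
  by (auto simp: lin_def)

lemma lin_plus: "lin M f \<Longrightarrow> lin M g \<Longrightarrow> lin M (\<lambda>x. f x + g x)"
  and lin_times: "lin M f \<Longrightarrow> lin M (\<lambda>x. c * f x)"
  and lin_times': "lin M f \<Longrightarrow> lin M (\<lambda>x. f x * c)"
  and lin_zero: "lin M (\<lambda>x. 0)"
  by (auto simp: lin_def algebra_simps)

lemma lin_sum: "(\<And>i. i \<in> I \<Longrightarrow> lin M (f i)) \<Longrightarrow> lin M (\<lambda>x. \<Sum>i\<in>I. f i x)"
  by (induction I rule: infinite_finite_induct) (auto intro: lin_zero lin_plus)

lemma bilin_iff: "B \<in> bilin M N \<longleftrightarrow> (\<forall>y\<in>carrier N. lin M (\<lambda>x. B x y)) \<and> (\<forall>x\<in>carrier M. lin N (B x))"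
  unfolding bilin_def lin_def by blast

lemma bilinI: "(\<And>y. y \<in> carrier N \<Longrightarrow> lin M (\<lambda>x. B x y)) \<Longrightarrow> (\<And>x. x \<in> carrier M \<Longrightarrow> lin N (B x)) \<Longrightarrow> B \<in> bilin M N"
  and bilin1: "B \<in> bilin M N \<Longrightarrow> y \<in> carrier N \<Longrightarrow> lin M (\<lambda>x. B x y)"
  and bilin2: "B \<in> bilin M N \<Longrightarrow> x \<in> carrier M \<Longrightarrow> lin N (B x)"
  by (auto simp: bilin_iff)

lemma bilin_plus: "B \<in> bilin M N \<Longrightarrow> C \<in> bilin M N \<Longrightarrow> (\<lambda>x y. B x y + C x y) \<in> bilin M N"
  and bilin_times: "B \<in> bilin M N \<Longrightarrow> (\<lambda>x y. c * B x y) \<in> bilin M N"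
  and bilin_zero: "(\<lambda>x y. 0) \<in> bilin M N"
  and bilin_prod: "lin M f \<Longrightarrow> lin N g \<Longrightarrow> (\<lambda>x y. f x * g y) \<in> bilin M N"
  by (auto simp: bilin_iff lin_def algebra_simps)

locale gralg =
  fixes M :: "('g::ab_group_add, 'a, 'm) graded_scheme" (structure)
  assumes gr: "graded_algebra M"
begin

lemma ring_M: "ring M" and module_M: "Module.module complex_alg M"
  using gr by (auto simp: graded_algebra_def complex_algebra_def)

sublocale ring M by (rule ring_M)

sublocale md: Module.module complex_alg M by (rule module_M)

lemma sm_closed [simp, intro]: "x \<in> carrier M \<Longrightarrow> c \<odot> x \<in> carrier M"
  using md.smult_closed[of c x] by (simp add: complex_alg_def)

lemma sm_add1: "x \<in> carrier M \<Longrightarrow> (b + c) \<odot> x = b \<odot> x \<oplus> c \<odot> x"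
  using md.smult_l_distr[of b c x] by (simp add: complex_alg_def)

lemma sm_add2: "x \<in> carrier M \<Longrightarrow> y \<in> carrier M \<Longrightarrow> c \<odot> (x \<oplus> y) = c \<odot> x \<oplus> c \<odot> y"
  using md.smult_r_distr[of c x y] by (simp add: complex_alg_def)

lemma sm_assoc: "x \<in> carrier M \<Longrightarrow> (b * c) \<odot> x = b \<odot> (c \<odot> x)"
  using md.smult_assoc1[of b c x] by (simp add: complex_alg_def)

lemma sm_one [simp]: "x \<in> carrier M \<Longrightarrow> 1 \<odot> x = x"
  using md.smult_one[of x] by (simp add: complex_alg_def)

lemma sm_zero [simp]: "x \<in> carrier M \<Longrightarrow> 0 \<odot> x = \<zero>" "c \<odot> \<zero> = \<zero>"
  using md.smult_l_null[of x] md.smult_r_null[of c] by (simp_all add: complex_alg_def)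

lemma sm_minus: "x \<in> carrier M \<Longrightarrow> (- 1) \<odot> x = \<ominus> x"
proof -
  assume x: "x \<in> carrier M"
  have "(- 1) \<odot> x \<oplus> x = \<zero>" using sm_add1[OF x, of "-1" 1] x by simp
  then show ?thesis using x by (metis minus_equality sm_closed)
qed

lemma sm_mult: "x \<in> carrier M \<Longrightarrow> y \<in> carrier M \<Longrightarrow> (c \<odot> x) \<otimes> y = c \<odot> (x \<otimes> y)"
  "x \<in> carrier M \<Longrightarrow> y \<in> carrier M \<Longrightarrow> x \<otimes> (c \<odot> y) = c \<odot> (x \<otimes> y)"
  using gr unfolding graded_algebra_def complex_algebra_def by metis+

lemma grade_sub: "submodule (grade M \<alpha>) complex_alg M"
  using gr by (auto simp: graded_algebra_def)

lemma grade_carrier [dest]: "x \<in> grade M \<alpha> \<Longrightarrow> x \<in> carrier M"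
  using md.submoduleE(1)[OF grade_sub] by auto

lemma grade_add: "x \<in> grade M \<alpha> \<Longrightarrow> y \<in> grade M \<alpha> \<Longrightarrow> x \<oplus> y \<in> grade M \<alpha>"
  using md.submoduleE(5)[OF grade_sub] by auto

lemma grade_sm: "x \<in> grade M \<alpha> \<Longrightarrow> c \<odot> x \<in> grade M \<alpha>"
  using md.submoduleE(4)[OF grade_sub, of c x \<alpha>] by (auto simp: complex_alg_def)

lemma grade_zero [simp]: "\<zero> \<in> grade M \<alpha>"
proof -
  obtain x where "x \<in> grade M \<alpha>" using md.submoduleE(2)[OF grade_sub] by blast
  then show ?thesis using grade_sm[of x \<alpha> 0] by auto
qed

lemma grade_one [simp]: "\<one> \<in> grade M 0"
  using gr by (auto simp: graded_algebra_def)

lemma grade_mult: "x \<in> grade M \<alpha> \<Longrightarrow> y \<in> grade M \<beta> \<Longrightarrow> x \<otimes> y \<in> grade M (\<alpha> + \<beta>)"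
  using gr by (auto simp: graded_algebra_def)

lemma hdecomp_ex: "x \<in> carrier M \<Longrightarrow> hdecomp M x (\<lambda>\<alpha>. hpart M \<alpha> x)"
proof -
  assume "x \<in> carrier M"
  then have "\<exists>!u. hdecomp M x u" using gr by (auto simp: graded_algebra_def)
  then show ?thesis unfolding hpart_def by (rule theI')
qed

lemma hpart_eqI: "x \<in> carrier M \<Longrightarrow> hdecomp M x u \<Longrightarrow> hpart M \<alpha> x = u \<alpha>"
proof -
  assume "x \<in> carrier M" and u: "hdecomp M x u"
  then have "\<exists>!u. hdecomp M x u" using gr by (auto simp: graded_algebra_def)
  then show ?thesis unfolding hpart_def using u by (simp add: the1_equality)
qed

lemma hdecompI:
  assumes "\<And>\<alpha>. u \<alpha> \<in> grade M \<alpha>" "finite S" "\<And>\<alpha>. \<alpha> \<notin> S \<Longrightarrow> u \<alpha> = \<zero>" "x = finsum M u S"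
  shows "hdecomp M x u"
proof -
  have sub: "{\<alpha>. u \<alpha> \<noteq> \<zero>} \<subseteq> S" using assms(3) by auto
  have "finsum M u S = finsum M u {\<alpha>. u \<alpha> \<noteq> \<zero>}"
    by (rule add.finprod_mono_neutral_cong_right) (use assms sub in auto)
  then show ?thesis using assms finite_subset[OF sub] by (auto simp: hdecomp_def)
qed

lemma hpart_grade [simp]: "x \<in> carrier M \<Longrightarrow> hpart M \<alpha> x \<in> grade M \<alpha>"
  using hdecomp_ex by (auto simp: hdecomp_def)

lemma hpart_carrier [simp]: "x \<in> carrier M \<Longrightarrow> hpart M \<alpha> x \<in> carrier M"
  using hpart_grade by blast

lemma hsupp_finite [simp]: "x \<in> carrier M \<Longrightarrow> finite (hsupp M x)"
  using hdecomp_ex[of x] by (auto simp: hdecomp_def hsupp_def)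

lemma hpart_sum: "x \<in> carrier M \<Longrightarrow> x = finsum M (\<lambda>\<alpha>. hpart M \<alpha> x) (hsupp M x)"
  using hdecomp_ex[of x] by (auto simp: hdecomp_def hsupp_def)

lemma hpart_hom: "x \<in> grade M \<alpha> \<Longrightarrow> hpart M \<beta> x = (if \<beta> = \<alpha> then x else \<zero>)"
proof -
  assume x: "x \<in> grade M \<alpha>"
  have "hdecomp M x (\<lambda>\<beta>. if \<beta> = \<alpha> then x else \<zero>)"
    by (rule hdecompI[where S = "{\<alpha>}"]) (use x grade_carrier in auto)
  then show ?thesis using hpart_eqI[OF grade_carrier[OF x]] by auto
qed

lemma hom_induct [consumes 1, case_names hom add]:
  assumes x: "x \<in> carrier M" and hom: "\<And>\<alpha> y. y \<in> grade M \<alpha> \<Longrightarrow> P y"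
    and add: "\<And>y z. y \<in> carrier M \<Longrightarrow> z \<in> carrier M \<Longrightarrow> P y \<Longrightarrow> P z \<Longrightarrow> P (y \<oplus> z)"
  shows "P x"
proof -
  have "finite S \<Longrightarrow> P (finsum M (\<lambda>\<alpha>. hpart M \<alpha> x) S)" for S
  proof (induction S rule: finite_induct)
    case empty
    then show ?case using hom[OF grade_zero] by simp
  next
    case (insert \<alpha> S)
    then show ?case using x hom[OF hpart_grade[OF x, of \<alpha>]]
      by (simp add: Pi_def add)
  qed
  then show ?thesis using hpart_sum[OF x] x hsupp_finite[OF x] by metis
qed

lemma hpart_add: "x \<in> carrier M \<Longrightarrow> y \<in> carrier M \<Longrightarrow> hpart M \<alpha> (x \<oplus> y) = hpart M \<alpha> x \<oplus> hpart M \<alpha> y"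
proof -
  assume x: "x \<in> carrier M" and y: "y \<in> carrier M"
  let ?S = "hsupp M x \<union> hsupp M y"
  have 1: "finsum M (\<lambda>\<alpha>. hpart M \<alpha> x) ?S = x"
    by (subst (2) hpart_sum[OF x], rule add.finprod_mono_neutral_cong_right) (use x y hsupp_finite[OF x] hsupp_finite[OF y] in \<open>auto simp: hsupp_def\<close>)
  have 2: "finsum M (\<lambda>\<alpha>. hpart M \<alpha> y) ?S = y"
    by (subst (2) hpart_sum[OF y], rule add.finprod_mono_neutral_cong_right) (use x y hsupp_finite[OF x] hsupp_finite[OF y] in \<open>auto simp: hsupp_def\<close>)
  have "finsum M (\<lambda>\<alpha>. hpart M \<alpha> x \<oplus> hpart M \<alpha> y) ?S = x \<oplus> y"
    by (subst finsum_addf) (use x y 1 2 in auto)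
  then have "hdecomp M (x \<oplus> y) (\<lambda>\<alpha>. hpart M \<alpha> x \<oplus> hpart M \<alpha> y)"
    by (intro hdecompI[where S = ?S]) (use x y hsupp_finite[OF x] hsupp_finite[OF y] in \<open>auto simp: hsupp_def intro: grade_add\<close>)
  then show ?thesis using hpart_eqI x y by simp
qed

lemma hpart_sm: "x \<in> carrier M \<Longrightarrow> hpart M \<alpha> (c \<odot> x) = c \<odot> hpart M \<alpha> x"
proof (induction rule: hom_induct)
  case (hom \<beta> y)
  then show ?case using hpart_hom[OF grade_sm[OF hom, of c]] by (simp add: hpart_hom)
qed (simp add: hpart_add sm_add2)

lemma lin_0: "lin M f \<Longrightarrow> f \<zero> = 0"
  using lin_smult[of M f \<zero> 0] by simp

lemma lin_ext:
  assumes "lin M f" "lin M g" "\<And>\<alpha> y. y \<in> grade M \<alpha> \<Longrightarrow> f y = g y" "x \<in> carrier M"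
  shows "f x = g x"
  using assms(4) by (induction rule: hom_induct) (simp_all add: assms lin_add)

text \<open>The support is contained in the one degree \<alpha>, and it is empty if \<open>x\<close>
  is zero; the hypothesis on \<open>g\<close> covers that case.\<close>

lemma hsum_hom: "\<lbrakk>\<And>\<alpha>. g \<alpha> \<zero> = (0 :: complex); x \<in> grade M \<alpha>\<rbrakk> \<Longrightarrow> (\<Sum>\<beta>\<in>hsupp M x. g \<beta> (hpart M \<beta> x)) = g \<alpha> x"
proof -
  assume g: "\<And>\<alpha>. g \<alpha> \<zero> = 0" and x: "x \<in> grade M \<alpha>"
  have "hsupp M x \<subseteq> {\<alpha>}" using x by (auto simp: hsupp_def hpart_hom split: if_splits)
  then have "(\<Sum>\<beta>\<in>hsupp M x. g \<beta> (hpart M \<beta> x)) = (\<Sum>\<beta>\<in>{\<alpha>}. g \<beta> (hpart M \<beta> x))"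
    by (rule sum.mono_neutral_left[rotated]) (auto simp: hsupp_def g)
  then show ?thesis using x by (simp add: hpart_hom)
qed

lemma hsum_super:
  assumes "\<And>\<alpha>. g \<alpha> \<zero> = (0 :: complex)" "finite S" "hsupp M x \<subseteq> S"
  shows "(\<Sum>\<beta>\<in>hsupp M x. g \<beta> (hpart M \<beta> x)) = (\<Sum>\<beta>\<in>S. g \<beta> (hpart M \<beta> x))"
  by (rule sum.mono_neutral_left) (use assms in \<open>auto simp: hsupp_def\<close>)

text \<open>The index set varies with the argument. Since each \<open>g \<alpha>\<close> vanishes at
  zero, all sums in question may be taken over one common finite set of degrees.\<close>

lemma hsum_lin:
  assumes g: "\<And>\<alpha>. lin M (g \<alpha>)"
  shows "lin M (\<lambda>x. \<Sum>\<alpha>\<in>hsupp M x. g \<alpha> (hpart M \<alpha> x))"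
  unfolding lin_def
proof (intro conjI allI ballI)
  have g0: "g \<alpha> \<zero> = 0" for \<alpha> using lin_0[OF g] .
  fix x y assume x: "x \<in> carrier M" and y: "y \<in> carrier M"
  let ?S = "hsupp M x \<union> hsupp M y \<union> hsupp M (x \<oplus> y)"
  show "(\<Sum>\<alpha>\<in>hsupp M (x \<oplus> y). g \<alpha> (hpart M \<alpha> (x \<oplus> y))) =
    (\<Sum>\<alpha>\<in>hsupp M x. g \<alpha> (hpart M \<alpha> x)) + (\<Sum>\<alpha>\<in>hsupp M y. g \<alpha> (hpart M \<alpha> y))"
    using x y by (subst (1 2 3) hsum_super[where g = g, OF g0, where S = ?S])
      (auto simp: hpart_add lin_add[OF g] sum.distrib)
next
  have g0: "g \<alpha> \<zero> = 0" for \<alpha> using lin_0[OF g] .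
  fix c x assume x: "x \<in> carrier M"
  let ?S = "hsupp M x \<union> hsupp M (c \<odot> x)"
  show "(\<Sum>\<alpha>\<in>hsupp M (c \<odot> x). g \<alpha> (hpart M \<alpha> (c \<odot> x))) = c * (\<Sum>\<alpha>\<in>hsupp M x. g \<alpha> (hpart M \<alpha> x))"
    using x by (subst (1 2) hsum_super[where g = g, OF g0, where S = ?S])
      (auto simp: hpart_sm lin_smult[OF g] sum_distrib_left)
qed

lemma lin_hpart: "lin M f \<Longrightarrow> lin M (\<lambda>x. f (hpart M \<alpha> x))"
  by (auto simp: lin_def hpart_add hpart_sm)

lemma lin_lmult: "lin M f \<Longrightarrow> x \<in> carrier M \<Longrightarrow> lin M (\<lambda>y. f (x \<otimes> y))"
  and lin_rmult: "lin M f \<Longrightarrow> x \<in> carrier M \<Longrightarrow> lin M (\<lambda>y. f (y \<otimes> x))"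
  by (auto simp: lin_def r_distr l_distr sm_mult)

lemma lin_hsum: "lin M f \<Longrightarrow> x \<in> carrier M \<Longrightarrow> f x = (\<Sum>\<alpha>\<in>hsupp M x. f (hpart M \<alpha> x))"
  by (rule lin_ext[where f = f and g = "\<lambda>x. (\<Sum>\<alpha>\<in>hsupp M x. f (hpart M \<alpha> x))"])
    (auto intro: hsum_lin simp: hsum_hom[where g = "\<lambda>_. f"] lin_0)

text \<open>The diagonal operator with eigenvalue \<open>c \<alpha>\<close> in degree \<alpha>. For
  \<open>c = \<omega> d\<close> it records the factor that arises when an element of degree
  \<open>d\<close> is moved past \<open>x\<close>, without \<open>x\<close> having to be
  homogeneous.\<close>

definition wt :: "('g \<Rightarrow> complex) \<Rightarrow> 'a \<Rightarrow> 'a" where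
  "wt c x = finsum M (\<lambda>\<alpha>. c \<alpha> \<odot> hpart M \<alpha> x) (hsupp M x)"

lemma wt_closed [simp]: "x \<in> carrier M \<Longrightarrow> wt c x \<in> carrier M"
  unfolding wt_def by (rule finsum_closed) auto

lemma wt_super:
  assumes "x \<in> carrier M" "finite S" "hsupp M x \<subseteq> S"
  shows "wt c x = finsum M (\<lambda>\<alpha>. c \<alpha> \<odot> hpart M \<alpha> x) S"
  unfolding wt_def
  by (rule add.finprod_mono_neutral_cong_left) (use assms in \<open>auto simp: hsupp_def\<close>)

lemma wt_add: "x \<in> carrier M \<Longrightarrow> y \<in> carrier M \<Longrightarrow> wt c (x \<oplus> y) = wt c x \<oplus> wt c y"
proof -
  assume x: "x \<in> carrier M" and y: "y \<in> carrier M"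
  let ?S = "hsupp M x \<union> hsupp M y \<union> hsupp M (x \<oplus> y)"
  show ?thesis using x y
    by (subst (1 2 3) wt_super[where S = ?S])
      (auto simp: hpart_add sm_add2 finsum_addf Pi_def)
qed

lemma wt_hom: "x \<in> grade M \<alpha> \<Longrightarrow> wt c x = c \<alpha> \<odot> x"
  by (subst wt_super[where S = "{\<alpha>}"]) (auto simp: hpart_hom hsupp_def split: if_splits)

lemma wt_sm: "x \<in> carrier M \<Longrightarrow> wt c (b \<odot> x) = b \<odot> wt c x"
proof (induction rule: hom_induct)
  case (hom \<beta> y)
  then have "c \<beta> \<odot> (b \<odot> y) = b \<odot> (c \<beta> \<odot> y)"
    by (metis sm_assoc mult.commute grade_carrier)
  then show ?case using hom wt_hom[OF grade_sm[OF hom, of b], of c] by (simp add: wt_hom)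
qed (simp add: wt_add sm_add2)

lemma lin_wt: "lin M f \<Longrightarrow> lin M (\<lambda>x. f (wt c x))"
  by (auto simp: lin_def wt_add wt_sm)

end

section \<open>Tensor products of graded algebras\<close>

lemma sum_list_fun_apply: "sum_list (map f ps) B = (\<Sum>p\<leftarrow>ps. f p B)"
  for f :: "'p \<Rightarrow> 'b \<Rightarrow> complex"
  by (induction ps) (auto simp: fun_app)

locale grtens = comm_factor \<omega> + gralg M for \<omega> :: "'g::ab_group_add \<Rightarrow> 'g \<Rightarrow> complex"
  and M :: "('g, 'a, 'm) graded_scheme" (structure)
begin

abbreviation "pt \<equiv> pure_tensor M M"
abbreviation "TT \<equiv> tensor_sub M M (carrier M) (carrier M)"
abbreviation "Bil \<equiv> bilin M M"
abbreviation "tm \<equiv> tensor_mult \<omega> M M"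

lemma pt_eval [simp]: "B \<in> Bil \<Longrightarrow> pt x y B = B x y"
  and pt_off: "B \<notin> Bil \<Longrightarrow> pt x y B = 0"
  by (auto simp: pure_tensor_def)

lemma tensor_eqI: "(\<And>B. B \<in> Bil \<Longrightarrow> z B = w B) \<Longrightarrow> (\<And>B. B \<notin> Bil \<Longrightarrow> z B = 0) \<Longrightarrow> (\<And>B. B \<notin> Bil \<Longrightarrow> w B = 0) \<Longrightarrow> z = w"
  for z w :: "('a, 'a) tensor"
  by (rule ext) metis

lemma pt_add1: "x \<in> carrier M \<Longrightarrow> x' \<in> carrier M \<Longrightarrow> y \<in> carrier M \<Longrightarrow> pt (x \<oplus> x') y = pt x y + pt x' y"
  and pt_add2: "x \<in> carrier M \<Longrightarrow> y' \<in> carrier M \<Longrightarrow> y \<in> carrier M \<Longrightarrow> pt x (y \<oplus> y') = pt x y + pt x y'"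
  and pt_sm1: "x \<in> carrier M \<Longrightarrow> y \<in> carrier M \<Longrightarrow> pt (c \<odot> x) y = (\<lambda>B. c * pt x y B)"
  and pt_sm2: "x \<in> carrier M \<Longrightarrow> y \<in> carrier M \<Longrightarrow> pt x (c \<odot> y) = (\<lambda>B. c * pt x y B)"
  by (auto simp: pure_tensor_def bilin_def fun_app)

lemma ts_zero: "0 \<in> tensor_sums M M R"
  unfolding tensor_sums_def by (auto intro: exI[of _ "[]"])

lemma ts_pt: "(x, y) \<in> R \<Longrightarrow> pt x y \<in> tensor_sums M M R"
  unfolding tensor_sums_def by (auto intro!: exI[of _ "[(x, y)]"])

lemma ts_add: "z \<in> tensor_sums M M R \<Longrightarrow> w \<in> tensor_sums M M R \<Longrightarrow> z + w \<in> tensor_sums M M R"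
proof -
  assume "z \<in> tensor_sums M M R" "w \<in> tensor_sums M M R"
  then obtain ps qs where "set ps \<subseteq> R" "set qs \<subseteq> R" "z = sum_list (map (\<lambda>(x, y). pt x y) ps)" "w = sum_list (map (\<lambda>(x, y). pt x y) qs)"
    unfolding tensor_sums_def by blast
  then show ?thesis unfolding tensor_sums_def by (auto intro!: exI[of _ "ps @ qs"])
qed

lemma ts_induct [consumes 1, case_names zero pt]:
  assumes "z \<in> tensor_sums M M R" "P 0"
    "\<And>x y z. (x, y) \<in> R \<Longrightarrow> z \<in> tensor_sums M M R \<Longrightarrow> P z \<Longrightarrow> P (pt x y + z)"
  shows "P z"
proof -
  obtain ps where "set ps \<subseteq> R" and z: "z = sum_list (map (\<lambda>(x, y). pt x y) ps)"
    using assms(1) unfolding tensor_sums_def by blast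
  then have "P (sum_list (map (\<lambda>(x, y). pt x y) ps))"
  proof (induction ps arbitrary: z)
    case (Cons p ps)
    then show ?case
      by (cases p) (auto intro!: assms(3) simp: tensor_sums_def)
  qed (use assms in simp)
  then show ?thesis using z by simp
qed

lemma ts_sub: "z \<in> tensor_sums M M R \<Longrightarrow> (\<And>x y. (x, y) \<in> R \<Longrightarrow> pt x y \<in> tensor_sums M M R') \<Longrightarrow> z \<in> tensor_sums M M R'"
  by (induction rule: ts_induct) (auto intro: ts_zero ts_add)

lemma ts_mono: "R \<subseteq> R' \<Longrightarrow> z \<in> tensor_sums M M R \<Longrightarrow> z \<in> tensor_sums M M R'"
  by (erule ts_sub) (auto intro: ts_pt)

lemma ts_sum_list: "(\<And>p. p \<in> set ps \<Longrightarrow> f p \<in> tensor_sums M M R) \<Longrightarrow> sum_list (map f ps) \<in> tensor_sums M M R"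
  by (induction ps) (auto intro: ts_zero ts_add)

definition HP :: "('a \<times> 'a) set" where
  "HP = {(x, y). (\<exists>\<alpha>. x \<in> grade M \<alpha>) \<and> (\<exists>\<beta>. y \<in> grade M \<beta>)}"

lemma TT_HP: "TT = tensor_sums M M HP"
proof
  have 1: "x \<in> carrier M \<Longrightarrow> y \<in> grade M \<beta> \<Longrightarrow> pt x y \<in> tensor_sums M M HP" for x y \<beta>
    by (induction rule: hom_induct) (auto simp: pt_add1 HP_def intro!: ts_add intro: ts_pt)
  have "y \<in> carrier M \<Longrightarrow> x \<in> carrier M \<Longrightarrow> pt x y \<in> tensor_sums M M HP" for x y
    by (induction rule: hom_induct) (auto simp: pt_add2 intro!: ts_add intro: 1)
  then show "TT \<subseteq> tensor_sums M M HP"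
    unfolding tensor_sub_def by (auto elim!: ts_sub)
  show "tensor_sums M M HP \<subseteq> TT"
    unfolding tensor_sub_def by (auto elim!: ts_mono[rotated] simp: HP_def)
qed

lemma TT_induct [consumes 1, case_names zero pt add]:
  assumes "z \<in> TT" "P 0" "\<And>\<alpha> \<beta> x y. x \<in> grade M \<alpha> \<Longrightarrow> y \<in> grade M \<beta> \<Longrightarrow> P (pt x y)"
    "\<And>z w. z \<in> TT \<Longrightarrow> w \<in> TT \<Longrightarrow> P z \<Longrightarrow> P w \<Longrightarrow> P (z + w)"
  shows "P z"
  using assms(1) unfolding TT_HP
proof (induction rule: ts_induct)
  case (pt x y z)
  then have "P (pt x y)" by (auto simp: HP_def intro: assms(3))
  then show ?case using pt by (intro assms(4)) (auto simp: TT_HP intro: ts_pt)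
qed (rule assms(2))

lemma TT_pt [simp, intro]: "x \<in> carrier M \<Longrightarrow> y \<in> carrier M \<Longrightarrow> pt x y \<in> TT"
  unfolding tensor_sub_def by (rule ts_pt) auto

lemma TT_add [intro]: "z \<in> TT \<Longrightarrow> w \<in> TT \<Longrightarrow> z + w \<in> TT"
  and TT_zero [simp]: "0 \<in> TT"
  unfolding tensor_sub_def by (auto intro: ts_add ts_zero)

lemma TT_off: "z \<in> TT \<Longrightarrow> B \<notin> Bil \<Longrightarrow> z B = 0"
  by (induction rule: TT_induct) (auto simp: pt_off fun_app)

lemma TT_eqI: "z \<in> TT \<Longrightarrow> w \<in> TT \<Longrightarrow> (\<And>B. B \<in> Bil \<Longrightarrow> z B = w B) \<Longrightarrow> z = w"
  by (rule tensor_eqI) (auto simp: TT_off)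

lemma TT_plus: "z \<in> TT \<Longrightarrow> B \<in> Bil \<Longrightarrow> C \<in> Bil \<Longrightarrow> z (\<lambda>x y. B x y + C x y) = z B + z C"
  by (induction rule: TT_induct) (auto simp: bilin_plus fun_app)

lemma TT_times: "z \<in> TT \<Longrightarrow> B \<in> Bil \<Longrightarrow> z (\<lambda>x y. c * B x y) = c * z B"
  by (induction rule: TT_induct) (auto simp: bilin_times algebra_simps fun_app)

text \<open>Homogeneous pairs span the tensor product. This is how forms are rewritten under a
  comultiplication; both forms must be bilinear, because tensors vanish elsewhere.\<close>

lemma TT_cong: "z \<in> TT \<Longrightarrow> B \<in> Bil \<Longrightarrow> C \<in> Bil \<Longrightarrow>
    (\<And>\<alpha> \<beta> x y. x \<in> grade M \<alpha> \<Longrightarrow> y \<in> grade M \<beta> \<Longrightarrow> B x y = C x y) \<Longrightarrow> z B = z C"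
  by (induction rule: TT_induct) (auto simp: fun_app)

lemma Bil_cong: "B \<in> Bil \<Longrightarrow> (\<And>x y. x \<in> carrier M \<Longrightarrow> y \<in> carrier M \<Longrightarrow> B x y = C x y) \<Longrightarrow> C \<in> Bil"
  by (auto simp: bilin_iff lin_def)

lemma TT_smult: "z \<in> TT \<Longrightarrow> (\<lambda>B. c * z B) \<in> TT"
proof (induction rule: TT_induct)
  case (pt \<alpha> \<beta> x y)
  then show ?case using TT_pt[of "c \<odot> x" y] pt_sm1[of x y c, symmetric] by (simp add: grade_carrier)
next
  case (add z w)
  have "(\<lambda>B. c * (z + w) B) = (\<lambda>B. c * z B) + (\<lambda>B. c * w B)" by (auto simp: algebra_simps fun_app)
  then show ?case using add by auto
qed (simp add: fun_app flip: zero_fun_def)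

text \<open>An iterated evaluation is meaningful only if the inner value is bilinear in the outer
  variables, since the outer tensor would return 0 otherwise.\<close>

lemma Bil_eval:
  assumes w: "w \<in> TT" and G1: "\<And>x y. x \<in> carrier M \<Longrightarrow> y \<in> carrier M \<Longrightarrow> G x y \<in> Bil"
    and G2: "\<And>x y. x \<in> carrier M \<Longrightarrow> y \<in> carrier M \<Longrightarrow> (\<lambda>u v. G u v x y) \<in> Bil"
  shows "(\<lambda>u v. w (G u v)) \<in> Bil"
  using w
proof (induction rule: TT_induct)
  case zero
  then show ?case by (simp add: bilin_zero fun_app)
next
  case (pt \<alpha> \<beta> x y)
  then show ?case by (intro Bil_cong[OF G2[of x y]]) (auto simp: G1)
next
  case (add z w)
  then show ?case by (simp add: bilin_plus fun_app)
qed

text \<open>The form under the two evaluations in \<open>tensor_mult\<close>, isolated so that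
  linearity in each of its four variables can be proved separately.\<close>

definition mform :: "('a \<Rightarrow> 'a \<Rightarrow> complex) \<Rightarrow> 'a \<Rightarrow> 'a \<Rightarrow> 'a \<Rightarrow> 'a \<Rightarrow> complex" where
  "mform B x y x' y' = (\<Sum>\<beta>\<in>hsupp M y. \<Sum>\<alpha>\<in>hsupp M x'.
       \<omega> \<beta> \<alpha> * B (x \<otimes> hpart M \<alpha> x') (hpart M \<beta> y \<otimes> y'))"

lemma mform_lin1: "B \<in> Bil \<Longrightarrow> y \<in> carrier M \<Longrightarrow> x' \<in> carrier M \<Longrightarrow> y' \<in> carrier M \<Longrightarrow> lin M (\<lambda>x. mform B x y x' y')"
  unfolding mform_def by (intro lin_sum lin_times lin_rmult[of "\<lambda>z. B z (hpart M _ y \<otimes> y')"] bilin1) auto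

lemma mform_lin4: "B \<in> Bil \<Longrightarrow> x \<in> carrier M \<Longrightarrow> y \<in> carrier M \<Longrightarrow> x' \<in> carrier M \<Longrightarrow> lin M (\<lambda>y'. mform B x y x' y')"
  unfolding mform_def by (intro lin_sum lin_times lin_lmult[of "B (x \<otimes> hpart M _ x')"] bilin2) auto

lemma mform_lin2: "B \<in> Bil \<Longrightarrow> x \<in> carrier M \<Longrightarrow> x' \<in> carrier M \<Longrightarrow> y' \<in> carrier M \<Longrightarrow> lin M (\<lambda>y. mform B x y x' y')"
  unfolding mform_def
  by (intro hsum_lin[where g = "\<lambda>\<beta> y. \<Sum>\<alpha>\<in>hsupp M x'. \<omega> \<beta> \<alpha> * B (x \<otimes> hpart M \<alpha> x') (y \<otimes> y')"]
     lin_sum lin_times lin_rmult[of "B (x \<otimes> hpart M _ x')"] bilin2) auto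

lemma mform_lin3: "B \<in> Bil \<Longrightarrow> x \<in> carrier M \<Longrightarrow> y \<in> carrier M \<Longrightarrow> y' \<in> carrier M \<Longrightarrow> lin M (\<lambda>x'. mform B x y x' y')"
  unfolding mform_def
  \<comment> \<open>The sum over the components of \<open>x'\<close> has to be the outer one for
    \<open>hsum_lin\<close> to apply to it.\<close>
  by (subst sum.swap, intro hsum_lin[where g = "\<lambda>\<alpha> x'. \<Sum>\<beta>\<in>hsupp M y. \<omega> \<beta> \<alpha> * B (x \<otimes> x') (hpart M \<beta> y \<otimes> y')"]
     lin_sum lin_times lin_lmult[of "\<lambda>z. B z (hpart M _ y \<otimes> y')"] bilin1) auto

lemma mform_Bil1: "B \<in> Bil \<Longrightarrow> x \<in> carrier M \<Longrightarrow> y \<in> carrier M \<Longrightarrow> mform B x y \<in> Bil"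
  and mform_Bil2: "B \<in> Bil \<Longrightarrow> x' \<in> carrier M \<Longrightarrow> y' \<in> carrier M \<Longrightarrow> (\<lambda>x y. mform B x y x' y') \<in> Bil"
  by (auto intro!: bilinI intro: mform_lin1 mform_lin2 mform_lin3 mform_lin4)

lemma mform_hom: "\<lbrakk>B \<in> Bil; x \<in> carrier M; y \<in> grade M \<beta>; x' \<in> grade M \<alpha>; y' \<in> carrier M\<rbrakk>
    \<Longrightarrow> mform B x y x' y' = \<omega> \<beta> \<alpha> * B (x \<otimes> x') (y \<otimes> y')"
proof -
  assume B: "B \<in> Bil" and c: "x \<in> carrier M" "y \<in> grade M \<beta>" "x' \<in> grade M \<alpha>" "y' \<in> carrier M"
  have cc: "y \<in> carrier M" "x' \<in> carrier M" using c by auto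
  have 1: "B \<zero> v = 0" "B v \<zero> = 0" if "v \<in> carrier M" for v
    using lin_0[OF bilin1[OF B that]] lin_0[OF bilin2[OF B that]] by auto
  have "mform B x y x' y' = (\<Sum>\<alpha>\<in>hsupp M x'. \<omega> \<beta> \<alpha> * B (x \<otimes> hpart M \<alpha> x') (y \<otimes> y'))"
    unfolding mform_def
    by (subst hsum_hom[where \<alpha> = \<beta>]) (use c cc 1 in auto)
  also have "\<dots> = \<omega> \<beta> \<alpha> * B (x \<otimes> x') (y \<otimes> y')"
    by (subst hsum_hom[where \<alpha> = \<alpha> and g = "\<lambda>\<alpha> x'. \<omega> \<beta> \<alpha> * B (x \<otimes> x') (y \<otimes> y')"]) (use c cc 1 in auto)
  finally show ?thesis .
qed

lemma tm_def': "tm z w = (\<lambda>B. if B \<in> Bil then z (\<lambda>x y. w (mform B x y)) else 0)"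
  unfolding tensor_mult_def mform_def ..

lemma tm_form: "w \<in> TT \<Longrightarrow> B \<in> Bil \<Longrightarrow> (\<lambda>x y. w (mform B x y)) \<in> Bil"
  by (rule Bil_eval) (auto intro: mform_Bil1 mform_Bil2)

lemma tm_pt: "\<lbrakk>x \<in> carrier M; y \<in> grade M \<beta>; x' \<in> grade M \<alpha>; y' \<in> carrier M\<rbrakk>
    \<Longrightarrow> tm (pt x y) (pt x' y') = pt (\<omega> \<beta> \<alpha> \<odot> (x \<otimes> x')) (y \<otimes> y')"
proof (rule tensor_eqI)
  fix B assume B: "B \<in> Bil" and c: "x \<in> carrier M" "y \<in> grade M \<beta>" "x' \<in> grade M \<alpha>" "y' \<in> carrier M"
  have cc: "y \<in> carrier M" "x' \<in> carrier M" using c by auto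
  show "tm (pt x y) (pt x' y') B = pt (\<omega> \<beta> \<alpha> \<odot> (x \<otimes> x')) (y \<otimes> y') B"
    using B c cc tm_form[OF TT_pt[of x' y'] B]
    by (simp add: tm_def' mform_Bil1 mform_hom lin_smult[OF bilin1[OF B]])
qed (auto simp: tm_def' pt_off)

lemma tm_add1: "tm (z + z') w = tm z w + tm z' w"
  by (auto simp: tm_def' fun_app)

lemma tm_zero1: "tm 0 w = 0"
  by (auto simp: tm_def' fun_app)

lemma tm_add2: "z \<in> TT \<Longrightarrow> w \<in> TT \<Longrightarrow> w' \<in> TT \<Longrightarrow> tm z (w + w') = tm z w + tm z w'"
  by (rule ext) (simp add: tm_def' tm_form fun_app
    TT_plus[where B = "\<lambda>x y. w (mform _ x y)" and C = "\<lambda>x y. w' (mform _ x y)"])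

lemma tm_zero2: "z \<in> TT \<Longrightarrow> tm z 0 = 0"
  using tm_add2[of z 0 0] by simp

lemma tm_smult1: "tm (\<lambda>B. c * z B) w = (\<lambda>B. c * tm z w B)"
  by (auto simp: tm_def' fun_app)

lemma tm_smult2: "z \<in> TT \<Longrightarrow> w \<in> TT \<Longrightarrow> tm z (\<lambda>B. c * w B) = (\<lambda>B. c * tm z w B)"
  by (rule ext) (simp add: tm_def' TT_times[where B = "\<lambda>x y. w (mform _ x y)"] tm_form)

lemma tm_closed [intro]: "z \<in> TT \<Longrightarrow> w \<in> TT \<Longrightarrow> tm z w \<in> TT"
proof (induction arbitrary: w rule: TT_induct)
  case (pt \<alpha> \<beta> x y)
  from pt(3) show ?case
  proof (induction rule: TT_induct)
    case (pt \<alpha>' \<beta>' x' y')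
    then show ?case using \<open>x \<in> grade M \<alpha>\<close> \<open>y \<in> grade M \<beta>\<close> by (subst tm_pt) auto
  qed (use pt in \<open>auto simp: tm_zero2 tm_add2 grade_carrier\<close>)
qed (auto simp: tm_zero1 tm_add1)

text \<open>By multiplicativity of \<omega> in each argument, both bracketings of homogeneous
  tensors carry the factor \<open>\<omega> \<beta> \<alpha>' * \<omega> \<beta> \<alpha>'' *
  \<omega> \<beta>' \<alpha>''\<close>.\<close>

lemma tm_assoc: "z \<in> TT \<Longrightarrow> w \<in> TT \<Longrightarrow> v \<in> TT \<Longrightarrow> tm (tm z w) v = tm z (tm w v)"
proof (induction rule: TT_induct)
  case (pt \<alpha> \<beta> x y)
  from pt(3,4) show ?case
  proof (induction rule: TT_induct)
    case (pt \<alpha>' \<beta>' x' y')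
    from pt(3) show ?case
    proof (induction rule: TT_induct)
      case (pt \<alpha>'' \<beta>'' x'' y'')
      note h = \<open>x \<in> grade M \<alpha>\<close> \<open>y \<in> grade M \<beta>\<close> \<open>x' \<in> grade M \<alpha>'\<close> \<open>y' \<in> grade M \<beta>'\<close> pt
      note c = h[THEN grade_carrier]
      show ?case
        using h c by (simp add: tm_pt[where \<alpha> = \<alpha>' and \<beta> = \<beta>] tm_pt[where \<alpha> = \<alpha>'' and \<beta> = \<beta>']
          tm_pt[where \<alpha> = \<alpha>'' and \<beta> = "\<beta> + \<beta>'"] tm_pt[where \<alpha> = "\<alpha>' + \<alpha>''" and \<beta> = \<beta>]
          grade_mult grade_sm sm_mult m_assoc om_add sm_assoc[symmetric] mult_ac)
    qed (use pt \<open>x \<in> grade M \<alpha>\<close> \<open>y \<in> grade M \<beta>\<close> in \<open>auto simp: tm_zero2 tm_add2 grade_carrier tm_closed\<close>)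
  qed (use pt in \<open>auto simp: tm_zero1 tm_zero2 tm_add1 tm_add2 grade_carrier tm_closed\<close>)
qed (auto simp: tm_zero1 tm_add1)

end

section \<open>Functions of finite rank\<close>

lemma sum_list_product: "(\<Sum>p\<leftarrow>ps. \<Sum>q\<leftarrow>qs. g p q) = (\<Sum>(p, q)\<leftarrow>List.product ps qs. (g p q :: complex))"
  by (induction ps) (simp_all add: comp_def)

lemma sum_list_times: "(\<Sum>p\<leftarrow>ps. c * f p) = c * (\<Sum>p\<leftarrow>ps. (f p :: complex))"
  by (simp add: sum_list_const_mult)

lemma sum_list_ev: "(\<And>p. p \<in> set ps \<Longrightarrow> f p = g p) \<Longrightarrow> (\<Sum>p\<leftarrow>ps. f p) = (\<Sum>p\<leftarrow>ps. (g p :: complex))"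
  by (induction ps) auto

text \<open>Gaussian elimination: subtracting the rank one function through a nonzero entry
  lowers the rank and stays within the spans of the columns and of the rows.\<close>

lemma rank_decomp:
  fixes K :: "'x \<Rightarrow> 'y \<Rightarrow> complex" and ps :: "(('x \<Rightarrow> complex) \<times> ('y \<Rightarrow> complex)) list"
  assumes "\<And>x y. x \<in> X \<Longrightarrow> y \<in> Y \<Longrightarrow> K x y = (\<Sum>(a, b)\<leftarrow>ps. a x * b y)"
    and "\<And>y. y \<in> Y \<Longrightarrow> C (\<lambda>x. K x y)" and "\<And>x. x \<in> X \<Longrightarrow> D (K x)"
    and C: "\<And>f g c. C f \<Longrightarrow> C g \<Longrightarrow> C (\<lambda>x. f x + c * g x)"
    and D: "\<And>f g c. D f \<Longrightarrow> D g \<Longrightarrow> D (\<lambda>x. f x + c * g x)"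
  shows "\<exists>qs. (\<forall>(a, b)\<in>set qs. C a \<and> D b) \<and> (\<forall>x\<in>X. \<forall>y\<in>Y. K x y = (\<Sum>(a, b)\<leftarrow>qs. a x * b y))"
  using assms(1-3)
proof (induction "length ps" arbitrary: ps K rule: less_induct)
  case less
  show ?case
  proof (cases "\<forall>x\<in>X. \<forall>y\<in>Y. K x y = 0")
    case True
    then show ?thesis by (intro exI[of _ "[]"]) simp
  next
    case False
    then obtain x0 y0 where x0: "x0 \<in> X" and y0: "y0 \<in> Y" and k0: "K x0 y0 \<noteq> 0" by blast
    have "\<exists>p\<in>set ps. fst p x0 \<noteq> 0"
    proof (rule ccontr)
      assume "\<not> ?thesis"
      then have "(\<Sum>(a, b)\<leftarrow>ps. a x0 * b y0) = (\<Sum>p\<leftarrow>ps. 0)"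
        by (intro sum_list_ev) (auto split: prod.splits)
      then show False using less(2)[OF x0 y0] k0 by simp
    qed
    then obtain a b where ab: "(a, b) \<in> set ps" and a0: "a x0 \<noteq> 0" by auto
    then obtain us vs where ps: "ps = us @ (a, b) # vs" by (meson split_list)
    define rs where "rs = us @ vs"
    have K: "K x y = a x * b y + (\<Sum>(c, d)\<leftarrow>rs. c x * d y)" if "x \<in> X" "y \<in> Y" for x y
      using less(2)[OF that] unfolding ps rs_def by simp
    define K' where "K' = (\<lambda>x y. K x y + (- K x0 y / K x0 y0) * K x y0)"
    \<comment> \<open>Correcting the first factors so that they vanish at \<open>x0\<close> turns
      the term of \<open>(a, b)\<close> into zero, hence one term fewer. This subtracts a multiple
      of the row \<open>K x0\<close> from each row, and the correction of the second factors
      exchanges it for the multiple that occurs in \<open>K'\<close>.\<close>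
    define ps' where "ps' = map (\<lambda>(c, d). (\<lambda>x. c x - a x / a x0 * c x0, \<lambda>y. d y - d y0 / K x0 y0 * K x0 y)) rs"
    have K': "K' x y = (\<Sum>(c, d)\<leftarrow>ps'. c x * d y)" if x: "x \<in> X" and y: "y \<in> Y" for x y
    proof -
      have L: "(\<Sum>(c, d)\<leftarrow>rs. (c x - a x / a x0 * c x0) * d y) = K x y - a x / a x0 * K x0 y" if y: "y \<in> Y" for y
      proof -
        have "(\<Sum>(c, d)\<leftarrow>rs. (c x - a x / a x0 * c x0) * d y) =
          (\<Sum>(c, d)\<leftarrow>rs. c x * d y) - a x / a x0 * (\<Sum>(c, d)\<leftarrow>rs. c x0 * d y)"
          unfolding sum_list_times[symmetric] sum_list_subtractf[symmetric]
          by (rule sum_list_ev) (auto simp: algebra_simps)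
        then show ?thesis using K[OF x y] K[OF x0 y] a0 by (simp add: field_simps)
      qed
      have "(\<Sum>(c, d)\<leftarrow>ps'. c x * d y) = (\<Sum>(c, d)\<leftarrow>rs. (c x - a x / a x0 * c x0) * d y)
        - K x0 y / K x0 y0 * (\<Sum>(c, d)\<leftarrow>rs. (c x - a x / a x0 * c x0) * d y0)"
        unfolding sum_list_times[symmetric] sum_list_subtractf[symmetric] ps'_def map_map
        by (rule sum_list_ev) (use k0 a0 in \<open>auto simp: field_simps\<close>)
      then show ?thesis unfolding L[OF y] L[OF y0] K'_def using k0 by (simp add: field_simps)
    qed
    have "\<exists>qs. (\<forall>(a, b)\<in>set qs. C a \<and> D b) \<and> (\<forall>x\<in>X. \<forall>y\<in>Y. K' x y = (\<Sum>(a, b)\<leftarrow>qs. a x * b y))"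
    proof (rule less(1)[where ps = ps'])
      show "length ps' < length ps" by (simp add: ps'_def ps rs_def)
      show "C (\<lambda>x. K' x y)" if "y \<in> Y" for y
        unfolding K'_def by (intro C less that y0)
      have e: "K' x = (\<lambda>y. K x y + (- K x y0 / K x0 y0) * K x0 y)" for x
        by (auto simp: K'_def)
      show "D (K' x)" if "x \<in> X" for x
        by (subst e) (rule D[OF less(4)[OF that] less(4)[OF x0]])
    qed (rule K')
    then obtain qs where q1: "\<forall>(a, b)\<in>set qs. C a \<and> D b"
      and q2: "\<forall>x\<in>X. \<forall>y\<in>Y. K' x y = (\<Sum>(a, b)\<leftarrow>qs. a x * b y)" by blast
    \<comment> \<open>The second factor is \<open>K x0 y / K x0 y0\<close>, written in the shape
      \<open>f + c * g\<close> to which the closure hypothesis on \<open>D\<close> applies.\<close>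
    let ?qs = "(\<lambda>x. K x y0, \<lambda>y. K x0 y + (1 / K x0 y0 - 1) * K x0 y) # qs"
    have "K x y = (\<Sum>(a, b)\<leftarrow>?qs. a x * b y)" if "x \<in> X" "y \<in> Y" for x y
    proof -
      have 1: "(\<Sum>(a, b)\<leftarrow>qs. a x * b y) = K x y + (- K x0 y / K x0 y0) * K x y0"
        using q2 that unfolding K'_def by simp
      show ?thesis using k0 by (simp add: 1 field_simps)
    qed
    moreover have "\<forall>(a, b)\<in>set ?qs. C a \<and> D b"
      using q1 less(3)[OF y0] D[OF less(4)[OF x0] less(4)[OF x0]] by auto
    ultimately show ?thesis by (intro exI[of _ ?qs]) blast
  qed
qed

lemma neg_move: "a + b = - c \<Longrightarrow> a = - (c + b)" for a b c :: "'g::ab_group_add"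
  by (metis add_diff_cancel_right' diff_conv_add_uminus minus_add_distrib)

section \<open>The finite dual of a Hopf algebra\<close>

text \<open>The co-associativity, co-unit and antipode laws are stated after evaluation on forms, in
  accordance with the model of tensors. \<open>S_com\<close> says that the antipode reverses the
  comultiplication up to a factor; dually it makes the antipode of the finite dual reverse
  products.\<close>

locale gr_hopf = grtens \<omega> U for \<omega> :: "'g::ab_group_add \<Rightarrow> 'g \<Rightarrow> complex"
  and U :: "('g, 'a) hopf" (structure) +
  assumes com_TT [simp, intro]: "x \<in> carrier U \<Longrightarrow> comult U x \<in> TT"
    and com_add: "x \<in> carrier U \<Longrightarrow> y \<in> carrier U \<Longrightarrow> comult U (x \<oplus> y) = comult U x + comult U y"
    and com_sm: "x \<in> carrier U \<Longrightarrow> comult U (c \<odot> x) = (\<lambda>B. c * comult U x B)"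
    and com_mult: "x \<in> carrier U \<Longrightarrow> y \<in> carrier U \<Longrightarrow> comult U (x \<otimes> y) = tm (comult U x) (comult U y)"
    and com_one: "comult U \<one> = pt \<one> \<one>"
    and com_grade: "x \<in> grade U \<alpha> \<Longrightarrow> comult U x \<in> tensor_sums U U {(u, v). \<exists>\<beta>. u \<in> grade U \<beta> \<and> v \<in> grade U (\<alpha> - \<beta>)}"
    and cou_lin: "lin U (counit U)"
    and cou_mult: "x \<in> carrier U \<Longrightarrow> y \<in> carrier U \<Longrightarrow> counit U (x \<otimes> y) = counit U x * counit U y"
    and cou_one [simp]: "counit U \<one> = 1"
    and cou_grade: "x \<in> grade U \<alpha> \<Longrightarrow> \<alpha> \<noteq> 0 \<Longrightarrow> counit U x = 0"
    and coassoc: "x \<in> carrier U \<Longrightarrow> trilin U B \<Longrightarrow>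
      comult U x (\<lambda>y z. comult U y (\<lambda>u v. B u v z)) = comult U x (\<lambda>y z. comult U z (B y))"
    and cou_l: "x \<in> carrier U \<Longrightarrow> lin U f \<Longrightarrow> comult U x (\<lambda>y z. counit U y * f z) = f x"
    and cou_r: "x \<in> carrier U \<Longrightarrow> lin U f \<Longrightarrow> comult U x (\<lambda>y z. f y * counit U z) = f x"
    and S_closed [simp, intro]: "x \<in> carrier U \<Longrightarrow> antipode U x \<in> carrier U"
    and S_add: "x \<in> carrier U \<Longrightarrow> y \<in> carrier U \<Longrightarrow> antipode U (x \<oplus> y) = antipode U x \<oplus> antipode U y"
    and S_sm: "x \<in> carrier U \<Longrightarrow> antipode U (c \<odot> x) = c \<odot> antipode U x"
    and S_grade: "x \<in> grade U \<alpha> \<Longrightarrow> antipode U x \<in> grade U \<alpha>"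
    and S_mult: "x \<in> grade U \<alpha> \<Longrightarrow> y \<in> grade U \<beta> \<Longrightarrow> antipode U (x \<otimes> y) = \<omega> \<alpha> \<beta> \<odot> (antipode U y \<otimes> antipode U x)"
    and S_cou: "x \<in> carrier U \<Longrightarrow> counit U (antipode U x) = counit U x"
    and S_l: "x \<in> carrier U \<Longrightarrow> lin U f \<Longrightarrow> comult U x (\<lambda>y z. f (antipode U y \<otimes> z)) = counit U x * f \<one>"
    and S_r: "x \<in> carrier U \<Longrightarrow> lin U f \<Longrightarrow> comult U x (\<lambda>y z. f (y \<otimes> antipode U z)) = counit U x * f \<one>"
    and S_com: "x \<in> carrier U \<Longrightarrow> f \<in> dual_grade U \<phi> \<Longrightarrow> g \<in> dual_grade U \<psi> \<Longrightarrow>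
      comult U (antipode U x) (\<lambda>u v. f u * g v) = \<omega> \<psi> \<phi> * comult U x (\<lambda>u v. g (antipode U u) * f (antipode U v))"
begin

lemma dual_iff: "f \<in> dual_space U \<longleftrightarrow> lin U f \<and> (\<forall>x. x \<notin> carrier U \<longrightarrow> f x = 0)"
  by (auto simp: dual_space_def lin_def)

abbreviation "hg \<equiv> dual_grade U"

lemma hd_dual [dest]: "f \<in> hg \<phi> \<Longrightarrow> f \<in> dual_space U"
  and hd_vanish: "f \<in> hg \<phi> \<Longrightarrow> x \<in> grade U \<alpha> \<Longrightarrow> \<alpha> \<noteq> - \<phi> \<Longrightarrow> f x = 0"
  by (auto simp: dual_grade_def)

lemma dual_lin: "f \<in> dual_space U \<Longrightarrow> lin U f"
  and dual_off: "f \<in> dual_space U \<Longrightarrow> x \<notin> carrier U \<Longrightarrow> f x = 0"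
  by (auto simp: dual_iff)

lemma hd_lin: "f \<in> hg \<phi> \<Longrightarrow> lin U f"
  by (auto dest: dual_lin)

lemma dual_add: "f \<in> dual_space U \<Longrightarrow> g \<in> dual_space U \<Longrightarrow> f + g \<in> dual_space U"
  and dual_sm: "f \<in> dual_space U \<Longrightarrow> (\<lambda>x. c * f x) \<in> dual_space U"
  and dual_zero: "0 \<in> dual_space U"
  by (auto simp: dual_iff lin_def fun_app algebra_simps)

lemma hd_add: "f \<in> hg \<phi> \<Longrightarrow> g \<in> hg \<phi> \<Longrightarrow> f + g \<in> hg \<phi>"
  and hd_sm: "f \<in> hg \<phi> \<Longrightarrow> (\<lambda>x. c * f x) \<in> hg \<phi>"
  and hd_zero: "0 \<in> hg \<phi>"
  by (auto simp: dual_grade_def dual_add dual_sm dual_zero fun_app)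

lemma dual_eqI: "f \<in> dual_space U \<Longrightarrow> g \<in> dual_space U \<Longrightarrow> (\<And>\<alpha> x. x \<in> grade U \<alpha> \<Longrightarrow> f x = g x) \<Longrightarrow> f = g"
  by (rule ext, rename_tac x, case_tac "x \<in> carrier U") (auto simp: dual_off intro: lin_ext dual_lin)

definition rs :: "('a \<Rightarrow> complex) \<Rightarrow> 'a \<Rightarrow> complex" where
  "rs f x = (if x \<in> carrier U then f x else 0)"

lemma rs_in [simp]: "x \<in> carrier U \<Longrightarrow> rs f x = f x"
  by (simp add: rs_def)

lemma rs_dual: "lin U f \<Longrightarrow> rs f \<in> dual_space U"
  by (auto simp: dual_iff lin_def rs_def)

lemma rs_hd: "lin U f \<Longrightarrow> (\<And>\<alpha> x. x \<in> grade U \<alpha> \<Longrightarrow> \<alpha> \<noteq> - \<phi> \<Longrightarrow> f x = 0) \<Longrightarrow> rs f \<in> hg \<phi>"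
  by (auto simp: dual_grade_def rs_dual rs_def)

lemma Bil_ext:
  assumes "B \<in> Bil" "C \<in> Bil" "\<And>\<alpha> \<beta> x y. x \<in> grade U \<alpha> \<Longrightarrow> y \<in> grade U \<beta> \<Longrightarrow> B x y = C x y"
    "x \<in> carrier U" "y \<in> carrier U"
  shows "B x y = C x y"
proof (rule lin_ext[where f = "B x" and g = "C x"])
  fix \<beta> y assume y: "y \<in> grade U \<beta>"
  show "B x y = C x y"
    by (rule lin_ext[where f = "\<lambda>x. B x y" and g = "\<lambda>x. C x y"]) (use assms y in \<open>auto intro: bilin1\<close>)
qed (use assms in \<open>auto intro: bilin2\<close>)

lemma lin_com: "B \<in> Bil \<Longrightarrow> lin U (\<lambda>x. comult U x B)"
  by (auto simp: lin_def com_add com_sm fun_app)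

text \<open>Both claims go through one induction, since additivity of \<open>z\<close> needs the
  bilinearity of the remaining sum. With \<open>z = 0\<close> the second claim alone says that forms
  are closed under list sums.\<close>

lemma TT_sum_list: "z \<in> TT \<Longrightarrow> (\<And>p. p \<in> set ps \<Longrightarrow> B p \<in> Bil) \<Longrightarrow>
    z (\<lambda>u v. \<Sum>p\<leftarrow>ps. B p u v) = (\<Sum>p\<leftarrow>ps. z (B p)) \<and> (\<lambda>u v. \<Sum>p\<leftarrow>ps. B p u v) \<in> Bil"
proof (induction ps)
  case Nil
  then show ?case using TT_times[of z "\<lambda>u v. 0" 0] by (simp add: bilin_zero)
next
  case (Cons p ps)
  then show ?case using TT_plus[of z "B p" "\<lambda>u v. \<Sum>p\<leftarrow>ps. B p u v"] bilin_plus[of "B p" U U "\<lambda>u v. \<Sum>p\<leftarrow>ps. B p u v"] by simp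
qed

lemma pairing_Bil: "lin U f \<Longrightarrow> lin U g \<Longrightarrow> pairing \<omega> U f g \<in> Bil"
proof (rule bilinI)
  assume f: "lin U f" and g: "lin U g"
  show "lin U (\<lambda>x. pairing \<omega> U f g x y)" for y
    unfolding pairing_def
    by (intro hsum_lin[where g = "\<lambda>\<alpha> x. \<Sum>\<beta>\<in>hsupp U y. \<omega> (- \<beta>) \<alpha> * f x * g (hpart U \<beta> y)"] lin_sum lin_times' lin_times f)
  show "lin U (pairing \<omega> U f g x)" for x
    unfolding pairing_def
    by (subst sum.swap, intro hsum_lin[where g = "\<lambda>\<beta> y. \<Sum>\<alpha>\<in>hsupp U x. \<omega> (- \<beta>) \<alpha> * f (hpart U \<alpha> x) * g y"] lin_sum lin_times g)
qed

lemma pairing_hom: "lin U f \<Longrightarrow> lin U g \<Longrightarrow> x \<in> grade U \<alpha> \<Longrightarrow> y \<in> grade U \<beta> \<Longrightarrow>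
    pairing \<omega> U f g x y = \<omega> (- \<beta>) \<alpha> * f x * g y"
proof -
  assume f: "lin U f" and g: "lin U g" and x: "x \<in> grade U \<alpha>" and y: "y \<in> grade U \<beta>"
  have "pairing \<omega> U f g x y = (\<Sum>\<beta>\<in>hsupp U y. \<omega> (- \<beta>) \<alpha> * f x * g (hpart U \<beta> y))"
    unfolding pairing_def
    by (subst hsum_hom[where \<alpha> = \<alpha> and g = "\<lambda>\<alpha> x. \<Sum>\<beta>\<in>hsupp U y. \<omega> (- \<beta>) \<alpha> * f x * g (hpart U \<beta> y)"])
      (auto simp: x lin_0[OF f])
  also have "\<dots> = \<omega> (- \<beta>) \<alpha> * f x * g y"
    by (subst hsum_hom[where \<alpha> = \<beta> and g = "\<lambda>\<beta> y. \<omega> (- \<beta>) \<alpha> * f x * g y"]) (auto simp: y lin_0[OF g])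
  finally show ?thesis .
qed

text \<open>Only the degrees - \<phi> and - \<psi> contribute, and there the factor is
  \<open>\<omega> \<psi> (- \<phi>) = \<omega> \<phi> \<psi>\<close>. From here on the signs of the
  dual depend on the degrees of the functionals and no longer on the arguments.\<close>

lemma pairing_hd: "f \<in> hg \<phi> \<Longrightarrow> g \<in> hg \<psi> \<Longrightarrow> x \<in> carrier U \<Longrightarrow> y \<in> carrier U \<Longrightarrow>
    pairing \<omega> U f g x y = \<omega> \<phi> \<psi> * (f x * g y)"
proof (rule Bil_ext[where B = "pairing \<omega> U f g" and C = "\<lambda>x y. \<omega> \<phi> \<psi> * (f x * g y)"])
  assume f: "f \<in> hg \<phi>" and g: "g \<in> hg \<psi>"
  show "pairing \<omega> U f g \<in> Bil" by (intro pairing_Bil hd_lin[OF f] hd_lin[OF g])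
  show "(\<lambda>x y. \<omega> \<phi> \<psi> * (f x * g y)) \<in> Bil" by (intro bilin_times bilin_prod hd_lin[OF f] hd_lin[OF g])
  fix \<alpha> \<beta> x y assume x: "x \<in> grade U \<alpha>" and y: "y \<in> grade U \<beta>"
  show "pairing \<omega> U f g x y = \<omega> \<phi> \<psi> * (f x * g y)"
    using x y pairing_hom[OF hd_lin[OF f] hd_lin[OF g] x y] hd_vanish[OF f x] hd_vanish[OF g y] om_swap[of \<phi> \<psi>]
    by (cases "\<alpha> = - \<phi>"; cases "\<beta> = - \<psi>") (auto simp: om_minus)
qed

lemma pairing_add1: "pairing \<omega> U (f + f') g x y = pairing \<omega> U f g x y + pairing \<omega> U f' g x y"
  and pairing_add2: "pairing \<omega> U f (g + g') x y = pairing \<omega> U f g x y + pairing \<omega> U f g' x y"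
  and pairing_sm1: "pairing \<omega> U (\<lambda>x. c * f x) g x y = c * pairing \<omega> U f g x y"
  and pairing_sm2: "pairing \<omega> U f (\<lambda>x. c * g x) x y = c * pairing \<omega> U f g x y"
  by (simp_all add: pairing_def fun_app sum.distrib[symmetric] sum_distrib_left algebra_simps)

subsection \<open>Functionals with finite rank\<close>

text \<open>The kernel \<open>f (x \<otimes> y)\<close> has finite rank. The factors may be
  arbitrary functions; \<open>rank_decomp\<close> later replaces them by translates of
  \<open>f\<close>, which are linear.\<close>

definition frank :: "('a \<Rightarrow> complex) \<Rightarrow> bool" where
  "frank f \<longleftrightarrow> (\<exists>ps. \<forall>x\<in>carrier U. \<forall>y\<in>carrier U. f (x \<otimes> y) = (\<Sum>(a, b)\<leftarrow>ps. a x * (b y :: complex)))"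

lemma frankI: "(\<And>x y. x \<in> carrier U \<Longrightarrow> y \<in> carrier U \<Longrightarrow> f (x \<otimes> y) = (\<Sum>p\<leftarrow>ps. a p x * b p y)) \<Longrightarrow> frank f"
  unfolding frank_def by (rule exI[of _ "map (\<lambda>p. (a p, b p)) ps"]) (simp add: comp_def)

lemma frankE:
  assumes "frank f"
  obtains ps where "\<And>x y. x \<in> carrier U \<Longrightarrow> y \<in> carrier U \<Longrightarrow> f (x \<otimes> y) = (\<Sum>p\<leftarrow>ps. fst p x * (snd p y :: complex))"
proof -
  obtain ps where "\<forall>x\<in>carrier U. \<forall>y\<in>carrier U. f (x \<otimes> y) = (\<Sum>(a, b)\<leftarrow>ps. a x * (b y :: complex))"
    using assms unfolding frank_def by blast
  then show thesis using that[of ps] by (simp add: split_def)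
qed

text \<open>Columns of the kernel are right translates of \<open>f\<close> and rows are left
  translates. Both families are closed under linear combinations because \<open>u\<close> and
  \<open>v\<close> range over a vector space, so \<open>rank_decomp\<close> applies with
  \<open>C\<close> and \<open>D\<close> as these families.\<close>

lemma frank_translates:
  assumes f: "lin U f" "frank f"
  obtains zs where "set zs \<subseteq> carrier U \<times> carrier U"
    "\<And>x y. x \<in> carrier U \<Longrightarrow> y \<in> carrier U \<Longrightarrow> f (x \<otimes> y) = (\<Sum>(u, v)\<leftarrow>zs. f (x \<otimes> u) * f (v \<otimes> y))"
proof -
  define C where "C = (\<lambda>a. \<exists>u\<in>carrier U. \<forall>x\<in>carrier U. a x = f (x \<otimes> u))"
  define D where "D = (\<lambda>b. \<exists>v\<in>carrier U. \<forall>y\<in>carrier U. b y = f (v \<otimes> y))"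
  obtain ps where ps: "\<And>x y. x \<in> carrier U \<Longrightarrow> y \<in> carrier U \<Longrightarrow> f (x \<otimes> y) = (\<Sum>p\<leftarrow>ps. fst p x * (snd p y :: complex))"
    by (rule frankE[OF f(2)]) (rule that)
  have "\<exists>qs. (\<forall>(a, b)\<in>set qs. C a \<and> D b) \<and> (\<forall>x\<in>carrier U. \<forall>y\<in>carrier U. f (x \<otimes> y) = (\<Sum>(a, b)\<leftarrow>qs. a x * b y))"
  proof (rule rank_decomp)
    show "f (x \<otimes> y) = (\<Sum>(a, b)\<leftarrow>ps. a x * b y)" if "x \<in> carrier U" "y \<in> carrier U" for x y
      using ps[OF that] by (simp add: split_def)
    show "C (\<lambda>x. g x + c * h x)" if gh: "C g" "C h" for g h c
    proof -
      obtain u v where "u \<in> carrier U" "v \<in> carrier U" "\<forall>x\<in>carrier U. g x = f (x \<otimes> u)" "\<forall>x\<in>carrier U. h x = f (x \<otimes> v)"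
        using gh unfolding C_def by blast
      then show ?thesis unfolding C_def
        by (intro bexI[of _ "u \<oplus> c \<odot> v"]) (auto simp: r_distr sm_mult lin_add[OF f(1)] lin_smult[OF f(1)])
    qed
    show "D (\<lambda>x. g x + c * h x)" if gh: "D g" "D h" for g h c
    proof -
      obtain u v where "u \<in> carrier U" "v \<in> carrier U" "\<forall>x\<in>carrier U. g x = f (u \<otimes> x)" "\<forall>x\<in>carrier U. h x = f (v \<otimes> x)"
        using gh unfolding D_def by blast
      then show ?thesis unfolding D_def
        by (intro bexI[of _ "u \<oplus> c \<odot> v"]) (auto simp: l_distr sm_mult lin_add[OF f(1)] lin_smult[OF f(1)])
    qed
  qed (auto simp: C_def D_def)
  then obtain qs where q1: "\<forall>(a, b)\<in>set qs. C a \<and> D b"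
    and q2: "\<forall>x\<in>carrier U. \<forall>y\<in>carrier U. f (x \<otimes> y) = (\<Sum>(a, b)\<leftarrow>qs. a x * b y)" by blast
  have "\<forall>a. \<exists>u. C a \<longrightarrow> u \<in> carrier U \<and> (\<forall>x\<in>carrier U. a x = f (x \<otimes> u))" unfolding C_def by blast
  from choice[OF this] obtain cu where cu: "\<And>a. C a \<Longrightarrow> cu a \<in> carrier U \<and> (\<forall>x\<in>carrier U. a x = f (x \<otimes> cu a))"
    by blast
  have "\<forall>a. \<exists>v. D a \<longrightarrow> v \<in> carrier U \<and> (\<forall>x\<in>carrier U. a x = f (v \<otimes> x))" unfolding D_def by blast
  from choice[OF this] obtain dv where dv: "\<And>a. D a \<Longrightarrow> dv a \<in> carrier U \<and> (\<forall>x\<in>carrier U. a x = f (dv a \<otimes> x))"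
    by blast
  show thesis
  proof (rule that[of "map (\<lambda>(a, b). (cu a, dv b)) qs"])
    show "set (map (\<lambda>(a, b). (cu a, dv b)) qs) \<subseteq> carrier U \<times> carrier U"
      using q1 cu dv by auto
    fix x y assume x: "x \<in> carrier U" and y: "y \<in> carrier U"
    have "f (x \<otimes> y) = (\<Sum>(a, b)\<leftarrow>qs. a x * b y)" using q2 x y by blast
    also have "\<dots> = (\<Sum>(a, b)\<leftarrow>qs. f (x \<otimes> cu a) * f (dv b \<otimes> y))"
      by (rule sum_list_ev) (use q1 cu dv x y in \<open>auto split: prod.splits\<close>)
    finally show "f (x \<otimes> y) = (\<Sum>(u, v)\<leftarrow>map (\<lambda>(a, b). (cu a, dv b)) qs. f (x \<otimes> u) * f (v \<otimes> y))"
      by (simp add: split_def comp_def)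
  qed
qed

definition lcomb :: "(complex \<times> 'a) list \<Rightarrow> 'a" where
  "lcomb ps = foldr (\<lambda>(c, x) z. c \<odot> x \<oplus> z) ps \<zero>"

lemma lcomb_closed: "snd ` set ps \<subseteq> carrier U \<Longrightarrow> lcomb ps \<in> carrier U"
  by (induction ps) (auto simp: lcomb_def)

lemma lcomb_lin: "lin U f \<Longrightarrow> snd ` set ps \<subseteq> carrier U \<Longrightarrow> f (lcomb ps) = (\<Sum>(c, x)\<leftarrow>ps. c * f x)"
proof (induction ps)
  case (Cons p ps)
  have "lcomb (p # ps) = fst p \<odot> snd p \<oplus> lcomb ps" by (simp add: lcomb_def split_def)
  then show ?case using Cons lcomb_closed[of ps] by (auto simp: lin_add lin_smult split_def)
qed (simp add: lcomb_def lin_0)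

lemma lcomb_lspan: "snd ` set ps \<subseteq> S \<Longrightarrow> lcomb ps \<in> lspan U S"
proof (induction ps)
  case (Cons p ps)
  have "lcomb (p # ps) = fst p \<odot> snd p \<oplus> lcomb ps" by (simp add: lcomb_def split_def)
  then show ?case using Cons by (simp add: lspan.intros)
qed (simp add: lcomb_def lspan.zero)

lemma lspan_carrier: "S \<subseteq> carrier U \<Longrightarrow> z \<in> lspan U S \<Longrightarrow> z \<in> carrier U"
  by (erule lspan.induct) auto

text \<open>The largest two-sided ideal inside the kernel of \<open>f\<close> serves. It is graded
  because \<open>f\<close> is homogeneous, and it has finite codimension because the function
  sending \<open>x\<close> and \<open>(u, v)\<close> to \<open>f (u \<otimes> x \<otimes> v)\<close>
  again has finite rank.\<close>

lemma frank_ideal: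
  assumes f: "f \<in> hg \<phi>" "frank f"
  shows "\<exists>J. cofinite_graded_ideal U J \<and> (\<forall>x\<in>J. f x = 0)"
proof -
  note fl = hd_lin[OF f(1)]
  define J where "J = {x \<in> carrier U. \<forall>u\<in>carrier U. \<forall>v\<in>carrier U. f (u \<otimes> x \<otimes> v) = 0}"
  have l: "lin U (\<lambda>x. f (u \<otimes> x \<otimes> v))" if "u \<in> carrier U" "v \<in> carrier U" for u v
    using lin_lmult[OF lin_rmult[OF fl that(2)] that(1)] .
  have id: "ideal J U"
  proof (rule idealI[OF ring_M])
    show "subgroup J (add_monoid U)"
    proof (rule add.subgroupI)
      show "J \<subseteq> carrier U" by (auto simp: J_def)
      have "\<zero> \<in> J" unfolding J_def using lin_0[OF l] by auto
      then show "J \<noteq> {}" by auto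
      show "\<ominus> x \<in> J" if "x \<in> J" for x
        using that lin_smult[OF l, of _ _ x "-1"] by (auto simp: J_def sm_minus)
      show "x \<oplus> y \<in> J" if "x \<in> J" "y \<in> J" for x y
        using that lin_add[OF l] by (auto simp: J_def)
    qed
    show "x \<otimes> a \<in> J" if "a \<in> J" "x \<in> carrier U" for a x
    proof -
      have "u \<otimes> (x \<otimes> a) \<otimes> v = (u \<otimes> x) \<otimes> a \<otimes> v" if "u \<in> carrier U" "v \<in> carrier U" for u v
        using that \<open>a \<in> J\<close> \<open>x \<in> carrier U\<close> by (simp add: J_def m_assoc)
      then show ?thesis using that by (simp add: J_def)
    qed
    show "a \<otimes> x \<in> J" if "a \<in> J" "x \<in> carrier U" for a x
    proof -
      have "u \<otimes> (a \<otimes> x) \<otimes> v = u \<otimes> a \<otimes> (x \<otimes> v)" if "u \<in> carrier U" "v \<in> carrier U" for u v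
        using that \<open>a \<in> J\<close> \<open>x \<in> carrier U\<close> by (simp add: J_def m_assoc)
      then show ?thesis using that by (simp add: J_def)
    qed
  qed
  have gr: "hpart U \<alpha> x \<in> J" if x: "x \<in> J" for x \<alpha>
  proof -
    have xc: "x \<in> carrier U" using x by (simp add: J_def)
    have hom: "f (u \<otimes> hpart U \<alpha> x \<otimes> v) = 0" if u: "u \<in> grade U \<beta>" and v: "v \<in> grade U \<delta>" for u v \<beta> \<delta>
    proof -
      have uc: "u \<in> carrier U" and vc: "v \<in> carrier U" using u v by auto
      have g: "u \<otimes> hpart U \<kappa> x \<otimes> v \<in> grade U (\<beta> + \<kappa> + \<delta>)" for \<kappa>
        using u v xc by (intro grade_mult) auto
      show ?thesis
      proof (cases "\<beta> + \<alpha> + \<delta> = - \<phi>")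
        case True
        \<comment> \<open>For homogeneous \<open>u\<close> and \<open>v\<close>, the component of
          \<open>x\<close> of degree \<alpha> is the only one that is carried into the degree where
          \<open>f\<close> lives, so the sum over all components reduces to this one.\<close>
        have "0 = f (u \<otimes> x \<otimes> v)" using x uc vc by (auto simp: J_def)
        also have "\<dots> = (\<Sum>\<kappa>\<in>hsupp U x. f (u \<otimes> hpart U \<kappa> x \<otimes> v))"
          by (rule lin_hsum[OF l[OF uc vc] xc])
        also have "\<dots> = (\<Sum>\<kappa>\<in>hsupp U x. if \<kappa> = \<alpha> then f (u \<otimes> hpart U \<alpha> x \<otimes> v) else 0)"
        proof (rule sum.cong[OF refl])
          fix \<kappa> show "f (u \<otimes> hpart U \<kappa> x \<otimes> v) = (if \<kappa> = \<alpha> then f (u \<otimes> hpart U \<alpha> x \<otimes> v) else 0)"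
          proof (cases "\<kappa> = \<alpha>")
            case False
            then have "\<beta> + \<kappa> + \<delta> \<noteq> - \<phi>" using True by (metis add_left_cancel add_right_cancel)
            then show ?thesis using hd_vanish[OF f(1) g[of \<kappa>]] False by simp
          qed simp
        qed
        also have "\<dots> = f (u \<otimes> hpart U \<alpha> x \<otimes> v)"
        proof (cases "\<alpha> \<in> hsupp U x")
          case False
          then have "hpart U \<alpha> x = \<zero>" by (simp add: hsupp_def)
          then show ?thesis using False xc lin_0[OF l[OF uc vc]] by simp
        qed (use xc in simp)
        finally show ?thesis by simp
      next
        case False
        then show ?thesis using hd_vanish[OF f(1) g[of \<alpha>]] by simp
      qed
    qed
    have "f (u \<otimes> hpart U \<alpha> x \<otimes> v) = 0" if "u \<in> carrier U" "v \<in> carrier U" for u v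
    proof (rule Bil_ext[where C = "\<lambda>u v. 0" and B = "\<lambda>u v. f (u \<otimes> hpart U \<alpha> x \<otimes> v)"])
      show "(\<lambda>u v. f (u \<otimes> hpart U \<alpha> x \<otimes> v)) \<in> Bil"
        using xc by (intro bilinI lin_lmult[OF fl] lin_rmult[OF lin_rmult[OF fl]]) auto
    qed (auto simp: hom that bilin_zero)
    then show ?thesis using xc by (simp add: J_def)
  qed
  have cof: "\<exists>S. finite S \<and> S \<subseteq> carrier U \<and> (\<forall>x\<in>carrier U. \<exists>y\<in>lspan U S. x \<ominus> y \<in> J)"
  proof -
    obtain zs where zs: "set zs \<subseteq> carrier U \<times> carrier U"
      "\<And>x y. x \<in> carrier U \<Longrightarrow> y \<in> carrier U \<Longrightarrow> f (x \<otimes> y) = (\<Sum>(u, v)\<leftarrow>zs. f (x \<otimes> u) * f (v \<otimes> y))"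
      using frank_translates[OF fl f(2)] by metis
    \<comment> \<open>Rows are required to come from elements of \<open>U\<close>. In a
      decomposition with rows coming from elements \<open>cx b\<close>, the difference of
      \<open>x\<close> and the combination of the \<open>cx b\<close> with coefficients
      \<open>a x\<close> then lies in \<open>J\<close>.\<close>
    define D where "D = (\<lambda>d. \<exists>x\<in>carrier U. \<forall>u\<in>carrier U. \<forall>v\<in>carrier U. d (u, v) = f (u \<otimes> x \<otimes> v))"
    \<comment> \<open>Splitting twice: \<open>f (u \<otimes> x \<otimes> v)\<close> is the sum of
      \<open>f (u \<otimes> x \<otimes> p) * f (q \<otimes> v)\<close>, and the first factor is
      split once more between \<open>u\<close> and \<open>x \<otimes> p\<close>.\<close>
    define ps where "ps = map (\<lambda>((p, q), (r, s)). (\<lambda>x. f (s \<otimes> (x \<otimes> p)), \<lambda>(u, v). f (u \<otimes> r) * f (q \<otimes> v))) (List.product zs zs)"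
    have "\<exists>qs. (\<forall>(a, b)\<in>set qs. True \<and> D b) \<and> (\<forall>x\<in>carrier U. \<forall>y\<in>carrier U \<times> carrier U. (case y of (u, v) \<Rightarrow> f (u \<otimes> x \<otimes> v)) = (\<Sum>(a, b)\<leftarrow>qs. a x * b y))"
    proof (rule rank_decomp)
      fix x y assume x: "x \<in> carrier U" and y: "y \<in> carrier U \<times> carrier U"
      obtain u v where uv: "y = (u, v)" "u \<in> carrier U" "v \<in> carrier U" using y by auto
      have "f (u \<otimes> x \<otimes> v) = (\<Sum>(p, q)\<leftarrow>zs. f (u \<otimes> x \<otimes> p) * f (q \<otimes> v))"
        using zs(2) x uv by simp
      also have "\<dots> = (\<Sum>(p, q)\<leftarrow>zs. \<Sum>(r, s)\<leftarrow>zs. f (s \<otimes> (x \<otimes> p)) * (f (u \<otimes> r) * f (q \<otimes> v)))"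
      proof (rule sum_list_ev, clarify)
        fix p q assume pq: "(p, q) \<in> set zs"
        then have p: "p \<in> carrier U" using zs(1) by auto
        have "f (u \<otimes> x \<otimes> p) = (\<Sum>(r, s)\<leftarrow>zs. f (u \<otimes> r) * f (s \<otimes> (x \<otimes> p)))"
          using zs(2)[of u "x \<otimes> p"] x uv p by (simp add: m_assoc)
        then show "f (u \<otimes> x \<otimes> p) * f (q \<otimes> v) = (\<Sum>(r, s)\<leftarrow>zs. f (s \<otimes> (x \<otimes> p)) * (f (u \<otimes> r) * f (q \<otimes> v)))"
          by (simp only: split_def sum_list_mult_const[symmetric]) (rule sum_list_ev, simp)
      qed
      also have "\<dots> = (\<Sum>(a, b)\<leftarrow>ps. a x * b y)"
        unfolding split_def sum_list_product ps_def map_map uv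
        by (simp add: split_def comp_def)
      finally show "(case y of (u, v) \<Rightarrow> f (u \<otimes> x \<otimes> v)) = (\<Sum>(a, b)\<leftarrow>ps. a x * b y)"
        using uv by simp
    next
      show "D (\<lambda>x. g x + c * h x)" if gh: "D g" "D h" for g h c
      proof -
        obtain x y where "x \<in> carrier U" "y \<in> carrier U" "\<forall>u\<in>carrier U. \<forall>v\<in>carrier U. g (u, v) = f (u \<otimes> x \<otimes> v)"
          "\<forall>u\<in>carrier U. \<forall>v\<in>carrier U. h (u, v) = f (u \<otimes> y \<otimes> v)" using gh unfolding D_def by blast
        then show ?thesis unfolding D_def
          by (intro bexI[of _ "x \<oplus> c \<odot> y"]) (auto simp: lin_add[OF l] lin_smult[OF l])
      qed
    qed (auto simp: D_def)
    then obtain qs where q1: "\<forall>(a, b)\<in>set qs. D b"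
      and q2: "\<forall>x\<in>carrier U. \<forall>y\<in>carrier U \<times> carrier U. (case y of (u, v) \<Rightarrow> f (u \<otimes> x \<otimes> v)) = (\<Sum>(a, b)\<leftarrow>qs. a x * b y)"
      by blast
    have "\<forall>d. \<exists>x. D d \<longrightarrow> x \<in> carrier U \<and> (\<forall>u\<in>carrier U. \<forall>v\<in>carrier U. d (u, v) = f (u \<otimes> x \<otimes> v))"
      unfolding D_def by blast
    from choice[OF this] obtain cx where cx: "\<And>d. D d \<Longrightarrow> cx d \<in> carrier U \<and> (\<forall>u\<in>carrier U. \<forall>v\<in>carrier U. d (u, v) = f (u \<otimes> cx d \<otimes> v))"
      by blast
    define S where "S = (\<lambda>(a, b). cx b) ` set qs"
    have S: "finite S" "S \<subseteq> carrier U" unfolding S_def using q1 cx by auto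
    have "\<exists>y\<in>lspan U S. x \<ominus> y \<in> J" if x: "x \<in> carrier U" for x
    proof
      let ?y = "lcomb (map (\<lambda>(a, b). (a x, cx b)) qs)"
      show y: "?y \<in> lspan U S" by (rule lcomb_lspan) (auto simp: S_def)
      then have yc: "?y \<in> carrier U" using lspan_carrier S(2) by blast
      have "f (u \<otimes> (x \<ominus> ?y) \<otimes> v) = 0" if u: "u \<in> carrier U" and v: "v \<in> carrier U" for u v
      proof -
        have "f (u \<otimes> ?y \<otimes> v) = (\<Sum>(a, b)\<leftarrow>qs. a x * f (u \<otimes> cx b \<otimes> v))"
          by (subst lcomb_lin[OF l[OF u v]]) (use q1 cx in \<open>auto simp: split_def comp_def\<close>)
        also have "\<dots> = (\<Sum>(a, b)\<leftarrow>qs. a x * b (u, v))"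
          by (rule sum_list_ev) (use q1 cx u v in \<open>auto split: prod.splits\<close>)
        also have "\<dots> = f (u \<otimes> x \<otimes> v)" using q2 x u v by auto
        finally have 1: "f (u \<otimes> ?y \<otimes> v) = f (u \<otimes> x \<otimes> v)" .
        have "x \<ominus> ?y = x \<oplus> (- 1) \<odot> ?y" using yc by (simp add: sm_minus minus_eq)
        then show ?thesis using 1 x yc lin_add[OF l[OF u v], of x "(-1) \<odot> ?y"] lin_smult[OF l[OF u v], of ?y "-1"] by simp
      qed
      then show "x \<ominus> ?y \<in> J" using x yc by (auto simp: J_def)
    qed
    then show ?thesis using S by blast
  qed
  have "f x = 0" if "x \<in> J" for x
  proof -
    have "x \<in> carrier U" "f (\<one> \<otimes> x \<otimes> \<one>) = 0" using that one_closed unfolding J_def by blast+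
    then show ?thesis by simp
  qed
  then show ?thesis using id gr cof unfolding cofinite_graded_ideal_def by blast
qed

text \<open>As a function of \<open>y\<close>, the value \<open>f (x \<otimes> y)\<close> depends
  only on the class of \<open>y\<close> modulo \<open>J\<close>, and this class is a combination of
  the finitely many elements of \<open>S\<close>. The coefficients of that combination do not depend
  on \<open>x\<close>.\<close>

lemma ideal_frank:
  assumes f: "lin U f" and J: "cofinite_graded_ideal U J" "\<forall>x\<in>J. f x = 0"
  shows "frank f"
proof -
  interpret J: ideal J U using J by (simp add: cofinite_graded_ideal_def)
  obtain S where S: "finite S" "S \<subseteq> carrier U" "\<forall>x\<in>carrier U. \<exists>y\<in>lspan U S. x \<ominus> y \<in> J"
    using J by (auto simp: cofinite_graded_ideal_def)
  obtain l where l: "set l = S" "distinct l" using finite_distinct_list[OF S(1)] by blast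
  have 1: "\<exists>c. \<forall>x\<in>carrier U. f (x \<otimes> z) = (\<Sum>s\<in>S. f (x \<otimes> s) * c s)" if "z \<in> lspan U S" for z
    using that
  proof (induction rule: lspan.induct)
    case zero
    show ?case by (rule exI[of _ "\<lambda>s. 0"]) (simp add: lin_0[OF f])
  next
    case (base z)
    show ?case
      by (rule exI[of _ "\<lambda>s. if s = z then 1 else 0"]) (use base S(1) in \<open>simp add: if_distrib[of "(*) _"] cong: if_cong\<close>)
  next
    case (add y z)
    then obtain b c where "\<forall>x\<in>carrier U. f (x \<otimes> y) = (\<Sum>s\<in>S. f (x \<otimes> s) * b s)"
      "\<forall>x\<in>carrier U. f (x \<otimes> z) = (\<Sum>s\<in>S. f (x \<otimes> s) * c s)" by blast
    moreover have "y \<in> carrier U" "z \<in> carrier U" using add lspan_carrier S(2) by blast+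
    ultimately show ?case
      by (intro exI[of _ "\<lambda>s. b s + c s"]) (auto simp: r_distr lin_add[OF f] algebra_simps sum.distrib)
  next
    case (smult y d)
    then obtain b where "\<forall>x\<in>carrier U. f (x \<otimes> y) = (\<Sum>s\<in>S. f (x \<otimes> s) * b s)" by blast
    moreover have "y \<in> carrier U" using smult lspan_carrier S(2) by blast
    ultimately show ?case
      by (intro exI[of _ "\<lambda>s. d * b s"]) (auto simp: sm_mult lin_smult[OF f] sum_distrib_left mult_ac)
  qed
  have "\<exists>c. \<forall>x\<in>carrier U. f (x \<otimes> y) = (\<Sum>s\<in>S. f (x \<otimes> s) * c s)" if y: "y \<in> carrier U" for y
  proof -
    obtain z where z: "z \<in> lspan U S" "y \<ominus> z \<in> J" using S(3) y by blast
    have zc: "z \<in> carrier U" using z lspan_carrier S(2) by blast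
    have "f (x \<otimes> y) = f (x \<otimes> z)" if x: "x \<in> carrier U" for x
    proof -
      have "f (x \<otimes> (y \<ominus> z)) = 0" using J.I_l_closed[OF z(2) x] J(2) by blast
      moreover have "x \<otimes> (y \<ominus> z) = x \<otimes> y \<oplus> (- 1) \<odot> (x \<otimes> z)"
        using x y zc by (simp add: minus_eq r_distr sm_minus r_minus)
      ultimately show ?thesis using lin_add[OF f, of "x \<otimes> y" "(-1) \<odot> (x \<otimes> z)"] lin_smult[OF f, of "x \<otimes> z" "-1"] x y zc by simp
    qed
    then show ?thesis using 1[OF z(1)] by auto
  qed
  then have "\<forall>y. \<exists>c. y \<in> carrier U \<longrightarrow> (\<forall>x\<in>carrier U. f (x \<otimes> y) = (\<Sum>s\<in>S. f (x \<otimes> s) * c s))" by blast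
  from choice[OF this] obtain c where c: "\<And>y x. y \<in> carrier U \<Longrightarrow> x \<in> carrier U \<Longrightarrow> f (x \<otimes> y) = (\<Sum>s\<in>S. f (x \<otimes> s) * c y s)"
    by blast
  show ?thesis
  proof (rule frankI)
    fix x y assume "x \<in> carrier U" "y \<in> carrier U"
    then show "f (x \<otimes> y) = (\<Sum>s\<leftarrow>l. f (x \<otimes> s) * c y s)"
      using c[of y x] sum.distinct_set_conv_list[OF l(2), of "\<lambda>s. f (x \<otimes> s) * c y s"] l(1) by simp
  qed
qed

lemma frank_add: "frank f \<Longrightarrow> frank g \<Longrightarrow> frank (f + g)"
proof -
  assume "frank f" "frank g"
  then obtain ps qs where "\<forall>x\<in>carrier U. \<forall>y\<in>carrier U. f (x \<otimes> y) = (\<Sum>(a, b)\<leftarrow>ps. a x * (b y :: complex))"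
     "\<forall>x\<in>carrier U. \<forall>y\<in>carrier U. g (x \<otimes> y) = (\<Sum>(a, b)\<leftarrow>qs. a x * (b y :: complex))"
    unfolding frank_def by blast
  then show ?thesis unfolding frank_def by (intro exI[of _ "ps @ qs"]) (simp add: fun_app)
qed

lemma frank_zero: "frank 0"
  unfolding frank_def by (rule exI[of _ "[]"]) (simp add: fun_app)

lemma frank_sm: "frank f \<Longrightarrow> frank (\<lambda>x. c * f x)"
proof (erule frankE)
  fix ps assume "\<And>x y. x \<in> carrier U \<Longrightarrow> y \<in> carrier U \<Longrightarrow> f (x \<otimes> y) = (\<Sum>p\<leftarrow>ps. fst p x * (snd p y :: complex))"
  then show ?thesis by (intro frankI[where ps = ps and a = "\<lambda>p x. c * fst p x" and b = snd]) (simp add: sum_list_times mult.assoc)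
qed

section \<open>Homogeneous functionals of finite rank and their translates\<close>

definition Fh :: "'g \<Rightarrow> ('a \<Rightarrow> complex) set" where
  "Fh \<phi> = {f \<in> hg \<phi>. frank f}"

abbreviation "FD \<equiv> finite_dual_carrier U"

lemma Fh_hd: "f \<in> Fh \<phi> \<Longrightarrow> f \<in> hg \<phi>" and Fh_lin: "f \<in> Fh \<phi> \<Longrightarrow> lin U f" and Fh_dual: "f \<in> Fh \<phi> \<Longrightarrow> f \<in> dual_space U"
  by (auto simp: Fh_def intro: hd_lin)

text \<open>For homogeneous functionals, finite rank is equivalent to vanishing on a graded ideal of
  finite codimension, by \<open>frank_ideal\<close> and \<open>ideal_frank\<close>. The ideals
  disappear from the argument at this point.\<close>

lemma FD_eq: "FD = {sum_list fs |fs. set fs \<subseteq> (\<Union>\<phi>. Fh \<phi>)}"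
proof -
  have "{f. \<exists>\<gamma> J. f \<in> dual_grade U \<gamma> \<and> cofinite_graded_ideal U J \<and> (\<forall>x\<in>J. f x = 0)} = (\<Union>\<phi>. Fh \<phi>)"
    (is "?L = ?R")
  proof (intro subset_antisym subsetI)
    fix f assume "f \<in> ?L"
    then obtain \<gamma> J where "f \<in> hg \<gamma>" "cofinite_graded_ideal U J" "\<forall>x\<in>J. f x = 0" by blast
    then show "f \<in> ?R" using ideal_frank[OF hd_lin] by (intro UN_I[of \<gamma>]) (simp_all add: Fh_def)
  next
    fix f assume "f \<in> ?R"
    then obtain \<gamma> where "f \<in> hg \<gamma>" "frank f" by (auto simp: Fh_def)
    then show "f \<in> ?L" using frank_ideal[of f \<gamma>] by (intro CollectI exI[of _ \<gamma>]) blast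
  qed
  then show ?thesis unfolding finite_dual_carrier_def by simp
qed

lemma Fh_FD: "f \<in> Fh \<phi> \<Longrightarrow> f \<in> FD"
  unfolding FD_eq by (auto intro!: exI[of _ "[f]"])

lemma Fh_zero: "0 \<in> Fh \<phi>" and Fh_add: "f \<in> Fh \<phi> \<Longrightarrow> g \<in> Fh \<phi> \<Longrightarrow> f + g \<in> Fh \<phi>"
  and Fh_sm: "f \<in> Fh \<phi> \<Longrightarrow> (\<lambda>x. c * f x) \<in> Fh \<phi>"
  by (auto simp: Fh_def hd_zero hd_add hd_sm frank_zero frank_add frank_sm)

lemma FD_zero: "0 \<in> FD"
  by (rule Fh_FD[OF Fh_zero])

lemma FD_add: "f \<in> FD \<Longrightarrow> g \<in> FD \<Longrightarrow> f + g \<in> FD"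
proof -
  assume "f \<in> FD" "g \<in> FD"
  then obtain fs gs where "f = sum_list fs" "g = sum_list gs" "set fs \<subseteq> (\<Union>\<phi>. Fh \<phi>)" "set gs \<subseteq> (\<Union>\<phi>. Fh \<phi>)"
    unfolding FD_eq by auto
  then show ?thesis unfolding FD_eq by (intro CollectI exI[of _ "fs @ gs"] conjI) simp_all
qed

lemma hom_sum_induct:
  assumes "f \<in> {sum_list fs |fs. set fs \<subseteq> R}" "P 0" "\<And>f g. f \<in> R \<Longrightarrow> g \<in> {sum_list fs |fs. set fs \<subseteq> R} \<Longrightarrow> P g \<Longrightarrow> P (f + g)"
  shows "P f"
proof -
  obtain fs where "f = sum_list fs" "set fs \<subseteq> R" using assms(1) by auto
  then show ?thesis
  proof (induction fs arbitrary: f)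
    case (Cons g fs)
    then have "P (g + sum_list fs)" by (intro assms(3)) auto
    then show ?case using Cons by simp
  qed (simp add: assms(2))
qed

lemma FD_induct [consumes 1, case_names hom add]:
  assumes "f \<in> FD" "\<And>\<phi> f. f \<in> Fh \<phi> \<Longrightarrow> P f" "\<And>f g. f \<in> FD \<Longrightarrow> g \<in> FD \<Longrightarrow> P f \<Longrightarrow> P g \<Longrightarrow> P (f + g)"
  shows "P f"
  using assms(1)[unfolded FD_eq]
proof (rule hom_sum_induct)
  show "P 0" by (rule assms(2)[OF Fh_zero[of 0]])
  fix f g assume "f \<in> (\<Union>\<phi>. Fh \<phi>)" "g \<in> {sum_list fs |fs. set fs \<subseteq> (\<Union>\<phi>. Fh \<phi>)}" "P g"
  then show "P (f + g)" by (intro assms(3)) (auto simp: FD_eq[symmetric] Fh_FD assms(2))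
qed

lemma FD_dual: "f \<in> FD \<Longrightarrow> f \<in> dual_space U"
  by (induction rule: FD_induct) (auto simp: Fh_dual dual_add)

lemma FD_lin: "f \<in> FD \<Longrightarrow> lin U f"
  by (auto dest: FD_dual dual_lin)

lemma FD_frank: "f \<in> FD \<Longrightarrow> frank f"
  by (induction rule: FD_induct) (auto simp: Fh_def frank_add)

lemma FD_sm: "f \<in> FD \<Longrightarrow> (\<lambda>x. c * f x) \<in> FD"
proof (induction rule: FD_induct)
  case (add f g)
  have "(\<lambda>x. c * (f + g) x) = (\<lambda>x. c * f x) + (\<lambda>x. c * g x)" by (auto simp: fun_app algebra_simps)
  then show ?case using add by (simp add: FD_add)
qed (auto intro: Fh_FD Fh_sm)

lemma Fh_iff: "f \<in> Fh \<phi> \<longleftrightarrow> f \<in> FD \<and> f \<in> hg \<phi>"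
  using FD_frank Fh_FD by (auto simp: Fh_def)

text \<open>Associativity moves \<open>y\<close> into the second factor of a decomposition of
  \<open>f\<close>, so the rank stays finite. The degree is \<phi> + \<beta> because
  \<open>x \<otimes> y\<close> must have degree - \<phi>.\<close>

lemma rtrans_Fh: "f \<in> Fh \<phi> \<Longrightarrow> y \<in> grade U \<beta> \<Longrightarrow> rs (\<lambda>x. f (x \<otimes> y)) \<in> Fh (\<phi> + \<beta>)"
proof -
  assume f: "f \<in> Fh \<phi>" and y: "y \<in> grade U \<beta>"
  have yc: "y \<in> carrier U" using y by auto
  obtain ps where ps: "\<And>x y. x \<in> carrier U \<Longrightarrow> y \<in> carrier U \<Longrightarrow> f (x \<otimes> y) = (\<Sum>p\<leftarrow>ps. fst p x * (snd p y :: complex))"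
    using f by (auto simp: Fh_def elim: frankE)
  have "frank (rs (\<lambda>x. f (x \<otimes> y)))"
    by (rule frankI[where ps = ps and a = fst and b = "\<lambda>p x'. snd p (x' \<otimes> y)"]) (simp add: yc m_assoc ps)
  moreover have "rs (\<lambda>x. f (x \<otimes> y)) \<in> hg (\<phi> + \<beta>)"
  proof (rule rs_hd)
    show "lin U (\<lambda>x. f (x \<otimes> y))" by (rule lin_rmult[OF Fh_lin[OF f] yc])
    fix \<alpha> x assume "x \<in> grade U \<alpha>" and ne: "\<alpha> \<noteq> - (\<phi> + \<beta>)"
    then have "x \<otimes> y \<in> grade U (\<alpha> + \<beta>)" using y grade_mult by blast
    moreover have "\<alpha> + \<beta> \<noteq> - \<phi>" using ne neg_move by (metis add.commute)
    ultimately show "f (x \<otimes> y) = 0" by (rule hd_vanish[OF Fh_hd[OF f]])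
  qed
  ultimately show ?thesis by (simp add: Fh_def)
qed

lemma ltrans_Fh: "f \<in> Fh \<phi> \<Longrightarrow> y \<in> grade U \<beta> \<Longrightarrow> rs (\<lambda>x. f (y \<otimes> x)) \<in> Fh (\<phi> + \<beta>)"
proof -
  assume f: "f \<in> Fh \<phi>" and y: "y \<in> grade U \<beta>"
  have yc: "y \<in> carrier U" using y by auto
  obtain ps where ps: "\<And>x y. x \<in> carrier U \<Longrightarrow> y \<in> carrier U \<Longrightarrow> f (x \<otimes> y) = (\<Sum>p\<leftarrow>ps. fst p x * (snd p y :: complex))"
    using f by (auto simp: Fh_def elim: frankE)
  have "frank (rs (\<lambda>x. f (y \<otimes> x)))"
    by (rule frankI[where ps = ps and b = snd and a = "\<lambda>p x'. fst p (y \<otimes> x')"]) (simp add: yc m_assoc[symmetric] ps)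
  moreover have "rs (\<lambda>x. f (y \<otimes> x)) \<in> hg (\<phi> + \<beta>)"
  proof (rule rs_hd)
    show "lin U (\<lambda>x. f (y \<otimes> x))" by (rule lin_lmult[OF Fh_lin[OF f] yc])
    fix \<alpha> x assume "x \<in> grade U \<alpha>" and ne: "\<alpha> \<noteq> - (\<phi> + \<beta>)"
    then have "y \<otimes> x \<in> grade U (\<beta> + \<alpha>)" using y grade_mult by blast
    moreover have "\<beta> + \<alpha> \<noteq> - \<phi>" using ne neg_move by (metis add.commute)
    ultimately show "f (y \<otimes> x) = 0" by (rule hd_vanish[OF Fh_hd[OF f]])
  qed
  ultimately show ?thesis by (simp add: Fh_def)
qed

lemma rtrans_FD: "y \<in> carrier U \<Longrightarrow> f \<in> Fh \<phi> \<Longrightarrow> rs (\<lambda>x. f (x \<otimes> y)) \<in> FD"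
proof (induction rule: hom_induct)
  case (add y z)
  have "rs (\<lambda>x. f (x \<otimes> (y \<oplus> z))) = rs (\<lambda>x. f (x \<otimes> y)) + rs (\<lambda>x. f (x \<otimes> z))"
    using add Fh_lin[OF add(5)] by (auto simp: rs_def fun_app r_distr lin_add)
  then show ?case using add by (simp add: FD_add)
qed (auto intro: Fh_FD rtrans_Fh)

lemma ltrans_FD: "y \<in> carrier U \<Longrightarrow> f \<in> Fh \<phi> \<Longrightarrow> rs (\<lambda>x. f (y \<otimes> x)) \<in> FD"
proof (induction rule: hom_induct)
  case (add y z)
  have "rs (\<lambda>x. f ((y \<oplus> z) \<otimes> x)) = rs (\<lambda>x. f (y \<otimes> x)) + rs (\<lambda>x. f (z \<otimes> x))"
    using add Fh_lin[OF add(5)] by (auto simp: rs_def fun_app l_distr lin_add)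
  then show ?case using add by (simp add: FD_add)
qed (auto intro: Fh_FD ltrans_Fh)

lemma FD_pair_hom: "f \<in> FD \<Longrightarrow> g \<in> FD \<Longrightarrow>
   \<exists>ps. (\<forall>(\<phi>, a, \<psi>, b)\<in>set ps. a \<in> Fh \<phi> \<and> b \<in> Fh \<psi>) \<and> (\<forall>x y. f x * g y = (\<Sum>(\<phi>, a, \<psi>, b)\<leftarrow>ps. a x * b y))"
proof (induction arbitrary: g rule: FD_induct)
  case (hom \<phi> f)
  from hom(2) show ?case
  proof (induction rule: FD_induct)
    case (hom \<psi> g)
    then show ?case using \<open>f \<in> Fh \<phi>\<close> by (intro exI[of _ "[(\<phi>, f, \<psi>, g)]"]) simp
  next
    case (add g h)
    then obtain ps qs where "(\<forall>(\<phi>, a, \<psi>, b)\<in>set ps. a \<in> Fh \<phi> \<and> b \<in> Fh \<psi>) \<and> (\<forall>x y. f x * g y = (\<Sum>(\<phi>, a, \<psi>, b)\<leftarrow>ps. a x * b y))"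
      "(\<forall>(\<phi>, a, \<psi>, b)\<in>set qs. a \<in> Fh \<phi> \<and> b \<in> Fh \<psi>) \<and> (\<forall>x y. f x * h y = (\<Sum>(\<phi>, a, \<psi>, b)\<leftarrow>qs. a x * b y))" by blast
    then show ?case by (intro exI[of _ "ps @ qs"]) (auto simp: fun_app algebra_simps)
  qed
next
  case (add f f')
  obtain ps where "(\<forall>(\<phi>, a, \<psi>, b)\<in>set ps. a \<in> Fh \<phi> \<and> b \<in> Fh \<psi>) \<and> (\<forall>x y. f x * g y = (\<Sum>(\<phi>, a, \<psi>, b)\<leftarrow>ps. a x * b y))"
    using add by blast
  moreover obtain qs where "(\<forall>(\<phi>, a, \<psi>, b)\<in>set qs. a \<in> Fh \<phi> \<and> b \<in> Fh \<psi>) \<and> (\<forall>x y. f' x * g y = (\<Sum>(\<phi>, a, \<psi>, b)\<leftarrow>qs. a x * b y))"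
    using add by blast
  ultimately show ?case by (intro exI[of _ "ps @ qs"]) (auto simp: fun_app algebra_simps)
qed

definition factors :: "'g \<Rightarrow> ('a \<Rightarrow> complex) \<Rightarrow> ('g \<times> ('a \<Rightarrow> complex) \<times> ('a \<Rightarrow> complex)) list \<Rightarrow> bool" where
  "factors \<phi> f ps \<longleftrightarrow> (\<forall>(\<psi>, a, b)\<in>set ps. a \<in> Fh \<psi> \<and> b \<in> Fh (\<phi> - \<psi>)) \<and>
     (\<forall>x\<in>carrier U. \<forall>y\<in>carrier U. f (x \<otimes> y) = (\<Sum>(\<psi>, a, b)\<leftarrow>ps. a x * b y))"

lemma factors_ex:
  assumes f: "f \<in> Fh \<phi>"
  shows "\<exists>ps. factors \<phi> f ps"
proof -
  note fl = Fh_lin[OF f]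
  obtain zs where zs: "set zs \<subseteq> carrier U \<times> carrier U"
    "\<And>x y. x \<in> carrier U \<Longrightarrow> y \<in> carrier U \<Longrightarrow> f (x \<otimes> y) = (\<Sum>(u, v)\<leftarrow>zs. f (x \<otimes> u) * f (v \<otimes> y))"
    using frank_translates[OF fl] f by (auto simp: Fh_def)
  have "\<exists>qs. (\<forall>(\<phi>, a, \<psi>, b)\<in>set qs. a \<in> Fh \<phi> \<and> b \<in> Fh \<psi>) \<and>
      (\<forall>x\<in>carrier U. \<forall>y\<in>carrier U. (\<Sum>(u, v)\<leftarrow>zs. f (x \<otimes> u) * f (v \<otimes> y)) = (\<Sum>(\<phi>, a, \<psi>, b)\<leftarrow>qs. a x * b y))"
    using zs(1)
  proof (induction zs)
    case Nil
    then show ?case by (intro exI[of _ "[]"]) simp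
  next
    case (Cons z zs)
    obtain u v where z: "z = (u, v)" "u \<in> carrier U" "v \<in> carrier U" using Cons(2) by auto
    obtain ps where p: "\<forall>(\<phi>, a, \<psi>, b)\<in>set ps. a \<in> Fh \<phi> \<and> b \<in> Fh \<psi>"
      "\<forall>x y. rs (\<lambda>x. f (x \<otimes> u)) x * rs (\<lambda>x. f (v \<otimes> x)) y = (\<Sum>(\<phi>, a, \<psi>, b)\<leftarrow>ps. a x * b y)"
      using FD_pair_hom[OF rtrans_FD[OF z(2) f] ltrans_FD[OF z(3) f]] by blast
    obtain qs where q: "\<forall>(\<phi>, a, \<psi>, b)\<in>set qs. a \<in> Fh \<phi> \<and> b \<in> Fh \<psi>"
      "\<forall>x\<in>carrier U. \<forall>y\<in>carrier U. (\<Sum>(u, v)\<leftarrow>zs. f (x \<otimes> u) * f (v \<otimes> y)) = (\<Sum>(\<phi>, a, \<psi>, b)\<leftarrow>qs. a x * b y)"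
      using Cons by auto
    have "(\<Sum>(u, v)\<leftarrow>z # zs. f (x \<otimes> u) * f (v \<otimes> y)) = (\<Sum>(\<phi>, a, \<psi>, b)\<leftarrow>ps @ qs. a x * b y)"
      if x: "x \<in> carrier U" and y: "y \<in> carrier U" for x y
      using p(2)[rule_format, of x y] q(2) x y z by simp
    then show ?case using p(1) q(1) by (intro exI[of _ "ps @ qs"]) auto
  qed
  then obtain qs where q: "\<forall>(\<phi>, a, \<psi>, b)\<in>set qs. a \<in> Fh \<phi> \<and> b \<in> Fh \<psi>"
    "\<And>x y. x \<in> carrier U \<Longrightarrow> y \<in> carrier U \<Longrightarrow> f (x \<otimes> y) = (\<Sum>(\<phi>, a, \<psi>, b)\<leftarrow>qs. a x * b y)" using zs(2) by auto
  \<comment> \<open>A term with factors of degrees \<psi> and \<chi> is supported on pairs of total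
    degree - (\<psi> + \<chi>). The terms kept are those supported where \<open>f\<close> lives; the
    others contribute nothing there, and elsewhere the terms kept vanish together with
    \<open>f\<close>.\<close>
  define rs' where "rs' = filter (\<lambda>(\<psi>, a, \<chi>, b). \<chi> = \<phi> - \<psi>) qs"
  have fq: "(\<Sum>q\<leftarrow>rs'. h q) = (\<Sum>q\<leftarrow>qs. if fst (snd (snd q)) = \<phi> - fst q then h q else 0)" for h :: "_ \<Rightarrow> complex"
    unfolding rs'_def split_def by (induction qs) auto
  have bl: "(\<lambda>x y. \<Sum>(\<psi>, a, \<chi>, b)\<leftarrow>qs'. a x * b y) \<in> Bil" if "set qs' \<subseteq> set qs" for qs'
  proof -
    have "(\<lambda>x y. case q of (\<psi>, a, \<chi>, b) \<Rightarrow> a x * b y) \<in> Bil" if "q \<in> set qs'" for q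
      using q(1) that \<open>set qs' \<subseteq> set qs\<close> by (cases q) (auto intro!: bilin_prod Fh_lin)
    then show ?thesis using TT_sum_list[OF TT_zero, of qs' "\<lambda>q x y. case q of (\<psi>, a, \<chi>, b) \<Rightarrow> a x * b y"] by auto
  qed
  have "f (x \<otimes> y) = (\<Sum>(\<psi>, a, \<chi>, b)\<leftarrow>rs'. a x * b y)" if "x \<in> carrier U" "y \<in> carrier U" for x y
  proof (rule Bil_ext[where B = "\<lambda>x y. f (x \<otimes> y)" and C = "\<lambda>x y. \<Sum>(\<psi>, a, \<chi>, b)\<leftarrow>rs'. a x * b y"])
    show "(\<lambda>x y. f (x \<otimes> y)) \<in> Bil" by (intro bilinI lin_rmult[OF fl] lin_lmult[OF fl])
    show "(\<lambda>x y. \<Sum>(\<psi>, a, \<chi>, b)\<leftarrow>rs'. a x * b y) \<in> Bil" by (rule bl) (auto simp: rs'_def)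
    fix \<alpha> \<beta> x y assume x: "x \<in> grade U \<alpha>" and y: "y \<in> grade U \<beta>"
    have xy: "x \<otimes> y \<in> grade U (\<alpha> + \<beta>)" "x \<in> carrier U" "y \<in> carrier U" using x y grade_mult by auto
    have term0: "a x * b y = 0" if "(\<psi>, a, \<chi>, b) \<in> set qs" "(\<alpha> + \<beta> = - \<phi>) \<noteq> (\<chi> = \<phi> - \<psi>)" for \<psi> a \<chi> b
    proof -
      have "a \<in> hg \<psi>" "b \<in> hg \<chi>" using q(1) that by (auto simp: Fh_hd)
      then show ?thesis using hd_vanish[OF _ x] hd_vanish[OF _ y] that(2)
        by (cases "\<alpha> = - \<psi>"; cases "\<beta> = - \<chi>") (auto simp: algebra_simps)
    qed
    show "f (x \<otimes> y) = (\<Sum>(\<psi>, a, \<chi>, b)\<leftarrow>rs'. a x * b y)"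
    proof (cases "\<alpha> + \<beta> = - \<phi>")
      case True
      show ?thesis unfolding q(2)[OF xy(2,3)] fq
        by (rule sum_list_ev) (use True in \<open>auto intro: term0\<close>)
    next
      case False
      have "(\<Sum>(\<psi>, a, \<chi>, b)\<leftarrow>rs'. a x * b y) = (\<Sum>q\<leftarrow>qs. 0)" unfolding fq
        by (rule sum_list_ev) (use False in \<open>auto intro: term0\<close>)
      then show ?thesis using hd_vanish[OF Fh_hd[OF f] xy(1)] False by simp
    qed
  qed (use that in auto)
  then have "factors \<phi> f (map (\<lambda>(\<psi>, a, \<chi>, b). (\<psi>, a, b)) rs')"
    unfolding factors_def using q(1) by (intro conjI) (auto simp: rs'_def split_def, simp add: split_def comp_def)
  then show ?thesis ..
qed

end

subsection \<open>The algebra structure of the finite dual\<close>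

lemma complex_cring: "cring complex_alg"
proof (rule cringI)
  show "abelian_group complex_alg"
  proof (rule abelian_groupI)
    fix x :: complex
    show "\<exists>y\<in>carrier complex_alg. y \<oplus>\<^bsub>complex_alg\<^esub> x = \<zero>\<^bsub>complex_alg\<^esub>"
      by (rule bexI[of _ "- x"]) (simp_all add: complex_alg_def)
  qed (simp_all add: complex_alg_def)
  show "Group.comm_monoid complex_alg"
    by (rule comm_monoidI) (simp_all add: complex_alg_def)
qed (simp add: complex_alg_def algebra_simps)

lemma finsum_pointwise:
  fixes G :: "('b::comm_monoid_add, 'm) ring_scheme"
  assumes "abelian_monoid G" "add G = (+)" "\<zero>\<^bsub>G\<^esub> = 0" "finite S" "u ` S \<subseteq> carrier G"
  shows "finsum G u S = sum u S"
  using assms(4,5)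
proof (induction S rule: finite_induct)
  case (insert x S)
  interpret abelian_monoid G by fact
  show ?case using insert by (subst finsum_insert) (auto simp: assms(2))
next
  case empty
  interpret abelian_monoid G by fact
  show ?case by (simp add: assms(3))
qed

lemma sum_list_prod: "(\<Sum>p\<leftarrow>ps. F p) * (\<Sum>q\<leftarrow>qs. G q) = (\<Sum>p\<leftarrow>ps. \<Sum>q\<leftarrow>qs. F p * (G q :: complex))"
  by (induction ps) (simp_all add: distrib_right sum_list_const_mult)

context gr_hopf
begin

abbreviation "H \<equiv> finite_dual \<omega> U"

lemma H_simps [simp]: "carrier H = FD" "\<zero>\<^bsub>H\<^esub> = 0" "add H = (+)" "smult H = (\<lambda>c f x. c * f x)"
  "counit H = (\<lambda>f. f \<one>)" "antipode H = (\<lambda>f. rs (\<lambda>x. f (antipode U x)))"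
  by (simp_all add: finite_dual_def finite_dual_alg_def graded.defs hopf.defs rs_def fun_eq_iff)

lemma H_one: "\<one>\<^bsub>H\<^esub> = rs (counit U)"
  and H_mult: "f \<otimes>\<^bsub>H\<^esub> g = rs (\<lambda>x. comult U x (pairing \<omega> U f g))"
  by (auto simp: finite_dual_def finite_dual_alg_def graded.defs hopf.defs rs_def)

lemma H_grade [simp]: "grade H \<phi> = Fh \<phi>"
  by (auto simp: finite_dual_def finite_dual_alg_def graded.defs hopf.defs Fh_iff)

text \<open>Convolution without the factor of the pairing. Working with it first keeps associativity
  and unit laws free of signs; the product of functionals of degrees \<phi> and \<psi> is
  \<open>\<omega> \<phi> \<psi>\<close> times it.\<close>

definition conv :: "('a \<Rightarrow> complex) \<Rightarrow> ('a \<Rightarrow> complex) \<Rightarrow> 'a \<Rightarrow> complex" where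
  "conv f g x = comult U x (\<lambda>u v. f u * g v)"

lemma conv_lin: "lin U f \<Longrightarrow> lin U g \<Longrightarrow> lin U (conv f g)"
  unfolding conv_def by (intro lin_com bilin_prod)

lemma hm_hom: "f \<in> hg \<phi> \<Longrightarrow> g \<in> hg \<psi> \<Longrightarrow> f \<otimes>\<^bsub>H\<^esub> g = rs (\<lambda>x. \<omega> \<phi> \<psi> * conv f g x)"
proof -
  assume f: "f \<in> hg \<phi>" and g: "g \<in> hg \<psi>"
  have B: "(\<lambda>u v. f u * g v) \<in> Bil" by (intro bilin_prod hd_lin[OF f] hd_lin[OF g])
  have "comult U x (pairing \<omega> U f g) = \<omega> \<phi> \<psi> * conv f g x" if x: "x \<in> carrier U" for x
  proof -
    have "comult U x (pairing \<omega> U f g) = comult U x (\<lambda>u v. \<omega> \<phi> \<psi> * (f u * g v))"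
      by (rule TT_cong[OF com_TT[OF x]]) (auto intro: pairing_Bil bilin_times B hd_lin f g pairing_hd)
    then show ?thesis unfolding conv_def using TT_times[OF com_TT[OF x] B] by simp
  qed
  then show ?thesis by (auto simp: H_mult rs_def)
qed

lemma hm_dual: "f \<in> dual_space U \<Longrightarrow> g \<in> dual_space U \<Longrightarrow> f \<otimes>\<^bsub>H\<^esub> g \<in> dual_space U"
  unfolding H_mult by (intro rs_dual lin_com pairing_Bil dual_lin)

lemma hm_add1: "f \<in> dual_space U \<Longrightarrow> f' \<in> dual_space U \<Longrightarrow> g \<in> dual_space U \<Longrightarrow> (f + f') \<otimes>\<^bsub>H\<^esub> g = f \<otimes>\<^bsub>H\<^esub> g + f' \<otimes>\<^bsub>H\<^esub> g"
proof (rule ext)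
  fix x assume "f \<in> dual_space U" "f' \<in> dual_space U" "g \<in> dual_space U"
  moreover have "pairing \<omega> U (f + f') g = (\<lambda>x y. pairing \<omega> U f g x y + pairing \<omega> U f' g x y)"
    by (intro ext pairing_add1)
  ultimately show "((f + f') \<otimes>\<^bsub>H\<^esub> g) x = (f \<otimes>\<^bsub>H\<^esub> g + f' \<otimes>\<^bsub>H\<^esub> g) x"
    by (simp add: H_mult rs_def fun_app TT_plus pairing_Bil dual_lin)
qed

lemma hm_add2: "f \<in> dual_space U \<Longrightarrow> f' \<in> dual_space U \<Longrightarrow> g \<in> dual_space U \<Longrightarrow> g \<otimes>\<^bsub>H\<^esub> (f + f') = g \<otimes>\<^bsub>H\<^esub> f + g \<otimes>\<^bsub>H\<^esub> f'"
proof (rule ext)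
  fix x assume "f \<in> dual_space U" "f' \<in> dual_space U" "g \<in> dual_space U"
  moreover have "pairing \<omega> U g (f + f') = (\<lambda>x y. pairing \<omega> U g f x y + pairing \<omega> U g f' x y)"
    by (intro ext pairing_add2)
  ultimately show "(g \<otimes>\<^bsub>H\<^esub> (f + f')) x = (g \<otimes>\<^bsub>H\<^esub> f + g \<otimes>\<^bsub>H\<^esub> f') x"
    by (simp add: H_mult rs_def fun_app TT_plus pairing_Bil dual_lin)
qed

lemma hm_sm1: "f \<in> dual_space U \<Longrightarrow> g \<in> dual_space U \<Longrightarrow> (\<lambda>x. c * f x) \<otimes>\<^bsub>H\<^esub> g = (\<lambda>x. c * (f \<otimes>\<^bsub>H\<^esub> g) x)"
proof (rule ext)
  fix x assume "f \<in> dual_space U" "g \<in> dual_space U"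
  moreover have "pairing \<omega> U (\<lambda>x. c * f x) g = (\<lambda>x y. c * pairing \<omega> U f g x y)"
    by (intro ext pairing_sm1)
  ultimately show "((\<lambda>x. c * f x) \<otimes>\<^bsub>H\<^esub> g) x = c * (f \<otimes>\<^bsub>H\<^esub> g) x"
    by (simp add: H_mult rs_def TT_times pairing_Bil dual_lin)
qed

lemma hm_sm2: "f \<in> dual_space U \<Longrightarrow> g \<in> dual_space U \<Longrightarrow> f \<otimes>\<^bsub>H\<^esub> (\<lambda>x. c * g x) = (\<lambda>x. c * (f \<otimes>\<^bsub>H\<^esub> g) x)"
proof (rule ext)
  fix x assume "f \<in> dual_space U" "g \<in> dual_space U"
  moreover have "pairing \<omega> U f (\<lambda>x. c * g x) = (\<lambda>x y. c * pairing \<omega> U f g x y)"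
    by (intro ext pairing_sm2)
  ultimately show "(f \<otimes>\<^bsub>H\<^esub> (\<lambda>x. c * g x)) x = c * (f \<otimes>\<^bsub>H\<^esub> g) x"
    by (simp add: H_mult rs_def TT_times pairing_Bil dual_lin)
qed

lemma conv_grade:
  assumes f: "f \<in> hg \<phi>" and g: "g \<in> hg \<psi>" and x: "x \<in> grade U \<alpha>" and ne: "\<alpha> \<noteq> - (\<phi> + \<psi>)"
  shows "conv f g x = 0"
  unfolding conv_def using com_grade[OF x]
proof (induction rule: ts_induct)
  case (pt u v z)
  then obtain \<beta> where u: "u \<in> grade U \<beta>" and v: "v \<in> grade U (\<alpha> - \<beta>)" by auto
  have "f u * g v = 0"
  proof (cases "\<beta> = - \<phi>")
    case True
    then have "\<alpha> - \<beta> \<noteq> - \<psi>" using ne by (metis add.commute diff_add_cancel minus_add_distrib)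
    then show ?thesis using hd_vanish[OF g v] by simp
  qed (use hd_vanish[OF f u] in simp)
  then show ?case using pt bilin_prod[OF hd_lin[OF f] hd_lin[OF g]] by (simp add: fun_app)
qed (simp add: fun_app)

lemma factorsD:
  assumes "factors \<phi> f ps"
  shows "p \<in> set ps \<Longrightarrow> fst (snd p) \<in> Fh (fst p)" "p \<in> set ps \<Longrightarrow> snd (snd p) \<in> Fh (\<phi> - fst p)"
    "x \<in> carrier U \<Longrightarrow> y \<in> carrier U \<Longrightarrow> f (x \<otimes> y) = (\<Sum>p\<leftarrow>ps. fst (snd p) x * snd (snd p) y)"
  using assms by (auto simp: factors_def split_def)

text \<open>The co-product of \<open>U\<close> is multiplicative, so decompositions of
  \<open>f\<close> and \<open>g\<close> separate \<open>x\<close> from \<open>y\<close>. This shows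
  that products have finite rank, and it is half of the proof that the comultiplication of the dual
  is multiplicative. The scalar is the exchange factor for the first factor of \<open>g\<close> and
  the second factor of \<open>f\<close>.\<close>

lemma conv_mult:
  assumes f: "f \<in> Fh \<phi>" and g: "g \<in> Fh \<psi>" and ps: "factors \<phi> f ps" and qs: "factors \<psi> g qs"
    and x: "x \<in> carrier U" and y: "y \<in> carrier U"
  shows "conv f g (x \<otimes> y) = (\<Sum>r\<leftarrow>List.product ps qs. \<omega> (fst (snd r)) (\<phi> - fst (fst r)) *
    (conv (fst (snd (fst r))) (fst (snd (snd r))) x * conv (snd (snd (fst r))) (snd (snd (snd r))) y))"
proof -
  define B where "B = (\<lambda>u v. f u * g v)"
  have B: "B \<in> Bil" unfolding B_def by (intro bilin_prod Fh_lin[OF f] Fh_lin[OF g])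
  define a where "a = (\<lambda>r::('g \<times> ('a \<Rightarrow> complex) \<times> ('a \<Rightarrow> complex)) \<times> ('g \<times> ('a \<Rightarrow> complex) \<times> ('a \<Rightarrow> complex)). fst (snd (fst r)))"
  define b where "b = (\<lambda>r::('g \<times> ('a \<Rightarrow> complex) \<times> ('a \<Rightarrow> complex)) \<times> ('g \<times> ('a \<Rightarrow> complex) \<times> ('a \<Rightarrow> complex)). snd (snd (fst r)))"
  define c where "c = (\<lambda>r::('g \<times> ('a \<Rightarrow> complex) \<times> ('a \<Rightarrow> complex)) \<times> ('g \<times> ('a \<Rightarrow> complex) \<times> ('a \<Rightarrow> complex)). fst (snd (snd r)))"
  define d where "d = (\<lambda>r::('g \<times> ('a \<Rightarrow> complex) \<times> ('a \<Rightarrow> complex)) \<times> ('g \<times> ('a \<Rightarrow> complex) \<times> ('a \<Rightarrow> complex)). snd (snd (snd r)))"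
  define k where "k = (\<lambda>r::('g \<times> ('a \<Rightarrow> complex) \<times> ('a \<Rightarrow> complex)) \<times> ('g \<times> ('a \<Rightarrow> complex) \<times> ('a \<Rightarrow> complex)). \<omega> (fst (snd r)) (\<phi> - fst (fst r)))"
  define L where "L = List.product ps qs"
  have L: "a r \<in> Fh (fst (fst r))" "b r \<in> Fh (\<phi> - fst (fst r))" "c r \<in> Fh (fst (snd r))" "d r \<in> Fh (\<psi> - fst (snd r))" if "r \<in> set L" for r
    using that factorsD[OF ps] factorsD[OF qs] by (auto simp: L_def a_def b_def c_def d_def)
  note ll = Fh_lin[OF L(1)] Fh_lin[OF L(2)] Fh_lin[OF L(3)] Fh_lin[OF L(4)]
  \<comment> \<open>Only \<open>v\<close> and \<open>u'\<close> have to be homogeneous here, as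
    their degrees enter the factor. On the term of \<open>r\<close> they must be the negatives of
    the degrees of \<open>c r\<close> and \<open>b r\<close>, and the two signs cancel inside
    \<omega>, leaving \<open>k r\<close>.\<close>
  have key: "mform B u v u' v' = (\<Sum>r\<leftarrow>L. (k r * (a r u * c r v)) * (b r u' * d r v'))"
    if c4: "u \<in> carrier U" "v \<in> carrier U" "u' \<in> carrier U" "v' \<in> carrier U" for u v u' v'
  proof (rule Bil_ext[where B = "\<lambda>v u'. mform B u v u' v'" and C = "\<lambda>v u'. \<Sum>r\<leftarrow>L. (k r * (a r u * c r v)) * (b r u' * d r v')"])
    show "(\<lambda>v u'. mform B u v u' v') \<in> Bil"
      using c4 by (intro bilinI mform_lin2 mform_lin3 B)
    have "(\<lambda>v u'. k r * (a r u * c r v) * (b r u' * d r v')) \<in> Bil" if "r \<in> set L" for r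
      by (intro bilin_prod lin_times lin_times' ll that)
    then show "(\<lambda>v u'. \<Sum>r\<leftarrow>L. (k r * (a r u * c r v)) * (b r u' * d r v')) \<in> Bil"
      using TT_sum_list[OF TT_zero, of L] by auto
    fix \<kappa> \<mu> v u' assume v: "v \<in> grade U \<kappa>" and u': "u' \<in> grade U \<mu>"
    have vc: "v \<in> carrier U" "u' \<in> carrier U" using v u' by auto
    have "mform B u v u' v' = \<omega> \<kappa> \<mu> * (f (u \<otimes> u') * g (v \<otimes> v'))"
      using mform_hom[OF B c4(1) v u' c4(4)] by (simp add: B_def)
    also have "\<dots> = \<omega> \<kappa> \<mu> * (\<Sum>p\<leftarrow>ps. \<Sum>q\<leftarrow>qs. (fst (snd p) u * snd (snd p) u') * (fst (snd q) v * snd (snd q) v'))"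
      unfolding factorsD(3)[OF ps c4(1) vc(2)] factorsD(3)[OF qs vc(1) c4(4)]
      by (simp only: sum_list_prod)
    also have "\<dots> = (\<Sum>r\<leftarrow>L. \<omega> \<kappa> \<mu> * ((a r u * b r u') * (c r v * d r v')))"
      by (subst sum_list_product) (simp only: sum_list_times L_def a_def b_def c_def d_def split_def)
    also have "\<dots> = (\<Sum>r\<leftarrow>L. (k r * (a r u * c r v)) * (b r u' * d r v'))"
    proof (rule sum_list_ev)
      fix r assume r: "r \<in> set L"
      show "\<omega> \<kappa> \<mu> * ((a r u * b r u') * (c r v * d r v')) = (k r * (a r u * c r v)) * (b r u' * d r v')"
        using hd_vanish[OF Fh_hd[OF L(2)[OF r]] u'] hd_vanish[OF Fh_hd[OF L(3)[OF r]] v]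
        by (cases "\<mu> = - (\<phi> - fst (fst r))"; cases "\<kappa> = - fst (snd r)") (auto simp: k_def om_minus om_diff)
    qed
    finally show "mform B u v u' v' = (\<Sum>r\<leftarrow>L. (k r * (a r u * c r v)) * (b r u' * d r v'))" .
  qed (use that in auto)
  have i1: "comult U y (mform B u v) = (\<Sum>r\<leftarrow>L. (k r * conv (b r) (d r) y) * (a r u * c r v))"
    if u: "u \<in> carrier U" and v: "v \<in> carrier U" for u v
  proof -
    have bl: "(\<lambda>u' v'. (k r * (a r u * c r v)) * (b r u' * d r v')) \<in> Bil" if "r \<in> set L" for r
      by (intro bilin_prod bilin_times ll that)
    have "comult U y (mform B u v) = comult U y (\<lambda>u' v'. \<Sum>r\<leftarrow>L. (k r * (a r u * c r v)) * (b r u' * d r v'))"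
      by (rule TT_cong[OF com_TT[OF y]]) (use u v TT_sum_list[OF TT_zero, of L, OF bl] in \<open>auto intro!: key mform_Bil1 B\<close>)
    also have "\<dots> = (\<Sum>r\<leftarrow>L. comult U y (\<lambda>u' v'. (k r * (a r u * c r v)) * (b r u' * d r v')))"
      using TT_sum_list[OF com_TT[OF y], of L, OF bl] by simp
    also have "\<dots> = (\<Sum>r\<leftarrow>L. (k r * conv (b r) (d r) y) * (a r u * c r v))"
    proof (rule sum_list_ev)
      fix r assume r: "r \<in> set L"
      show "comult U y (\<lambda>u' v'. (k r * (a r u * c r v)) * (b r u' * d r v')) = (k r * conv (b r) (d r) y) * (a r u * c r v)"
        using TT_times[OF com_TT[OF y] bilin_prod[OF ll(2,4)[OF r]], of "k r * (a r u * c r v)"] by (simp add: conv_def)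
    qed
    finally show ?thesis .
  qed
  have bl: "(\<lambda>u v. (k r * conv (b r) (d r) y) * (a r u * c r v)) \<in> Bil" if "r \<in> set L" for r
    by (intro bilin_prod bilin_times ll that)
  have "conv f g (x \<otimes> y) = comult U x (\<lambda>u v. comult U y (mform B u v))"
    unfolding conv_def com_mult[OF x y] B_def[symmetric] using B by (simp add: tm_def')
  also have "\<dots> = comult U x (\<lambda>u v. \<Sum>r\<leftarrow>L. (k r * conv (b r) (d r) y) * (a r u * c r v))"
    by (rule TT_cong[OF com_TT[OF x]]) (use TT_sum_list[OF TT_zero, of L, OF bl] y in \<open>auto intro!: i1 tm_form B\<close>)
  also have "\<dots> = (\<Sum>r\<leftarrow>L. comult U x (\<lambda>u v. (k r * conv (b r) (d r) y) * (a r u * c r v)))"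
    using TT_sum_list[OF com_TT[OF x], of L, OF bl] by simp
  also have "\<dots> = (\<Sum>r\<leftarrow>L. k r * (conv (a r) (c r) x * conv (b r) (d r) y))"
  proof (rule sum_list_ev)
    fix r assume r: "r \<in> set L"
    show "comult U x (\<lambda>u v. (k r * conv (b r) (d r) y) * (a r u * c r v)) = k r * (conv (a r) (c r) x * conv (b r) (d r) y)"
      using TT_times[OF com_TT[OF x] bilin_prod[OF ll(1,3)[OF r]], of "k r * conv (b r) (d r) y"] by (simp add: conv_def)
  qed
  finally show ?thesis unfolding L_def a_def b_def c_def d_def k_def .
qed

lemma hm_Fh: "f \<in> Fh \<phi> \<Longrightarrow> g \<in> Fh \<psi> \<Longrightarrow> f \<otimes>\<^bsub>H\<^esub> g \<in> Fh (\<phi> + \<psi>)"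
proof -
  assume f: "f \<in> Fh \<phi>" and g: "g \<in> Fh \<psi>"
  obtain ps qs where ps: "factors \<phi> f ps" and qs: "factors \<psi> g qs" using factors_ex f g by blast
  have l: "lin U (\<lambda>x. \<omega> \<phi> \<psi> * conv f g x)" by (intro lin_times conv_lin Fh_lin[OF f] Fh_lin[OF g])
  have "rs (\<lambda>x. \<omega> \<phi> \<psi> * conv f g x) \<in> hg (\<phi> + \<psi>)"
    by (rule rs_hd[OF l]) (use conv_grade[OF Fh_hd[OF f] Fh_hd[OF g]] in simp)
  moreover have "frank (rs (\<lambda>x. \<omega> \<phi> \<psi> * conv f g x))"
    by (rule frankI[where ps = "List.product ps qs" and b = "\<lambda>r. conv (snd (snd (fst r))) (snd (snd (snd r)))" and
        a = "\<lambda>r x. \<omega> \<phi> \<psi> * \<omega> (fst (snd r)) (\<phi> - fst (fst r)) * conv (fst (snd (fst r))) (fst (snd (snd r))) x"])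
      (simp add: conv_mult[OF f g ps qs] sum_list_const_mult[symmetric] mult.assoc)
  ultimately show ?thesis using hm_hom[OF Fh_hd[OF f] Fh_hd[OF g]] by (simp add: Fh_def)
qed

lemma hm_FD: "f \<in> FD \<Longrightarrow> g \<in> FD \<Longrightarrow> f \<otimes>\<^bsub>H\<^esub> g \<in> FD"
proof (induction arbitrary: g rule: FD_induct)
  case (hom \<phi> f)
  from hom(2) show ?case
  proof (induction rule: FD_induct)
    case (hom \<psi> g)
    show ?case by (rule Fh_FD[OF hm_Fh[OF \<open>f \<in> Fh \<phi>\<close> hom]])
  next
    case (add g h)
    then show ?case using \<open>f \<in> Fh \<phi>\<close> by (simp add: hm_add2 FD_dual Fh_dual FD_add)
  qed
next
  case (add f g h)
  then show ?case by (simp add: hm_add1 FD_dual FD_add)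
qed

lemma one_Fh: "\<one>\<^bsub>H\<^esub> \<in> Fh 0"
proof -
  have "rs (counit U) \<in> hg 0" by (rule rs_hd[OF cou_lin]) (simp add: cou_grade)
  moreover have "frank (rs (counit U))"
    by (rule frankI[where ps = "[()]" and a = "\<lambda>_. counit U" and b = "\<lambda>_. counit U"]) (simp add: cou_mult)
  ultimately show ?thesis by (simp add: H_one Fh_def)
qed

lemma conv_one: "lin U f \<Longrightarrow> x \<in> carrier U \<Longrightarrow> conv (rs (counit U)) f x = f x"
    "lin U f \<Longrightarrow> x \<in> carrier U \<Longrightarrow> conv f (rs (counit U)) x = f x"
proof -
  assume f: "lin U f" and x: "x \<in> carrier U"
  have r: "lin U (rs (counit U))" by (rule dual_lin[OF rs_dual[OF cou_lin]])
  have "conv (rs (counit U)) f x = comult U x (\<lambda>u v. counit U u * f v)"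
    unfolding conv_def by (rule TT_cong[OF com_TT[OF x]]) (auto intro!: bilin_prod f r cou_lin simp: grade_carrier)
  then show "conv (rs (counit U)) f x = f x" using cou_l[OF x f] by simp
  have "conv f (rs (counit U)) x = comult U x (\<lambda>u v. f u * counit U v)"
    unfolding conv_def by (rule TT_cong[OF com_TT[OF x]]) (auto intro!: bilin_prod f r cou_lin simp: grade_carrier)
  then show "conv f (rs (counit U)) x = f x" using cou_r[OF x f] by simp
qed

lemma hm_one: "f \<in> FD \<Longrightarrow> \<one>\<^bsub>H\<^esub> \<otimes>\<^bsub>H\<^esub> f = f" "f \<in> FD \<Longrightarrow> f \<otimes>\<^bsub>H\<^esub> \<one>\<^bsub>H\<^esub> = f"
proof -
  note o = Fh_dual[OF one_Fh]
  assume f: "f \<in> FD"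
  show "\<one>\<^bsub>H\<^esub> \<otimes>\<^bsub>H\<^esub> f = f" using f
  proof (induction rule: FD_induct)
    case (hom \<phi> f)
    have "rs (conv (rs (counit U)) f) = f"
      using conv_one(1)[OF Fh_lin[OF hom]] dual_off[OF Fh_dual[OF hom]] by (auto simp: fun_eq_iff rs_def[of "conv _ _"])
    then show ?case using hm_hom[OF Fh_hd[OF one_Fh] Fh_hd[OF hom]] by (simp add: H_one)
  qed (simp add: hm_add2 o FD_dual)
  show "f \<otimes>\<^bsub>H\<^esub> \<one>\<^bsub>H\<^esub> = f" using f
  proof (induction rule: FD_induct)
    case (hom \<phi> f)
    have "rs (conv f (rs (counit U))) = f"
      using conv_one(2)[OF Fh_lin[OF hom]] dual_off[OF Fh_dual[OF hom]] by (auto simp: fun_eq_iff rs_def[of "conv _ _"])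
    then show ?case using hm_hom[OF Fh_hd[OF hom] Fh_hd[OF one_Fh]] by (simp add: H_one)
  qed (simp add: hm_add1 o FD_dual)
qed

text \<open>Co-associativity of \<open>U\<close> tested on the trilinear form
  \<open>f u * g v * h w\<close>.\<close>

lemma conv_assoc:
  assumes f: "lin U f" and g: "lin U g" and h: "lin U h" and x: "x \<in> carrier U"
  shows "conv (conv f g) h x = conv f (conv g h) x"
proof -
  define B where "B = (\<lambda>u v w. f u * g v * h w)"
  have b1: "(\<lambda>u v. B u v w) \<in> Bil" for w
    unfolding B_def mult.assoc by (intro bilin_prod lin_times' f g)
  have b2: "B u \<in> Bil" for u
    unfolding B_def by (intro bilin_prod lin_times g h)
  have t: "trilin U B" unfolding trilin_def using b1 b2 by simp
  have "comult U y (\<lambda>u v. B u v z) = conv f g y * h z" if "y \<in> carrier U" for y z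
    using TT_times[OF com_TT[OF that] bilin_prod[OF f g], of "h z"] by (simp add: B_def conv_def mult_ac)
  moreover have "comult U z (B y) = f y * conv g h z" if "z \<in> carrier U" for y z
    using TT_times[OF com_TT[OF that] bilin_prod[OF g h], of "f y"] by (simp add: B_def conv_def mult.assoc)
  moreover have "comult U x (\<lambda>y z. conv f g y * h z) = comult U x (\<lambda>y z. comult U y (\<lambda>u v. B u v z))"
    by (rule TT_cong[OF com_TT[OF x]])
      (auto intro!: bilin_prod conv_lin f g h Bil_cong[OF bilin_prod[OF conv_lin[OF f g] h]] simp: calculation grade_carrier)
  moreover have "comult U x (\<lambda>y z. f y * conv g h z) = comult U x (\<lambda>y z. comult U z (B y))"
    by (rule TT_cong[OF com_TT[OF x]])
      (auto intro!: bilin_prod conv_lin f g h Bil_cong[OF bilin_prod[OF f conv_lin[OF g h]]] simp: calculation grade_carrier)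
  ultimately show ?thesis using coassoc[OF x t] by (simp add: conv_def[of "conv f g"] conv_def[of f "conv g h"])
qed

lemma conv_scale: "lin U f \<Longrightarrow> lin U g \<Longrightarrow> x \<in> carrier U \<Longrightarrow> conv (rs (\<lambda>x. c * f x)) g x = c * conv f g x"
  "lin U f \<Longrightarrow> lin U g \<Longrightarrow> x \<in> carrier U \<Longrightarrow> conv f (rs (\<lambda>x. c * g x)) x = c * conv f g x"
proof -
  assume f: "lin U f" and g: "lin U g" and x: "x \<in> carrier U"
  have r: "lin U h \<Longrightarrow> lin U (rs (\<lambda>x. c * h x))" for h by (rule dual_lin, rule rs_dual, rule lin_times)
  have "conv (rs (\<lambda>x. c * f x)) g x = comult U x (\<lambda>u v. c * (f u * g v))"
    unfolding conv_def by (rule TT_cong[OF com_TT[OF x]]) (auto intro!: bilin_times bilin_prod f r g simp: grade_carrier)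
  then show "conv (rs (\<lambda>x. c * f x)) g x = c * conv f g x"
    using TT_times[OF com_TT[OF x] bilin_prod[OF f g]] by (simp add: conv_def)
  have "conv f (rs (\<lambda>x. c * g x)) x = comult U x (\<lambda>u v. c * (f u * g v))"
    unfolding conv_def by (rule TT_cong[OF com_TT[OF x]]) (auto intro!: bilin_times bilin_prod f r g simp: grade_carrier)
  then show "conv f (rs (\<lambda>x. c * g x)) x = c * conv f g x"
    using TT_times[OF com_TT[OF x] bilin_prod[OF f g]] by (simp add: conv_def)
qed

lemma hm_assoc: "f \<in> FD \<Longrightarrow> g \<in> FD \<Longrightarrow> h \<in> FD \<Longrightarrow> (f \<otimes>\<^bsub>H\<^esub> g) \<otimes>\<^bsub>H\<^esub> h = f \<otimes>\<^bsub>H\<^esub> (g \<otimes>\<^bsub>H\<^esub> h)"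
proof (induction arbitrary: g h rule: FD_induct)
  case (hom \<phi> f)
  note f = hom(1)
  from hom(2,3) show ?case
  proof (induction arbitrary: h rule: FD_induct)
    case (hom \<psi> g)
    note g = hom(1)
    from hom(2) show ?case
    proof (induction rule: FD_induct)
      case (hom \<chi> h)
      note l = f[THEN Fh_lin] g[THEN Fh_lin] hom[THEN Fh_lin]
      note d = f[THEN Fh_hd] g[THEN Fh_hd] hom[THEN Fh_hd]
      have "(f \<otimes>\<^bsub>H\<^esub> g) \<otimes>\<^bsub>H\<^esub> h = rs (\<lambda>x. \<omega> (\<phi> + \<psi>) \<chi> * conv (rs (\<lambda>x. \<omega> \<phi> \<psi> * conv f g x)) h x)"
        using hm_hom[OF Fh_hd[OF hm_Fh[OF f g]] d(3)] hm_hom[OF d(1,2)] by simp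
      also have "\<dots> = rs (\<lambda>x. \<omega> \<phi> (\<psi> + \<chi>) * conv f (rs (\<lambda>x. \<omega> \<psi> \<chi> * conv g h x)) x)"
        by (auto simp: rs_def[of "\<lambda>x. _ * conv f (rs _) x"] rs_def[of "\<lambda>x. _ * conv (rs _) h x"] conv_scale conv_lin l conv_assoc om_add)
      also have "\<dots> = f \<otimes>\<^bsub>H\<^esub> (g \<otimes>\<^bsub>H\<^esub> h)"
        using hm_hom[OF d(1) Fh_hd[OF hm_Fh[OF g hom]]] hm_hom[OF d(2,3)] by simp
      finally show ?case .
    qed (use f g in \<open>simp add: hm_add2 FD_dual Fh_dual hm_dual\<close>)
  qed (use f in \<open>simp add: hm_add1 hm_add2 FD_dual Fh_dual hm_dual\<close>)
qed (simp add: hm_add1 hm_add2 FD_dual hm_dual)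

text \<open>The component of degree \<phi> of a functional, obtained by composing it with the
  projection of \<open>U\<close> onto degree - \<phi>.\<close>

definition Fp :: "'g \<Rightarrow> ('a \<Rightarrow> complex) \<Rightarrow> 'a \<Rightarrow> complex" where
  "Fp \<phi> f = rs (\<lambda>x. f (hpart U (- \<phi>) x))"

lemma Fp_hom: "f \<in> hg \<psi> \<Longrightarrow> Fp \<phi> f = (if \<phi> = \<psi> then f else 0)"
proof (rule dual_eqI)
  assume f: "f \<in> hg \<psi>"
  show "Fp \<phi> f \<in> dual_space U" unfolding Fp_def by (intro rs_dual lin_hpart hd_lin[OF f])
  show "(if \<phi> = \<psi> then f else 0) \<in> dual_space U" using f by (auto simp: dual_zero)
  show "Fp \<phi> f x = (if \<phi> = \<psi> then f else 0) x" if "x \<in> grade U \<alpha>" for x \<alpha>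
    using that hd_vanish[OF f that] lin_0[OF hd_lin[OF f]]
    by (auto simp: Fp_def hpart_hom grade_carrier fun_app)
qed

lemma Fp_add: "Fp \<phi> (f + g) = Fp \<phi> f + Fp \<phi> g" and Fp_0: "Fp \<phi> 0 = 0"
  by (auto simp: Fp_def rs_def fun_app)

lemma Fp_sum: "Fp \<phi> (sum u S) = (\<Sum>i\<in>S. Fp \<phi> (u i))"
  by (induction S rule: infinite_finite_induct) (auto simp: Fp_0 Fp_add)

text \<open>The hypothesis \<open>hom\<close> says that \<open>A\<close> is spanned by its
  homogeneous elements. As \<open>Fp \<phi>\<close> selects the summands of degree \<phi>, the
  components of an element of \<open>A\<close> stay in \<open>A\<close>; applying \<open>Fp\<close>
  to any other decomposition shows uniqueness.\<close>

lemma sub_gralg: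
  assumes A: "A \<subseteq> FD" "0 \<in> A" "\<And>f g. f \<in> A \<Longrightarrow> g \<in> A \<Longrightarrow> f + g \<in> A" "\<And>c f. f \<in> A \<Longrightarrow> (\<lambda>x. c * f x) \<in> A"
    "\<one>\<^bsub>H\<^esub> \<in> A" "\<And>f g. f \<in> A \<Longrightarrow> g \<in> A \<Longrightarrow> f \<otimes>\<^bsub>H\<^esub> g \<in> A"
    and hom: "\<And>f. f \<in> A \<Longrightarrow> f \<in> {sum_list fs |fs. set fs \<subseteq> A \<inter> (\<Union>\<phi>. Fh \<phi>)}"
  shows "graded_algebra (sub_graded H A)"
proof -
  let ?R = "sub_graded H A"
  have R [simp]: "carrier ?R = A" "mult ?R = mult H" "one ?R = one H" "zero ?R = 0" "add ?R = (+)"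
    "smult ?R = (\<lambda>c f x. c * f x)" "grade ?R \<alpha> = Fh \<alpha> \<inter> A" for \<alpha>
    by (simp_all add: sub_graded_def)
  have AF: "f \<in> A \<Longrightarrow> f \<in> FD" for f using A(1) by auto
  have AD: "f \<in> A \<Longrightarrow> f \<in> dual_space U" for f using AF FD_dual by blast
  have mn: "(\<lambda>x. - 1 * f x) = - f" for f :: "'a \<Rightarrow> complex" by (auto simp: fun_Compl_def)
  have ag: "abelian_group ?R"
  proof (rule abelian_groupI)
    show "\<exists>g\<in>carrier ?R. g \<oplus>\<^bsub>?R\<^esub> f = \<zero>\<^bsub>?R\<^esub>" if "f \<in> carrier ?R" for f
      using A(4)[of f "-1"] that mn[of f] by (intro bexI[of _ "- f"]) auto
  qed (auto simp: A add_ac)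
  have rg: "ring ?R"
  proof (rule ringI[OF ag])
    show "Group.monoid ?R"
      by (rule monoidI) (auto simp: A AF hm_assoc hm_one)
  qed (auto simp: hm_add1 hm_add2 AD)
  have md: "Module.module complex_alg ?R"
    by (rule moduleI[OF complex_cring ag]) (auto simp: A complex_alg_def fun_app algebra_simps plus_fun_def)
  have inv: "\<ominus>\<^bsub>?R\<^esub> f = - f" if "f \<in> A" for f
    using abelian_group.minus_equality[OF ag, of "- f" f] A(4)[of f "-1"] that mn[of f] by auto
  have sm: "submodule (grade ?R \<alpha>) complex_alg ?R" for \<alpha>
  proof (rule Module.module.submoduleI[OF md])
    show "\<ominus>\<^bsub>?R\<^esub> f \<in> grade ?R \<alpha>" if "f \<in> grade ?R \<alpha>" for f
      using that inv[of f] A(4)[of f "-1"] Fh_sm[of f \<alpha> "-1"] mn[of f] by auto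
  qed (auto simp: A Fh_zero Fh_add Fh_sm)
  have fs: "finsum ?R u S = sum u S" if "finite S" "u ` S \<subseteq> A" for u S
    by (rule finsum_pointwise) (use that ag in \<open>auto simp: abelian_group.axioms\<close>)
  have ex: "\<exists>S. finite S \<and> (\<forall>\<phi>. Fp \<phi> f \<in> Fh \<phi> \<inter> A) \<and> (\<forall>\<phi>. \<phi> \<notin> S \<longrightarrow> Fp \<phi> f = 0) \<and> f = (\<Sum>\<phi>\<in>S. Fp \<phi> f)" if "f \<in> A" for f
    using hom[OF that]
  proof (rule hom_sum_induct)
    show "\<exists>S. finite S \<and> (\<forall>\<phi>. Fp \<phi> 0 \<in> Fh \<phi> \<inter> A) \<and> (\<forall>\<phi>. \<phi> \<notin> S \<longrightarrow> Fp \<phi> 0 = 0) \<and> 0 = (\<Sum>\<phi>\<in>S. Fp \<phi> 0)"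
      by (rule exI[of _ "{}"]) (auto simp: Fp_0 Fh_zero A)
    fix f g
    assume f: "f \<in> A \<inter> (\<Union>\<phi>. Fh \<phi>)"
      and "\<exists>S. finite S \<and> (\<forall>\<phi>. Fp \<phi> g \<in> Fh \<phi> \<inter> A) \<and> (\<forall>\<phi>. \<phi> \<notin> S \<longrightarrow> Fp \<phi> g = 0) \<and> g = (\<Sum>\<phi>\<in>S. Fp \<phi> g)"
    then obtain S \<psi> where S: "finite S" "\<forall>\<phi>. Fp \<phi> g \<in> Fh \<phi> \<inter> A" "\<forall>\<phi>. \<phi> \<notin> S \<longrightarrow> Fp \<phi> g = 0" "g = (\<Sum>\<phi>\<in>S. Fp \<phi> g)"
      and f: "f \<in> A" "f \<in> Fh \<psi>" by blast
    have "g = (\<Sum>\<phi>\<in>insert \<psi> S. Fp \<phi> g)"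
      by (subst S(4), rule sum.mono_neutral_left) (use S in auto)
    moreover have "f = (\<Sum>\<phi>\<in>insert \<psi> S. Fp \<phi> f)"
      using S(1) by (simp add: Fp_hom[OF Fh_hd[OF f(2)]])
    ultimately have sum1: "f + g = (\<Sum>\<phi>\<in>insert \<psi> S. Fp \<phi> (f + g))"
      unfolding Fp_add sum.distrib by simp
    have "Fp \<phi> (f + g) \<in> Fh \<phi> \<inter> A" "\<phi> \<notin> insert \<psi> S \<Longrightarrow> Fp \<phi> (f + g) = 0" for \<phi>
      using S f by (auto simp: Fp_add Fp_hom[OF Fh_hd[OF f(2)]] intro!: Fh_add A)
    then show "\<exists>S. finite S \<and> (\<forall>\<phi>. Fp \<phi> (f + g) \<in> Fh \<phi> \<inter> A) \<and> (\<forall>\<phi>. \<phi> \<notin> S \<longrightarrow> Fp \<phi> (f + g) = 0) \<and> f + g = (\<Sum>\<phi>\<in>S. Fp \<phi> (f + g))"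
      using S(1) sum1 by (intro exI[of _ "insert \<psi> S"]) blast
  qed
  have "\<exists>!u. hdecomp ?R f u" if f: "f \<in> A" for f
  proof (rule ex1I)
    obtain S where S: "finite S" "\<forall>\<phi>. Fp \<phi> f \<in> Fh \<phi> \<inter> A" "\<forall>\<phi>. \<phi> \<notin> S \<longrightarrow> Fp \<phi> f = 0" "f = (\<Sum>\<phi>\<in>S. Fp \<phi> f)"
      using ex[OF f] by blast
    have sub: "{\<phi>. Fp \<phi> f \<noteq> 0} \<subseteq> S" using S by auto
    have fin: "finite {\<phi>. Fp \<phi> f \<noteq> 0}" using finite_subset[OF sub S(1)] .
    have "f = (\<Sum>\<phi> | Fp \<phi> f \<noteq> 0. Fp \<phi> f)"
      by (subst (1) S(4), rule sum.mono_neutral_right) (use S sub in auto)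
    moreover have "(\<lambda>\<phi>. Fp \<phi> f) ` {\<phi>. Fp \<phi> f \<noteq> 0} \<subseteq> A" using S(2) by auto
    ultimately have "f = finsum ?R (\<lambda>\<phi>. Fp \<phi> f) {\<phi>. Fp \<phi> f \<noteq> 0}" using fs[OF fin] by metis
    then show "hdecomp ?R f (\<lambda>\<phi>. Fp \<phi> f)"
      unfolding hdecomp_def R using S(2) fin by blast
    fix u assume "hdecomp ?R f u"
    then have u: "\<forall>\<alpha>. u \<alpha> \<in> Fh \<alpha> \<inter> A" "finite {\<alpha>. u \<alpha> \<noteq> 0}" "f = finsum ?R u {\<alpha>. u \<alpha> \<noteq> 0}"
      unfolding hdecomp_def R by auto
    then have fu: "f = sum u {\<alpha>. u \<alpha> \<noteq> 0}" using fs[OF u(2), of u] by auto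
    show "u = (\<lambda>\<phi>. Fp \<phi> f)"
    proof (rule ext)
      fix \<phi>
      have "Fp \<phi> f = (\<Sum>\<alpha> | u \<alpha> \<noteq> 0. Fp \<phi> (u \<alpha>))" by (subst fu) (rule Fp_sum)
      also have "\<dots> = (\<Sum>\<alpha> | u \<alpha> \<noteq> 0. if \<phi> = \<alpha> then u \<alpha> else 0)"
        by (rule sum.cong[OF refl]) (use u(1) in \<open>auto simp: Fp_hom Fh_hd\<close>)
      also have "\<dots> = u \<phi>" using u(2) by simp
      finally show "u \<phi> = Fp \<phi> f" by simp
    qed
  qed
  then show ?thesis
    unfolding graded_algebra_def complex_algebra_def
    using rg md sm A one_Fh hm_Fh by (auto simp: hm_sm1 hm_sm2 AD)
qed

lemma H_gralg: "graded_algebra H"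
proof -
  have "graded_algebra (sub_graded H FD)"
  proof (rule sub_gralg)
    show "f \<in> {sum_list fs |fs. set fs \<subseteq> FD \<inter> (\<Union>\<phi>. Fh \<phi>)}" if "f \<in> FD" for f
    proof -
      have "FD \<inter> (\<Union>\<phi>. Fh \<phi>) = (\<Union>\<phi>. Fh \<phi>)" using Fh_FD by auto
      then show ?thesis using that unfolding FD_eq by simp
    qed
  qed (auto simp: FD_zero FD_add FD_sm hm_FD Fh_FD[OF one_Fh])
  moreover have "(\<lambda>\<alpha>. Fh \<alpha> \<inter> FD) = grade H" using Fh_FD by (auto simp: fun_eq_iff)
  then have "sub_graded H FD = H" by (simp add: sub_graded_def)
  ultimately show ?thesis by simp
qed

end

subsection \<open>The comultiplication of the finite dual\<close>

context gr_hopf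
begin

sublocale HH: grtens \<omega> "finite_dual \<omega> U"
  by unfold_locales (rule H_gralg)

lemmas HTT_simps [simp, intro] = HH.TT_zero[simplified] HH.TT_add[simplified] HH.TT_pt[simplified]
  HH.TT_smult[simplified]

lemma H_lin: "lin H L \<longleftrightarrow> (\<forall>f\<in>FD. \<forall>g\<in>FD. L (f + g) = L f + L g) \<and> (\<forall>c. \<forall>f\<in>FD. L (\<lambda>x. c * f x) = c * L f)"
  by (simp add: lin_def)

lemma H_lin_comb:
  assumes "lin H L" "\<And>p. p \<in> set ps \<Longrightarrow> F p \<in> FD"
  shows "(\<lambda>x. \<Sum>p\<leftarrow>ps. c p * F p x) \<in> FD \<and> L (\<lambda>x. \<Sum>p\<leftarrow>ps. c p * F p x) = (\<Sum>p\<leftarrow>ps. c p * L (F p))"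
  using assms(2)
proof (induction ps)
  case Nil
  then show ?case using FD_zero HH.lin_0[OF assms(1)] by (simp add: zero_fun_def)
next
  case (Cons p ps)
  have e: "(\<lambda>x. \<Sum>p\<leftarrow>p # ps. c p * F p x) = (\<lambda>x. c p * F p x) + (\<lambda>x. \<Sum>p\<leftarrow>ps. c p * F p x)"
    by (auto simp: fun_app)
  show ?case unfolding e using Cons assms(1) by (auto simp: H_lin FD_add FD_sm)
qed

lemma H_Bil_lin: "B \<in> HH.Bil \<Longrightarrow> g \<in> FD \<Longrightarrow> lin H (\<lambda>f. B f g)" "B \<in> HH.Bil \<Longrightarrow> g \<in> FD \<Longrightarrow> lin H (B g)"
  using bilin1[of B H H g] bilin2[of B H H g] by simp_all

text \<open>As in Gaussian elimination, a term with nonzero second factor can be absorbed into the others.\<close>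

lemma tens_zero:
  assumes "\<And>p. p \<in> set ps \<Longrightarrow> F p \<in> FD" "\<And>p. p \<in> set ps \<Longrightarrow> G p \<in> FD"
    "\<And>x y. x \<in> carrier U \<Longrightarrow> y \<in> carrier U \<Longrightarrow> (\<Sum>p\<leftarrow>ps. F p x * G p y) = 0" "B \<in> HH.Bil"
  shows "(\<Sum>p\<leftarrow>ps. B (F p) (G p)) = 0"
  using assms(1-3)
proof (induction ps arbitrary: G)
  case (Cons p ps)
  note FD = Cons(2,3)
  show ?case
  proof (cases "\<forall>y\<in>carrier U. G p y = 0")
    case True
    then have "G p = 0" using FD_dual[OF FD(2)[of p]] dual_off by (fastforce simp: fun_app)
    then have "B (F p) (G p) = 0" using HH.lin_0[OF H_Bil_lin(2)[OF assms(4) FD(1)[of p]]] by simp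
    moreover have "(\<Sum>p\<leftarrow>ps. B (F p) (G p)) = 0"
      by (rule Cons(1)) (use Cons(2-4) True in auto)
    ultimately show ?thesis by simp
  next
    case False
    then obtain y0 where y0: "y0 \<in> carrier U" "G p y0 \<noteq> 0" by blast
    define c where "c = (\<lambda>q. - (G q y0 / G p y0))"
    define G' where "G' = (\<lambda>q y. G q y + c q * G p y)"
    have sm: "G' q = G q + (\<lambda>y. c q * G p y)" for q by (auto simp: G'_def fun_app)
    have Fp: "F p x = (\<Sum>q\<leftarrow>ps. c q * F q x)" for x
    proof (cases "x \<in> carrier U")
      case True
      have "F p x * G p y0 = - (\<Sum>q\<leftarrow>ps. F q x * G q y0)"
        using Cons(4)[OF True y0(1)] by (simp add: eq_neg_iff_add_eq_0)
      also have "\<dots> = G p y0 * (\<Sum>q\<leftarrow>ps. c q * F q x)"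
        unfolding sum_list_times[symmetric] uminus_sum_list_map comp_def
        by (rule sum_list_ev) (use y0 in \<open>simp add: c_def\<close>)
      finally show ?thesis using y0 by simp
    next
      case False
      have "F q x = 0" if "q \<in> set (p # ps)" for q using FD(1)[OF that] FD_dual dual_off False by blast
      then have "(\<Sum>q\<leftarrow>ps. c q * F q x) = (\<Sum>q\<leftarrow>ps. 0)" by (intro sum_list_ev) simp
      then show ?thesis using \<open>\<And>q. q \<in> set (p # ps) \<Longrightarrow> F q x = 0\<close>[of p] by simp
    qed
    have Fp': "F p = (\<lambda>x. \<Sum>q\<leftarrow>ps. c q * F q x)" using Fp by blast
    have B1: "B (F p) (G p) = (\<Sum>q\<leftarrow>ps. c q * B (F q) (G p))"
      by (subst Fp', subst H_lin_comb[OF H_Bil_lin(1)[OF assms(4)]]) (use FD in auto)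
    have "(\<Sum>q\<leftarrow>ps. B (F q) (G' q)) = 0"
    proof (rule Cons(1))
      show "G' q \<in> FD" if "q \<in> set ps" for q unfolding sm using FD that by (auto intro!: FD_add FD_sm)
      fix x y assume x: "x \<in> carrier U" and y: "y \<in> carrier U"
      have "(\<Sum>q\<leftarrow>ps. F q x * G' q y) = (\<Sum>q\<leftarrow>ps. F q x * G q y) + (\<Sum>q\<leftarrow>ps. c q * F q x) * G p y"
        unfolding sum_list_addf[symmetric] sum_list_mult_const[symmetric]
        by (rule sum_list_ev) (simp add: G'_def algebra_simps)
      then show "(\<Sum>q\<leftarrow>ps. F q x * G' q y) = 0" using Cons(4)[OF x y] Fp[of x] by (simp add: add.commute)
    qed (use FD in auto)
    moreover have "(\<Sum>q\<leftarrow>ps. B (F q) (G' q)) = (\<Sum>q\<leftarrow>ps. B (F q) (G q)) + (\<Sum>q\<leftarrow>ps. c q * B (F q) (G p))"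
      unfolding sum_list_addf[symmetric]
    proof (rule sum_list_ev)
      fix q assume "q \<in> set ps"
      then have "F q \<in> FD" "G q \<in> FD" "G p \<in> FD" using FD by auto
      then show "B (F q) (G' q) = B (F q) (G q) + c q * B (F q) (G p)"
        unfolding sm using H_Bil_lin(2)[OF assms(4), of "F q"] by (simp add: H_lin FD_sm)
    qed
    ultimately show ?thesis using B1 by (simp add: add.commute)
  qed
qed simp

text \<open>The same elimination on the third factor. Fixing a point where \<open>K p\<close> is
  nonzero gives a relation in the first two factors, which \<open>tens_zero\<close> turns into a
  relation for the form with third argument \<open>K p\<close>.\<close>

lemma tens_zero3:
  assumes "\<And>p. p \<in> set ps \<Longrightarrow> F p \<in> FD" "\<And>p. p \<in> set ps \<Longrightarrow> G p \<in> FD" "\<And>p. p \<in> set ps \<Longrightarrow> K p \<in> FD"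
    "\<And>x y z. x \<in> carrier U \<Longrightarrow> y \<in> carrier U \<Longrightarrow> z \<in> carrier U \<Longrightarrow> (\<Sum>p\<leftarrow>ps. F p x * G p y * K p z) = 0" "trilin H B"
  shows "(\<Sum>p\<leftarrow>ps. B (F p) (G p) (K p)) = 0"
  using assms(1-4)
proof (induction ps arbitrary: K)
  case (Cons p ps)
  note FD = Cons(2-4)
  have B1: "f \<in> FD \<Longrightarrow> g \<in> FD \<Longrightarrow> lin H (B f g)" and B2: "h \<in> FD \<Longrightarrow> (\<lambda>f g. B f g h) \<in> HH.Bil" for f g h
    using assms(5) bilin2[of "B f" H H g] by (auto simp: trilin_def)
  show ?case
  proof (cases "\<forall>y\<in>carrier U. K p y = 0")
    case True
    then have "K p = 0" using FD_dual[OF FD(3)[of p]] dual_off by (fastforce simp: fun_app)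
    then have "B (F p) (G p) (K p) = 0" using HH.lin_0[OF B1[OF FD(1)[of p] FD(2)[of p]]] by simp
    moreover have "(\<Sum>p\<leftarrow>ps. B (F p) (G p) (K p)) = 0"
      by (rule Cons(1)) (use Cons(2-5) True in auto)
    ultimately show ?thesis by simp
  next
    case False
    then obtain z0 where z0: "z0 \<in> carrier U" "K p z0 \<noteq> 0" by blast
    define c where "c = (\<lambda>q. - (K q z0 / K p z0))"
    define K' where "K' = (\<lambda>q y. K q y + c q * K p y)"
    have sm: "K' q = K q + (\<lambda>y. c q * K p y)" for q by (auto simp: K'_def fun_app)
    have Fp: "F p x * G p y = (\<Sum>q\<leftarrow>ps. c q * F q x * G q y)" if "x \<in> carrier U" "y \<in> carrier U" for x y
    proof -
      have "F p x * G p y * K p z0 = - (\<Sum>q\<leftarrow>ps. F q x * G q y * K q z0)"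
        using Cons(5)[OF that z0(1)] by (simp add: eq_neg_iff_add_eq_0)
      also have "\<dots> = K p z0 * (\<Sum>q\<leftarrow>ps. c q * F q x * G q y)"
        unfolding sum_list_times[symmetric] uminus_sum_list_map comp_def
        by (rule sum_list_ev) (use z0 in \<open>simp add: c_def\<close>)
      finally show ?thesis using z0 by simp
    qed
    \<comment> \<open>The extra index \<open>None\<close> carries the term of \<open>p\<close> with
      coefficient -1, so that the relation \<open>Fp\<close> becomes a vanishing sum over one
      list.\<close>
    define b where "b = (\<lambda>q :: 'b option. case q of None \<Rightarrow> (\<lambda>x. (- 1) * F p x) | Some q \<Rightarrow> (\<lambda>x. c q * F q x))"
    define d where "d = (\<lambda>q :: 'b option. case q of None \<Rightarrow> G p | Some q \<Rightarrow> G q)"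
    have "(\<Sum>q\<leftarrow>None # map Some ps. B (b q) (d q) (K p)) = 0"
      by (rule tens_zero[OF _ _ _ B2])
        (use FD Fp FD_sm[of "F p" "-1"] in \<open>auto simp: b_def d_def comp_def intro!: FD_sm\<close>)
    moreover have sc: "B (\<lambda>x. a * F q x) (G q) (K p) = a * B (F q) (G q) (K p)" if "q \<in> set (p # ps)" for q a
      using FD that H_Bil_lin(1)[OF B2, of "K p" "G q"] by (auto simp: H_lin)
    ultimately have BB: "B (F p) (G p) (K p) = (\<Sum>q\<leftarrow>ps. c q * B (F q) (G q) (K p))"
      using sc[of p "-1"] by (simp add: b_def d_def comp_def cong: map_cong)
    have "(\<Sum>q\<leftarrow>ps. B (F q) (G q) (K' q)) = 0"
    proof (rule Cons(1))
      show "K' q \<in> FD" if "q \<in> set ps" for q unfolding sm using FD that by (auto intro!: FD_add FD_sm)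
      fix x y z assume x: "x \<in> carrier U" and y: "y \<in> carrier U" and z: "z \<in> carrier U"
      have "(\<Sum>q\<leftarrow>ps. F q x * G q y * K' q z) = (\<Sum>q\<leftarrow>ps. F q x * G q y * K q z) + (\<Sum>q\<leftarrow>ps. c q * F q x * G q y) * K p z"
        unfolding sum_list_addf[symmetric] sum_list_mult_const[symmetric]
        by (rule sum_list_ev) (simp add: K'_def algebra_simps)
      then show "(\<Sum>q\<leftarrow>ps. F q x * G q y * K' q z) = 0" using Cons(5)[OF x y z] Fp[OF x y] by (simp add: add.commute)
    qed (use FD in auto)
    moreover have "(\<Sum>q\<leftarrow>ps. B (F q) (G q) (K' q)) = (\<Sum>q\<leftarrow>ps. B (F q) (G q) (K q)) + (\<Sum>q\<leftarrow>ps. c q * B (F q) (G q) (K p))"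
      unfolding sum_list_addf[symmetric]
    proof (rule sum_list_ev)
      fix q assume "q \<in> set ps"
      then have "F q \<in> FD" "G q \<in> FD" "K q \<in> FD" "K p \<in> FD" using FD by auto
      then show "B (F q) (G q) (K' q) = B (F q) (G q) (K q) + c q * B (F q) (G q) (K p)"
        unfolding sm using B1[of "F q" "G q"] by (simp add: H_lin FD_sm)
    qed
    ultimately show ?thesis using BB by (simp add: add.commute)
  qed
qed simp

section \<open>Recovering a tensor over the finite dual from its evaluations\<close>

abbreviation "ev x y \<equiv> (\<lambda>g h. pairing \<omega> U g h x y)"

lemma ev_Bil: "ev x y \<in> HH.Bil"
  unfolding bilin_def by (simp add: pairing_add1 pairing_add2 pairing_sm1 pairing_sm2)

lemma HTT_list:
  assumes "z \<in> HH.TT"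
  shows "\<exists>ps. set ps \<subseteq> FD \<times> FD \<and> z = (\<Sum>(f, g)\<leftarrow>ps. HH.pt f g) \<and>
    (\<forall>B\<in>HH.Bil. z B = (\<Sum>p\<leftarrow>ps. B (fst p) (snd p)))"
proof -
  obtain ps where ps: "set ps \<subseteq> FD \<times> FD" "z = (\<Sum>(f, g)\<leftarrow>ps. HH.pt f g)"
    using assms unfolding tensor_sub_def tensor_sums_def by (simp add: split_def) blast
  have "z B = (\<Sum>p\<leftarrow>ps. B (fst p) (snd p))" if "B \<in> HH.Bil" for B
    unfolding ps(2) sum_list_fun_apply using that by (simp add: split_def)
  then show ?thesis using ps by blast
qed

text \<open>For homogeneous \<open>x\<close> and \<open>y\<close> the pairing multiplies all terms
  by the same nonzero factor, so the plain sum of products vanishes on homogeneous pairs, hence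
  everywhere by bilinearity. \<open>tens_zero\<close> then applies.\<close>

lemma ev_zero:
  assumes z: "z \<in> HH.TT" and 0: "\<And>x y. x \<in> carrier U \<Longrightarrow> y \<in> carrier U \<Longrightarrow> z (ev x y) = 0"
  shows "z = 0"
proof (rule HH.TT_eqI[OF z HH.TT_zero])
  fix B assume B: "B \<in> HH.Bil"
  obtain ps where ps: "set ps \<subseteq> FD \<times> FD" "\<And>B. B \<in> HH.Bil \<Longrightarrow> z B = (\<Sum>p\<leftarrow>ps. B (fst p) (snd p))"
    using HTT_list[OF z] by blast
  have pl: "lin U (fst p)" "lin U (snd p)" if "p \<in> set ps" for p using ps(1) that by (metis FD_lin mem_Times_iff subsetD)+
  have "(\<Sum>p\<leftarrow>ps. B (fst p) (snd p)) = 0"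
  proof (rule tens_zero[OF _ _ _ B])
    fix x y assume "x \<in> carrier U" "y \<in> carrier U"
    then show "(\<Sum>p\<leftarrow>ps. fst p x * snd p y) = 0"
    proof (rule Bil_ext[where C = "\<lambda>x y. 0" and B = "\<lambda>x y. \<Sum>p\<leftarrow>ps. fst p x * snd p y", rotated 3])
      show "(\<lambda>x y. \<Sum>p\<leftarrow>ps. fst p x * snd p y) \<in> Bil"
        using TT_sum_list[OF TT_zero, of ps "\<lambda>p x y. fst p x * snd p y"] by (auto intro: bilin_prod pl)
      fix \<alpha> \<beta> x y assume x: "x \<in> grade U \<alpha>" and y: "y \<in> grade U \<beta>"
      have "0 = (\<Sum>p\<leftarrow>ps. pairing \<omega> U (fst p) (snd p) x y)"
        using 0[of x y] x y ps(2)[OF ev_Bil] by (simp add: grade_carrier)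
      also have "\<dots> = (\<Sum>p\<leftarrow>ps. \<omega> (- \<beta>) \<alpha> * (fst p x * snd p y))"
        by (rule sum_list_ev) (simp add: pairing_hom[OF pl x y])
      finally show "(\<Sum>p\<leftarrow>ps. fst p x * snd p y) = 0" by (simp add: sum_list_times)
    qed (auto simp: bilin_zero)
  qed (use ps(1) in auto)
  then show "z B = 0 B" using ps(2)[OF B] by (simp add: fun_app)
qed

lemma HTT_diff: "z \<in> HH.TT \<Longrightarrow> w \<in> HH.TT \<Longrightarrow> z - w \<in> HH.TT"
proof -
  assume z: "z \<in> HH.TT" and w: "w \<in> HH.TT"
  have e: "z - w = z + (\<lambda>B. (- 1) * w B)" by (simp add: fun_eq_iff fun_app)
  show ?thesis unfolding e by (intro HH.TT_add HH.TT_smult z w)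
qed

lemma comult_H_def: "comult H f = (THE z. z \<in> HH.TT \<and> (\<forall>x\<in>carrier U. \<forall>y\<in>carrier U. z (ev x y) = f (x \<otimes> y)))"
proof -
  have 1: "bilin (finite_dual_alg \<omega> U) (finite_dual_alg \<omega> U) = HH.Bil"
    unfolding bilin_def by (simp add: finite_dual_alg_def)
  then have 2: "pure_tensor (finite_dual_alg \<omega> U) (finite_dual_alg \<omega> U) = HH.pt"
    by (auto simp: pure_tensor_def fun_eq_iff)
  have "carrier (tensor_alg \<omega> (finite_dual_alg \<omega> U) (finite_dual_alg \<omega> U)) = HH.TT"
    by (simp add: tensor_alg_def tensor_sub_def tensor_sums_def 2) (simp add: finite_dual_alg_def)
  moreover have "comult H f = dual_comult \<omega> U f"
    by (simp add: finite_dual_def finite_dual_alg_def graded.defs hopf.defs)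
  ultimately show ?thesis by (simp add: dual_comult_def)
qed

text \<open>By \<open>ev_zero\<close> a tensor is determined by its evaluations, so the definite
  description is unique and identities for the comultiplication reduce to identities for
  \<open>f (x \<otimes> y)\<close>.\<close>

lemma comult_H_eqI:
  assumes "z \<in> HH.TT" "\<And>x y. x \<in> carrier U \<Longrightarrow> y \<in> carrier U \<Longrightarrow> z (ev x y) = f (x \<otimes> y)"
  shows "comult H f = z"
  unfolding comult_H_def
proof (rule the_equality)
  fix w assume w: "w \<in> HH.TT \<and> (\<forall>x\<in>carrier U. \<forall>y\<in>carrier U. w (ev x y) = f (x \<otimes> y))"
  have "w - z = 0" by (rule ev_zero) (use w assms HTT_diff in auto)
  then show "w = z" by simp
qed (use assms in auto)

text \<open>The scalar is inverse to the factor \<open>\<omega> \<psi> (\<phi> - \<psi>)\<close>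
  with which the pairing evaluates a tensor of functionals of degrees \<psi> and \<phi> -
  \<psi>.\<close>

definition twist :: "'g \<Rightarrow> 'g \<times> ('a \<Rightarrow> complex) \<times> ('a \<Rightarrow> complex) \<Rightarrow> 'a \<Rightarrow> complex" where
  "twist \<phi> p = (\<lambda>x. \<omega> (\<phi> - fst p) (fst p) * fst (snd p) x)"

lemma twist_Fh: "factors \<phi> f ps \<Longrightarrow> p \<in> set ps \<Longrightarrow> twist \<phi> p \<in> Fh (fst p)"
  using factorsD(1) unfolding twist_def by (intro Fh_sm) blast

lemma comult_factors:
  assumes f: "f \<in> Fh \<phi>" and ps: "factors \<phi> f ps"
  shows "comult H f = (\<Sum>p\<leftarrow>ps. HH.pt (twist \<phi> p) (snd (snd p)))"
proof (rule comult_H_eqI)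
  note d = factorsD[OF ps]
  show "(\<Sum>p\<leftarrow>ps. HH.pt (twist \<phi> p) (snd (snd p))) \<in> HH.TT"
    unfolding tensor_sub_def
    by (rule HH.ts_sum_list, rule HH.ts_pt) (simp add: Fh_FD[OF twist_Fh[OF ps]] Fh_FD[OF d(2)])
  fix x y assume x: "x \<in> carrier U" and y: "y \<in> carrier U"
  have "(\<Sum>p\<leftarrow>ps. HH.pt (twist \<phi> p) (snd (snd p))) (ev x y) = (\<Sum>p\<leftarrow>ps. pairing \<omega> U (twist \<phi> p) (snd (snd p)) x y)"
    unfolding sum_list_fun_apply using ev_Bil[of x y] by simp
  also have "\<dots> = (\<Sum>p\<leftarrow>ps. fst (snd p) x * snd (snd p) y)"
  proof (rule sum_list_ev)
    fix p assume p: "p \<in> set ps"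
    show "pairing \<omega> U (twist \<phi> p) (snd (snd p)) x y = fst (snd p) x * snd (snd p) y"
      using om_swap_mult[of "\<phi> - fst p" "fst p"] unfolding twist_def pairing_sm1
      by (subst pairing_hd[OF Fh_hd[OF d(1)[OF p]] Fh_hd[OF d(2)[OF p]] x y]) (simp only: mult.assoc[symmetric], simp)
  qed
  finally show "(\<Sum>p\<leftarrow>ps. HH.pt (twist \<phi> p) (snd (snd p))) (ev x y) = f (x \<otimes> y)" using d(3)[OF x y] by simp
qed

lemma comult_H: "f \<in> FD \<Longrightarrow> comult H f \<in> HH.TT \<and> (\<forall>x\<in>carrier U. \<forall>y\<in>carrier U. comult H f (ev x y) = f (x \<otimes> y))"
proof -
  assume "f \<in> FD"
  then have "\<exists>z\<in>HH.TT. \<forall>x\<in>carrier U. \<forall>y\<in>carrier U. z (ev x y) = f (x \<otimes> y)"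
  proof (induction rule: FD_induct)
    case (hom \<phi> f)
    obtain ps where ps: "factors \<phi> f ps" using factors_ex[OF hom] by blast
    note d = factorsD[OF ps]
    let ?z = "\<Sum>p\<leftarrow>ps. HH.pt (twist \<phi> p) (snd (snd p))"
    have "?z \<in> HH.TT"
      unfolding tensor_sub_def
      by (rule HH.ts_sum_list, rule HH.ts_pt) (simp add: Fh_FD[OF twist_Fh[OF ps]] Fh_FD[OF d(2)])
    moreover have "?z (ev x y) = f (x \<otimes> y)" if x: "x \<in> carrier U" and y: "y \<in> carrier U" for x y
    proof -
      have "?z (ev x y) = (\<Sum>p\<leftarrow>ps. pairing \<omega> U (twist \<phi> p) (snd (snd p)) x y)"
        unfolding sum_list_fun_apply using ev_Bil[of x y] by simp
      also have "\<dots> = (\<Sum>p\<leftarrow>ps. fst (snd p) x * snd (snd p) y)"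
      proof (rule sum_list_ev)
        fix p assume p: "p \<in> set ps"
        show "pairing \<omega> U (twist \<phi> p) (snd (snd p)) x y = fst (snd p) x * snd (snd p) y"
          using om_swap_mult[of "\<phi> - fst p" "fst p"] unfolding twist_def pairing_sm1
          by (subst pairing_hd[OF Fh_hd[OF d(1)[OF p]] Fh_hd[OF d(2)[OF p]] x y]) (simp only: mult.assoc[symmetric], simp)
      qed
      finally show ?thesis using d(3)[OF x y] by simp
    qed
    ultimately show ?case by blast
  next
    case (add f g)
    then obtain z w where "z \<in> HH.TT" "w \<in> HH.TT" "\<forall>x\<in>carrier U. \<forall>y\<in>carrier U. z (ev x y) = f (x \<otimes> y)"
      "\<forall>x\<in>carrier U. \<forall>y\<in>carrier U. w (ev x y) = g (x \<otimes> y)" by blast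
    then show ?case by (intro bexI[of _ "z + w"]) (auto simp: fun_app)
  qed
  then show ?thesis using comult_H_eqI by metis
qed

lemma Hcom_TT: "f \<in> FD \<Longrightarrow> comult H f \<in> HH.TT"
  and Hcom_ev: "f \<in> FD \<Longrightarrow> x \<in> carrier U \<Longrightarrow> y \<in> carrier U \<Longrightarrow> comult H f (ev x y) = f (x \<otimes> y)"
  using comult_H by auto

lemmas Hcom_TT' [simp] = Hcom_TT[simplified]

lemma Hcom_add: "f \<in> FD \<Longrightarrow> g \<in> FD \<Longrightarrow> comult H (f + g) = comult H f + comult H g"
  by (rule comult_H_eqI) (auto simp: Hcom_TT Hcom_ev fun_app)

lemma Hcom_sm: "f \<in> FD \<Longrightarrow> comult H (\<lambda>x. c * f x) = (\<lambda>B. c * comult H f B)"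
  by (rule comult_H_eqI) (auto simp: Hcom_TT Hcom_ev HH.TT_smult)

lemma Hcom_zero: "comult H 0 = 0"
  by (rule comult_H_eqI) (auto simp: fun_app)

lemma Hcom_one: "comult H \<one>\<^bsub>H\<^esub> = HH.pt \<one>\<^bsub>H\<^esub> \<one>\<^bsub>H\<^esub>"
proof (rule comult_H_eqI)
  fix x y assume x: "x \<in> carrier U" and y: "y \<in> carrier U"
  show "HH.pt \<one>\<^bsub>H\<^esub> \<one>\<^bsub>H\<^esub> (ev x y) = \<one>\<^bsub>H\<^esub> (x \<otimes> y)"
    using ev_Bil[of x y] pairing_hd[OF Fh_hd[OF one_Fh] Fh_hd[OF one_Fh] x y] x y by (simp add: H_one cou_mult)
qed (simp add: Fh_FD[OF one_Fh])

lemma Hcom_grade: "f \<in> Fh \<phi> \<Longrightarrow> comult H f \<in> tensor_sums H H {(a, b). \<exists>\<psi>. a \<in> Fh \<psi> \<and> b \<in> Fh (\<phi> - \<psi>)}"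
proof -
  assume f: "f \<in> Fh \<phi>"
  obtain ps where ps: "factors \<phi> f ps" using factors_ex[OF f] by blast
  show ?thesis unfolding comult_factors[OF f ps]
    by (rule HH.ts_sum_list, rule HH.ts_pt, simp) (use twist_Fh[OF ps] factorsD(2)[OF ps] in blast)
qed

text \<open>Both sides are evaluated at a pair \<open>x\<close>, \<open>y\<close>. The product side
  is expanded by \<open>conv_mult\<close>, the tensor side by \<open>comult_factors\<close>, and the
  two sums run over the same pairs of terms with equal scalars.\<close>

lemma Hcom_mult_hom:
  assumes f: "f \<in> Fh \<phi>" and g: "g \<in> Fh \<psi>"
  shows "comult H (f \<otimes>\<^bsub>H\<^esub> g) = HH.tm (comult H f) (comult H g)"
proof (rule comult_H_eqI)
  show "HH.tm (comult H f) (comult H g) \<in> HH.TT" by (intro HH.tm_closed Hcom_TT Fh_FD[OF f] Fh_FD[OF g])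
  obtain ps qs where ps: "factors \<phi> f ps" and qs: "factors \<psi> g qs" using factors_ex f g by blast
  note dp = factorsD[OF ps] and dq = factorsD[OF qs]
  fix x y assume x: "x \<in> carrier U" and y: "y \<in> carrier U"
  note B = ev_Bil[of x y]
  have tw: "twist \<phi> p \<in> Fh (fst p)" if "p \<in> set ps" for p using dp(1)[OF that] by (auto simp: twist_def Fh_sm)
  have tw': "twist \<psi> q \<in> Fh (fst q)" if "q \<in> set qs" for q using dq(1)[OF that] by (auto simp: twist_def Fh_sm)
  have i: "comult H g (HH.mform (ev x y) a b) = (\<Sum>q\<leftarrow>qs. HH.mform (ev x y) a b (twist \<psi> q) (snd (snd q)))"
    if "a \<in> FD" "b \<in> FD" for a b
    unfolding comult_factors[OF g qs] sum_list_fun_apply using HH.mform_Bil1[OF B, of a b] that by simp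
  have "HH.tm (comult H f) (comult H g) (ev x y) = comult H f (\<lambda>a b. comult H g (HH.mform (ev x y) a b))"
    using B by (simp add: HH.tm_def')
  also have "\<dots> = (\<Sum>p\<leftarrow>ps. comult H g (HH.mform (ev x y) (twist \<phi> p) (snd (snd p))))"
    unfolding comult_factors[OF f ps] sum_list_fun_apply
    using HH.tm_form[OF Hcom_TT[OF Fh_FD[OF g]] B] by simp
  also have "\<dots> = (\<Sum>p\<leftarrow>ps. \<Sum>q\<leftarrow>qs. HH.mform (ev x y) (twist \<phi> p) (snd (snd p)) (twist \<psi> q) (snd (snd q)))"
    by (rule sum_list_ev, rule i) (use dp tw Fh_FD in blast)+
  also have "\<dots> = (\<Sum>r\<leftarrow>List.product ps qs. HH.mform (ev x y) (twist \<phi> (fst r)) (snd (snd (fst r))) (twist \<psi> (snd r)) (snd (snd (snd r))))"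
    unfolding sum_list_product by (simp add: split_def)
  also have "\<dots> = (\<Sum>r\<leftarrow>List.product ps qs. \<omega> \<phi> \<psi> * (\<omega> (fst (snd r)) (\<phi> - fst (fst r)) *
    (conv (fst (snd (fst r))) (fst (snd (snd r))) x * conv (snd (snd (fst r))) (snd (snd (snd r))) y)))"
  proof (rule sum_list_ev)
    fix r assume "r \<in> set (List.product ps qs)"
    then obtain p q where r: "r = (p, q)" "p \<in> set ps" "q \<in> set qs" by auto
    define a b c d where "a = fst (snd p)" and "b = snd (snd p)" and "c = fst (snd q)" and "d = snd (snd q)"
    define \<alpha> \<alpha>' \<beta> \<beta>' where "\<alpha> = fst p" and "\<alpha>' = \<phi> - fst p" and "\<beta> = fst q" and "\<beta>' = \<psi> - fst q"
    have h: "a \<in> Fh \<alpha>" "b \<in> Fh \<alpha>'" "c \<in> Fh \<beta>" "d \<in> Fh \<beta>'"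
      using dp(1,2)[OF r(2)] dq(1,2)[OF r(3)] by (simp_all add: a_def b_def c_def d_def \<alpha>_def \<alpha>'_def \<beta>_def \<beta>'_def)
    have ph: "\<phi> = \<alpha> + \<alpha>'" "\<psi> = \<beta> + \<beta>'" by (simp_all add: \<alpha>_def \<alpha>'_def \<beta>_def \<beta>'_def)
    have t: "twist \<phi> p = (\<lambda>x. \<omega> \<alpha>' \<alpha> * a x)" "twist \<psi> q = (\<lambda>x. \<omega> \<beta>' \<beta> * c x)"
      by (simp_all add: twist_def a_def c_def \<alpha>_def \<alpha>'_def \<beta>_def \<beta>'_def)
    have "HH.mform (ev x y) (twist \<phi> p) b (twist \<psi> q) d = \<omega> \<alpha>' \<beta> * pairing \<omega> U (twist \<phi> p \<otimes>\<^bsub>H\<^esub> twist \<psi> q) (b \<otimes>\<^bsub>H\<^esub> d) x y"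
      by (subst HH.mform_hom[where \<alpha> = \<beta> and \<beta> = \<alpha>'])
        (use h tw[OF r(2)] tw'[OF r(3)] B in \<open>auto simp: Fh_FD \<beta>_def\<close>)
    also have "twist \<phi> p \<otimes>\<^bsub>H\<^esub> twist \<psi> q = (\<lambda>x. \<omega> \<alpha>' \<alpha> * (\<omega> \<beta>' \<beta> * (a \<otimes>\<^bsub>H\<^esub> c) x))"
      unfolding t using h[THEN Fh_dual] by (subst hm_sm1, simp, simp add: dual_sm, subst hm_sm2, auto)
    also have "pairing \<omega> U (\<lambda>x. \<omega> \<alpha>' \<alpha> * (\<omega> \<beta>' \<beta> * (a \<otimes>\<^bsub>H\<^esub> c) x)) (b \<otimes>\<^bsub>H\<^esub> d) x y
      = \<omega> \<alpha>' \<alpha> * (\<omega> \<beta>' \<beta> * (\<omega> (\<alpha> + \<beta>) (\<alpha>' + \<beta>') * ((a \<otimes>\<^bsub>H\<^esub> c) x * (b \<otimes>\<^bsub>H\<^esub> d) y)))"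
      unfolding pairing_sm1 using pairing_hd[OF Fh_hd[OF hm_Fh[OF h(1,3)]] Fh_hd[OF hm_Fh[OF h(2,4)]] x y] by simp
    also have "(a \<otimes>\<^bsub>H\<^esub> c) x = \<omega> \<alpha> \<beta> * conv a c x" using hm_hom[OF h(1,3)[THEN Fh_hd]] x by simp
    also have "(b \<otimes>\<^bsub>H\<^esub> d) y = \<omega> \<alpha>' \<beta>' * conv b d y" using hm_hom[OF h(2,4)[THEN Fh_hd]] y by simp
    \<comment> \<open>After expanding
      \<open>\<omega> (\<alpha> + \<beta>) (\<alpha>' + \<beta>')\<close>, the twists
      \<open>\<omega> \<alpha>' \<alpha>\<close> and \<open>\<omega> \<beta>' \<beta>\<close> cancel
      \<open>\<omega> \<alpha> \<alpha>'\<close> and \<open>\<omega> \<beta> \<beta>'\<close>. What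
      remains is \<open>\<omega> \<beta> \<alpha>'\<close> times the four factors of
      \<open>\<omega> (\<alpha> + \<alpha>') (\<beta> + \<beta>')\<close>.\<close>
    also have "\<omega> \<alpha>' \<beta> * (\<omega> \<alpha>' \<alpha> * (\<omega> \<beta>' \<beta> * (\<omega> (\<alpha> + \<beta>) (\<alpha>' + \<beta>') * (\<omega> \<alpha> \<beta> * conv a c x * (\<omega> \<alpha>' \<beta>' * conv b d y)))))
      = \<omega> \<phi> \<psi> * (\<omega> \<beta> \<alpha>' * (conv a c x * conv b d y))"
      unfolding ph by (simp add: om_add om_swap[of \<alpha>' \<alpha>] om_swap[of \<beta>' \<beta>] field_simps)
    finally show "HH.mform (ev x y) (twist \<phi> (fst r)) (snd (snd (fst r))) (twist \<psi> (snd r)) (snd (snd (snd r)))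
      = \<omega> \<phi> \<psi> * (\<omega> (fst (snd r)) (\<phi> - fst (fst r)) *
         (conv (fst (snd (fst r))) (fst (snd (snd r))) x * conv (snd (snd (fst r))) (snd (snd (snd r))) y))"
      by (simp add: r a_def b_def c_def d_def \<beta>_def \<alpha>'_def)
  qed
  also have "\<dots> = (f \<otimes>\<^bsub>H\<^esub> g) (x \<otimes> y)"
    using hm_hom[OF Fh_hd[OF f] Fh_hd[OF g]] conv_mult[OF f g ps qs x y] x y by (simp add: sum_list_times)
  finally show "HH.tm (comult H f) (comult H g) (ev x y) = (f \<otimes>\<^bsub>H\<^esub> g) (x \<otimes> y)" .
qed

lemma Hcom_mult: "f \<in> FD \<Longrightarrow> g \<in> FD \<Longrightarrow> comult H (f \<otimes>\<^bsub>H\<^esub> g) = HH.tm (comult H f) (comult H g)"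
proof (induction arbitrary: g rule: FD_induct)
  case (hom \<phi> f)
  from hom(2) show ?case
  proof (induction rule: FD_induct)
    case (hom \<psi> g)
    show ?case by (rule Hcom_mult_hom[OF \<open>f \<in> Fh \<phi>\<close> hom])
  next
    case (add g h)
    have "f \<in> FD" using \<open>f \<in> Fh \<phi>\<close> by (rule Fh_FD)
    then show ?case using add by (simp add: hm_add2 FD_dual Hcom_add hm_FD HH.tm_add2 Hcom_TT)
  qed
next
  case (add f f')
  then show ?case by (simp add: hm_add1 FD_dual Hcom_add hm_FD HH.tm_add1)
qed

end

subsection \<open>Coassociativity, counit and antipode of the finite dual\<close>

lemma sum_list_concat_map: "(\<Sum>t\<leftarrow>concat (map f ps). g t) = (\<Sum>p\<leftarrow>ps. \<Sum>t\<leftarrow>f p. (g t :: complex))"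
  by (induction ps) auto

lemma list_msum_eq: "zero M = 0 \<Longrightarrow> add M = (+) \<Longrightarrow> list_msum M xs = sum_list xs"
  by (simp add: list_msum_def sum_list.eq_foldr)

context gr_hopf
begin

lemma expressesD:
  assumes "expresses H A f ps" "A \<subseteq> FD"
  shows "set ps \<subseteq> FD \<times> FD" "B \<in> HH.Bil \<Longrightarrow> comult H f B = (\<Sum>p\<leftarrow>ps. B (fst p) (snd p))"
proof -
  have 1: "set ps \<subseteq> A \<times> A" "comult H f = (\<Sum>(y, z)\<leftarrow>ps. HH.pt y z)" using assms by (auto simp: expresses_def)
  then show "set ps \<subseteq> FD \<times> FD" using assms(2) by blast
  show "comult H f B = (\<Sum>p\<leftarrow>ps. B (fst p) (snd p))" if "B \<in> HH.Bil"
    unfolding 1(2) sum_list_fun_apply using that by (simp add: split_def)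
qed

lemma Hcom_list: "f \<in> FD \<Longrightarrow> \<exists>ps. set ps \<subseteq> FD \<times> FD \<and> (\<forall>B\<in>HH.Bil. comult H f B = (\<Sum>p\<leftarrow>ps. B (fst p) (snd p)))"
  using HTT_list[OF Hcom_TT] by blast

lemma tri_ext:
  assumes "\<And>x y. x \<in> carrier U \<Longrightarrow> y \<in> carrier U \<Longrightarrow> lin U (T x y)"
    and "\<And>x z. x \<in> carrier U \<Longrightarrow> z \<in> carrier U \<Longrightarrow> lin U (\<lambda>y. T x y z)"
    and "\<And>y z. y \<in> carrier U \<Longrightarrow> z \<in> carrier U \<Longrightarrow> lin U (\<lambda>x. T x y z)"
    and "\<And>\<alpha> \<beta> \<kappa> x y z. x \<in> grade U \<alpha> \<Longrightarrow> y \<in> grade U \<beta> \<Longrightarrow> z \<in> grade U \<kappa> \<Longrightarrow> T x y z = 0"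
    and c: "x \<in> carrier U" "y \<in> carrier U" "z \<in> carrier U"
  shows "T x y z = 0"
proof -
  have 1: "T x y z = 0" if "x \<in> grade U \<alpha>" "y \<in> grade U \<beta>" "z \<in> carrier U" for x y z \<alpha> \<beta>
    using lin_ext[where f = "T x y" and g = "\<lambda>z. 0", OF assms(1) lin_zero] assms(4) that by blast
  have 2: "T x y z = 0" if "x \<in> grade U \<alpha>" "y \<in> carrier U" "z \<in> carrier U" for x y z \<alpha>
    using lin_ext[where f = "\<lambda>y. T x y z" and g = "\<lambda>z. 0", OF assms(2) lin_zero] 1 that by blast
  show ?thesis
    using lin_ext[where f = "\<lambda>x. T x y z" and g = "\<lambda>z. 0", OF assms(3) lin_zero] 2 c by blast
qed

lemma lin_sum_list: "(\<And>p. p \<in> set ps \<Longrightarrow> lin U (f p)) \<Longrightarrow> lin U (\<lambda>x. \<Sum>p\<leftarrow>ps. f p x)"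
  by (induction ps) (auto intro: lin_zero lin_plus)

text \<open>On homogeneous \<open>x\<close>, \<open>y\<close>, \<open>z\<close> each of the two
  double sums, times a nonzero factor, equals the value of \<open>f\<close> at the triple product.
  The two factors agree by multiplicativity of \<omega>, so the sums agree as functions, and
  \<open>tens_zero3\<close> carries this over to the trilinear form.\<close>

lemma Hcoassoc:
  assumes f: "f \<in> FD" and B: "trilin H B" and ps: "set ps \<subseteq> FD \<times> FD"
    and fps: "\<And>B. B \<in> HH.Bil \<Longrightarrow> comult H f B = (\<Sum>p\<leftarrow>ps. B (fst p) (snd p))"
  shows "(\<Sum>p\<leftarrow>ps. comult H (fst p) (\<lambda>u v. B u v (snd p))) = (\<Sum>p\<leftarrow>ps. comult H (snd p) (B (fst p)))"
proof -
  have "\<forall>y. \<exists>qs. y \<in> FD \<longrightarrow> set qs \<subseteq> FD \<times> FD \<and> (\<forall>B\<in>HH.Bil. comult H y B = (\<Sum>p\<leftarrow>qs. B (fst p) (snd p)))"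
    using Hcom_list by blast
  from choice[OF this] obtain ly where ly: "\<And>y. y \<in> FD \<Longrightarrow> set (ly y) \<subseteq> FD \<times> FD"
    "\<And>y B. y \<in> FD \<Longrightarrow> B \<in> HH.Bil \<Longrightarrow> comult H y B = (\<Sum>p\<leftarrow>ly y. B (fst p) (snd p))" by blast
  have FDp: "fst p \<in> FD" "snd p \<in> FD" if "p \<in> set ps" for p using ps that by auto
  have FDq: "fst q \<in> FD" "snd q \<in> FD" if "q \<in> set (ly y)" "y \<in> FD" for q y using ly(1)[OF that(2)] that(1) by auto
  \<comment> \<open>The difference of the two double co-products as one list of triples: coefficient
    1 where the first leg is split, -1 where the second leg is split.\<close>
  define ts where "ts = concat (map (\<lambda>p. map (\<lambda>q. (1 :: complex, fst q, snd q, snd p)) (ly (fst p))) ps) @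
    concat (map (\<lambda>p. map (\<lambda>q. (- 1 :: complex, fst p, fst q, snd q)) (ly (snd p))) ps)"
  have sums: "(\<Sum>(c, f, g, h)\<leftarrow>ts. c * X f g h) = (\<Sum>p\<leftarrow>ps. \<Sum>q\<leftarrow>ly (fst p). X (fst q) (snd q) (snd p))
     - (\<Sum>p\<leftarrow>ps. \<Sum>q\<leftarrow>ly (snd p). X (fst p) (fst q) (snd q))" for X :: "_ \<Rightarrow> _ \<Rightarrow> _ \<Rightarrow> complex"
    unfolding ts_def map_append sum_list_append sum_list_concat_map map_map comp_def split_def fst_conv snd_conv
      sum_list_times by simp
  have FDt: "f \<in> FD" "g \<in> FD" "h \<in> FD" if "(c, f, g, h) \<in> set ts" for c f g h
    using that FDp FDq unfolding ts_def by auto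
  have zero: "(\<Sum>(c, f, g, h)\<leftarrow>ts. c * (f x * g y * h z)) = 0" if "x \<in> carrier U" "y \<in> carrier U" "z \<in> carrier U" for x y z
  proof (rule tri_ext[where T = "\<lambda>x y z. \<Sum>(c, f, g, h)\<leftarrow>ts. c * (f x * g y * h z)"])
    show "lin U (\<lambda>z. \<Sum>(c, f, g, h)\<leftarrow>ts. c * (f x * g y * h z))" for x y
      unfolding split_def by (intro lin_sum_list lin_times FD_lin) (use FDt in auto)
    show "lin U (\<lambda>y. \<Sum>(c, f, g, h)\<leftarrow>ts. c * (f x * g y * h z))" for x z
      unfolding split_def by (intro lin_sum_list lin_times lin_times' FD_lin) (use FDt in auto)
    show "lin U (\<lambda>x. \<Sum>(c, f, g, h)\<leftarrow>ts. c * (f x * g y * h z))" for y z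
      unfolding split_def mult.assoc by (intro lin_sum_list lin_times lin_times' FD_lin) (use FDt in auto)
    fix \<alpha> \<beta> \<kappa> x y z assume x: "x \<in> grade U \<alpha>" and y: "y \<in> grade U \<beta>" and z: "z \<in> grade U \<kappa>"
    have c: "x \<in> carrier U" "y \<in> carrier U" "z \<in> carrier U" using x y z by auto
    define L where "L = (\<Sum>p\<leftarrow>ps. \<Sum>q\<leftarrow>ly (fst p). fst q x * snd q y * snd p z)"
    define R where "R = (\<Sum>p\<leftarrow>ps. \<Sum>q\<leftarrow>ly (snd p). fst p x * fst q y * snd q z)"
    have l1: "\<omega> (- \<beta>) \<alpha> * (\<Sum>q\<leftarrow>ly g. fst q x * snd q y) = g (x \<otimes> y)" if "g \<in> FD" for g
    proof -
      have "g (x \<otimes> y) = (\<Sum>q\<leftarrow>ly g. pairing \<omega> U (fst q) (snd q) x y)"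
        using Hcom_ev[OF that c(1,2)] ly(2)[OF that ev_Bil] by simp
      also have "\<dots> = (\<Sum>q\<leftarrow>ly g. \<omega> (- \<beta>) \<alpha> * (fst q x * snd q y))"
        by (rule sum_list_ev) (use pairing_hom[OF FD_lin FD_lin x y] FDq[OF _ that] in simp)
      finally show ?thesis by (simp add: sum_list_times)
    qed
    have l2: "\<omega> (- \<kappa>) \<beta> * (\<Sum>q\<leftarrow>ly g. fst q y * snd q z) = g (y \<otimes> z)" if "g \<in> FD" for g
    proof -
      have "g (y \<otimes> z) = (\<Sum>q\<leftarrow>ly g. pairing \<omega> U (fst q) (snd q) y z)"
        using Hcom_ev[OF that c(2,3)] ly(2)[OF that ev_Bil] by simp
      also have "\<dots> = (\<Sum>q\<leftarrow>ly g. \<omega> (- \<kappa>) \<beta> * (fst q y * snd q z))"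
        by (rule sum_list_ev) (use pairing_hom[OF FD_lin FD_lin y z] FDq[OF _ that] in simp)
      finally show ?thesis by (simp add: sum_list_times)
    qed
    have "\<omega> (- \<kappa>) (\<alpha> + \<beta>) * \<omega> (- \<beta>) \<alpha> * L = (\<Sum>p\<leftarrow>ps. pairing \<omega> U (fst p) (snd p) (x \<otimes> y) z)"
      unfolding L_def sum_list_times[symmetric]
    proof (rule sum_list_ev)
      fix p assume p: "p \<in> set ps"
      have "(\<Sum>q\<leftarrow>ly (fst p). \<omega> (- \<kappa>) (\<alpha> + \<beta>) * \<omega> (- \<beta>) \<alpha> * (fst q x * snd q y * snd p z))
        = \<omega> (- \<kappa>) (\<alpha> + \<beta>) * (\<omega> (- \<beta>) \<alpha> * (\<Sum>q\<leftarrow>ly (fst p). fst q x * snd q y)) * snd p z"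
        unfolding sum_list_times[symmetric] sum_list_mult_const[symmetric] by (rule sum_list_ev) simp
      then show "(\<Sum>q\<leftarrow>ly (fst p). \<omega> (- \<kappa>) (\<alpha> + \<beta>) * \<omega> (- \<beta>) \<alpha> * (fst q x * snd q y * snd p z)) = pairing \<omega> U (fst p) (snd p) (x \<otimes> y) z"
        unfolding l1[OF FDp(1)[OF p]] by (simp add: pairing_hom[OF FD_lin[OF FDp(1)[OF p]] FD_lin[OF FDp(2)[OF p]] grade_mult[OF x y] z])
    qed
    also have "\<dots> = f (x \<otimes> y \<otimes> z)"
      using Hcom_ev[OF f, of "x \<otimes> y" z] fps[OF ev_Bil] c by simp
    finally have 1: "\<omega> (- \<kappa>) (\<alpha> + \<beta>) * \<omega> (- \<beta>) \<alpha> * L = f (x \<otimes> y \<otimes> z)" .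
    have "\<omega> (- (\<beta> + \<kappa>)) \<alpha> * \<omega> (- \<kappa>) \<beta> * R = (\<Sum>p\<leftarrow>ps. pairing \<omega> U (fst p) (snd p) x (y \<otimes> z))"
      unfolding R_def sum_list_times[symmetric]
    proof (rule sum_list_ev)
      fix p assume p: "p \<in> set ps"
      have "(\<Sum>q\<leftarrow>ly (snd p). \<omega> (- (\<beta> + \<kappa>)) \<alpha> * \<omega> (- \<kappa>) \<beta> * (fst p x * fst q y * snd q z))
        = \<omega> (- (\<beta> + \<kappa>)) \<alpha> * fst p x * (\<omega> (- \<kappa>) \<beta> * (\<Sum>q\<leftarrow>ly (snd p). fst q y * snd q z))"
        unfolding sum_list_times[symmetric] by (rule sum_list_ev) simp
      then show "(\<Sum>q\<leftarrow>ly (snd p). \<omega> (- (\<beta> + \<kappa>)) \<alpha> * \<omega> (- \<kappa>) \<beta> * (fst p x * fst q y * snd q z)) = pairing \<omega> U (fst p) (snd p) x (y \<otimes> z)"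
        unfolding l2[OF FDp(2)[OF p]] by (simp only: pairing_hom[OF FD_lin[OF FDp(1)[OF p]] FD_lin[OF FDp(2)[OF p]] x grade_mult[OF y z]])
    qed
    also have "\<dots> = f (x \<otimes> y \<otimes> z)"
      using Hcom_ev[OF f, of x "y \<otimes> z"] fps[OF ev_Bil] c by (simp add: m_assoc)
    finally have "\<omega> (- (\<beta> + \<kappa>)) \<alpha> * \<omega> (- \<kappa>) \<beta> * R = \<omega> (- \<kappa>) (\<alpha> + \<beta>) * \<omega> (- \<beta>) \<alpha> * L" using 1 by simp
    moreover have "\<omega> (- \<kappa>) (\<alpha> + \<beta>) * \<omega> (- \<beta>) \<alpha> = \<omega> (- (\<beta> + \<kappa>)) \<alpha> * \<omega> (- \<kappa>) \<beta>"
      by (simp only: om_minus om_add inverse_mult_distrib mult_ac)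
    ultimately have "L = R" using om_nz[of "- (\<beta> + \<kappa>)" \<alpha>] om_nz[of "- \<kappa>" \<beta>]
      by (metis mult_left_cancel mult_eq_0_iff)
    then show "(\<Sum>(c, f, g, h)\<leftarrow>ts. c * (f x * g y * h z)) = 0"
      unfolding sums[of "\<lambda>f g h. f x * g y * h z"] L_def R_def by (rule right_minus_eq[THEN iffD2])
  qed (use that in auto)
  have B1: "g \<in> FD \<Longrightarrow> h \<in> FD \<Longrightarrow> lin H (\<lambda>f. B f g h)" and B2: "h \<in> FD \<Longrightarrow> (\<lambda>f g. B f g h) \<in> HH.Bil"
    and B3: "f \<in> FD \<Longrightarrow> B f \<in> HH.Bil" for f g h
    using B H_Bil_lin(1)[of "\<lambda>f g. B f g h" g] by (auto simp: trilin_def)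
  have FDt': "fst (snd t) \<in> FD" "fst (snd (snd t)) \<in> FD" "snd (snd (snd t)) \<in> FD" if "t \<in> set ts" for t
    using FDt[of "fst t" "fst (snd t)" "fst (snd (snd t))" "snd (snd (snd t))"] that by simp_all
  have "0 = (\<Sum>t\<leftarrow>ts. B (\<lambda>x. fst t * fst (snd t) x) (fst (snd (snd t))) (snd (snd (snd t))))"
  proof (rule tens_zero3[OF _ _ _ _ B, symmetric])
    fix x y z assume "x \<in> carrier U" "y \<in> carrier U" "z \<in> carrier U"
    then show "(\<Sum>t\<leftarrow>ts. fst t * fst (snd t) x * fst (snd (snd t)) y * snd (snd (snd t)) z) = 0"
      using zero[of x y z] unfolding split_def mult.assoc by blast
  qed (use FDt' in \<open>simp_all add: FD_sm\<close>)
  also have "\<dots> = (\<Sum>(c, f, g, h)\<leftarrow>ts. c * B f g h)"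
    unfolding split_def
  proof (rule sum_list_ev)
    fix t assume "t \<in> set ts"
    note t = FDt'[OF this]
    show "B (\<lambda>x. fst t * fst (snd t) x) (fst (snd (snd t))) (snd (snd (snd t))) = fst t * B (fst (snd t)) (fst (snd (snd t))) (snd (snd (snd t)))"
      using B1[OF t(2,3)] t by (simp add: H_lin)
  qed
  finally have "(\<Sum>p\<leftarrow>ps. \<Sum>q\<leftarrow>ly (fst p). B (fst q) (snd q) (snd p)) = (\<Sum>p\<leftarrow>ps. \<Sum>q\<leftarrow>ly (snd p). B (fst p) (fst q) (snd q))"
    unfolding sums by (rule right_minus_eq[THEN iffD1, OF sym])
  moreover have "(\<Sum>p\<leftarrow>ps. comult H (fst p) (\<lambda>u v. B u v (snd p))) = (\<Sum>p\<leftarrow>ps. \<Sum>q\<leftarrow>ly (fst p). B (fst q) (snd q) (snd p))"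
    by (rule sum_list_ev) (use ly(2)[OF FDp(1) B2[OF FDp(2)]] in blast)
  moreover have "(\<Sum>p\<leftarrow>ps. comult H (snd p) (B (fst p))) = (\<Sum>p\<leftarrow>ps. \<Sum>q\<leftarrow>ly (snd p). B (fst p) (fst q) (snd q))"
    by (rule sum_list_ev) (use ly(2)[OF FDp(2) B3[OF FDp(1)]] in blast)
  ultimately show ?thesis by simp
qed

text \<open>Evaluate the co-product at the pairs of the unit with \<open>x\<close>. The unit has
  degree 0, so the pairing contributes no factor.\<close>

lemma Hcounit:
  assumes f: "f \<in> FD" and ps: "set ps \<subseteq> FD \<times> FD"
    and fps: "\<And>B. B \<in> HH.Bil \<Longrightarrow> comult H f B = (\<Sum>p\<leftarrow>ps. B (fst p) (snd p))"
  shows "(\<Sum>p\<leftarrow>ps. (\<lambda>x. fst p \<one> * snd p x)) = f" "(\<Sum>p\<leftarrow>ps. (\<lambda>x. snd p \<one> * fst p x)) = f"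
proof -
  have FDp: "fst p \<in> FD" "snd p \<in> FD" if "p \<in> set ps" for p using ps that by auto
  have 1: "(\<Sum>p\<leftarrow>ps. fst p \<one> * snd p x) = f x" "(\<Sum>p\<leftarrow>ps. snd p \<one> * fst p x) = f x" if x: "x \<in> carrier U" for x
  proof -
    have p1: "pairing \<omega> U g h \<one> x = g \<one> * h x" and p2: "pairing \<omega> U g h x \<one> = h \<one> * g x" if "g \<in> FD" "h \<in> FD" for g h
    proof -
      note l = FD_lin[OF that(1)] FD_lin[OF that(2)]
      show "pairing \<omega> U g h \<one> x = g \<one> * h x"
        by (rule lin_ext[where f = "pairing \<omega> U g h \<one>" and g = "\<lambda>x. g \<one> * h x"])
          (auto intro!: bilin2[OF pairing_Bil] l lin_times x simp: pairing_hom[OF l grade_one])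
      show "pairing \<omega> U g h x \<one> = h \<one> * g x"
        by (rule lin_ext[where f = "\<lambda>x. pairing \<omega> U g h x \<one>" and g = "\<lambda>x. h \<one> * g x"])
          (auto intro!: bilin1[OF pairing_Bil] l lin_times x simp: pairing_hom[OF l _ grade_one])
    qed
    have "f x = (\<Sum>p\<leftarrow>ps. pairing \<omega> U (fst p) (snd p) \<one> x)"
      using Hcom_ev[OF f one_closed x] fps[OF ev_Bil] x by simp
    also have "\<dots> = (\<Sum>p\<leftarrow>ps. fst p \<one> * snd p x)" by (rule sum_list_ev) (simp add: p1 FDp)
    finally show "(\<Sum>p\<leftarrow>ps. fst p \<one> * snd p x) = f x" by simp
    have "f x = (\<Sum>p\<leftarrow>ps. pairing \<omega> U (fst p) (snd p) x \<one>)"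
      using Hcom_ev[OF f x one_closed] fps[OF ev_Bil] x by simp
    also have "\<dots> = (\<Sum>p\<leftarrow>ps. snd p \<one> * fst p x)" by (rule sum_list_ev) (simp add: p2 FDp)
    finally show "(\<Sum>p\<leftarrow>ps. snd p \<one> * fst p x) = f x" by simp
  qed
  have off: "fst p x = 0" "snd p x = 0" if "p \<in> set ps" "x \<notin> carrier U" for p x
    using FDp[OF that(1)] FD_dual dual_off that(2) by blast+
  show "(\<Sum>p\<leftarrow>ps. (\<lambda>x. fst p \<one> * snd p x)) = f"
  proof (rule ext)
    fix x show "(\<Sum>p\<leftarrow>ps. (\<lambda>x. fst p \<one> * snd p x)) x = f x"
    proof (cases "x \<in> carrier U")
      case False
      then have "(\<Sum>p\<leftarrow>ps. fst p \<one> * snd p x) = (\<Sum>p\<leftarrow>ps. 0)" by (intro sum_list_ev) (simp add: off)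
      then show ?thesis using False FD_dual[OF f] dual_off by (simp add: sum_list_fun_apply)
    qed (simp add: sum_list_fun_apply 1)
  qed
  show "(\<Sum>p\<leftarrow>ps. (\<lambda>x. snd p \<one> * fst p x)) = f"
  proof (rule ext)
    fix x show "(\<Sum>p\<leftarrow>ps. (\<lambda>x. snd p \<one> * fst p x)) x = f x"
    proof (cases "x \<in> carrier U")
      case False
      then have "(\<Sum>p\<leftarrow>ps. snd p \<one> * fst p x) = (\<Sum>p\<leftarrow>ps. 0)" by (intro sum_list_ev) (simp add: off)
      then show ?thesis using False FD_dual[OF f] dual_off by (simp add: sum_list_fun_apply)
    qed (simp add: sum_list_fun_apply 1)
  qed
qed

lemma lin_S: "lin U f \<Longrightarrow> lin U (\<lambda>x. f (antipode U x))"
  by (auto simp: lin_def S_add S_sm)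

text \<open>The antipode of \<open>U\<close> reverses products, so a decomposition of
  \<open>f\<close> gives one of its composite with the antipode, with factors exchanged. The factor
  \<open>\<omega> \<alpha> \<beta>\<close> is constant on each term, because the degrees of
  \<open>x\<close> and \<open>y\<close> are forced there.\<close>

lemma HS_Fh: "f \<in> Fh \<phi> \<Longrightarrow> antipode H f \<in> Fh \<phi>"
proof -
  assume f: "f \<in> Fh \<phi>"
  note fl = Fh_lin[OF f]
  obtain ps where ps: "factors \<phi> f ps" using factors_ex[OF f] by blast
  note d = factorsD[OF ps]
  define b where "b = (\<lambda>p :: 'g \<times> ('a \<Rightarrow> complex) \<times> ('a \<Rightarrow> complex). \<lambda>x. \<omega> (\<phi> - fst p) (fst p) * snd (snd p) (antipode U x))"
  define a where "a = (\<lambda>p :: 'g \<times> ('a \<Rightarrow> complex) \<times> ('a \<Rightarrow> complex). \<lambda>x. fst (snd p) (antipode U x))"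
  have bl: "(\<lambda>x y. b p x * a p y) \<in> Bil" if "p \<in> set ps" for p
    unfolding a_def b_def by (intro bilin_prod lin_times lin_S Fh_lin[OF d(1)[OF that]] Fh_lin[OF d(2)[OF that]])
  have "f (antipode U (x \<otimes> y)) = (\<Sum>p\<leftarrow>ps. b p x * a p y)" if "x \<in> carrier U" "y \<in> carrier U" for x y
  proof (rule Bil_ext[where B = "\<lambda>x y. f (antipode U (x \<otimes> y))" and C = "\<lambda>x y. \<Sum>p\<leftarrow>ps. b p x * a p y"])
    show "(\<lambda>x y. f (antipode U (x \<otimes> y))) \<in> Bil"
      by (intro bilinI lin_lmult[OF lin_S[OF fl]] lin_rmult[OF lin_S[OF fl]])
    show "(\<lambda>x y. \<Sum>p\<leftarrow>ps. b p x * a p y) \<in> Bil"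
      using TT_sum_list[OF TT_zero, of ps "\<lambda>p x y. b p x * a p y"] bl by blast
    fix \<alpha> \<beta> x y assume x: "x \<in> grade U \<alpha>" and y: "y \<in> grade U \<beta>"
    have c: "x \<in> carrier U" "y \<in> carrier U" using x y by auto
    have "f (antipode U (x \<otimes> y)) = \<omega> \<alpha> \<beta> * (\<Sum>p\<leftarrow>ps. fst (snd p) (antipode U y) * snd (snd p) (antipode U x))"
      using c by (simp add: S_mult[OF x y] lin_smult[OF fl] d(3))
    also have "\<dots> = (\<Sum>p\<leftarrow>ps. b p x * a p y)"
      unfolding sum_list_times[symmetric]
    proof (rule sum_list_ev)
      fix p assume p: "p \<in> set ps"
      show "\<omega> \<alpha> \<beta> * (fst (snd p) (antipode U y) * snd (snd p) (antipode U x)) = b p x * a p y"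
        using hd_vanish[OF Fh_hd[OF d(1)[OF p]] S_grade[OF y]] hd_vanish[OF Fh_hd[OF d(2)[OF p]] S_grade[OF x]]
        by (cases "\<beta> = - fst p"; cases "\<alpha> = - (\<phi> - fst p)") (auto simp: a_def b_def om_minus om_diff)
    qed
    finally show "f (antipode U (x \<otimes> y)) = (\<Sum>p\<leftarrow>ps. b p x * a p y)" .
  qed (use that in auto)
  then have "frank (rs (\<lambda>x. f (antipode U x)))"
    by (intro frankI[where ps = ps and a = b and b = a]) simp
  moreover have "rs (\<lambda>x. f (antipode U x)) \<in> hg \<phi>"
    by (rule rs_hd[OF lin_S[OF fl]]) (use S_grade hd_vanish[OF Fh_hd[OF f]] in blast)
  ultimately show ?thesis by (simp add: Fh_def)
qed

lemma HS_add: "antipode H (f + g) = antipode H f + antipode H g"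
  and HS_sm: "antipode H (\<lambda>x. c * f x) = (\<lambda>x. c * antipode H f x)"
  and HS_zero: "antipode H 0 = 0"
  by (auto simp: rs_def fun_app)

lemma HS_FD: "f \<in> FD \<Longrightarrow> antipode H f \<in> FD"
proof (induction rule: FD_induct)
  case (add f g)
  then show ?case using HS_add[of f g] FD_add by (metis)
qed (use HS_Fh Fh_FD in blast)

lemma HS_one: "antipode H \<one>\<^bsub>H\<^esub> = \<one>\<^bsub>H\<^esub>"
  by (auto simp: rs_def H_one S_cou)

text \<open>Dual to \<open>S_com\<close>. The factor \<open>\<omega> \<psi> \<phi>\<close> of that
  law is absorbed by the product of the two antipodes, which has the degrees in the opposite
  order.\<close>

lemma HS_mult:
  assumes f: "f \<in> Fh \<phi>" and g: "g \<in> Fh \<psi>"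
  shows "antipode H (f \<otimes>\<^bsub>H\<^esub> g) = (\<lambda>x. \<omega> \<phi> \<psi> * (antipode H g \<otimes>\<^bsub>H\<^esub> antipode H f) x)"
proof (rule ext)
  fix x
  note Sf = HS_Fh[OF f] and Sg = HS_Fh[OF g]
  show "antipode H (f \<otimes>\<^bsub>H\<^esub> g) x = \<omega> \<phi> \<psi> * (antipode H g \<otimes>\<^bsub>H\<^esub> antipode H f) x"
  proof (cases "x \<in> carrier U")
    case True
    have "antipode H (f \<otimes>\<^bsub>H\<^esub> g) x = \<omega> \<phi> \<psi> * conv f g (antipode U x)"
      using hm_hom[OF Fh_hd[OF f] Fh_hd[OF g]] True by simp
    also have "conv f g (antipode U x) = \<omega> \<psi> \<phi> * comult U x (\<lambda>u v. g (antipode U u) * f (antipode U v))"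
      unfolding conv_def by (rule S_com[OF True Fh_hd[OF f] Fh_hd[OF g]])
    also have "comult U x (\<lambda>u v. g (antipode U u) * f (antipode U v)) = conv (antipode H g) (antipode H f) x"
      unfolding conv_def
      by (rule TT_cong[OF com_TT[OF True] bilin_prod[OF lin_S[OF Fh_lin[OF g]] lin_S[OF Fh_lin[OF f]]] bilin_prod[OF Fh_lin[OF Sg] Fh_lin[OF Sf]]])
        (simp add: grade_carrier)
    also have "\<omega> \<psi> \<phi> * conv (antipode H g) (antipode H f) x = (antipode H g \<otimes>\<^bsub>H\<^esub> antipode H f) x"
      using hm_hom[OF Fh_hd[OF Sg] Fh_hd[OF Sf]] True by simp
    finally show ?thesis .
  qed (simp add: rs_def H_mult)
qed

text \<open>The antipode of \<open>U\<close> preserves degrees, so composing one functional with it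
  only replaces the corresponding argument of the pairing. The sum over \<open>ps\<close> therefore
  is \<open>f\<close> applied to the antipode expression in \<open>U\<close>, and the antipode law
  of \<open>U\<close> finishes.\<close>

lemma Hantipode:
  assumes f: "f \<in> FD" and ps: "set ps \<subseteq> FD \<times> FD"
    and fps: "\<And>B. B \<in> HH.Bil \<Longrightarrow> comult H f B = (\<Sum>p\<leftarrow>ps. B (fst p) (snd p))"
  shows "(\<Sum>p\<leftarrow>ps. antipode H (fst p) \<otimes>\<^bsub>H\<^esub> snd p) = (\<lambda>x. f \<one> * \<one>\<^bsub>H\<^esub> x)"
    "(\<Sum>p\<leftarrow>ps. fst p \<otimes>\<^bsub>H\<^esub> antipode H (snd p)) = (\<lambda>x. f \<one> * \<one>\<^bsub>H\<^esub> x)"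
proof -
  note fl = FD_lin[OF f]
  have FDp: "fst p \<in> FD" "snd p \<in> FD" if "p \<in> set ps" for p using ps that by auto
  have lp: "lin U (fst p)" "lin U (snd p)" "lin U (antipode H (fst p))" "lin U (antipode H (snd p))" if "p \<in> set ps" for p
    using FDp[OF that] HS_FD FD_lin by blast+
  have b1: "pairing \<omega> U (antipode H (fst p)) (snd p) \<in> Bil" "pairing \<omega> U (fst p) (antipode H (snd p)) \<in> Bil" if "p \<in> set ps" for p
    by (intro pairing_Bil lp that)+
  have fB: "(\<lambda>v w. f (antipode U v \<otimes> w)) \<in> Bil" "(\<lambda>v w. f (v \<otimes> antipode U w)) \<in> Bil"
    by (intro bilinI lin_S[OF lin_rmult[OF fl]] lin_lmult[OF fl] S_closed lin_S[OF lin_lmult[OF fl]] lin_rmult[OF fl]; assumption?)+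
  show "(\<Sum>p\<leftarrow>ps. antipode H (fst p) \<otimes>\<^bsub>H\<^esub> snd p) = (\<lambda>x. f \<one> * \<one>\<^bsub>H\<^esub> x)"
  proof (rule ext)
    fix x show "(\<Sum>p\<leftarrow>ps. antipode H (fst p) \<otimes>\<^bsub>H\<^esub> snd p) x = f \<one> * \<one>\<^bsub>H\<^esub> x"
    proof (cases "x \<in> carrier U")
      case x: True
      have "(\<Sum>p\<leftarrow>ps. antipode H (fst p) \<otimes>\<^bsub>H\<^esub> snd p) x = (\<Sum>p\<leftarrow>ps. comult U x (pairing \<omega> U (antipode H (fst p)) (snd p)))"
        unfolding sum_list_fun_apply H_mult using x by simp
      also have "\<dots> = comult U x (\<lambda>u v. \<Sum>p\<leftarrow>ps. pairing \<omega> U (antipode H (fst p)) (snd p) u v)"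
        using TT_sum_list[OF com_TT[OF x], of ps "\<lambda>p. pairing \<omega> U (antipode H (fst p)) (snd p)"] b1(1) by simp
      also have "\<dots> = comult U x (\<lambda>v w. f (antipode U v \<otimes> w))"
      proof (rule TT_cong[OF com_TT[OF x] _ fB(1)])
        show "(\<lambda>u v. \<Sum>p\<leftarrow>ps. pairing \<omega> U (antipode H (fst p)) (snd p) u v) \<in> Bil"
          using TT_sum_list[OF com_TT[OF x], of ps "\<lambda>p. pairing \<omega> U (antipode H (fst p)) (snd p)"] b1(1) by blast
        fix \<alpha> \<beta> u v assume u: "u \<in> grade U \<alpha>" and v: "v \<in> grade U \<beta>"
        have "(\<Sum>p\<leftarrow>ps. pairing \<omega> U (antipode H (fst p)) (snd p) u v) = (\<Sum>p\<leftarrow>ps. pairing \<omega> U (fst p) (snd p) (antipode U u) v)"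
          by (rule sum_list_ev) (use u in \<open>simp only: pairing_hom[OF lp(3,2) u v] pairing_hom[OF lp(1,2) S_grade[OF u] v]; simp add: grade_carrier\<close>)
        then show "(\<Sum>p\<leftarrow>ps. pairing \<omega> U (antipode H (fst p)) (snd p) u v) = f (antipode U u \<otimes> v)"
          using Hcom_ev[OF f, of "antipode U u" v] fps[OF ev_Bil] u v by (simp add: grade_carrier)
      qed
      also have "\<dots> = counit U x * f \<one>" by (rule S_l[OF x fl])
      finally show ?thesis using x by (simp add: H_one)
    qed (simp add: sum_list_fun_apply H_mult H_one rs_def sum_list_0)
  qed
  show "(\<Sum>p\<leftarrow>ps. fst p \<otimes>\<^bsub>H\<^esub> antipode H (snd p)) = (\<lambda>x. f \<one> * \<one>\<^bsub>H\<^esub> x)"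
  proof (rule ext)
    fix x show "(\<Sum>p\<leftarrow>ps. fst p \<otimes>\<^bsub>H\<^esub> antipode H (snd p)) x = f \<one> * \<one>\<^bsub>H\<^esub> x"
    proof (cases "x \<in> carrier U")
      case x: True
      have "(\<Sum>p\<leftarrow>ps. fst p \<otimes>\<^bsub>H\<^esub> antipode H (snd p)) x = (\<Sum>p\<leftarrow>ps. comult U x (pairing \<omega> U (fst p) (antipode H (snd p))))"
        unfolding sum_list_fun_apply H_mult using x by simp
      also have "\<dots> = comult U x (\<lambda>u v. \<Sum>p\<leftarrow>ps. pairing \<omega> U (fst p) (antipode H (snd p)) u v)"
        using TT_sum_list[OF com_TT[OF x], of ps "\<lambda>p. pairing \<omega> U (fst p) (antipode H (snd p))"] b1(2) by simp
      also have "\<dots> = comult U x (\<lambda>v w. f (v \<otimes> antipode U w))"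
      proof (rule TT_cong[OF com_TT[OF x] _ fB(2)])
        show "(\<lambda>u v. \<Sum>p\<leftarrow>ps. pairing \<omega> U (fst p) (antipode H (snd p)) u v) \<in> Bil"
          using TT_sum_list[OF com_TT[OF x], of ps "\<lambda>p. pairing \<omega> U (fst p) (antipode H (snd p))"] b1(2) by blast
        fix \<alpha> \<beta> u v assume u: "u \<in> grade U \<alpha>" and v: "v \<in> grade U \<beta>"
        have "(\<Sum>p\<leftarrow>ps. pairing \<omega> U (fst p) (antipode H (snd p)) u v) = (\<Sum>p\<leftarrow>ps. pairing \<omega> U (fst p) (snd p) u (antipode U v))"
          by (rule sum_list_ev) (use v in \<open>simp only: pairing_hom[OF lp(1,4) u v] pairing_hom[OF lp(1,2) u S_grade[OF v]]; simp add: grade_carrier\<close>)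
        then show "(\<Sum>p\<leftarrow>ps. pairing \<omega> U (fst p) (antipode H (snd p)) u v) = f (u \<otimes> antipode U v)"
          using Hcom_ev[OF f, of u "antipode U v"] fps[OF ev_Bil] u v by (simp add: grade_carrier)
      qed
      also have "\<dots> = counit U x * f \<one>" by (rule S_r[OF x fl])
      finally show ?thesis using x by (simp add: H_one)
    qed (simp add: sum_list_fun_apply H_mult H_one rs_def sum_list_0)
  qed
qed

subsection \<open>Subalgebras generated by homogeneous elements\<close>

text \<open>Used mainly for sets of homogeneous functionals closed under scalars, where it is the
  linear span. It allows laws that are available only for homogeneous elements to be used in
  arguments about subalgebras.\<close>

definition hs :: "('a \<Rightarrow> complex) set \<Rightarrow> ('a \<Rightarrow> complex) set" where
  "hs Q = {sum_list fs |fs. set fs \<subseteq> Q}"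

lemma hs_zero: "0 \<in> hs Q"
  unfolding hs_def by (rule CollectI, rule exI[of _ "[]"]) simp

lemma hs_base: "f \<in> Q \<Longrightarrow> f \<in> hs Q"
  unfolding hs_def by (rule CollectI, rule exI[of _ "[f]"]) simp

lemma hs_induct:
  "f \<in> hs Q \<Longrightarrow> P 0 \<Longrightarrow> (\<And>f g. f \<in> Q \<Longrightarrow> g \<in> hs Q \<Longrightarrow> P g \<Longrightarrow> P (f + g)) \<Longrightarrow> P f"
  unfolding hs_def by (rule hom_sum_induct[where P = P and R = Q and f = f])

lemma hs_add: "f \<in> hs Q \<Longrightarrow> g \<in> hs Q \<Longrightarrow> f + g \<in> hs Q"
proof -
  assume "f \<in> hs Q" "g \<in> hs Q"
  then obtain fs gs where "f = sum_list fs" "g = sum_list gs" "set fs \<subseteq> Q" "set gs \<subseteq> Q" by (auto simp: hs_def)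
  then show ?thesis unfolding hs_def by (intro CollectI exI[of _ "fs @ gs"] conjI) simp_all
qed

lemma hs_map:
  assumes "f \<in> hs Q" "T 0 = 0" "\<And>f g. f \<in> Q \<Longrightarrow> g \<in> hs Q \<Longrightarrow> T (f + g) = T f + T g" "\<And>f. f \<in> Q \<Longrightarrow> T f \<in> hs R"
  shows "T f \<in> hs R"
  using assms(1)
proof (rule hs_induct)
  show "T 0 \<in> hs R" unfolding assms(2) by (rule hs_zero)
  show "T (f + g) \<in> hs R" if "f \<in> Q" "g \<in> hs Q" "T g \<in> hs R" for f g
    unfolding assms(3)[OF that(1,2)] by (rule hs_add[OF assms(4)[OF that(1)] that(3)])
qed

lemma hs_sm: "f \<in> hs Q \<Longrightarrow> (\<And>f. f \<in> Q \<Longrightarrow> (\<lambda>x. c * f x) \<in> Q) \<Longrightarrow> (\<lambda>x. c * f x) \<in> hs Q"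
  by (erule hs_map[where T = "\<lambda>f x. c * f x"]) (auto simp: fun_app algebra_simps intro!: hs_base)

lemma hs_FD: "Q \<subseteq> FD \<Longrightarrow> f \<in> hs Q \<Longrightarrow> f \<in> FD"
  by (rule hs_induct[where P = "\<lambda>f. f \<in> FD"]) (auto intro: FD_zero FD_add)

lemma hs_hm:
  assumes f: "f \<in> hs Q" and g: "g \<in> hs Q'" and Q: "Q \<subseteq> FD" "Q' \<subseteq> FD"
    and hm: "\<And>f g. f \<in> Q \<Longrightarrow> g \<in> Q' \<Longrightarrow> f \<otimes>\<^bsub>H\<^esub> g \<in> R"
  shows "f \<otimes>\<^bsub>H\<^esub> g \<in> hs R"
  using f
proof (rule hs_map[where T = "\<lambda>f. f \<otimes>\<^bsub>H\<^esub> g"])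
  have gF: "g \<in> FD" by (rule hs_FD[OF Q(2) g])
  show "0 \<otimes>\<^bsub>H\<^esub> g = 0" using HH.l_null[of g] gF by simp
  show "(f + h) \<otimes>\<^bsub>H\<^esub> g = f \<otimes>\<^bsub>H\<^esub> g + h \<otimes>\<^bsub>H\<^esub> g" if "f \<in> Q" "h \<in> hs Q" for f h
    using that Q hs_FD[OF Q(1) that(2)] gF by (auto intro!: hm_add1 FD_dual)
  fix f assume f: "f \<in> Q"
  show "f \<otimes>\<^bsub>H\<^esub> g \<in> hs R" using g
  proof (rule hs_map[where T = "\<lambda>g. f \<otimes>\<^bsub>H\<^esub> g"])
    show "f \<otimes>\<^bsub>H\<^esub> 0 = 0" using HH.r_null[of f] f Q by auto
    show "f \<otimes>\<^bsub>H\<^esub> (g + h) = f \<otimes>\<^bsub>H\<^esub> g + f \<otimes>\<^bsub>H\<^esub> h" if "g \<in> Q'" "h \<in> hs Q'" for g h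
      using that Q f hs_FD[OF Q(2) that(2)] by (auto intro!: hm_add2 FD_dual)
  qed (use f hm hs_base in blast)
qed

text \<open>Pure tensors of sums expand, first in the left and then in the right factor.\<close>

lemma tensor_hs:
  assumes A: "A \<subseteq> hs Q" and Q: "Q \<subseteq> FD" and z: "z \<in> tensor_sub H H A A"
  shows "z \<in> tensor_sums H H (Q \<times> Q)"
proof -
  have 1: "HH.pt f g \<in> tensor_sums H H (Q \<times> Q)" if "f \<in> hs Q" "g \<in> Q" for f g
    using that(1)
  proof (rule hs_induct)
    show "HH.pt 0 g \<in> tensor_sums H H (Q \<times> Q)"
      using HH.pt_add1[of 0 0 g] that Q FD_zero HH.ts_zero by auto
    fix f h assume fh: "f \<in> Q" "h \<in> hs Q" "HH.pt h g \<in> tensor_sums H H (Q \<times> Q)"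
    have "HH.pt (f + h) g = HH.pt f g + HH.pt h g"
      using HH.pt_add1[of f h g] fh that Q hs_FD[OF Q fh(2)] by auto
    then show "HH.pt (f + h) g \<in> tensor_sums H H (Q \<times> Q)"
      using fh that by (auto intro!: HH.ts_add HH.ts_pt)
  qed
  have 2: "HH.pt f g \<in> tensor_sums H H (Q \<times> Q)" if f: "f \<in> hs Q" and g: "g \<in> hs Q" for f g
    using g
  proof (rule hs_induct)
    have fF: "f \<in> FD" by (rule hs_FD[OF Q f])
    show "HH.pt f 0 \<in> tensor_sums H H (Q \<times> Q)"
      using HH.pt_add2[of f 0 0] fF FD_zero HH.ts_zero by auto
    fix g h assume gh: "g \<in> Q" "h \<in> hs Q" "HH.pt f h \<in> tensor_sums H H (Q \<times> Q)"
    have "HH.pt f (g + h) = HH.pt f g + HH.pt f h"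
      using HH.pt_add2[of f h g] gh Q hs_FD[OF Q gh(2)] fF by auto
    then show "HH.pt f (g + h) \<in> tensor_sums H H (Q \<times> Q)"
      using gh 1[OF f] by (auto intro!: HH.ts_add)
  qed
  show ?thesis using z unfolding tensor_sub_def
    by (rule HH.ts_sub) (use 2 A in blast)
qed

text \<open>Homogeneity makes the product of two pure tensors a pure tensor again. The scalar in the
  hypothesis on \<open>R\<close> absorbs the exchange factor in the left leg; in the right leg it is
  taken to be 1.\<close>

lemma tm_sub:
  assumes P: "P \<subseteq> (\<Union>\<phi>. Fh \<phi>)" and Q: "Q \<subseteq> (\<Union>\<phi>. Fh \<phi>)"
    and PQ: "\<And>p q c. p \<in> P \<Longrightarrow> q \<in> Q \<Longrightarrow> (\<lambda>x. c * (p \<otimes>\<^bsub>H\<^esub> q) x) \<in> R"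
    and z: "z \<in> tensor_sums H H (P \<times> P)" and w: "w \<in> tensor_sums H H (Q \<times> Q)"
  shows "HH.tm z w \<in> tensor_sub H H R R"
  using z unfolding tensor_sub_def
proof (induction rule: HH.ts_induct)
  case zero
  then show ?case by (simp add: HH.tm_zero1 HH.ts_zero)
next
  case (pt a b z)
  have QF: "Q \<times> Q \<subseteq> carrier H \<times> carrier H" using Q Fh_FD by auto
  from pt(1) P obtain \<alpha> \<beta> where a: "a \<in> P" "b \<in> P" "a \<in> Fh \<alpha>" "b \<in> Fh \<beta>" by blast
  from w have "HH.tm (HH.pt a b) w \<in> tensor_sums H H (R \<times> R)"
  proof (induction rule: HH.ts_induct)
    case zero
    then show ?case using a by (simp add: HH.tm_zero2 HH.ts_zero Fh_FD)
  next
    case (pt c d w)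
    from pt(1) Q obtain \<gamma> \<delta> where c: "c \<in> Q" "d \<in> Q" "c \<in> Fh \<gamma>" "d \<in> Fh \<delta>" by blast
    have "HH.pt c d \<in> HH.TT" using c by (simp add: Fh_FD)
    moreover have "w \<in> HH.TT" using HH.ts_mono[OF QF pt(2)] by (simp only: tensor_sub_def)
    ultimately have "HH.tm (HH.pt a b) (HH.pt c d + w) = HH.tm (HH.pt a b) (HH.pt c d) + HH.tm (HH.pt a b) w"
      using a by (intro HH.tm_add2) (simp_all add: Fh_FD)
    also have "HH.tm (HH.pt a b) (HH.pt c d) = HH.pt (\<lambda>x. \<omega> \<beta> \<gamma> * (a \<otimes>\<^bsub>H\<^esub> c) x) (b \<otimes>\<^bsub>H\<^esub> d)"
      using a c by (subst HH.tm_pt[where \<alpha> = \<gamma> and \<beta> = \<beta>]) (simp_all add: Fh_FD)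
    finally show ?case
      using pt(3) PQ[OF a(1) c(1)] PQ[OF a(2) c(2), of 1] by (auto intro!: HH.ts_add HH.ts_pt)
  qed
  then show ?case using pt(3) by (simp add: HH.tm_add1 HH.ts_add)
qed

lemma ts_smult:
  assumes "z \<in> tensor_sub H H A A" "\<And>f. f \<in> A \<Longrightarrow> (\<lambda>x. c * f x) \<in> A" "A \<subseteq> FD"
  shows "(\<lambda>B. c * z B) \<in> tensor_sub H H A A"
  using assms(1) unfolding tensor_sub_def
proof (induction rule: HH.ts_induct)
  case zero
  then show ?case using HH.ts_zero by (simp add: fun_app zero_fun_def)
next
  case (pt f g z)
  have fg: "f \<in> FD" "g \<in> FD" using pt(1) assms(3) by auto
  have "(\<lambda>B. c * (HH.pt f g + z) B) = HH.pt (\<lambda>x. c * f x) g + (\<lambda>B. c * z B)"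
    using HH.pt_sm1[of f g c] fg by (simp add: fun_eq_iff fun_app algebra_simps)
  then show ?case using pt assms(2) by (auto intro!: HH.ts_add HH.ts_pt)
qed

text \<open>All identities hold in the whole finite dual and are inherited. What has to be known
  about \<open>A\<close> is closure under the operations, being spanned by homogeneous elements, and
  that the comultiplication stays in \<open>A\<close> tensor \<open>A\<close>.\<close>

lemma sub_bialg:
  assumes A: "A \<subseteq> FD" "0 \<in> A" "\<And>f g. f \<in> A \<Longrightarrow> g \<in> A \<Longrightarrow> f + g \<in> A" "\<And>c f. f \<in> A \<Longrightarrow> (\<lambda>x. c * f x) \<in> A"
    "\<one>\<^bsub>H\<^esub> \<in> A" "\<And>f g. f \<in> A \<Longrightarrow> g \<in> A \<Longrightarrow> f \<otimes>\<^bsub>H\<^esub> g \<in> A"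
    and hom: "\<And>f. f \<in> A \<Longrightarrow> f \<in> hs (A \<inter> (\<Union>\<phi>. Fh \<phi>))"
    and com: "\<And>f. f \<in> A \<Longrightarrow> comult H f \<in> tensor_sub H H A A"
  shows "bialgebra_on \<omega> H A"
proof -
  have R [simp]: "carrier (sub_graded H A) = A" "mult (sub_graded H A) = mult H" "one (sub_graded H A) = one H"
    "zero (sub_graded H A) = 0" "add (sub_graded H A) = (+)" "smult (sub_graded H A) = (\<lambda>c f x. c * f x)"
    by (simp_all add: sub_graded_def)
  have T [simp]: "carrier (tensor_alg \<omega> H H) = HH.TT" "mult (tensor_alg \<omega> H H) = HH.tm" "one (tensor_alg \<omega> H H) = HH.pt \<one>\<^bsub>H\<^esub> \<one>\<^bsub>H\<^esub>"
    "add (tensor_alg \<omega> H H) = (+)" "smult (tensor_alg \<omega> H H) = (\<lambda>c z B. c * z B)"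
    "grade (tensor_alg \<omega> H H) \<gamma> = tensor_sums H H {(x, y). \<exists>\<alpha>. x \<in> Fh \<alpha> \<and> y \<in> Fh (\<gamma> - \<alpha>)}" for \<gamma>
    by (simp_all add: tensor_alg_def)
  have AF: "f \<in> A \<Longrightarrow> f \<in> FD" for f using A(1) by auto
  have g: "graded_algebra (sub_graded H A)" by (rule sub_gralg) (use A hom[unfolded hs_def] in auto)
  have h1: "alg_hom (sub_graded H A) (tensor_alg \<omega> H H) (comult H)"
    unfolding alg_hom_def ring_hom_def by (auto simp: AF Hcom_mult Hcom_add Hcom_one Hcom_sm)
  have h2: "alg_hom (sub_graded H A) complex_alg (counit H)"
  proof -
    have "(f \<otimes>\<^bsub>H\<^esub> g) \<one> = f \<one> * g \<one>" if "f \<in> A" "g \<in> A" for f g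
      using pairing_hom[OF FD_lin[OF AF[OF that(1)]] FD_lin[OF AF[OF that(2)]] grade_one grade_one]
        pairing_Bil[OF FD_lin[OF AF[OF that(1)]] FD_lin[OF AF[OF that(2)]]]
      by (simp add: H_mult com_one)
    then show ?thesis unfolding alg_hom_def ring_hom_def
      by (auto simp: complex_alg_def fun_app H_one)
  qed
  have h3: "(\<forall>B. trilin H B \<longrightarrow> sum_list (map (\<lambda>(y, z). comult H y (\<lambda>u v. B u v z)) ps) = sum_list (map (\<lambda>(y, z). comult H z (\<lambda>u v. B y u v)) ps)) \<and>
        list_msum H (map (\<lambda>(y, z). counit H y \<odot>\<^bsub>H\<^esub> z) ps) = f \<and>
        list_msum H (map (\<lambda>(y, z). counit H z \<odot>\<^bsub>H\<^esub> y) ps) = f" if f: "f \<in> A" and ps: "expresses H A f ps" for f ps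
    using Hcoassoc[OF AF[OF f] _ expressesD[OF ps A(1)]] Hcounit[OF AF[OF f] expressesD[OF ps A(1)]]
    by (simp add: list_msum_eq split_def)
  show ?thesis unfolding bialgebra_on_def
    using g h1 h2 h3 com Hcom_grade hd_vanish[OF Fh_hd grade_one] by (auto simp del: H_simps(5))
      (auto)
qed

lemma sub_hopf:
  assumes "bialgebra_on \<omega> H A" "A \<subseteq> FD" "\<And>f. f \<in> A \<Longrightarrow> antipode H f \<in> A"
  shows "hopf_on \<omega> H A"
proof -
  have AF: "f \<in> A \<Longrightarrow> f \<in> FD" for f using assms(2) by auto
  have "list_msum H (map (\<lambda>(y, z). antipode H y \<otimes>\<^bsub>H\<^esub> z) ps) = counit H f \<odot>\<^bsub>H\<^esub> \<one>\<^bsub>H\<^esub> \<and>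
        list_msum H (map (\<lambda>(y, z). y \<otimes>\<^bsub>H\<^esub> antipode H z) ps) = counit H f \<odot>\<^bsub>H\<^esub> \<one>\<^bsub>H\<^esub>" if f: "f \<in> A" and ps: "expresses H A f ps" for f ps
    using Hantipode[OF AF[OF f] expressesD[OF ps assms(2)]] by (simp add: list_msum_eq split_def)
  then show ?thesis unfolding hopf_on_def
    using assms HS_add HS_sm HS_mult HS_Fh by (auto simp del: H_simps(6))
qed

text \<open>Sums of elements of a set closed under scalars and products are closed under all
  operations of the algebra. Claims about a generated subalgebra are thereby reduced to a suitable
  set \<open>Q\<close>, usually of homogeneous elements.\<close>

lemma gen_hs:
  assumes Q: "Q \<subseteq> FD" "Z \<subseteq> Q" "\<one>\<^bsub>H\<^esub> \<in> Q" "\<And>c f. f \<in> Q \<Longrightarrow> (\<lambda>x. c * f x) \<in> Q" "\<And>f g. f \<in> Q \<Longrightarrow> g \<in> Q \<Longrightarrow> f \<otimes>\<^bsub>H\<^esub> g \<in> Q"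
    and f: "f \<in> gen_subalgebra H Z"
  shows "f \<in> hs Q"
  using f
proof (induction rule: gen_subalgebra.induct)
  case (smult f c)
  then show ?case using hs_sm Q(4) by simp
next
  case (mult f g)
  then show ?case using hs_hm[OF _ _ Q(1) Q(1)] Q(5) by blast
qed (use Q hs_zero hs_base hs_add in auto)

lemma gen_FD: "Z \<subseteq> FD \<Longrightarrow> f \<in> gen_subalgebra H Z \<Longrightarrow> f \<in> FD"
  using hs_FD[OF order_refl] gen_hs[of FD Z f] Fh_FD[OF one_Fh] FD_sm hm_FD by blast

lemma gen_closed: "0 \<in> gen_subalgebra H Z" "f \<in> gen_subalgebra H Z \<Longrightarrow> g \<in> gen_subalgebra H Z \<Longrightarrow> f + g \<in> gen_subalgebra H Z"
   "f \<in> gen_subalgebra H Z \<Longrightarrow> (\<lambda>x. c * f x) \<in> gen_subalgebra H Z"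
  using gen_subalgebra.zero[of H Z] gen_subalgebra.add[of f H Z g] gen_subalgebra.smult[of f H Z c] by simp_all

lemma gen_hom:
  assumes "Z \<subseteq> (\<Union>\<phi>. Fh \<phi>)" "f \<in> gen_subalgebra H Z"
  shows "f \<in> hs (gen_subalgebra H Z \<inter> (\<Union>\<phi>. Fh \<phi>))"
proof (rule gen_hs[OF _ _ _ _ _ assms(2)])
  show "gen_subalgebra H Z \<inter> (\<Union>\<phi>. Fh \<phi>) \<subseteq> FD" using Fh_FD by auto
  show "Z \<subseteq> gen_subalgebra H Z \<inter> (\<Union>\<phi>. Fh \<phi>)" using assms(1) by (auto intro: gen_subalgebra.base)
  show "\<one>\<^bsub>H\<^esub> \<in> gen_subalgebra H Z \<inter> (\<Union>\<phi>. Fh \<phi>)" using one_Fh gen_subalgebra.one by blast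
  show "(\<lambda>x. c * f x) \<in> gen_subalgebra H Z \<inter> (\<Union>\<phi>. Fh \<phi>)" if f: "f \<in> gen_subalgebra H Z \<inter> (\<Union>\<phi>. Fh \<phi>)" for c f
  proof -
    obtain \<phi> where "f \<in> Fh \<phi>" using f by blast
    then show ?thesis using f by (intro IntI gen_closed(3) UN_I[of \<phi>] Fh_sm) auto
  qed
  show "f \<otimes>\<^bsub>H\<^esub> g \<in> gen_subalgebra H Z \<inter> (\<Union>\<phi>. Fh \<phi>)"
    if "f \<in> gen_subalgebra H Z \<inter> (\<Union>\<phi>. Fh \<phi>)" "g \<in> gen_subalgebra H Z \<inter> (\<Union>\<phi>. Fh \<phi>)" for f g
    using that hm_Fh gen_subalgebra.mult[of f H Z g] by blast
qed

text \<open>The comultiplication is an algebra homomorphism, so membership in \<open>?A\<close>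
  tensor \<open>?A\<close> propagates from the generators. In the case of products both tensors are
  first rewritten with homogeneous legs, where \<open>tm_sub\<close> computes their product.\<close>

lemma gen_bi_subalgebra:
  assumes Z: "Z \<subseteq> (\<Union>\<phi>. Fh \<phi>)" and com: "\<And>f. f \<in> Z \<Longrightarrow> comult H f \<in> tensor_sub H H Z Z"
  shows "bi_subalgebra \<omega> H (gen_subalgebra H Z)"
proof -
  let ?A = "gen_subalgebra H Z"
  have ZF: "Z \<subseteq> FD" using Z Fh_FD by auto
  have AF: "?A \<subseteq> FD" using gen_FD[OF ZF] by auto
  have one: "\<one>\<^bsub>H\<^esub> \<in> ?A" by (rule gen_subalgebra.one)
  have "comult H f \<in> tensor_sub H H ?A ?A" if "f \<in> ?A" for f
    using that
  proof (induction rule: gen_subalgebra.induct)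
    case zero
    then show ?case using HH.ts_zero by (simp add: Hcom_zero tensor_sub_def)
  next
    case one
    then show ?case unfolding Hcom_one tensor_sub_def by (rule HH.ts_pt) (simp add: gen_subalgebra.one)
  next
    case (base f)
    show ?case using com[OF base] unfolding tensor_sub_def
      by (rule HH.ts_mono[rotated]) (auto intro: gen_subalgebra.base)
  next
    case (add f g)
    then show ?case using AF by (simp add: Hcom_add subsetD[OF AF] tensor_sub_def HH.ts_add)
  next
    case (smult f c)
    have "(\<lambda>B. c * comult H f B) \<in> tensor_sub H H ?A ?A"
      by (rule ts_smult[OF smult.IH gen_closed(3) AF])
    then show ?case by (simp add: Hcom_sm subsetD[OF AF smult.hyps])
  next
    case (mult f g)
    have Q: "?A \<inter> (\<Union>\<phi>. Fh \<phi>) \<subseteq> FD" using AF by auto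
    have hom: "?A \<subseteq> hs (?A \<inter> (\<Union>\<phi>. Fh \<phi>))" using gen_hom[OF Z] by blast
    show ?case
      unfolding Hcom_mult[OF subsetD[OF AF mult.hyps(1)] subsetD[OF AF mult.hyps(2)]]
    proof (rule tm_sub[OF _ _ _ tensor_hs[OF hom Q mult.IH(1)] tensor_hs[OF hom Q mult.IH(2)]])
      fix p q c assume "p \<in> ?A \<inter> (\<Union>\<phi>. Fh \<phi>)" "q \<in> ?A \<inter> (\<Union>\<phi>. Fh \<phi>)"
      then show "(\<lambda>x. c * (p \<otimes>\<^bsub>H\<^esub> q) x) \<in> ?A"
        by (intro gen_closed(3) gen_subalgebra.mult) auto
    qed auto
  qed
  note com' = this
  have "bialgebra_on \<omega> H ?A"
    by (intro sub_bialg AF gen_closed gen_subalgebra.mult gen_subalgebra.one gen_hom[OF Z] com')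
  then show ?thesis using AF by (simp add: bi_subalgebra_def)
qed

text \<open>The antipode reverses products, with a factor, only for homogeneous arguments. The
  induction therefore runs over \<open>?Q\<close>, and additivity extends the result to
  sums.\<close>

lemma gen_hopf_subalgebra:
  assumes Z: "Z \<subseteq> (\<Union>\<phi>. Fh \<phi>)" and com: "\<And>f. f \<in> Z \<Longrightarrow> comult H f \<in> tensor_sub H H Z Z"
    and S: "\<And>f. f \<in> Z \<Longrightarrow> antipode H f \<in> gen_subalgebra H Z"
  shows "hopf_subalgebra \<omega> H (gen_subalgebra H Z)"
proof -
  let ?A = "gen_subalgebra H Z"
  let ?Q = "{f \<in> ?A \<inter> (\<Union>\<phi>. Fh \<phi>). antipode H f \<in> ?A}"
  have bi: "bialgebra_on \<omega> H ?A" "?A \<subseteq> FD" using gen_bi_subalgebra[OF Z com] by (auto simp: bi_subalgebra_def)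
  have "antipode H f \<in> ?A" if f: "f \<in> ?A" for f
  proof -
    have "f \<in> hs ?Q"
    proof (rule gen_hs[OF _ _ _ _ _ f])
      show "?Q \<subseteq> FD" using Fh_FD by auto
      show "Z \<subseteq> ?Q" using Z S by (auto intro: gen_subalgebra.base simp del: H_simps)
      show "\<one>\<^bsub>H\<^esub> \<in> ?Q" using one_Fh HS_one by (auto intro: gen_subalgebra.one simp del: H_simps)
      show "(\<lambda>x. c * f x) \<in> ?Q" if f: "f \<in> ?Q" for c f
      proof -
        obtain \<phi> where "f \<in> Fh \<phi>" using f by blast
        then have "(\<lambda>x. c * f x) \<in> ?A \<inter> (\<Union>\<phi>. Fh \<phi>)" using f by (intro IntI gen_closed(3) UN_I[of \<phi>] Fh_sm) auto
        moreover have "antipode H (\<lambda>x. c * f x) \<in> ?A" unfolding HS_sm by (rule gen_closed(3)) (use f in blast)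
        ultimately show ?thesis by blast
      qed
      fix f g assume fg: "f \<in> ?Q" "g \<in> ?Q"
      then obtain \<phi> \<psi> where h: "f \<in> Fh \<phi>" "g \<in> Fh \<psi>" by blast
      have "antipode H (f \<otimes>\<^bsub>H\<^esub> g) \<in> ?A"
        unfolding HS_mult[OF h] by (rule gen_closed(3), rule gen_subalgebra.mult) (use fg in blast)+
      then show "f \<otimes>\<^bsub>H\<^esub> g \<in> ?Q" using fg hm_Fh[OF h] by (auto intro: gen_subalgebra.mult simp del: H_simps)
    qed
    then have "antipode H f \<in> hs ?A"
      by (rule hs_map[where T = "antipode H"]) (use HS_add HS_zero hs_base in blast)+
    then show ?thesis by (rule hs_induct) (use gen_closed in blast)+
  qed
  then show ?thesis using sub_hopf bi by (simp add: hopf_subalgebra_def del: H_simps) simp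
qed

lemma lspan_closed: "0 \<in> lspan H Z" "f \<in> lspan H Z \<Longrightarrow> g \<in> lspan H Z \<Longrightarrow> f + g \<in> lspan H Z"
   "f \<in> lspan H Z \<Longrightarrow> (\<lambda>x. c * f x) \<in> lspan H Z"
  using lspan.zero[of H Z] lspan.add[of f H Z g] lspan.smult[of f H Z c] by simp_all

text \<open>Induction on the length of a monomial: multiplying by a generator on the left raises the
  length of both legs by one. For length 0 the span is that of the unit.\<close>

lemma product_span_coideal:
  assumes Z: "Z \<subseteq> (\<Union>\<phi>. Fh \<phi>)" and com: "\<And>f. f \<in> Z \<Longrightarrow> comult H f \<in> tensor_sub H H Z Z"
  shows "comult H ` product_span H Z r \<subseteq> tensor_sub H H (product_span H Z r) (product_span H Z r)"
proof -
  let ?m = "\<lambda>xs. foldr (\<lambda>x y. x \<otimes>\<^bsub>H\<^esub> y) xs \<one>\<^bsub>H\<^esub>"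
  let ?P = "product_span H Z"
  have mon: "\<exists>\<phi>. ?m xs \<in> Fh \<phi>" if "set xs \<subseteq> Z" for xs
    using that
  proof (induction xs)
    case (Cons x xs)
    then obtain \<phi> \<psi> where "x \<in> Fh \<phi>" "?m xs \<in> Fh \<psi>" using Z by auto
    then have "?m (x # xs) \<in> Fh (\<phi> + \<psi>)" using hm_Fh by simp
    then show ?case by blast
  qed (use one_Fh in auto)
  have PF: "?P r \<subseteq> FD" for r
  proof
    fix f assume "f \<in> ?P r"
    then show "f \<in> FD" unfolding product_span_def
      by (induction rule: lspan.induct) (use mon Fh_FD FD_zero FD_add FD_sm in auto)
  qed
  have hom: "?P r \<subseteq> hs (?P r \<inter> (\<Union>\<phi>. Fh \<phi>))" for r
  proof
    fix f assume "f \<in> ?P r"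
    then show "f \<in> hs (?P r \<inter> (\<Union>\<phi>. Fh \<phi>))" unfolding product_span_def
    proof (induction rule: lspan.induct)
      case (base f)
      then have "f \<in> (\<Union>\<phi>. Fh \<phi>)" using mon by auto
      then show ?case using lspan.base[OF base] by (intro hs_base) blast
    next
      case (smult f c)
      have "(\<lambda>x. c * f x) \<in> hs (lspan H {?m xs |xs. length xs = r \<and> set xs \<subseteq> Z} \<inter> (\<Union>\<phi>. Fh \<phi>))"
      proof (rule hs_sm[OF smult.IH])
        fix f assume f: "f \<in> lspan H {?m xs |xs. length xs = r \<and> set xs \<subseteq> Z} \<inter> (\<Union>\<phi>. Fh \<phi>)"
        then obtain \<phi> where "f \<in> Fh \<phi>" by blast
        then show "(\<lambda>x. c * f x) \<in> lspan H {?m xs |xs. length xs = r \<and> set xs \<subseteq> Z} \<inter> (\<Union>\<phi>. Fh \<phi>)"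
          using f by (intro IntI lspan_closed(3) UN_I[of \<phi>] Fh_sm) auto
      qed
      then show ?case by simp
    next
      case zero
      then show ?case using hs_zero by simp
    next
      case (add f g)
      then show ?case using hs_add by simp
    qed
  qed
  have step: "z \<otimes>\<^bsub>H\<^esub> f \<in> ?P (Suc r)" if z: "z \<in> Z" and f: "f \<in> ?P r" for z f r
  proof -
    have zF: "z \<in> FD" using Z z Fh_FD by auto
    have F: "g \<in> FD" if "g \<in> lspan H {?m xs |xs. length xs = r \<and> set xs \<subseteq> Z}" for g
      using that PF[of r] by (auto simp: product_span_def)
    show ?thesis using f unfolding product_span_def
    proof (induction rule: lspan.induct)
      case zero
      then show ?case using HH.r_null[of z] zF lspan_closed(1) by simp
    next
      case (base f)
      then obtain xs where "f = ?m xs" "length xs = r" "set xs \<subseteq> Z" by auto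
      then show ?case using z by (intro lspan.base CollectI exI[of _ "z # xs"]) auto
    next
      case (add f g)
      then show ?case using F zF by (simp add: hm_add2 FD_dual lspan_closed(2))
    next
      case (smult f c)
      have "z \<otimes>\<^bsub>H\<^esub> (\<lambda>x. c * f x) = (\<lambda>x. c * (z \<otimes>\<^bsub>H\<^esub> f) x)"
        by (rule hm_sm2[OF FD_dual[OF zF] FD_dual[OF F[OF smult.hyps]]])
      then show ?case using lspan_closed(3)[OF smult.IH, of c] by simp
    qed
  qed
  have Pcl: "0 \<in> ?P r" "f \<in> ?P r \<Longrightarrow> g \<in> ?P r \<Longrightarrow> f + g \<in> ?P r" "f \<in> ?P r \<Longrightarrow> (\<lambda>x. c * f x) \<in> ?P r" for f g c r
    unfolding product_span_def by (rule lspan_closed; assumption)+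
  have mono: "comult H (?m xs) \<in> tensor_sub H H (?P (length xs)) (?P (length xs))" if "set xs \<subseteq> Z" for xs
    using that
  proof (induction xs)
    case Nil
    have "\<one>\<^bsub>H\<^esub> \<in> ?P 0" unfolding product_span_def by (rule lspan.base) auto
    then show ?case by (auto simp: Hcom_one tensor_sub_def intro!: HH.ts_pt)
  next
    case (Cons x xs)
    have x: "x \<in> Z" using Cons by auto
    have xs: "?m xs \<in> FD" using mon[of xs] Cons Fh_FD by auto
    have xF: "x \<in> FD" using x Z Fh_FD by auto
    have Q: "?P (length xs) \<inter> (\<Union>\<phi>. Fh \<phi>) \<subseteq> FD" using PF by auto
    have "HH.tm (comult H x) (comult H (?m xs)) \<in> tensor_sub H H (?P (Suc (length xs))) (?P (Suc (length xs)))"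
    proof (rule tm_sub[OF Z _ _ com[OF x, unfolded tensor_sub_def] tensor_hs[OF hom Q Cons.IH]])
      fix p q c assume "p \<in> Z" "q \<in> ?P (length xs) \<inter> (\<Union>\<phi>. Fh \<phi>)"
      then show "(\<lambda>x. c * (p \<otimes>\<^bsub>H\<^esub> q) x) \<in> ?P (Suc (length xs))"
        using step by (intro Pcl(3)) auto
    qed (use Cons in auto)
    then show ?case using Hcom_mult[OF xF xs] by simp
  qed
  have "comult H f \<in> tensor_sub H H (?P r) (?P r)" if "f \<in> ?P r" for f
  proof -
    have "f \<in> FD \<and> comult H f \<in> tensor_sub H H (?P r) (?P r)"
      using that unfolding product_span_def[of H Z r, THEN arg_cong[where f = "\<lambda>S. f \<in> S"]]
    proof (induction rule: lspan.induct)
      case zero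
      then show ?case by (simp add: Hcom_zero tensor_sub_def HH.ts_zero FD_zero)
    next
      case (base f)
      then show ?case using mono mon Fh_FD by auto
    next
      case (add f g)
      then show ?case by (simp add: Hcom_add tensor_sub_def HH.ts_add FD_add)
    next
      case (smult f c)
      then have "(\<lambda>B. c * comult H f B) \<in> tensor_sub H H (?P r) (?P r)"
        by (intro ts_smult[OF _ Pcl(3) PF]) blast
      then show ?case using smult.IH by (simp add: Hcom_sm FD_sm)
    qed
    then show ?thesis by blast
  qed
  then show ?thesis by blast
qed

end

section \<open>Actions of free algebras\<close>

definition sc :: "complex \<Rightarrow> ('x fword \<Rightarrow>\<^sub>0 complex) \<Rightarrow> 'x fword \<Rightarrow>\<^sub>0 complex" where
  "sc c x = Poly_Mapping.single 0 c * x"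

lemma lookup_sc: "Poly_Mapping.lookup (sc c x) w = c * Poly_Mapping.lookup x w"
  by (simp add: sc_def mult_map_scale_conv_mult[symmetric] Poly_Mapping.map.rep_eq when_def)

lemma sc_add: "sc (b + c) x = sc b x + sc c x" "sc c (x + y) = sc c x + sc c y"
  and sc_minus: "sc c (x - y) = sc c x - sc c y"
  and sc_sc: "sc b (sc c x) = sc (b * c) x"
  and sc_one [simp]: "sc 1 x = x" and sc_zero [simp]: "sc 0 x = 0" "sc c 0 = 0"
  and sc_uminus: "sc (- c) x = - sc c x" "sc c (- x) = - sc c x"
  by (rule poly_mapping_eqI; simp add: lookup_sc lookup_add lookup_minus algebra_simps)+

lemma sc_sum: "sc c (sum f A) = (\<Sum>a\<in>A. sc c (f a))"
  by (induction A rule: infinite_finite_induct) (simp_all add: sc_add)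

lemma poly_sum_single: "x = (\<Sum>w\<in>Poly_Mapping.keys x. Poly_Mapping.single w (Poly_Mapping.lookup x w))"
  for x :: "'a \<Rightarrow>\<^sub>0 'b::comm_monoid_add"
  by (rule poly_mapping_eqI) (simp add: lookup_sum lookup_single when_def in_keys_iff)

lemma sc_mult1: "sc c x * y = sc c (x * y)"
  by (simp add: sc_def mult.assoc)

lemma sc_mult2: "x * sc c y = sc c (x * y)"
proof -
  have "Poly_Mapping.single w d * Poly_Mapping.single 0 c = Poly_Mapping.single 0 c * Poly_Mapping.single w d" for w :: "'a fword" and d
    by (simp add: mult_single mult.commute)
  then have "(\<Sum>w\<in>Poly_Mapping.keys x. Poly_Mapping.single w (Poly_Mapping.lookup x w)) * Poly_Mapping.single 0 c
    = Poly_Mapping.single 0 c * (\<Sum>w\<in>Poly_Mapping.keys x. Poly_Mapping.single w (Poly_Mapping.lookup x w))"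
    unfolding sum_distrib_left sum_distrib_right by simp
  then have "x * Poly_Mapping.single 0 c = Poly_Mapping.single 0 c * x" using poly_sum_single[of x] by simp
  then show ?thesis by (metis sc_def mult.assoc)
qed

abbreviation "CF G \<equiv> carrier (free_alg G)"

lemma CF_iff: "x \<in> CF G \<longleftrightarrow> (\<forall>w\<in>Poly_Mapping.keys x. set (letters w) \<subseteq> G)"
  by (simp add: free_alg_def)

lemma CF_add: "x \<in> CF G \<Longrightarrow> y \<in> CF G \<Longrightarrow> x + y \<in> CF G"
  using Poly_Mapping.keys_add[of x y] by (auto simp: CF_iff)

lemma CF_zero: "0 \<in> CF G" and CF_one: "1 \<in> CF G"
  by (auto simp: CF_iff zero_fword_def)

lemma CF_single: "set (letters w) \<subseteq> G \<Longrightarrow> Poly_Mapping.single w c \<in> CF G"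
  by (auto simp: CF_iff)

lemma CF_sc: "x \<in> CF G \<Longrightarrow> sc c x \<in> CF G"
  by (auto simp: CF_iff in_keys_iff lookup_sc)

lemma CF_uminus: "x \<in> CF G \<Longrightarrow> - x \<in> CF G"
  by (auto simp: CF_iff in_keys_iff)

lemma CF_minus: "x \<in> CF G \<Longrightarrow> y \<in> CF G \<Longrightarrow> x - y \<in> CF G"
  using CF_add[OF _ CF_uminus, of x G y] by simp

lemma CF_mult: "x \<in> CF G \<Longrightarrow> y \<in> CF G \<Longrightarrow> x * y \<in> CF G"
  using keys_mult[of x y] by (fastforce simp: CF_iff plus_fword_def)

lemma CF_sum: "(\<And>i. i \<in> A \<Longrightarrow> f i \<in> CF G) \<Longrightarrow> sum f A \<in> CF G"
  by (induction A rule: infinite_finite_induct) (auto intro: CF_zero CF_add)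

lemma CF_gen: "X \<in> G \<Longrightarrow> gen X \<in> CF G"
  by (simp add: gen_def CF_single)

lemma CF_induct [consumes 1, case_names zero single add]:
  assumes "x \<in> CF G" "P 0" "\<And>w c. set (letters w) \<subseteq> G \<Longrightarrow> P (Poly_Mapping.single w c)"
    "\<And>x y. x \<in> CF G \<Longrightarrow> y \<in> CF G \<Longrightarrow> P x \<Longrightarrow> P y \<Longrightarrow> P (x + y)"
  shows "P x"
proof -
  have "A \<subseteq> Poly_Mapping.keys x \<Longrightarrow> (\<Sum>w\<in>A. Poly_Mapping.single w (Poly_Mapping.lookup x w)) \<in> CF G \<and>
      P (\<Sum>w\<in>A. Poly_Mapping.single w (Poly_Mapping.lookup x w))" if "finite A" for A
    using that
  proof (induction A rule: finite_induct)
    case (insert w A)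
    then have "set (letters w) \<subseteq> G" using assms(1) by (auto simp: CF_iff)
    then show ?case using insert assms(4)[OF CF_single _ assms(3), of w "\<Sum>w\<in>A. Poly_Mapping.single w (Poly_Mapping.lookup x w)"]
      by (auto intro!: CF_add CF_single)
  qed (simp add: assms CF_zero)
  from this[of "Poly_Mapping.keys x"] show ?thesis using poly_sum_single[of x] by simp
qed

lemma single_Cons: "Poly_Mapping.single (Word (X # Xs)) c = gen X * Poly_Mapping.single (Word Xs) c"
  by (simp add: gen_def mult_single plus_fword_def)

lemma single_Nil: "Poly_Mapping.single (Word []) c = sc c 1"
  by (simp add: sc_def zero_fword_def)

lemma free_alg_simps [simp]: "mult (free_alg G) = (*)" "one (free_alg G) = 1" "zero (free_alg G) = 0" "add (free_alg G) = (+)"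
  "smult (free_alg G) = sc"
  by (auto simp: free_alg_def sc_def fun_eq_iff)

lemma free_alg_ring: "ring (free_alg G)"
proof (rule ringI)
  show "abelian_group (free_alg G)"
  proof (rule abelian_groupI)
    show "\<exists>y\<in>CF G. y \<oplus>\<^bsub>free_alg G\<^esub> x = \<zero>\<^bsub>free_alg G\<^esub>" if "x \<in> CF G" for x
      using that by (intro bexI[of _ "- x"]) (auto intro: CF_uminus)
  qed (auto intro: CF_zero CF_add simp: add_ac)
  show "Group.monoid (free_alg G)"
    by (rule monoidI) (auto intro: CF_mult CF_one simp: mult.assoc)
qed (auto simp: distrib_left distrib_right)

text \<open>An action of the free algebra on \<open>C\<close> which is to be read modulo
  \<open>K\<close>, so that no quotient space has to be formed. The relations of the enveloping
  algebra need only send \<open>C\<close> into \<open>K\<close>; with \<open>K = {0}\<close> they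
  have to act by zero.\<close>

locale frep = vector_space sW for sW :: "complex \<Rightarrow> 'w::ab_group_add \<Rightarrow> 'w" +
  fixes G :: "'x set" and C K :: "'w set" and \<rho> :: "'x \<Rightarrow> 'w \<Rightarrow> 'w"
  assumes K0: "0 \<in> K" and KC: "K \<subseteq> C"
    and C_add: "x \<in> C \<Longrightarrow> y \<in> C \<Longrightarrow> x + y \<in> C" and C_sc: "x \<in> C \<Longrightarrow> sW c x \<in> C"
    and K_add: "x \<in> K \<Longrightarrow> y \<in> K \<Longrightarrow> x + y \<in> K" and K_sc: "x \<in> K \<Longrightarrow> sW c x \<in> K"
    and rho_C: "X \<in> G \<Longrightarrow> x \<in> C \<Longrightarrow> \<rho> X x \<in> C" and rho_K: "X \<in> G \<Longrightarrow> x \<in> K \<Longrightarrow> \<rho> X x \<in> K"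
    and rho_add: "X \<in> G \<Longrightarrow> x \<in> C \<Longrightarrow> y \<in> C \<Longrightarrow> \<rho> X (x + y) = \<rho> X x + \<rho> X y"
    and rho_sc: "X \<in> G \<Longrightarrow> x \<in> C \<Longrightarrow> \<rho> X (sW c x) = sW c (\<rho> X x)"
begin

lemma C0: "0 \<in> C" using K0 KC by blast

lemma K_uminus: "x \<in> K \<Longrightarrow> - x \<in> K" using K_sc[of x "-1"] by simp

definition act :: "('x fword \<Rightarrow>\<^sub>0 complex) \<Rightarrow> 'w \<Rightarrow> 'w" where
  "act x w = (\<Sum>v\<in>Poly_Mapping.keys x. sW (Poly_Mapping.lookup x v) (foldr \<rho> (letters v) w))"

lemma act_super: "finite A \<Longrightarrow> Poly_Mapping.keys x \<subseteq> A \<Longrightarrow>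
    act x w = (\<Sum>v\<in>A. sW (Poly_Mapping.lookup x v) (foldr \<rho> (letters v) w))"
  unfolding act_def by (rule sum.mono_neutral_left) (auto simp: in_keys_iff)

lemma act_add: "act (x + y) w = act x w + act y w"
  using Poly_Mapping.keys_add[of x y]
  by (subst (1 2 3) act_super[where A = "Poly_Mapping.keys x \<union> Poly_Mapping.keys y"])
    (auto simp: lookup_add scale_left_distrib sum.distrib)

lemma act_sc: "act (sc c x) w = sW c (act x w)"
proof -
  have "Poly_Mapping.keys (sc c x) \<subseteq> Poly_Mapping.keys x" by (auto simp: in_keys_iff lookup_sc)
  then show ?thesis by (subst (1 2) act_super[where A = "Poly_Mapping.keys x"])
      (auto simp: lookup_sc scale_sum_right)
qed

lemma act_uminus: "act (- x) w = - act x w"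
  using act_sc[of "-1" x w] sc_uminus(1)[of 1 x] by simp

lemma act_minus: "act (x - y) w = act x w - act y w"
  using act_add[of x "- y" w] by (simp add: act_uminus)

lemma act_zero: "act 0 w = 0"
  by (simp add: act_def)

lemma act_single: "act (Poly_Mapping.single v c) w = sW c (foldr \<rho> (letters v) w)"
  by (cases "c = 0") (simp_all add: act_def)

lemma act_one: "act 1 w = w"
  unfolding single_one[symmetric] act_single by (simp add: zero_fword_def)

lemma act_gen: "act (gen X) w = \<rho> X w"
  by (simp add: gen_def act_single)

lemma foldr_C: "set Xs \<subseteq> G \<Longrightarrow> w \<in> C \<Longrightarrow> foldr \<rho> Xs w \<in> C"
  and foldr_K: "set Xs \<subseteq> G \<Longrightarrow> w \<in> K \<Longrightarrow> foldr \<rho> Xs w \<in> K"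
  by (induction Xs) (auto intro: rho_C rho_K)

lemma foldr_add: "set Xs \<subseteq> G \<Longrightarrow> w \<in> C \<Longrightarrow> w' \<in> C \<Longrightarrow> foldr \<rho> Xs (w + w') = foldr \<rho> Xs w + foldr \<rho> Xs w'"
  and foldr_sc: "set Xs \<subseteq> G \<Longrightarrow> w \<in> C \<Longrightarrow> foldr \<rho> Xs (sW c w) = sW c (foldr \<rho> Xs w)"
  by (induction Xs) (auto simp: rho_add rho_sc foldr_C)

lemma act_C: "x \<in> CF G \<Longrightarrow> w \<in> C \<Longrightarrow> act x w \<in> C"
  by (induction rule: CF_induct) (auto simp: act_zero act_add act_single intro: C0 C_add C_sc foldr_C)

lemma act_K: "x \<in> CF G \<Longrightarrow> w \<in> K \<Longrightarrow> act x w \<in> K"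
  by (induction rule: CF_induct) (auto simp: act_zero act_add act_single intro: K0 K_add K_sc foldr_K)

lemma act_add2: "x \<in> CF G \<Longrightarrow> w \<in> C \<Longrightarrow> w' \<in> C \<Longrightarrow> act x (w + w') = act x w + act x w'"
  by (induction rule: CF_induct) (auto simp: act_zero act_add act_single foldr_add scale_right_distrib)

lemma act_sc2: "x \<in> CF G \<Longrightarrow> w \<in> C \<Longrightarrow> act x (sW c w) = sW c (act x w)"
  by (induction rule: CF_induct) (auto simp: act_zero act_add act_single foldr_sc scale_right_distrib mult.commute)

lemma act_mult: "x \<in> CF G \<Longrightarrow> y \<in> CF G \<Longrightarrow> w \<in> C \<Longrightarrow> act (x * y) w = act x (act y w)"
proof (induction rule: CF_induct)
  case (single v c)
  note v = single(1)
  from single(2,3) show ?case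
  proof (induction rule: CF_induct)
    case zero
    then show ?case using foldr_sc[OF v C0, of 0] by (simp add: act_zero act_single)
  next
    case (single v' c')
    then show ?case using v by (simp add: mult_single act_single plus_fword_def foldr_sc foldr_C)
  next
    case (add x y)
    then show ?case using v by (simp add: distrib_left act_add act_add2 act_C CF_single)
  qed
next
  case (add x y)
  then show ?case by (simp add: distrib_right act_add)
qed (simp add: act_zero)

text \<open>The elements that send \<open>C\<close> into \<open>K\<close> form a two-sided ideal:
  multiplying on the left uses that \<open>K\<close> is stable, on the right that \<open>C\<close>
  is stable. It contains \<open>R\<close>, hence the ideal generated by \<open>R\<close>.\<close>

lemma act_kill:
  assumes R: "R \<subseteq> CF G" and r: "\<And>x w. x \<in> R \<Longrightarrow> w \<in> C \<Longrightarrow> act x w \<in> K"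
    and x: "x \<in> genideal (free_alg G) R" and w: "w \<in> C"
  shows "act x w \<in> K"
proof -
  interpret F: ring "free_alg G" by (rule free_alg_ring)
  let ?N = "{x \<in> CF G. \<forall>w\<in>C. act x w \<in> K}"
  have inv: "\<ominus>\<^bsub>free_alg G\<^esub> x = - x" if "x \<in> CF G" for x
    using F.minus_equality[of "- x" x] that CF_uminus by auto
  have "ideal ?N (free_alg G)"
  proof (rule idealI[OF free_alg_ring])
    show "subgroup ?N (add_monoid (free_alg G))"
      by (rule F.add.subgroupI) (auto simp: act_zero act_add inv act_uminus CF_zero CF_add CF_uminus K_add K_uminus K0 intro!: exI[of _ 0])
    show "x \<otimes>\<^bsub>free_alg G\<^esub> a \<in> ?N" if "a \<in> ?N" "x \<in> CF G" for a x
      using that by (auto simp: CF_mult act_mult act_K)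
    show "a \<otimes>\<^bsub>free_alg G\<^esub> x \<in> ?N" if "a \<in> ?N" "x \<in> CF G" for a x
      using that by (auto simp: CF_mult act_mult act_C)
  qed
  then have "genideal (free_alg G) R \<subseteq> ?N" by (rule F.genideal_minimal) (use R r in auto)
  then show ?thesis using x w by blast
qed

end

section \<open>Homogeneous components of endomorphisms\<close>

locale gvs = comm_factor \<omega> for \<omega> :: "'g::ab_group_add \<Rightarrow> 'g \<Rightarrow> complex" +
  fixes scale :: "complex \<Rightarrow> 'v::ab_group_add \<Rightarrow> 'v" and V :: "'g \<Rightarrow> 'v set"
    and n :: nat and e :: "nat \<Rightarrow> 'v" and \<gamma> :: "nat \<Rightarrow> 'g"
  assumes gvs: "graded_vector_space scale V" and hb: "homogeneous_basis scale V n e \<gamma>"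
begin

sublocale vs: vector_space scale
  using gvs by (simp add: graded_vector_space_def)

lemma V_subspace: "vs.subspace (V \<alpha>)"
  using gvs by (simp add: graded_vector_space_def)

lemma V_zero: "0 \<in> V \<alpha>" and V_add: "v \<in> V \<alpha> \<Longrightarrow> w \<in> V \<alpha> \<Longrightarrow> v + w \<in> V \<alpha>"
  and V_scale: "v \<in> V \<alpha> \<Longrightarrow> scale c v \<in> V \<alpha>"
  using V_subspace vs.subspace_0 vs.subspace_add vs.subspace_scale by blast+

lemma V_minus: "v \<in> V \<alpha> \<Longrightarrow> w \<in> V \<alpha> \<Longrightarrow> v - w \<in> V \<alpha>"
  using V_subspace vs.subspace_diff by blast

lemma vdecomp_vpart: "vdecomp V v (\<lambda>\<alpha>. vpart V \<alpha> v)"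
proof -
  have "\<exists>!u. vdecomp V v u" using gvs by (simp add: graded_vector_space_def)
  then show ?thesis unfolding vpart_def by (rule theI')
qed

lemma vpart_eqI: "vdecomp V v u \<Longrightarrow> vpart V \<alpha> v = u \<alpha>"
proof -
  assume u: "vdecomp V v u"
  have "\<exists>!u. vdecomp V v u" using gvs by (simp add: graded_vector_space_def)
  then show ?thesis unfolding vpart_def using u by (simp add: the1_equality)
qed

lemma vdecompI:
  assumes "\<And>\<alpha>. u \<alpha> \<in> V \<alpha>" "finite S" "\<And>\<alpha>. \<alpha> \<notin> S \<Longrightarrow> u \<alpha> = 0" "v = sum u S"
  shows "vdecomp V v u"
proof -
  have sub: "{\<alpha>. u \<alpha> \<noteq> 0} \<subseteq> S" using assms(3) by auto
  have "sum u S = sum u {\<alpha>. u \<alpha> \<noteq> 0}"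
    by (rule sum.mono_neutral_right) (use assms sub in auto)
  then show ?thesis using assms finite_subset[OF sub] by (auto simp: vdecomp_def)
qed

lemma vpart_V [simp]: "vpart V \<alpha> v \<in> V \<alpha>" and vpart_finite: "finite {\<alpha>. vpart V \<alpha> v \<noteq> 0}"
  and vpart_sum0: "v = (\<Sum>\<alpha> | vpart V \<alpha> v \<noteq> 0. vpart V \<alpha> v)"
  using vdecomp_vpart[of v] by (auto simp: vdecomp_def)

lemma vpart_super: "finite S \<Longrightarrow> {\<alpha>. vpart V \<alpha> v \<noteq> 0} \<subseteq> S \<Longrightarrow> (\<Sum>\<alpha>\<in>S. vpart V \<alpha> v) = v"
  by (subst (2) vpart_sum0, rule sum.mono_neutral_right) auto

lemma vpart_hom: "v \<in> V \<beta> \<Longrightarrow> vpart V \<alpha> v = (if \<alpha> = \<beta> then v else 0)"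
proof -
  assume v: "v \<in> V \<beta>"
  have "vdecomp V v (\<lambda>\<alpha>. if \<alpha> = \<beta> then v else 0)"
    by (rule vdecompI[where S = "{\<beta>}"]) (use v V_zero in auto)
  then show ?thesis by (rule vpart_eqI)
qed

lemma vpart_add: "vpart V \<alpha> (v + w) = vpart V \<alpha> v + vpart V \<alpha> w"
proof -
  let ?S = "{\<alpha>. vpart V \<alpha> v \<noteq> 0} \<union> {\<alpha>. vpart V \<alpha> w \<noteq> 0}"
  have "vdecomp V (v + w) (\<lambda>\<alpha>. vpart V \<alpha> v + vpart V \<alpha> w)"
    by (rule vdecompI[where S = ?S]) (auto simp: V_add vpart_finite sum.distrib vpart_super)
  then show ?thesis by (rule vpart_eqI)
qed

lemma vpart_scale: "vpart V \<alpha> (scale c v) = scale c (vpart V \<alpha> v)"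
proof -
  let ?S = "{\<alpha>. vpart V \<alpha> v \<noteq> 0}"
  have "vdecomp V (scale c v) (\<lambda>\<alpha>. scale c (vpart V \<alpha> v))"
    by (rule vdecompI[where S = ?S]) (auto simp: V_scale vpart_finite vpart_super vs.scale_sum_right[symmetric])
  then show ?thesis by (rule vpart_eqI)
qed

lemma vpart_zero [simp]: "vpart V \<alpha> 0 = 0"
  using vpart_scale[of \<alpha> 0 0] by simp

definition degs :: "'g set" where "degs = \<gamma> ` {1..n}"

lemma degs_finite [simp]: "finite degs" by (simp add: degs_def)

text \<open>The vectors without component in degree \<alpha> form a subspace, which contains the
  basis. Hence only the finitely many degrees of basis vectors occur in \<open>V\<close>.\<close>

lemma vpart_off: "\<alpha> \<notin> degs \<Longrightarrow> vpart V \<alpha> v = 0"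
proof -
  assume a: "\<alpha> \<notin> degs"
  have "vs.subspace {v. vpart V \<alpha> v = 0}"
    by (rule vs.subspaceI) (auto simp: vpart_add vpart_scale)
  moreover have "e ` {1..n} \<subseteq> {v. vpart V \<alpha> v = 0}"
  proof (clarify)
    fix a assume n: "a \<in> {1..n}"
    then have "e a \<in> V (\<gamma> a)" using hb unfolding homogeneous_basis_def by blast
    moreover have "\<alpha> \<noteq> \<gamma> a" using a n by (auto simp: degs_def)
    ultimately show "vpart V \<alpha> (e a) = 0" by (simp add: vpart_hom)
  qed
  ultimately have "vs.span (e ` {1..n}) \<subseteq> {v. vpart V \<alpha> v = 0}" by (rule vs.span_minimal[rotated])
  then show ?thesis using hb by (auto simp: homogeneous_basis_def)
qed

lemma vpart_sum: "(\<Sum>\<alpha>\<in>degs. vpart V \<alpha> v) = v"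
  by (rule vpart_super) (use vpart_off in auto)

abbreviation "GL \<equiv> gl scale"
abbreviation "GLd \<equiv> gl_grade scale V"

lemma gl_iff: "X \<in> GL \<longleftrightarrow> (\<forall>x y. X (x + y) = X x + X y) \<and> (\<forall>c x. X (scale c x) = scale c (X x))"
  using vs.vector_space_axioms
  by (auto simp: gl_def Vector_Spaces.linear_def module_hom_def module_hom_axioms_def module_iff_vector_space)

lemma gl_add: "X \<in> GL \<Longrightarrow> X (x + y) = X x + X y" and gl_scale: "X \<in> GL \<Longrightarrow> X (scale c x) = scale c (X x)"
  by (simp_all add: gl_iff)

lemma gl_0: "X \<in> GL \<Longrightarrow> X 0 = 0"
  using gl_scale[of X 0 0] by simp

lemma gl_sum: "X \<in> GL \<Longrightarrow> X (sum f A) = (\<Sum>a\<in>A. X (f a))"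
  by (induction A rule: infinite_finite_induct) (simp_all add: gl_0 gl_add)

lemma gl_plus: "X \<in> GL \<Longrightarrow> Y \<in> GL \<Longrightarrow> (\<lambda>v. X v + Y v) \<in> GL"
  and gl_times: "X \<in> GL \<Longrightarrow> (\<lambda>v. scale c (X v)) \<in> GL"
  and gl_zero: "(\<lambda>v. 0) \<in> GL"
  and gl_comp: "X \<in> GL \<Longrightarrow> Y \<in> GL \<Longrightarrow> (\<lambda>v. X (Y v)) \<in> GL"
  by (auto simp: gl_iff vs.scale_right_distrib mult.commute)

lemma gl_minus: "X \<in> GL \<Longrightarrow> Y \<in> GL \<Longrightarrow> (\<lambda>v. X v - Y v) \<in> GL"
  by (auto simp: gl_iff vs.scale_right_diff_distrib)

lemma GLd_GL: "X \<in> GLd \<alpha> \<Longrightarrow> X \<in> GL" and GLd_V: "X \<in> GLd \<alpha> \<Longrightarrow> v \<in> V \<beta> \<Longrightarrow> X v \<in> V (\<alpha> + \<beta>)"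
  by (auto simp: gl_grade_def)

lemma GLdI: "X \<in> GL \<Longrightarrow> (\<And>\<beta> v. v \<in> V \<beta> \<Longrightarrow> X v \<in> V (\<alpha> + \<beta>)) \<Longrightarrow> X \<in> GLd \<alpha>"
  by (auto simp: gl_grade_def)

lemma GLd_zero: "(\<lambda>v. 0) \<in> GLd \<alpha>"
  by (auto intro!: GLdI gl_zero V_zero)

text \<open>The degrees are arguments because a map does not determine its degree: the zero map has
  every degree.\<close>

definition brk :: "'g \<Rightarrow> 'g \<Rightarrow> ('v \<Rightarrow> 'v) \<Rightarrow> ('v \<Rightarrow> 'v) \<Rightarrow> 'v \<Rightarrow> 'v" where
  "brk \<alpha> \<beta> X Y = (\<lambda>v. X (Y v) - scale (\<omega> \<alpha> \<beta>) (Y (X v)))"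

lemma GLd_brk: "X \<in> GLd \<alpha> \<Longrightarrow> Y \<in> GLd \<beta> \<Longrightarrow> brk \<alpha> \<beta> X Y \<in> GLd (\<alpha> + \<beta>)"
proof (rule GLdI)
  assume X: "X \<in> GLd \<alpha>" and Y: "Y \<in> GLd \<beta>"
  show "brk \<alpha> \<beta> X Y \<in> GL" unfolding brk_def
    by (rule gl_minus[OF gl_comp[OF GLd_GL[OF X] GLd_GL[OF Y]] gl_times[OF gl_comp[OF GLd_GL[OF Y] GLd_GL[OF X]]]])
  fix \<kappa> v assume v: "v \<in> V \<kappa>"
  have "X (Y v) \<in> V (\<alpha> + \<beta> + \<kappa>)" using GLd_V[OF X GLd_V[OF Y v]] by (simp add: add_ac)
  moreover have "Y (X v) \<in> V (\<alpha> + \<beta> + \<kappa>)" using GLd_V[OF Y GLd_V[OF X v]] by (simp add: add_ac)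
  ultimately show "brk \<alpha> \<beta> X Y v \<in> V (\<alpha> + \<beta> + \<kappa>)" unfolding brk_def by (rule V_minus[OF _ V_scale])
qed

text \<open>The component of degree \<open>d\<close> of an endomorphism, assembled from its blocks
  between \<open>V \<beta>\<close> and \<open>V (d + \<beta>)\<close>.\<close>

definition hc :: "'g \<Rightarrow> ('v \<Rightarrow> 'v) \<Rightarrow> 'v \<Rightarrow> 'v" where
  "hc d X v = (\<Sum>\<beta>\<in>degs. vpart V (d + \<beta>) (X (vpart V \<beta> v)))"

text \<open>The degrees that a nonzero homogeneous endomorphism can have. Their finiteness makes
  every endomorphism a finite sum of its components.\<close>

definition DD :: "'g set" where "DD = (\<lambda>(\<alpha>, \<beta>). \<alpha> - \<beta>) ` (degs \<times> degs)"

lemma DD_finite [simp]: "finite DD" by (simp add: DD_def)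

lemma hc_GLd: "X \<in> GL \<Longrightarrow> hc d X \<in> GLd d"
proof (rule GLdI)
  assume X: "X \<in> GL"
  show "hc d X \<in> GL"
    by (auto simp: gl_iff hc_def vpart_add vpart_scale gl_add[OF X] gl_scale[OF X] sum.distrib vs.scale_sum_right)
  fix \<beta> v assume v: "v \<in> V \<beta>"
  have "hc d X v = (\<Sum>\<alpha>\<in>degs. if \<alpha> = \<beta> then vpart V (d + \<beta>) (X v) else 0)"
    unfolding hc_def by (rule sum.cong) (auto simp: vpart_hom[OF v] gl_0[OF X])
  then show "hc d X v \<in> V (d + \<beta>)" by (simp add: V_zero)
qed

lemma hc_add: "hc d (\<lambda>v. X v + Y v) = (\<lambda>v. hc d X v + hc d Y v)"
  and hc_scale: "hc d (\<lambda>v. scale c (X v)) = (\<lambda>v. scale c (hc d X v))"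
  by (auto simp: hc_def vpart_add vpart_scale sum.distrib vs.scale_sum_right)

lemma hc_sum: "X \<in> GL \<Longrightarrow> (\<Sum>d\<in>DD. hc d X v) = X v"
proof -
  assume X: "X \<in> GL"
  have "(\<Sum>d\<in>DD. vpart V (d + \<beta>) y) = y" if b: "\<beta> \<in> degs" for \<beta> y
  proof -
    have "(\<Sum>d\<in>DD. vpart V (d + \<beta>) y) = (\<Sum>\<alpha>\<in>(\<lambda>d. d + \<beta>) ` DD. vpart V \<alpha> y)"
      by (subst sum.reindex) (auto simp: inj_on_def)
    also have "\<dots> = y"
    proof (rule vpart_super)
      show "{\<alpha>. vpart V \<alpha> y \<noteq> 0} \<subseteq> (\<lambda>d. d + \<beta>) ` DD"
      proof
        fix \<alpha> assume "\<alpha> \<in> {\<alpha>. vpart V \<alpha> y \<noteq> 0}"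
        then have "\<alpha> \<in> degs" using vpart_off by auto
        then have "\<alpha> - \<beta> \<in> DD" using b by (auto simp: DD_def)
        then show "\<alpha> \<in> (\<lambda>d. d + \<beta>) ` DD" by (rule rev_image_eqI) simp
      qed
    qed simp
    finally show ?thesis .
  qed
  then have "(\<Sum>d\<in>DD. hc d X v) = (\<Sum>\<beta>\<in>degs. X (vpart V \<beta> v))"
    unfolding hc_def by (subst sum.swap) (rule sum.cong, auto)
  then show ?thesis using gl_sum[OF X, of "\<lambda>\<beta>. vpart V \<beta> v" degs] vpart_sum by simp
qed

lemma hc_hom: "X \<in> GLd a \<Longrightarrow> hc d X = (if d = a then X else (\<lambda>v. 0))"
proof (rule ext)
  fix v assume X: "X \<in> GLd a"
  have "hc d X v = (\<Sum>\<beta>\<in>degs. if d = a then X (vpart V \<beta> v) else 0)"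
    unfolding hc_def by (rule sum.cong[OF refl]) (subst vpart_hom[OF GLd_V[OF X vpart_V]], auto)
  then show "hc d X v = (if d = a then X else (\<lambda>v. 0)) v"
    using gl_sum[OF GLd_GL[OF X], of "\<lambda>\<beta>. vpart V \<beta> v" degs] vpart_sum by simp
qed

lemma DD_hom: "X \<in> GLd a \<Longrightarrow> a \<notin> DD \<Longrightarrow> X = (\<lambda>v. 0)"
proof (rule ext)
  fix v assume X: "X \<in> GLd a" and "a \<notin> DD"
  then have "(\<Sum>d\<in>DD. hc d X v) = 0" by (intro sum.neutral) (auto simp: hc_hom)
  then show "X v = 0" using hc_sum[OF GLd_GL[OF X]] by simp
qed

end

section \<open>The enveloping algebra as a graded algebra\<close>

context gvs
begin

abbreviation "I \<equiv> env_ideal \<omega> scale V"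
abbreviation "cl \<equiv> env_class \<omega> scale V"
abbreviation "U \<equiv> env \<omega> scale V"
abbreviation "PF \<equiv> CF GL"

definition rel :: "'g \<Rightarrow> 'g \<Rightarrow> ('v \<Rightarrow> 'v) \<Rightarrow> ('v \<Rightarrow> 'v) \<Rightarrow> ('v \<Rightarrow> 'v) fword \<Rightarrow>\<^sub>0 complex" where
  "rel \<alpha> \<beta> X Y = gen X * gen Y - sc (\<omega> \<alpha> \<beta>) (gen Y * gen X) - gen (brk \<alpha> \<beta> X Y)"

lemma rels_eq: "env_relations \<omega> scale V =
   {gen (\<lambda>v. X v + Y v) - gen X - gen Y |X Y. X \<in> GL \<and> Y \<in> GL} \<union>
   {gen (\<lambda>v. scale c (X v)) - sc c (gen X) |c X. X \<in> GL} \<union>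
   {rel \<alpha> \<beta> X Y |X Y \<alpha> \<beta>. X \<in> GLd \<alpha> \<and> Y \<in> GLd \<beta>}"
  unfolding env_relations_def rel_def brk_def sc_def ..

lemma rels_CF: "env_relations \<omega> scale V \<subseteq> PF"
  unfolding rels_eq rel_def
  by (auto intro!: CF_minus CF_gen CF_sc CF_mult gl_plus gl_times dest: GLd_GL intro: GLd_GL[OF GLd_brk])

lemma I_ideal: "ideal I (free_alg GL)"
  unfolding env_ideal_def by (rule ring.genideal_ideal[OF free_alg_ring rels_CF])

lemma rels_I: "env_relations \<omega> scale V \<subseteq> I"
  unfolding env_ideal_def by (rule ring.genideal_self[OF free_alg_ring rels_CF])

lemma I_CF: "x \<in> I \<Longrightarrow> x \<in> PF"
  using additive_subgroup.a_subset[OF ideal.axioms(1)[OF I_ideal]] by blast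

lemma I_zero: "0 \<in> I"
  using additive_subgroup.zero_closed[OF ideal.axioms(1)[OF I_ideal]] by simp

lemma I_add: "x \<in> I \<Longrightarrow> y \<in> I \<Longrightarrow> x + y \<in> I"
  using additive_subgroup.a_closed[OF ideal.axioms(1)[OF I_ideal]] by simp

lemma I_lmult: "x \<in> I \<Longrightarrow> y \<in> PF \<Longrightarrow> y * x \<in> I"
  using ideal.I_l_closed[OF I_ideal] by simp

lemma I_rmult: "x \<in> I \<Longrightarrow> y \<in> PF \<Longrightarrow> x * y \<in> I"
  using ideal.I_r_closed[OF I_ideal] by simp

lemma I_sc: "x \<in> I \<Longrightarrow> sc c x \<in> I"
  unfolding sc_def by (rule I_lmult) (auto simp: CF_single zero_fword_def)

lemma I_uminus: "x \<in> I \<Longrightarrow> - x \<in> I"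
  using I_sc[of x "-1"] by (simp add: sc_uminus)

lemma I_minus: "x \<in> I \<Longrightarrow> y \<in> I \<Longrightarrow> x - y \<in> I"
  using I_add[OF _ I_uminus, of x y] by simp

lemma I_sum: "(\<And>i. i \<in> A \<Longrightarrow> f i \<in> I) \<Longrightarrow> sum f A \<in> I"
  by (induction A rule: infinite_finite_induct) (auto intro: I_zero I_add)

lemma I_trans: "x - y \<in> I \<Longrightarrow> y - z \<in> I \<Longrightarrow> x - z \<in> I"
  using I_add[of "x - y" "y - z"] by simp

lemma I_gen_add: "X \<in> GL \<Longrightarrow> Y \<in> GL \<Longrightarrow> gen (\<lambda>v. X v + Y v) - gen X - gen Y \<in> I"
  by (rule subsetD[OF rels_I], unfold rels_eq, rule UnI1, rule UnI1, rule CollectI, rule exI[of _ X], rule exI[of _ Y]) simp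

lemma I_gen_scale: "X \<in> GL \<Longrightarrow> gen (\<lambda>v. scale c (X v)) - sc c (gen X) \<in> I"
  by (rule subsetD[OF rels_I], unfold rels_eq, rule UnI1, rule UnI2, rule CollectI, rule exI[of _ c], rule exI[of _ X]) simp

lemma I_rel: "X \<in> GLd \<alpha> \<Longrightarrow> Y \<in> GLd \<beta> \<Longrightarrow> rel \<alpha> \<beta> X Y \<in> I"
  by (rule subsetD[OF rels_I], unfold rels_eq, rule UnI2, rule CollectI, intro exI[of _ X] exI[of _ Y] exI[of _ \<alpha>] exI[of _ \<beta>]) simp

lemma I_gen_zero: "gen (\<lambda>v. 0) \<in> I"
  using I_gen_scale[OF gl_zero, of 0] by simp

lemma cl_def: "cl x = (\<lambda>i. i + x) ` I"
  unfolding env_class_def a_r_coset_def' by auto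

lemma cl_eq: "x \<in> PF \<Longrightarrow> y \<in> PF \<Longrightarrow> cl x = cl y \<longleftrightarrow> x - y \<in> I"
proof
  assume "cl x = cl y"
  moreover have "x \<in> cl x" unfolding cl_def using I_zero by force
  ultimately obtain i where "i \<in> I" "x = i + y" unfolding cl_def by auto
  then show "x - y \<in> I" by simp
next
  assume d: "x - y \<in> I"
  show "cl x = cl y"
  proof (intro subset_antisym subsetI)
    fix z assume "z \<in> cl x"
    then obtain i where "i \<in> I" "z = i + x" by (auto simp: cl_def)
    then show "z \<in> cl y" unfolding cl_def using I_add[OF _ d] by (intro image_eqI[of _ _ "i + (x - y)"]) auto
  next
    fix z assume "z \<in> cl y"
    then obtain i where "i \<in> I" "z = i + y" by (auto simp: cl_def)
    then show "z \<in> cl x" unfolding cl_def using I_minus[OF _ d] by (intro image_eqI[of _ _ "i - (x - y)"]) auto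
  qed
qed

lemma cl_mem: "x \<in> cl x" unfolding cl_def using I_zero by force

lemma mem_cl: "y \<in> cl x \<Longrightarrow> x \<in> PF \<Longrightarrow> y \<in> PF \<and> cl y = cl x"
proof -
  assume "y \<in> cl x" and x: "x \<in> PF"
  then obtain i where i: "i \<in> I" "y = i + x" by (auto simp: cl_def)
  then have "y \<in> PF" using x I_CF CF_add by blast
  then show ?thesis using cl_eq x i by simp
qed

definition hw :: "'g \<Rightarrow> ('v \<Rightarrow> 'v) list \<Rightarrow> bool" where
  "hw \<alpha> Xs \<longleftrightarrow> (\<exists>ds. list_all2 (\<lambda>X d. X \<in> GLd d) Xs ds \<and> sum_list ds = \<alpha>)"

text \<open>Spanned by words in homogeneous letters. These subspaces do not grade the free algebra:
  other words are not covered, and a word in homogeneous letters among which the zero map occurs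
  lies in all of them. Both defects disappear modulo \<open>I\<close>.\<close>

definition hF :: "'g \<Rightarrow> (('v \<Rightarrow> 'v) fword \<Rightarrow>\<^sub>0 complex) set" where
  "hF \<alpha> = {x. \<forall>w\<in>Poly_Mapping.keys x. hw \<alpha> (letters w)}"

lemma env_alg_sel:
  "carrier (env_alg \<omega> scale V) = cl ` PF" "zero (env_alg \<omega> scale V) = cl 0" "one (env_alg \<omega> scale V) = cl 1"
  "grade (env_alg \<omega> scale V) \<alpha> = cl ` hF \<alpha>"
  "smult (env_alg \<omega> scale V) c u = (\<Union>x\<in>u. cl (sc c x))"
  "mult (env_alg \<omega> scale V) = mult (free_alg GL Quot I)" "add (env_alg \<omega> scale V) = add (free_alg GL Quot I)"
proof -
  have "a_rcosets\<^bsub>free_alg GL\<^esub> I = cl ` PF"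
    unfolding A_RCOSETS_def RCOSETS_def env_class_def a_r_coset_def by auto
  then show "carrier (env_alg \<omega> scale V) = cl ` PF" by (simp add: env_alg_def Let_def FactRing_def)
  have "I = cl 0" by (simp add: cl_def)
  then show "zero (env_alg \<omega> scale V) = cl 0" by (simp add: env_alg_def Let_def FactRing_def)
  show "one (env_alg \<omega> scale V) = cl 1" by (simp add: env_alg_def Let_def FactRing_def env_class_def)
  show "grade (env_alg \<omega> scale V) \<alpha> = cl ` hF \<alpha>" by (simp add: env_alg_def Let_def hF_def hw_def)
  show "smult (env_alg \<omega> scale V) c u = (\<Union>x\<in>u. cl (sc c x))" by (simp add: env_alg_def Let_def)
  show "mult (env_alg \<omega> scale V) = mult (free_alg GL Quot I)" "add (env_alg \<omega> scale V) = add (free_alg GL Quot I)"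
    by (simp_all add: env_alg_def Let_def)
qed

lemma env_sel0: "carrier U = carrier (env_alg \<omega> scale V)" "zero U = zero (env_alg \<omega> scale V)" "one U = one (env_alg \<omega> scale V)"
   "grade U = grade (env_alg \<omega> scale V)" "smult U = smult (env_alg \<omega> scale V)" "mult U = mult (env_alg \<omega> scale V)"
   "add U = add (env_alg \<omega> scale V)"
  by (simp_all add: env_def graded.defs hopf.defs)

lemma U_carrier: "carrier U = cl ` PF" and U_zero: "\<zero>\<^bsub>U\<^esub> = cl 0" and U_one: "\<one>\<^bsub>U\<^esub> = cl 1"
  and U_grade: "grade U \<alpha> = cl ` hF \<alpha>"
  by (simp_all add: env_sel0 env_alg_sel)

lemma cl_carrier: "x \<in> PF \<Longrightarrow> cl x \<in> carrier U"
  by (simp add: U_carrier)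

lemma cl_mult: "x \<in> PF \<Longrightarrow> y \<in> PF \<Longrightarrow> cl x \<otimes>\<^bsub>U\<^esub> cl y = cl (x * y)"
  using ring_hom_mult[OF ideal.rcos_ring_hom[OF I_ideal], of x y] by (simp only: env_sel0 env_alg_sel env_class_def free_alg_simps)

lemma cl_add: "x \<in> PF \<Longrightarrow> y \<in> PF \<Longrightarrow> cl x \<oplus>\<^bsub>U\<^esub> cl y = cl (x + y)"
  using ring_hom_add[OF ideal.rcos_ring_hom[OF I_ideal], of x y] by (simp only: env_sel0 env_alg_sel env_class_def free_alg_simps)

lemma cl_sc: "x \<in> PF \<Longrightarrow> c \<odot>\<^bsub>U\<^esub> cl x = cl (sc c x)"
proof -
  assume x: "x \<in> PF"
  have "cl (sc c y) = cl (sc c x)" if "y \<in> cl x" for y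
  proof -
    have y: "y \<in> PF" "cl y = cl x" using mem_cl[OF that x] by auto
    then have "sc c (y - x) \<in> I" using cl_eq[OF y(1) x] by (intro I_sc) blast
    then show ?thesis using cl_eq[OF CF_sc[OF y(1)] CF_sc[OF x]] by (simp only: sc_minus)
  qed
  then have "(\<Union>y\<in>cl x. cl (sc c y)) = (\<Union>y\<in>cl x. cl (sc c x))" by (intro SUP_cong refl)
  also have "\<dots> = cl (sc c x)" using cl_mem[of x] by (intro SUP_const) blast
  finally show ?thesis by (simp only: env_sel0 env_alg_sel)
qed

lemma U_cases: "u \<in> carrier U \<Longrightarrow> (\<And>x. x \<in> PF \<Longrightarrow> u = cl x \<Longrightarrow> thesis) \<Longrightarrow> thesis"
  by (auto simp: U_carrier)

lemma hw_Nil: "hw 0 []"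
  by (auto simp: hw_def)

lemma hw_Cons: "X \<in> GLd d \<Longrightarrow> hw \<alpha> Xs \<Longrightarrow> hw (d + \<alpha>) (X # Xs)"
proof -
  assume X: "X \<in> GLd d" and "hw \<alpha> Xs"
  then obtain ds where "list_all2 (\<lambda>X d. X \<in> GLd d) Xs ds" "sum_list ds = \<alpha>" by (auto simp: hw_def)
  then show ?thesis using X unfolding hw_def by (intro exI[of _ "d # ds"]) simp
qed

lemma hw_append: "hw \<alpha> Xs \<Longrightarrow> hw \<beta> Ys \<Longrightarrow> hw (\<alpha> + \<beta>) (Xs @ Ys)"
proof -
  assume "hw \<alpha> Xs" "hw \<beta> Ys"
  then obtain ds es where "list_all2 (\<lambda>X d. X \<in> GLd d) Xs ds" "sum_list ds = \<alpha>" "list_all2 (\<lambda>X d. X \<in> GLd d) Ys es" "sum_list es = \<beta>"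
    by (auto simp: hw_def)
  then show ?thesis unfolding hw_def by (intro exI[of _ "ds @ es"]) (simp add: list_all2_appendI)
qed

lemma hw_induct [consumes 1, case_names Nil Cons]:
  assumes "hw \<alpha> Xs" "P 0 []" "\<And>X d \<alpha> Xs. X \<in> GLd d \<Longrightarrow> hw \<alpha> Xs \<Longrightarrow> P \<alpha> Xs \<Longrightarrow> P (d + \<alpha>) (X # Xs)"
  shows "P \<alpha> Xs"
proof -
  obtain ds where "list_all2 (\<lambda>X d. X \<in> GLd d) Xs ds" "sum_list ds = \<alpha>" using assms(1) by (auto simp: hw_def)
  then show ?thesis
  proof (induction arbitrary: \<alpha> rule: list_all2_induct)
    case (Cons X Xs d ds)
    have "hw (sum_list ds) Xs" unfolding hw_def using Cons.hyps by blast
    from assms(3)[OF \<open>X \<in> GLd d\<close> this Cons.IH[OF refl]] show ?case using Cons.prems by simp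
  qed (use assms(2) in simp)
qed

lemma hw_GL: "hw \<alpha> Xs \<Longrightarrow> set Xs \<subseteq> GL"
  by (induction rule: hw_induct) (auto dest: GLd_GL)

lemma hF_CF: "x \<in> hF \<alpha> \<Longrightarrow> x \<in> PF"
  unfolding hF_def CF_iff using hw_GL by blast

lemma hF_zero: "0 \<in> hF \<alpha>" and hF_add: "x \<in> hF \<alpha> \<Longrightarrow> y \<in> hF \<alpha> \<Longrightarrow> x + y \<in> hF \<alpha>"
  and hF_sc: "x \<in> hF \<alpha> \<Longrightarrow> sc c x \<in> hF \<alpha>" and hF_one: "1 \<in> hF 0"
  using Poly_Mapping.keys_add[of x y] hw_Nil by (auto simp: hF_def in_keys_iff lookup_sc zero_fword_def lookup_one when_def)

lemma hF_single: "hw \<alpha> (letters w) \<Longrightarrow> Poly_Mapping.single w c \<in> hF \<alpha>"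
  by (auto simp: hF_def)

lemma hF_gen: "X \<in> GLd d \<Longrightarrow> gen X \<in> hF d"
  unfolding gen_def using hw_Cons[OF _ hw_Nil, of X d] by (intro hF_single) simp

lemma hF_sum: "(\<And>i. i \<in> A \<Longrightarrow> f i \<in> hF \<alpha>) \<Longrightarrow> sum f A \<in> hF \<alpha>"
  by (induction A rule: infinite_finite_induct) (auto intro: hF_zero hF_add)

lemma hF_uminus: "x \<in> hF \<alpha> \<Longrightarrow> - x \<in> hF \<alpha>"
  using hF_sc[of x \<alpha> "-1"] by (simp add: sc_uminus)

lemma hF_mult: "x \<in> hF \<alpha> \<Longrightarrow> y \<in> hF \<beta> \<Longrightarrow> x * y \<in> hF (\<alpha> + \<beta>)"
  using keys_mult[of x y] unfolding hF_def by (fastforce simp: plus_fword_def intro: hw_append)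

lemma hF_induct [consumes 1, case_names zero single add]:
  assumes "x \<in> hF \<alpha>" "P 0" "\<And>Xs c. hw \<alpha> Xs \<Longrightarrow> P (Poly_Mapping.single (Word Xs) c)"
    "\<And>x y. x \<in> hF \<alpha> \<Longrightarrow> y \<in> hF \<alpha> \<Longrightarrow> P x \<Longrightarrow> P y \<Longrightarrow> P (x + y)"
  shows "P x"
proof -
  have "A \<subseteq> Poly_Mapping.keys x \<Longrightarrow> (\<Sum>w\<in>A. Poly_Mapping.single w (Poly_Mapping.lookup x w)) \<in> hF \<alpha> \<and>
      P (\<Sum>w\<in>A. Poly_Mapping.single w (Poly_Mapping.lookup x w))" if "finite A" for A
    using that
  proof (induction A rule: finite_induct)
    case (insert w A)
    then have w: "hw \<alpha> (letters w)" using assms(1) by (auto simp: hF_def)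
    then have 1: "P (Poly_Mapping.single w c)" for c using assms(3)[OF w] by simp
    show ?case using insert assms(4)[OF hF_single[OF w] _ 1, of "\<Sum>w\<in>A. Poly_Mapping.single w (Poly_Mapping.lookup x w)"]
      by (auto intro!: hF_add hF_single w)
  qed (simp add: assms hF_zero)
  from this[of "Poly_Mapping.keys x"] show ?thesis using poly_sum_single[of x] by simp
qed

text \<open>The additive relations are applied along the finite set \<open>DD\<close>; the empty sum
  is covered by \<open>I_gen_zero\<close>.\<close>

lemma gen_hc_sum: "X \<in> GL \<Longrightarrow> gen X - (\<Sum>d\<in>DD. gen (hc d X)) \<in> I"
proof -
  assume X: "X \<in> GL"
  have "finite A \<Longrightarrow> (\<lambda>v. \<Sum>d\<in>A. hc d X v) \<in> GL \<and> gen (\<lambda>v. \<Sum>d\<in>A. hc d X v) - (\<Sum>d\<in>A. gen (hc d X)) \<in> I" for A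
  proof (induction A rule: finite_induct)
    case empty
    then show ?case using I_gen_zero gl_zero by simp
  next
    case (insert d A)
    have h: "hc d X \<in> GL" by (rule GLd_GL[OF hc_GLd[OF X]])
    have "gen (\<lambda>v. hc d X v + (\<Sum>d\<in>A. hc d X v)) - gen (hc d X) - gen (\<lambda>v. \<Sum>d\<in>A. hc d X v) \<in> I"
      using insert h by (intro I_gen_add) auto
    then have "(gen (\<lambda>v. hc d X v + (\<Sum>d\<in>A. hc d X v)) - gen (hc d X) - gen (\<lambda>v. \<Sum>d\<in>A. hc d X v))
       + (gen (\<lambda>v. \<Sum>d\<in>A. hc d X v) - (\<Sum>d\<in>A. gen (hc d X))) \<in> I"
      using insert by (intro I_add) auto
    then show ?case using insert h gl_plus[OF h, of "\<lambda>v. \<Sum>d\<in>A. hc d X v"] by (simp add: diff_diff_eq)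
  qed
  from this[of DD] show ?thesis using hc_sum[OF X] by simp
qed

text \<open>Each letter of a word is replaced, modulo \<open>I\<close>, by the sum of its
  homogeneous components, and the product is multiplied out.\<close>

lemma hdec: "x \<in> PF \<Longrightarrow> \<exists>xs. set xs \<subseteq> (\<Union>\<alpha>. hF \<alpha>) \<and> x - sum_list xs \<in> I"
proof (induction rule: CF_induct)
  case zero
  then show ?case using I_zero by (intro exI[of _ "[]"]) simp
next
  case (single w c)
  have "\<exists>xs. set xs \<subseteq> (\<Union>\<alpha>. hF \<alpha>) \<and> Poly_Mapping.single (Word Xs) c - sum_list xs \<in> I" if "set Xs \<subseteq> GL" for Xs
    using that
  proof (induction Xs)
    case Nil
    then show ?case using I_zero hF_sc[OF hF_one] by (intro exI[of _ "[sc c 1]"]) (auto simp: single_Nil)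
  next
    case (Cons X Xs)
    then obtain xs where xs: "set xs \<subseteq> (\<Union>\<alpha>. hF \<alpha>)" "Poly_Mapping.single (Word Xs) c - sum_list xs \<in> I" by auto
    have X: "X \<in> GL" using Cons by auto
    have xsC: "sum_list xs \<in> PF"
      using xs(1) by (induction xs) (auto intro: CF_zero CF_add hF_CF)
    obtain ds where ds: "set ds = DD" "distinct ds" using finite_distinct_list[OF DD_finite] by blast
    let ?ys = "concat (map (\<lambda>d. map (\<lambda>x. gen (hc d X) * x) xs) ds)"
    have "set ?ys \<subseteq> (\<Union>\<alpha>. hF \<alpha>)"
    proof
      fix y assume "y \<in> set ?ys"
      then obtain d x where y: "y = gen (hc d X) * x" "x \<in> set xs" by auto
      then obtain \<alpha> where "x \<in> hF \<alpha>" using xs(1) by blast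
      then have "y \<in> hF (d + \<alpha>)" unfolding y(1) by (rule hF_mult[OF hF_gen[OF hc_GLd[OF X]]])
      then show "y \<in> (\<Union>\<alpha>. hF \<alpha>)" by blast
    qed
    moreover have "sum_list ?ys = (\<Sum>d\<in>DD. gen (hc d X)) * sum_list xs"
    proof -
      have "sum_list ?ys = (\<Sum>d\<leftarrow>ds. gen (hc d X)) * sum_list xs"
        by (induction ds) (simp_all add: sum_list_const_mult distrib_right)
      then show ?thesis using sum.distinct_set_conv_list[OF ds(2), of "\<lambda>d. gen (hc d X)"] ds(1) by simp
    qed
    moreover have "Poly_Mapping.single (Word (X # Xs)) c - (\<Sum>d\<in>DD. gen (hc d X)) * sum_list xs \<in> I"
    proof -
      have "gen X * (Poly_Mapping.single (Word Xs) c - sum_list xs) + (gen X - (\<Sum>d\<in>DD. gen (hc d X))) * sum_list xs \<in> I"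
        by (intro I_add I_lmult I_rmult xs(2) gen_hc_sum X CF_gen xsC)
      then show ?thesis by (simp add: single_Cons algebra_simps)
    qed
    ultimately show ?case by (intro exI[of _ ?ys]) simp
  qed
  from this[of "letters w"] single show ?case by simp
next
  case (add x y)
  then obtain xs ys where "set xs \<subseteq> (\<Union>\<alpha>. hF \<alpha>)" "x - sum_list xs \<in> I" "set ys \<subseteq> (\<Union>\<alpha>. hF \<alpha>)" "y - sum_list ys \<in> I"
    by blast
  then show ?case using I_add[of "x - sum_list xs" "y - sum_list ys"]
    by (intro exI[of _ "xs @ ys"]) (simp add: algebra_simps)
qed

end

text \<open>Actions of the enveloping algebra on graded spaces of elements of the free algebra, where the
  degree of a component is recorded as an index; the relations hold modulo the ideal \<open>I\<close>.\<close>

locale grep = gvs \<omega> scale V n e \<gamma> for \<omega> :: "'g::ab_group_add \<Rightarrow> 'g \<Rightarrow> complex"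
  and scale :: "complex \<Rightarrow> 'v::ab_group_add \<Rightarrow> 'v" and V n e \<gamma> +
  fixes m :: "'g \<Rightarrow> ('v \<Rightarrow> 'v) \<Rightarrow> 'g \<Rightarrow> (('v \<Rightarrow> 'v) fword \<Rightarrow>\<^sub>0 complex) \<Rightarrow> ('v \<Rightarrow> 'v) fword \<Rightarrow>\<^sub>0 complex"
  assumes m_hF: "X \<in> GLd d \<Longrightarrow> x \<in> hF \<kappa> \<Longrightarrow> m d X \<kappa> x \<in> hF (\<kappa> + d)"
    and m_I: "X \<in> GLd d \<Longrightarrow> x \<in> I \<Longrightarrow> m d X \<kappa> x \<in> I"
    and m_add: "m d X \<kappa> (x + y) = m d X \<kappa> x + m d X \<kappa> y"
    and m_sc: "m d X \<kappa> (sc c x) = sc c (m d X \<kappa> x)"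
    and m_lin1: "X \<in> GLd d \<Longrightarrow> Y \<in> GLd d \<Longrightarrow> x \<in> hF \<kappa> \<Longrightarrow> m d (\<lambda>v. X v + Y v) \<kappa> x - m d X \<kappa> x - m d Y \<kappa> x \<in> I"
    and m_lin2: "X \<in> GLd d \<Longrightarrow> x \<in> hF \<kappa> \<Longrightarrow> m d (\<lambda>v. scale c (X v)) \<kappa> x - sc c (m d X \<kappa> x) \<in> I"
    and m_brk: "X \<in> GLd a \<Longrightarrow> Y \<in> GLd b \<Longrightarrow> x \<in> hF \<kappa> \<Longrightarrow> m a X (\<kappa> + b) (m b Y \<kappa> x)
       - sc (\<omega> a b) (m b Y (\<kappa> + a) (m a X \<kappa> x)) - m (a + b) (brk a b X Y) \<kappa> x \<in> I"
begin

lemma m_0: "m d X \<kappa> 0 = 0"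
  using m_sc[of d X \<kappa> 0 0] by simp

lemma m_minus: "m d X \<kappa> (x - y) = m d X \<kappa> x - m d X \<kappa> y"
  using m_add[of d X \<kappa> "x - y" y] by simp

lemma m_zero: "x \<in> hF \<kappa> \<Longrightarrow> m d (\<lambda>v. 0) \<kappa> x \<in> I"
  using m_lin2[OF GLd_zero, of x \<kappa> d 0] by simp


definition gC :: "('g \<Rightarrow> ('v \<Rightarrow> 'v) fword \<Rightarrow>\<^sub>0 complex) set" where
  "gC = {p. (\<forall>\<kappa>. p \<kappa> \<in> hF \<kappa>) \<and> finite {\<kappa>. p \<kappa> \<noteq> 0}}"

definition gK :: "('g \<Rightarrow> ('v \<Rightarrow> 'v) fword \<Rightarrow>\<^sub>0 complex) set" where
  "gK = {p \<in> gC. \<forall>\<kappa>. p \<kappa> \<in> I}"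

text \<open>The component of degree \<open>d\<close> of a letter raises the index by
  \<open>d\<close>, so the new entry at \<kappa> collects contributions from the indices \<kappa> -
  d.\<close>

definition gr :: "('v \<Rightarrow> 'v) \<Rightarrow> ('g \<Rightarrow> ('v \<Rightarrow> 'v) fword \<Rightarrow>\<^sub>0 complex) \<Rightarrow> 'g \<Rightarrow> ('v \<Rightarrow> 'v) fword \<Rightarrow>\<^sub>0 complex" where
  "gr X p = (\<lambda>\<kappa>. \<Sum>d\<in>DD. m d (hc d X) (\<kappa> - d) (p (\<kappa> - d)))"

lemma gC_add: "p \<in> gC \<Longrightarrow> q \<in> gC \<Longrightarrow> p + q \<in> gC"
proof -
  assume p: "p \<in> gC" and q: "q \<in> gC"
  have "{\<kappa>. (p + q) \<kappa> \<noteq> 0} \<subseteq> {\<kappa>. p \<kappa> \<noteq> 0} \<union> {\<kappa>. q \<kappa> \<noteq> 0}" by (auto simp: fun_app)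
  moreover have "finite ({\<kappa>. p \<kappa> \<noteq> 0} \<union> {\<kappa>. q \<kappa> \<noteq> 0})" using p q by (simp add: gC_def)
  ultimately have "finite {\<kappa>. (p + q) \<kappa> \<noteq> 0}" by (rule finite_subset)
  then show ?thesis using p q by (simp add: gC_def hF_add fun_app)
qed

lemma gC_sc: "p \<in> gC \<Longrightarrow> (\<lambda>\<kappa>. sc c (p \<kappa>)) \<in> gC"
proof -
  assume p: "p \<in> gC"
  have "{\<kappa>. sc c (p \<kappa>) \<noteq> 0} \<subseteq> {\<kappa>. p \<kappa> \<noteq> 0}" by auto
  then have "finite {\<kappa>. sc c (p \<kappa>) \<noteq> 0}" using p by (auto simp: gC_def intro: finite_subset)
  then show ?thesis using p by (simp add: gC_def hF_sc)
qed

lemma gr_gC: "X \<in> GL \<Longrightarrow> p \<in> gC \<Longrightarrow> gr X p \<in> gC"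
proof -
  assume X: "X \<in> GL" and p: "p \<in> gC"
  have "{\<kappa>. gr X p \<kappa> \<noteq> 0} \<subseteq> (\<Union>d\<in>DD. (\<lambda>\<kappa>. \<kappa> + d) ` {\<kappa>. p \<kappa> \<noteq> 0})"
  proof
    fix \<kappa> assume "\<kappa> \<in> {\<kappa>. gr X p \<kappa> \<noteq> 0}"
    then obtain d where d: "d \<in> DD" "m d (hc d X) (\<kappa> - d) (p (\<kappa> - d)) \<noteq> 0"
      unfolding gr_def by (auto elim: sum.not_neutral_contains_not_neutral)
    then have "p (\<kappa> - d) \<noteq> 0" using m_0 by auto
    then show "\<kappa> \<in> (\<Union>d\<in>DD. (\<lambda>\<kappa>. \<kappa> + d) ` {\<kappa>. p \<kappa> \<noteq> 0})" using d(1) by (auto intro!: bexI[of _ d] image_eqI[of _ _ "\<kappa> - d"])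
  qed
  moreover have "finite (\<Union>d\<in>DD. (\<lambda>\<kappa>. \<kappa> + d) ` {\<kappa>. p \<kappa> \<noteq> 0})" using p by (auto simp: gC_def)
  ultimately have "finite {\<kappa>. gr X p \<kappa> \<noteq> 0}" by (rule finite_subset)
  moreover have "gr X p \<kappa> \<in> hF \<kappa>" for \<kappa>
    unfolding gr_def
  proof (rule hF_sum)
    fix d show "m d (hc d X) (\<kappa> - d) (p (\<kappa> - d)) \<in> hF \<kappa>"
      using m_hF[OF hc_GLd[OF X], of "p (\<kappa> - d)" "\<kappa> - d" d] p by (simp add: gC_def)
  qed
  ultimately show ?thesis by (simp add: gC_def)
qed

lemma gr_I: "X \<in> GL \<Longrightarrow> (\<And>\<kappa>. p \<kappa> \<in> I) \<Longrightarrow> gr X p \<kappa> \<in> I"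
  unfolding gr_def by (intro I_sum m_I hc_GLd) auto

text \<open>All other components of \<open>X\<close> are the zero map, whose action lands in
  \<open>I\<close>. If \<open>a\<close> is not in \<open>DD\<close>, then \<open>X\<close> itself is
  zero and both terms lie in \<open>I\<close>.\<close>

lemma gr_hom: "X \<in> GLd a \<Longrightarrow> p \<in> gC \<Longrightarrow> gr X p \<kappa> - m a X (\<kappa> - a) (p (\<kappa> - a)) \<in> I"
proof -
  assume X: "X \<in> GLd a" and p: "p \<in> gC"
  have ph: "p \<kappa> \<in> hF \<kappa>" for \<kappa> using p by (simp add: gC_def)
  have z: "m d (hc d X) (\<kappa> - d) (p (\<kappa> - d)) \<in> I" if "d \<noteq> a" for d
    using that by (simp add: hc_hom[OF X] m_zero ph)
  show ?thesis
  proof (cases "a \<in> DD")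
    case True
    have "gr X p \<kappa> = m a X (\<kappa> - a) (p (\<kappa> - a)) + (\<Sum>d\<in>DD - {a}. m d (hc d X) (\<kappa> - d) (p (\<kappa> - d)))"
      unfolding gr_def by (subst sum.remove[OF DD_finite True]) (simp add: hc_hom[OF X])
    then show ?thesis using I_sum[of "DD - {a}" "\<lambda>d. m d (hc d X) (\<kappa> - d) (p (\<kappa> - d))"] z by simp
  next
    case False
    have "gr X p \<kappa> \<in> I" unfolding gr_def by (rule I_sum, rule z) (use False in auto)
    moreover have "m a X (\<kappa> - a) (p (\<kappa> - a)) \<in> I" using DD_hom[OF X False] m_zero ph by simp
    ultimately show ?thesis by (rule I_minus)
  qed
qed

sublocale R: frep "\<lambda>c p \<kappa>. sc c (p \<kappa>)" GL gC gK gr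
proof
  fix a b :: complex and p q :: "'g \<Rightarrow> ('v \<Rightarrow> 'v) fword \<Rightarrow>\<^sub>0 complex" and X
  show "(\<lambda>\<kappa>. sc a ((p + q) \<kappa>)) = (\<lambda>\<kappa>. sc a (p \<kappa>)) + (\<lambda>\<kappa>. sc a (q \<kappa>))" by (simp add: fun_eq_iff fun_app sc_add)
  show "(\<lambda>\<kappa>. sc (a + b) (p \<kappa>)) = (\<lambda>\<kappa>. sc a (p \<kappa>)) + (\<lambda>\<kappa>. sc b (p \<kappa>))" by (simp add: fun_eq_iff fun_app sc_add)
  show "(\<lambda>\<kappa>. sc a (sc b (p \<kappa>))) = (\<lambda>\<kappa>. sc (a * b) (p \<kappa>))" by (simp add: sc_sc)
  show "(\<lambda>\<kappa>. sc 1 (p \<kappa>)) = p" by simp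
  show "0 \<in> gK" by (simp add: gK_def gC_def fun_app I_zero hF_zero)
  show "gK \<subseteq> gC" by (auto simp: gK_def)
  show "p + q \<in> gC" if "p \<in> gC" "q \<in> gC" using that by (rule gC_add)
  show "(\<lambda>\<kappa>. sc a (p \<kappa>)) \<in> gC" if "p \<in> gC" using that by (rule gC_sc)
  show "p + q \<in> gK" if "p \<in> gK" "q \<in> gK" using that by (auto simp: gK_def gC_add fun_app I_add)
  show "(\<lambda>\<kappa>. sc a (p \<kappa>)) \<in> gK" if "p \<in> gK" using that by (auto simp: gK_def gC_sc I_sc)
  show "gr X p \<in> gC" if "X \<in> GL" "p \<in> gC" using that by (rule gr_gC)
  show "gr X p \<in> gK" if "X \<in> GL" "p \<in> gK" using that gr_I gr_gC by (auto simp: gK_def)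
  show "gr X (p + q) = gr X p + gr X q" by (simp add: fun_eq_iff fun_app gr_def m_add sum.distrib)
  show "gr X (\<lambda>\<kappa>. sc a (p \<kappa>)) = (\<lambda>\<kappa>. sc a (gr X p \<kappa>))" by (simp add: gr_def m_sc sc_sum)
qed

text \<open>The three families of relations correspond to \<open>m_lin1\<close>,
  \<open>m_lin2\<close> and \<open>m_brk\<close>. For the third one, \<open>gr_hom\<close> is used
  twice to replace the iterated action by the iterated maps \<open>m\<close>, modulo
  \<open>I\<close>.\<close>

lemma R_rel: "x \<in> env_relations \<omega> scale V \<Longrightarrow> p \<in> gC \<Longrightarrow> R.act x p \<in> gK"
proof -
  assume x: "x \<in> env_relations \<omega> scale V" and p: "p \<in> gC"
  have ph: "p \<kappa> \<in> hF \<kappa>" for \<kappa> using p by (simp add: gC_def)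
  have xC: "x \<in> PF" using x rels_CF by blast
  have "R.act x p \<kappa> \<in> I" for \<kappa>
  proof -
    from x consider (add) X Y where "x = gen (\<lambda>v. X v + Y v) - gen X - gen Y" "X \<in> GL" "Y \<in> GL"
      | (scale) c X where "x = gen (\<lambda>v. scale c (X v)) - sc c (gen X)" "X \<in> GL"
      | (brk) X Y \<alpha> \<beta> where "x = rel \<alpha> \<beta> X Y" "X \<in> GLd \<alpha>" "Y \<in> GLd \<beta>"
      unfolding rels_eq by blast
    then show ?thesis
    proof cases
      case add
      have "R.act x p \<kappa> = (\<Sum>d\<in>DD. m d (\<lambda>v. hc d X v + hc d Y v) (\<kappa> - d) (p (\<kappa> - d)) - m d (hc d X) (\<kappa> - d) (p (\<kappa> - d)) - m d (hc d Y) (\<kappa> - d) (p (\<kappa> - d)))"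
        unfolding add(1) R.act_minus R.act_gen by (simp add: gr_def hc_add sum_subtractf)
      also have "\<dots> \<in> I" by (intro I_sum m_lin1 hc_GLd add ph)
      finally show ?thesis .
    next
      case scale
      have "R.act x p \<kappa> = (\<Sum>d\<in>DD. m d (\<lambda>v. scale c (hc d X v)) (\<kappa> - d) (p (\<kappa> - d)) - sc c (m d (hc d X) (\<kappa> - d) (p (\<kappa> - d))))"
        unfolding scale(1) R.act_minus R.act_gen R.act_sc by (simp add: gr_def hc_scale sum_subtractf sc_sum)
      also have "\<dots> \<in> I" by (intro I_sum m_lin2 hc_GLd scale ph)
      finally show ?thesis .
    next
      case brk
      note X = brk(2) and Y = brk(3)
      note XG = GLd_GL[OF X] and YG = GLd_GL[OF Y]
      \<comment> \<open>The index from which both orders of the two letters, and their bracket,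
        arrive at \<kappa>.\<close>
      define k where "k = \<kappa> - \<alpha> - \<beta>"
      have k: "\<kappa> - \<alpha> = k + \<beta>" "\<kappa> - \<beta> = k + \<alpha>" "\<kappa> - (\<alpha> + \<beta>) = k" by (simp_all add: k_def algebra_simps)
      have 1: "gr X (gr Y p) \<kappa> - m \<alpha> X (k + \<beta>) (m \<beta> Y k (p k)) \<in> I"
      proof (rule I_trans)
        show "gr X (gr Y p) \<kappa> - m \<alpha> X (k + \<beta>) (gr Y p (k + \<beta>)) \<in> I"
          using gr_hom[OF X gr_gC[OF YG p], of \<kappa>] by (simp add: k)
        show "m \<alpha> X (k + \<beta>) (gr Y p (k + \<beta>)) - m \<alpha> X (k + \<beta>) (m \<beta> Y k (p k)) \<in> I"
          using m_I[OF X gr_hom[OF Y p, of "k + \<beta>"], of "k + \<beta>"] by (simp add: m_minus)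
      qed
      have 2: "gr Y (gr X p) \<kappa> - m \<beta> Y (k + \<alpha>) (m \<alpha> X k (p k)) \<in> I"
      proof (rule I_trans)
        show "gr Y (gr X p) \<kappa> - m \<beta> Y (k + \<alpha>) (gr X p (k + \<alpha>)) \<in> I"
          using gr_hom[OF Y gr_gC[OF XG p], of \<kappa>] by (simp add: k)
        show "m \<beta> Y (k + \<alpha>) (gr X p (k + \<alpha>)) - m \<beta> Y (k + \<alpha>) (m \<alpha> X k (p k)) \<in> I"
          using m_I[OF Y gr_hom[OF X p, of "k + \<alpha>"], of "k + \<alpha>"] by (simp add: m_minus)
      qed
      have 3: "gr (brk \<alpha> \<beta> X Y) p \<kappa> - m (\<alpha> + \<beta>) (brk \<alpha> \<beta> X Y) k (p k) \<in> I"
        using gr_hom[OF GLd_brk[OF X Y] p, of \<kappa>] by (simp add: k)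
      have "R.act x p \<kappa> = gr X (gr Y p) \<kappa> - sc (\<omega> \<alpha> \<beta>) (gr Y (gr X p) \<kappa>) - gr (brk \<alpha> \<beta> X Y) p \<kappa>"
        unfolding brk(1) rel_def R.act_minus R.act_sc
        by (simp add: R.act_mult CF_gen XG YG p R.act_gen)
      also have "\<dots> = (gr X (gr Y p) \<kappa> - m \<alpha> X (k + \<beta>) (m \<beta> Y k (p k)))
        - sc (\<omega> \<alpha> \<beta>) (gr Y (gr X p) \<kappa> - m \<beta> Y (k + \<alpha>) (m \<alpha> X k (p k)))
        - (gr (brk \<alpha> \<beta> X Y) p \<kappa> - m (\<alpha> + \<beta>) (brk \<alpha> \<beta> X Y) k (p k))
        + (m \<alpha> X (k + \<beta>) (m \<beta> Y k (p k)) - sc (\<omega> \<alpha> \<beta>) (m \<beta> Y (k + \<alpha>) (m \<alpha> X k (p k))) - m (\<alpha> + \<beta>) (brk \<alpha> \<beta> X Y) k (p k))"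
        by (simp add: sc_minus)
      also have "\<dots> \<in> I" by (intro I_add I_minus I_sc 1 2 3 m_brk X Y ph)
      finally show ?thesis .
    qed
  qed
  then show ?thesis using R.act_C[OF xC p] by (simp add: gK_def)
qed

definition T :: "(('v \<Rightarrow> 'v) fword \<Rightarrow>\<^sub>0 complex) \<Rightarrow> 'g \<Rightarrow> ('v \<Rightarrow> 'v) fword \<Rightarrow>\<^sub>0 complex" where
  "T x = R.act x (\<lambda>\<kappa>. if \<kappa> = 0 then 1 else 0)"

lemma unit_gC: "(\<lambda>\<kappa>. if \<kappa> = 0 then 1 else 0) \<in> gC"
  by (auto simp: gC_def hF_one hF_zero)

lemma T_gC: "x \<in> PF \<Longrightarrow> T x \<in> gC"
  unfolding T_def by (rule R.act_C[OF _ unit_gC])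

lemma T_hF: "x \<in> PF \<Longrightarrow> T x \<kappa> \<in> hF \<kappa>" and T_finite: "x \<in> PF \<Longrightarrow> finite {\<kappa>. T x \<kappa> \<noteq> 0}"
  using T_gC[of x] by (auto simp: gC_def)

lemma T_I: "x \<in> I \<Longrightarrow> T x \<kappa> \<in> I"
proof -
  assume x: "x \<in> I"
  have "T x \<in> gK" unfolding T_def
    by (rule R.act_kill[OF rels_CF _ x[unfolded env_ideal_def] unit_gC]) (rule R_rel)
  then show ?thesis by (simp add: gK_def)
qed

lemma T_add: "T (x + y) \<kappa> = T x \<kappa> + T y \<kappa>" and T_minus: "T (x - y) \<kappa> = T x \<kappa> - T y \<kappa>"
  and T_sc: "T (sc c x) \<kappa> = sc c (T x \<kappa>)" and T_one: "T 1 \<kappa> = (if \<kappa> = 0 then 1 else 0)" and T_0: "T 0 \<kappa> = 0"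
  by (simp_all add: T_def R.act_add R.act_minus R.act_sc R.act_one R.act_zero fun_app)

lemma T_gen: "X \<in> GLd d \<Longrightarrow> x \<in> PF \<Longrightarrow> T (gen X * x) \<kappa> - m d X (\<kappa> - d) (T x (\<kappa> - d)) \<in> I"
  unfolding T_def using gr_hom[OF _ R.act_C[OF _ unit_gC]]
  by (subst R.act_mult[OF CF_gen _ unit_gC]) (auto simp: R.act_gen dest: GLd_GL)

text \<open>Each homogeneous letter shifts the index by its degree, up to elements of
  \<open>I\<close>, starting from index 0. Hence a word of degree \<alpha> produces only the
  component at \<alpha>, modulo \<open>I\<close>.\<close>

lemma T_conc: "x \<in> hF \<alpha> \<Longrightarrow> \<kappa> \<noteq> \<alpha> \<Longrightarrow> T x \<kappa> \<in> I"
proof (induction rule: hF_induct)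
  case zero
  then show ?case by (simp add: T_0 I_zero)
next
  case (single Xs c)
  then show ?case
  proof (induction arbitrary: \<kappa> rule: hw_induct)
    case Nil
    then show ?case by (simp add: single_Nil T_sc T_one I_zero)
  next
    case (Cons X d \<alpha> Xs)
    have Xs: "Poly_Mapping.single (Word Xs) c \<in> PF" using hw_GL[OF Cons(2)] by (simp add: CF_single)
    have "\<kappa> - d \<noteq> \<alpha>" using Cons.prems by (auto simp: algebra_simps)
    from m_I[OF Cons(1) Cons.IH[OF this]]
    have "m d X (\<kappa> - d) (T (Poly_Mapping.single (Word Xs) c) (\<kappa> - d)) \<in> I" .
    from I_add[OF T_gen[OF Cons(1) Xs, of \<kappa>] this] show ?case by (simp add: single_Cons)
  qed
next
  case (add x y)
  then show ?case by (simp add: T_add I_add)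
qed

end

context gvs
begin

text \<open>The component of degree \<open>\<kappa>\<close> of an element \<open>x\<close> of the free algebra is read off from the action of \<open>x\<close>
  on the family with \<open>1\<close> in degree \<open>0\<close>, where letters act by left multiplication.\<close>

interpretation PI: grep \<omega> scale V n e \<gamma> "\<lambda>d X \<kappa> x. gen X * x"
proof
  fix X Y and a b d \<kappa> :: 'g and c :: complex and x y :: "('v \<Rightarrow> 'v) fword \<Rightarrow>\<^sub>0 complex"
  show "gen X * x \<in> hF (\<kappa> + d)" if "X \<in> GLd d" "x \<in> hF \<kappa>"
    using hF_mult[OF hF_gen[OF that(1)] that(2)] by (simp add: add.commute)
  show "gen X * x \<in> I" if "X \<in> GLd d" "x \<in> I"
    using I_lmult[OF that(2) CF_gen[OF GLd_GL[OF that(1)]]] .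
  show "gen X * (x + y) = gen X * x + gen X * y" by (simp add: distrib_left)
  show "gen X * sc c x = sc c (gen X * x)" by (rule sc_mult2)
  show "gen (\<lambda>v. X v + Y v) * x - gen X * x - gen Y * x \<in> I" if "X \<in> GLd d" "Y \<in> GLd d" "x \<in> hF \<kappa>"
    using I_rmult[OF I_gen_add[OF GLd_GL[OF that(1)] GLd_GL[OF that(2)]] hF_CF[OF that(3)]] by (simp add: left_diff_distrib)
  show "gen (\<lambda>v. scale c (X v)) * x - sc c (gen X * x) \<in> I" if "X \<in> GLd d" "x \<in> hF \<kappa>"
    using I_rmult[OF I_gen_scale[OF GLd_GL[OF that(1)]] hF_CF[OF that(2)]] by (simp add: left_diff_distrib sc_mult1)
  show "gen X * (gen Y * x) - sc (\<omega> a b) (gen Y * (gen X * x)) - gen (brk a b X Y) * x \<in> I"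
    if "X \<in> GLd a" "Y \<in> GLd b" "x \<in> hF \<kappa>"
    using I_rmult[OF I_rel[OF that(1,2)] hF_CF[OF that(3)]] by (simp add: rel_def left_diff_distrib sc_mult1 mult.assoc)
qed

text \<open>Acting on \<open>1\<close>, this twisted right multiplication produces the antipode.\<close>

lemma SI_grep: "grep \<omega> scale V n e \<gamma> (\<lambda>d X \<kappa> x. sc (- \<omega> d \<kappa>) (x * gen X))"
proof
  fix X Y and a b d \<kappa> :: 'g and c :: complex and x y :: "('v \<Rightarrow> 'v) fword \<Rightarrow>\<^sub>0 complex"
  show "sc (- \<omega> d \<kappa>) (x * gen X) \<in> hF (\<kappa> + d)" if "X \<in> GLd d" "x \<in> hF \<kappa>"
    by (rule hF_sc[OF hF_mult[OF that(2) hF_gen[OF that(1)]]])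
  show "sc (- \<omega> d \<kappa>) (x * gen X) \<in> I" if "X \<in> GLd d" "x \<in> I"
    by (rule I_sc[OF I_rmult[OF that(2) CF_gen[OF GLd_GL[OF that(1)]]]])
  show "sc (- \<omega> d \<kappa>) ((x + y) * gen X) = sc (- \<omega> d \<kappa>) (x * gen X) + sc (- \<omega> d \<kappa>) (y * gen X)"
    by (simp add: distrib_right sc_add)
  show "sc (- \<omega> d \<kappa>) (sc c x * gen X) = sc c (sc (- \<omega> d \<kappa>) (x * gen X))"
    by (simp add: sc_mult1 sc_sc mult.commute)
  show "sc (- \<omega> d \<kappa>) (x * gen (\<lambda>v. X v + Y v)) - sc (- \<omega> d \<kappa>) (x * gen X) - sc (- \<omega> d \<kappa>) (x * gen Y) \<in> I"
    if "X \<in> GLd d" "Y \<in> GLd d" "x \<in> hF \<kappa>"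
    using I_sc[OF I_lmult[OF I_gen_add[OF GLd_GL[OF that(1)] GLd_GL[OF that(2)]] hF_CF[OF that(3)]], of "- \<omega> d \<kappa>"]
    by (simp add: right_diff_distrib sc_minus)
  show "sc (- \<omega> d \<kappa>) (x * gen (\<lambda>v. scale c (X v))) - sc c (sc (- \<omega> d \<kappa>) (x * gen X)) \<in> I" if "X \<in> GLd d" "x \<in> hF \<kappa>"
    using I_sc[OF I_lmult[OF I_gen_scale[OF GLd_GL[OF that(1)]] hF_CF[OF that(2)]], of "- \<omega> d \<kappa>"]
    by (simp add: right_diff_distrib sc_minus sc_mult2 sc_sc mult.commute)
  show "sc (- \<omega> a (\<kappa> + b)) (sc (- \<omega> b \<kappa>) (x * gen Y) * gen X) - sc (\<omega> a b) (sc (- \<omega> b (\<kappa> + a)) (sc (- \<omega> a \<kappa>) (x * gen X) * gen Y))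
     - sc (- \<omega> (a + b) \<kappa>) (x * gen (brk a b X Y)) \<in> I"
    if "X \<in> GLd a" "Y \<in> GLd b" "x \<in> hF \<kappa>"
  proof -
    \<comment> \<open>The expression to be placed in \<open>I\<close> equals this element; the two
      identities for \<omega> that follow bring the coefficients of the two words into the form
      occurring in \<open>rel\<close>.\<close>
    have "sc (\<omega> (a + b) \<kappa>) (x * rel a b X Y) * (- 1) \<in> I"
      using I_uminus[OF I_sc[OF I_lmult[OF I_rel[OF that(1,2)] hF_CF[OF that(3)]], of "\<omega> (a + b) \<kappa>"]] by simp
    moreover have "\<omega> a b * (\<omega> b (\<kappa> + a) * \<omega> a \<kappa>) = \<omega> (a + b) \<kappa>"
      using om_swap_mult[of a b] by (simp add: om_add mult_ac)
    moreover have "\<omega> a (\<kappa> + b) * \<omega> b \<kappa> = \<omega> (a + b) \<kappa> * \<omega> a b" by (simp add: om_add mult_ac)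
    ultimately show ?thesis
      by (simp add: rel_def sc_minus sc_mult1 sc_mult2 sc_sc sc_uminus sc_add algebra_simps)
  qed
qed

section \<open>The grading of the enveloping algebra\<close>

lemma PI_self: "x \<in> hF \<alpha> \<Longrightarrow> PI.T x \<alpha> - x \<in> I"
proof (induction rule: hF_induct)
  case zero
  then show ?case by (simp add: PI.T_0 I_zero)
next
  case (single Xs c)
  then show ?case
  proof (induction rule: hw_induct)
    case Nil
    then show ?case by (simp add: single_Nil PI.T_sc PI.T_one I_zero)
  next
    case (Cons X d \<alpha> Xs)
    have Xs: "Poly_Mapping.single (Word Xs) c \<in> PF" using hw_GL[OF Cons(2)] by (simp add: CF_single)
    have "PI.T (gen X * Poly_Mapping.single (Word Xs) c) (d + \<alpha>) - gen X * PI.T (Poly_Mapping.single (Word Xs) c) \<alpha> \<in> I"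
      using PI.T_gen[OF Cons(1) Xs, of "d + \<alpha>"] by simp
    moreover have "gen X * PI.T (Poly_Mapping.single (Word Xs) c) \<alpha> - gen X * Poly_Mapping.single (Word Xs) c \<in> I"
      using I_lmult[OF Cons.IH CF_gen[OF GLd_GL[OF Cons(1)]]] by (simp add: right_diff_distrib)
    ultimately show ?case unfolding single_Cons by (rule I_trans)
  qed
next
  case (add x y)
  have "PI.T (x + y) \<alpha> - (x + y) = (PI.T x \<alpha> - x) + (PI.T y \<alpha> - y)" by (simp add: PI.T_add)
  then show ?case using add by (simp only: I_add)
qed

text \<open>Stated for all sufficiently large finite sets of degrees, so that summands can be added
  without comparing their supports. The claim holds for a homogeneous decomposition modulo
  \<open>I\<close> by \<open>PI_self\<close> and \<open>T_conc\<close>, and passes to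
  \<open>x\<close> because the components of an element of \<open>I\<close> lie in
  \<open>I\<close>.\<close>

lemma PI_total: "x \<in> PF \<Longrightarrow> \<exists>S0. finite S0 \<and> (\<forall>S. finite S \<longrightarrow> S0 \<subseteq> S \<longrightarrow> (\<Sum>\<kappa>\<in>S. PI.T x \<kappa>) - x \<in> I)"
proof -
  assume x: "x \<in> PF"
  obtain xs where xs: "set xs \<subseteq> (\<Union>\<alpha>. hF \<alpha>)" "x - sum_list xs \<in> I" using hdec[OF x] by blast
  have "\<exists>S0. finite S0 \<and> (\<forall>S. finite S \<longrightarrow> S0 \<subseteq> S \<longrightarrow> (\<Sum>\<kappa>\<in>S. PI.T (sum_list xs) \<kappa>) - sum_list xs \<in> I)"
    using xs(1)
  proof (induction xs)
    case Nil
    then show ?case by (intro exI[of _ "{}"]) (simp add: PI.T_0 I_zero)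
  next
    case (Cons h xs)
    then obtain S0 \<alpha> where S0: "finite S0" "\<forall>S. finite S \<longrightarrow> S0 \<subseteq> S \<longrightarrow> (\<Sum>\<kappa>\<in>S. PI.T (sum_list xs) \<kappa>) - sum_list xs \<in> I"
      and h: "h \<in> hF \<alpha>" by auto
    have "(\<Sum>\<kappa>\<in>S. PI.T (sum_list (h # xs)) \<kappa>) - sum_list (h # xs) \<in> I" if S: "finite S" "insert \<alpha> S0 \<subseteq> S" for S
    proof -
      have "(\<Sum>\<kappa>\<in>S. PI.T h \<kappa>) - h = (PI.T h \<alpha> - h) + (\<Sum>\<kappa>\<in>S - {\<alpha>}. PI.T h \<kappa>)"
        using sum.remove[OF S(1), of \<alpha> "PI.T h"] S by simp
      also have "\<dots> \<in> I" by (intro I_add PI_self[OF h] I_sum PI.T_conc[OF h]) auto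
      finally have "(\<Sum>\<kappa>\<in>S. PI.T h \<kappa>) - h \<in> I" .
      moreover have "(\<Sum>\<kappa>\<in>S. PI.T (sum_list xs) \<kappa>) - sum_list xs \<in> I" using S0 S by auto
      ultimately have "((\<Sum>\<kappa>\<in>S. PI.T h \<kappa>) - h) + ((\<Sum>\<kappa>\<in>S. PI.T (sum_list xs) \<kappa>) - sum_list xs) \<in> I" by (rule I_add)
      then show ?thesis by (simp add: PI.T_add sum.distrib algebra_simps)
    qed
    then show ?case using S0(1) by (intro exI[of _ "insert \<alpha> S0"]) auto
  qed
  then obtain S0 where S0: "finite S0" "\<forall>S. finite S \<longrightarrow> S0 \<subseteq> S \<longrightarrow> (\<Sum>\<kappa>\<in>S. PI.T (sum_list xs) \<kappa>) - sum_list xs \<in> I" by blast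
  have "(\<Sum>\<kappa>\<in>S. PI.T x \<kappa>) - x \<in> I" if S: "finite S" "S0 \<subseteq> S" for S
  proof -
    have "(\<Sum>\<kappa>\<in>S. PI.T x \<kappa>) - x = (\<Sum>\<kappa>\<in>S. PI.T (x - sum_list xs) \<kappa>) + ((\<Sum>\<kappa>\<in>S. PI.T (sum_list xs) \<kappa>) - sum_list xs) - (x - sum_list xs)"
      by (simp add: PI.T_minus sum_subtractf)
    also have "\<dots> \<in> I" using S0(2) S by (intro I_minus[OF I_add[OF I_sum[OF PI.T_I[OF xs(2)]]] xs(2)]) blast
    finally show ?thesis .
  qed
  then show ?thesis using S0(1) by blast
qed

lemma U_ring: "ring U"
proof (rule ringI)
  show "abelian_group U"
  proof (rule abelian_groupI)
    show "\<exists>y\<in>carrier U. y \<oplus>\<^bsub>U\<^esub> x = \<zero>\<^bsub>U\<^esub>" if x: "x \<in> carrier U" for x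
    proof -
      obtain a where "x = cl a" "a \<in> PF" using x by (rule U_cases)
      then show ?thesis using cl_carrier[OF CF_uminus] by (intro bexI[of _ "cl (- a)"]) (simp_all add: cl_add CF_uminus U_zero)
    qed
  qed (auto elim!: U_cases simp: cl_add U_zero CF_add CF_zero cl_carrier add_ac)
  show "Group.monoid U"
    by (rule monoidI) (auto elim!: U_cases simp: cl_mult U_one CF_mult CF_one cl_carrier mult.assoc)
qed (auto elim!: U_cases simp: cl_add cl_mult CF_add CF_mult distrib_left distrib_right)

lemma U_module: "Module.module complex_alg U"
  by (rule moduleI[OF complex_cring]) (use ring.is_abelian_group[OF U_ring] in
    \<open>auto elim!: U_cases simp: complex_alg_def cl_add cl_sc CF_add CF_sc sc_add sc_sc cl_carrier\<close>)

lemma cl_sum: "finite S \<Longrightarrow> (\<And>i. i \<in> S \<Longrightarrow> f i \<in> PF) \<Longrightarrow> finsum U (\<lambda>i. cl (f i)) S = cl (sum f S)"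
proof (induction S rule: finite_induct)
  interpret ring U by (rule U_ring)
  case (insert i S)
  then show ?case by (subst finsum_insert) (auto simp: cl_carrier cl_add CF_sum)
next
  interpret ring U by (rule U_ring)
  case empty
  then show ?case by (simp add: U_zero)
qed

text \<open>The projection onto degree \<kappa>. The chosen representative does not matter, since
  the components of an element of \<open>I\<close> lie in \<open>I\<close>.\<close>

definition Pp :: "'g \<Rightarrow> 'v env \<Rightarrow> 'v env" where
  "Pp \<kappa> u = cl (PI.T (SOME x. x \<in> u) \<kappa>)"

lemma some_cl: "x \<in> PF \<Longrightarrow> (SOME y. y \<in> cl x) \<in> PF \<and> (SOME y. y \<in> cl x) - x \<in> I"
proof -
  assume x: "x \<in> PF"
  have "(SOME y. y \<in> cl x) \<in> cl x" by (rule someI[of _ x]) (rule cl_mem)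
  from mem_cl[OF this x] show ?thesis using cl_eq x by blast
qed

lemma Pp_cl: "x \<in> PF \<Longrightarrow> Pp \<kappa> (cl x) = cl (PI.T x \<kappa>)"
proof -
  assume x: "x \<in> PF"
  have "PI.T (SOME y. y \<in> cl x) \<kappa> - PI.T x \<kappa> \<in> I"
    using PI.T_I[OF conjunct2[OF some_cl[OF x]], of \<kappa>] by (simp add: PI.T_minus)
  then show ?thesis unfolding Pp_def using some_cl[OF x] x
    by (subst cl_eq) (auto intro: hF_CF[OF PI.T_hF])
qed

lemma Pp_hom: "u \<in> grade U \<alpha> \<Longrightarrow> Pp \<kappa> u = (if \<kappa> = \<alpha> then u else \<zero>\<^bsub>U\<^esub>)"
proof -
  assume "u \<in> grade U \<alpha>"
  then obtain x where x: "u = cl x" "x \<in> hF \<alpha>" by (auto simp: U_grade)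
  note xC = hF_CF[OF x(2)]
  show ?thesis
  proof (cases "\<kappa> = \<alpha>")
    case True
    then show ?thesis unfolding x(1) Pp_cl[OF xC] using PI_self[OF x(2)] cl_eq[OF hF_CF[OF PI.T_hF[OF xC, of \<alpha>]] xC] by simp
  next
    case False
    then show ?thesis unfolding x(1) Pp_cl[OF xC] U_zero
      using PI.T_conc[OF x(2) False] cl_eq[OF hF_CF[OF PI.T_hF[OF xC, of \<kappa>]] CF_zero] by simp
  qed
qed

lemma Pp_add: "u \<in> carrier U \<Longrightarrow> v \<in> carrier U \<Longrightarrow> Pp \<kappa> (u \<oplus>\<^bsub>U\<^esub> v) = Pp \<kappa> u \<oplus>\<^bsub>U\<^esub> Pp \<kappa> v"
proof -
  assume u: "u \<in> carrier U" and v: "v \<in> carrier U"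
  obtain x where x: "x \<in> PF" "u = cl x" using u by (rule U_cases)
  obtain y where y: "y \<in> PF" "v = cl y" using v by (rule U_cases)
  show ?thesis using x y hF_CF[OF PI.T_hF] by (simp add: cl_add Pp_cl CF_add PI.T_add)
qed

text \<open>Existence of the decomposition is \<open>PI_total\<close>. Uniqueness holds because the
  additive maps \<open>Pp\<close> recover the components from any decomposition.\<close>

lemma U_gralg: "graded_algebra U"
proof -
  interpret ring U by (rule U_ring)
  interpret md: Module.module complex_alg U by (rule U_module)
  have sub: "submodule (grade U \<alpha>) complex_alg U" for \<alpha>
  proof (rule Module.module.submoduleI[OF U_module])
    show "grade U \<alpha> \<subseteq> carrier U" by (auto simp: U_grade intro: cl_carrier hF_CF)
    show "\<zero>\<^bsub>U\<^esub> \<in> grade U \<alpha>" unfolding U_zero U_grade by (rule imageI[OF hF_zero])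
    show "\<ominus>\<^bsub>U\<^esub> u \<in> grade U \<alpha>" if u: "u \<in> grade U \<alpha>" for u
    proof -
      obtain x where x: "u = cl x" "x \<in> hF \<alpha>" using u by (auto simp: U_grade)
      have "cl (- x) \<oplus>\<^bsub>U\<^esub> cl x = \<zero>\<^bsub>U\<^esub>" using hF_CF[OF x(2)] by (simp add: cl_add CF_uminus U_zero)
      then have "\<ominus>\<^bsub>U\<^esub> u = cl (- x)" unfolding x(1)
        by (rule minus_equality) (auto intro!: cl_carrier CF_uminus hF_CF[OF x(2)])
      then show ?thesis using hF_uminus[OF x(2)] by (simp add: U_grade)
    qed
    show "u \<oplus>\<^bsub>U\<^esub> v \<in> grade U \<alpha>" if "u \<in> grade U \<alpha>" "v \<in> grade U \<alpha>" for u v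
      using that by (auto simp: U_grade cl_add hF_CF hF_add)
    show "c \<odot>\<^bsub>U\<^esub> u \<in> grade U \<alpha>" if "u \<in> grade U \<alpha>" for c u
      using that by (auto simp: U_grade cl_sc hF_CF hF_sc)
  qed
  have "\<exists>!u. hdecomp U x u" if x: "x \<in> carrier U" for x
  proof (rule ex1I)
    obtain a where a: "a \<in> PF" "x = cl a" using x by (rule U_cases)
    obtain S0 where S0: "finite S0" "\<forall>S. finite S \<longrightarrow> S0 \<subseteq> S \<longrightarrow> (\<Sum>\<kappa>\<in>S. PI.T a \<kappa>) - a \<in> I" using PI_total[OF a(1)] by blast
    let ?S = "S0 \<union> {\<kappa>. PI.T a \<kappa> \<noteq> 0}"
    have fS: "finite ?S" using S0(1) PI.T_finite[OF a(1)] by simp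
    have TC: "PI.T a \<kappa> \<in> PF" for \<kappa> by (rule hF_CF[OF PI.T_hF[OF a(1)]])
    have sub2: "{\<alpha>. Pp \<alpha> x \<noteq> \<zero>\<^bsub>U\<^esub>} \<subseteq> ?S" using a by (auto simp: Pp_cl U_zero)
    have "x = finsum U (\<lambda>\<kappa>. Pp \<kappa> x) ?S"
    proof -
      have "finsum U (\<lambda>\<kappa>. Pp \<kappa> x) ?S = cl (\<Sum>\<kappa>\<in>?S. PI.T a \<kappa>)"
        using cl_sum[OF fS, of "PI.T a"] TC a by (simp add: Pp_cl)
      also have "\<dots> = cl a" using S0(2) fS by (subst cl_eq) (auto intro: CF_sum TC a)
      finally show ?thesis using a by simp
    qed
    also have "\<dots> = finsum U (\<lambda>\<kappa>. Pp \<kappa> x) {\<alpha>. Pp \<alpha> x \<noteq> \<zero>\<^bsub>U\<^esub>}"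
      by (rule add.finprod_mono_neutral_cong_right) (use fS sub2 a TC in \<open>auto simp: Pp_cl cl_carrier\<close>)
    finally have fx: "x = finsum U (\<lambda>\<kappa>. Pp \<kappa> x) {\<alpha>. Pp \<alpha> x \<noteq> \<zero>\<^bsub>U\<^esub>}" .
    have "Pp \<kappa> x \<in> grade U \<kappa>" for \<kappa> unfolding a(2) Pp_cl[OF a(1)] U_grade by (rule imageI[OF PI.T_hF[OF a(1)]])
    then show "hdecomp U x (\<lambda>\<kappa>. Pp \<kappa> x)"
      unfolding hdecomp_def using finite_subset[OF sub2 fS] fx by blast
    fix u assume "hdecomp U x u"
    then have u: "\<And>\<alpha>. u \<alpha> \<in> grade U \<alpha>" "finite {\<alpha>. u \<alpha> \<noteq> \<zero>\<^bsub>U\<^esub>}" "x = finsum U u {\<alpha>. u \<alpha> \<noteq> \<zero>\<^bsub>U\<^esub>}" by (auto simp: hdecomp_def)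
    have uc: "u \<alpha> \<in> carrier U" for \<alpha> using u(1)[of \<alpha>] md.submoduleE(1)[OF sub] by blast
    have P: "finite S \<Longrightarrow> Pp \<kappa> (finsum U u S) = (if \<kappa> \<in> S then u \<kappa> else \<zero>\<^bsub>U\<^esub>)" for S \<kappa>
    proof (induction S rule: finite_induct)
      case empty
      show ?case using Pp_hom[of "\<zero>\<^bsub>U\<^esub>" \<kappa> \<kappa>] hF_zero by (simp add: U_zero U_grade)
    next
      case (insert \<alpha> S)
      then show ?case using uc by (auto simp: Pp_add Pp_hom[OF u(1)] Pi_def)
    qed
    show "u = (\<lambda>\<kappa>. Pp \<kappa> x)"
    proof (rule ext)
      fix \<kappa> show "u \<kappa> = Pp \<kappa> x" using P[OF u(2), of \<kappa>] u(3) by (cases "u \<kappa> = \<zero>\<^bsub>U\<^esub>") auto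
    qed
  qed
  moreover have "c \<odot>\<^bsub>U\<^esub> (x \<otimes>\<^bsub>U\<^esub> y) = (c \<odot>\<^bsub>U\<^esub> x) \<otimes>\<^bsub>U\<^esub> y"
    "c \<odot>\<^bsub>U\<^esub> (x \<otimes>\<^bsub>U\<^esub> y) = x \<otimes>\<^bsub>U\<^esub> (c \<odot>\<^bsub>U\<^esub> y)"
    if x: "x \<in> carrier U" and y: "y \<in> carrier U" for x y c
  proof -
    obtain a where a: "a \<in> PF" "x = cl a" using x by (rule U_cases)
    obtain b where b: "b \<in> PF" "y = cl b" using y by (rule U_cases)
    show "c \<odot>\<^bsub>U\<^esub> (x \<otimes>\<^bsub>U\<^esub> y) = (c \<odot>\<^bsub>U\<^esub> x) \<otimes>\<^bsub>U\<^esub> y" "c \<odot>\<^bsub>U\<^esub> (x \<otimes>\<^bsub>U\<^esub> y) = x \<otimes>\<^bsub>U\<^esub> (c \<odot>\<^bsub>U\<^esub> y)"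
      using a b by (simp_all add: cl_mult cl_sc CF_mult CF_sc sc_mult1 sc_mult2)
  qed
  moreover have "x \<otimes>\<^bsub>U\<^esub> y \<in> grade U (\<alpha> + \<beta>)" if x: "x \<in> grade U \<alpha>" and y: "y \<in> grade U \<beta>" for x y \<alpha> \<beta>
  proof -
    obtain a where a: "a \<in> hF \<alpha>" "x = cl a" using x unfolding U_grade by blast
    obtain b where b: "b \<in> hF \<beta>" "y = cl b" using y unfolding U_grade by blast
    show ?thesis using hF_mult[OF a(1) b(1)] a b by (simp add: U_grade cl_mult hF_CF)
  qed
  moreover have "\<one>\<^bsub>U\<^esub> \<in> grade U 0" unfolding U_one U_grade by (rule imageI[OF hF_one])
  ultimately show ?thesis unfolding graded_algebra_def complex_algebra_def
    by (intro conjI allI ballI U_ring U_module sub)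
qed

end

section \<open>The enveloping algebra as a Hopf algebra\<close>

context gvs
begin

sublocale UU: grtens \<omega> "env \<omega> scale V"
  by unfold_locales (rule U_gralg)

interpretation SI: grep \<omega> scale V n e \<gamma> "\<lambda>d X \<kappa> x. sc (- \<omega> d \<kappa>) (x * gen X)"
  by (rule SI_grep)

definition io :: "('v \<Rightarrow> 'v) \<Rightarrow> 'v env" where "io X = cl (gen X)"

lemma env_incl_io: "env_incl \<omega> scale V = io"
  by (simp add: fun_eq_iff env_incl_def io_def)

lemma io_carrier [simp]: "X \<in> GL \<Longrightarrow> io X \<in> carrier U"
  by (simp add: io_def cl_carrier CF_gen)

lemma io_grade: "X \<in> GLd d \<Longrightarrow> io X \<in> grade U d"
  by (simp add: io_def U_grade hF_gen)

lemma io_add: "X \<in> GL \<Longrightarrow> Y \<in> GL \<Longrightarrow> io (\<lambda>v. X v + Y v) = io X \<oplus>\<^bsub>U\<^esub> io Y"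
  unfolding io_def using I_gen_add[of X Y]
  by (simp add: cl_add CF_gen cl_eq gl_plus CF_add diff_diff_eq)

lemma io_scale: "X \<in> GL \<Longrightarrow> io (\<lambda>v. scale c (X v)) = c \<odot>\<^bsub>U\<^esub> io X"
  unfolding io_def using I_gen_scale[of X c] by (simp add: cl_sc CF_gen cl_eq gl_times CF_sc)

lemma io_brk: "X \<in> GLd a \<Longrightarrow> Y \<in> GLd b \<Longrightarrow> io X \<otimes>\<^bsub>U\<^esub> io Y = \<omega> a b \<odot>\<^bsub>U\<^esub> (io Y \<otimes>\<^bsub>U\<^esub> io X) \<oplus>\<^bsub>U\<^esub> io (brk a b X Y)"
proof -
  assume X: "X \<in> GLd a" and Y: "Y \<in> GLd b"
  note c = CF_gen[OF GLd_GL[OF X]] CF_gen[OF GLd_GL[OF Y]] CF_gen[OF GLd_GL[OF GLd_brk[OF X Y]]]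
  show ?thesis unfolding io_def using I_rel[OF X Y] c
    by (simp add: cl_mult cl_sc cl_add CF_mult CF_sc CF_add cl_eq rel_def diff_diff_eq)
qed

text \<open>Zero has a case of its own, in all degrees, because the predicate may depend on the
  degree and zero belongs to each of them.\<close>

lemma U_grade_induct [consumes 1, case_names zero one step add sm]:
  assumes u: "u \<in> grade U \<alpha>" and zero: "\<And>\<alpha>. Q \<alpha> \<zero>\<^bsub>U\<^esub>" and one: "Q 0 \<one>\<^bsub>U\<^esub>"
    and step: "\<And>X d \<alpha> x. X \<in> GLd d \<Longrightarrow> x \<in> grade U \<alpha> \<Longrightarrow> Q \<alpha> x \<Longrightarrow> Q (d + \<alpha>) (io X \<otimes>\<^bsub>U\<^esub> x)"
    and add: "\<And>\<alpha> x y. x \<in> grade U \<alpha> \<Longrightarrow> y \<in> grade U \<alpha> \<Longrightarrow> Q \<alpha> x \<Longrightarrow> Q \<alpha> y \<Longrightarrow> Q \<alpha> (x \<oplus>\<^bsub>U\<^esub> y)"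
    and sm: "\<And>\<alpha> c x. x \<in> grade U \<alpha> \<Longrightarrow> Q \<alpha> x \<Longrightarrow> Q \<alpha> (c \<odot>\<^bsub>U\<^esub> x)"
  shows "Q \<alpha> u"
proof -
  obtain x where x: "u = cl x" "x \<in> hF \<alpha>" using u by (auto simp: U_grade)
  have "Q \<alpha> (cl x)" using x(2)
  proof (induction rule: hF_induct)
    case zero
    show ?case using assms(2) by (simp add: U_zero)
  next
    case (single Xs c)
    then show ?case
    proof (induction rule: hw_induct)
      case Nil
      have "Q 0 (c \<odot>\<^bsub>U\<^esub> \<one>\<^bsub>U\<^esub>)" by (rule sm[OF _ one]) simp
      then show ?case by (simp add: single_Nil U_one cl_sc CF_one)
    next
      case (Cons X d \<alpha> Xs)
      have h: "Poly_Mapping.single (Word Xs) c \<in> hF \<alpha>" using Cons(2) by (simp add: hF_single)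
      have "cl (Poly_Mapping.single (Word (X # Xs)) c) = io X \<otimes>\<^bsub>U\<^esub> cl (Poly_Mapping.single (Word Xs) c)"
        unfolding io_def single_Cons using CF_gen[OF GLd_GL[OF Cons(1)]] hF_CF[OF h] by (simp add: cl_mult)
      then show ?case using step[OF Cons(1) _ Cons.IH] h by (simp add: U_grade)
    qed
  next
    case (add x y)
    then show ?case using assms(5)[of "cl x" \<alpha> "cl y"] by (simp add: cl_add hF_CF U_grade)
  qed
  then show ?thesis using x by simp
qed

lemma U_induct [consumes 1, case_names one step add sm]:
  assumes u: "u \<in> carrier U" and one: "Q \<one>\<^bsub>U\<^esub>"
    and step: "\<And>X d \<alpha> x. X \<in> GLd d \<Longrightarrow> x \<in> grade U \<alpha> \<Longrightarrow> Q x \<Longrightarrow> Q (io X \<otimes>\<^bsub>U\<^esub> x)"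
    and add: "\<And>x y. x \<in> carrier U \<Longrightarrow> y \<in> carrier U \<Longrightarrow> Q x \<Longrightarrow> Q y \<Longrightarrow> Q (x \<oplus>\<^bsub>U\<^esub> y)"
    and sm: "\<And>c x. x \<in> carrier U \<Longrightarrow> Q x \<Longrightarrow> Q (c \<odot>\<^bsub>U\<^esub> x)"
  shows "Q u"
  using u
proof (induction rule: UU.hom_induct)
  case (hom \<alpha> y)
  then show ?case
  proof (induction rule: U_grade_induct)
    case zero
    show ?case using sm[OF UU.one_closed one, of 0] by simp
  qed (use one step add sm in blast)+
qed (use add in blast)

subsection \<open>The comultiplication\<close>

definition dl :: "('v \<Rightarrow> 'v) \<Rightarrow> ('v env, 'v env) tensor" where
  "dl X = UU.pt (io X) \<one>\<^bsub>U\<^esub> + UU.pt \<one>\<^bsub>U\<^esub> (io X)"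

lemma dl_TT: "X \<in> GL \<Longrightarrow> dl X \<in> UU.TT"
  unfolding dl_def by (intro UU.TT_add UU.TT_pt) simp_all

lemma dl_add: "X \<in> GL \<Longrightarrow> Y \<in> GL \<Longrightarrow> dl (\<lambda>v. X v + Y v) = dl X + dl Y"
  by (simp add: dl_def io_add UU.pt_add1 UU.pt_add2)

lemma dl_scale: "X \<in> GL \<Longrightarrow> dl (\<lambda>v. scale c (X v)) = (\<lambda>B. c * dl X B)"
  by (simp add: dl_def io_scale UU.pt_sm1 UU.pt_sm2 fun_eq_iff fun_app algebra_simps)

lemma tm_one_l: "z \<in> UU.TT \<Longrightarrow> UU.tm (UU.pt \<one>\<^bsub>U\<^esub> \<one>\<^bsub>U\<^esub>) z = z"
proof (induction rule: UU.TT_induct)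
  case (pt \<alpha> \<beta> x y)
  then show ?case by (subst UU.tm_pt[where \<alpha> = \<alpha> and \<beta> = 0]) (auto simp: UU.grade_carrier)
qed (simp_all add: UU.tm_zero2 UU.tm_add2)

lemma tm_one_r: "z \<in> UU.TT \<Longrightarrow> UU.tm z (UU.pt \<one>\<^bsub>U\<^esub> \<one>\<^bsub>U\<^esub>) = z"
proof (induction rule: UU.TT_induct)
  case (pt \<alpha> \<beta> x y)
  then show ?case by (subst UU.tm_pt[where \<alpha> = 0 and \<beta> = \<beta>]) (auto simp: UU.grade_carrier)
qed (simp_all add: UU.tm_zero1 UU.tm_add1)

lemma dl_mult: "X \<in> GLd a \<Longrightarrow> Y \<in> GLd b \<Longrightarrow> UU.tm (dl X) (dl Y) =
   UU.pt (io X \<otimes>\<^bsub>U\<^esub> io Y) \<one>\<^bsub>U\<^esub> + UU.pt (io X) (io Y) + (\<lambda>B. \<omega> a b * UU.pt (io Y) (io X) B) + UU.pt \<one>\<^bsub>U\<^esub> (io X \<otimes>\<^bsub>U\<^esub> io Y)"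
proof -
  assume X: "X \<in> GLd a" and Y: "Y \<in> GLd b"
  note g = io_grade[OF X] io_grade[OF Y]
  note c = UU.grade_carrier[OF g(1)] UU.grade_carrier[OF g(2)]
  have 1: "UU.tm (UU.pt (io X) \<one>\<^bsub>U\<^esub>) (UU.pt (io Y) \<one>\<^bsub>U\<^esub>) = UU.pt (io X \<otimes>\<^bsub>U\<^esub> io Y) \<one>\<^bsub>U\<^esub>"
    using c by (subst UU.tm_pt[OF _ UU.grade_one g(2)]) simp_all
  have 2: "UU.tm (UU.pt (io X) \<one>\<^bsub>U\<^esub>) (UU.pt \<one>\<^bsub>U\<^esub> (io Y)) = UU.pt (io X) (io Y)"
    using c by (subst UU.tm_pt[OF _ UU.grade_one UU.grade_one]) simp_all
  have 3: "UU.tm (UU.pt \<one>\<^bsub>U\<^esub> (io X)) (UU.pt (io Y) \<one>\<^bsub>U\<^esub>) = (\<lambda>B. \<omega> a b * UU.pt (io Y) (io X) B)"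
    using c by (subst UU.tm_pt[OF _ g]) (simp_all add: UU.pt_sm1)
  have 4: "UU.tm (UU.pt \<one>\<^bsub>U\<^esub> (io X)) (UU.pt \<one>\<^bsub>U\<^esub> (io Y)) = UU.pt \<one>\<^bsub>U\<^esub> (io X \<otimes>\<^bsub>U\<^esub> io Y)"
    using c by (subst UU.tm_pt[OF _ g(1) UU.grade_one]) simp_all
  show ?thesis unfolding dl_def using c 1 2 3 4 by (simp add: UU.tm_add1 UU.tm_add2 UU.TT_add add_ac)
qed

text \<open>The mixed terms on both sides agree since
  \<open>\<omega> a b * \<omega> b a = 1\<close>; the remaining terms are the defining relation in
  the first and in the second leg.\<close>

lemma dl_brk: "X \<in> GLd a \<Longrightarrow> Y \<in> GLd b \<Longrightarrow> UU.tm (dl X) (dl Y) = (\<lambda>B. \<omega> a b * UU.tm (dl Y) (dl X) B) + dl (brk a b X Y)"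
proof (rule UU.tensor_eqI)
  assume X: "X \<in> GLd a" and Y: "Y \<in> GLd b"
  note g = io_grade[OF X] io_grade[OF Y] io_grade[OF GLd_brk[OF X Y]]
  note c = UU.grade_carrier[OF g(1)] UU.grade_carrier[OF g(2)] UU.grade_carrier[OF g(3)]
  fix B assume B: "B \<in> UU.Bil"
  have l: "lin U (\<lambda>u. B u \<one>\<^bsub>U\<^esub>)" "lin U (B \<one>\<^bsub>U\<^esub>)" using bilin1[OF B] bilin2[OF B] by simp_all
  show "UU.tm (dl X) (dl Y) B = ((\<lambda>B. \<omega> a b * UU.tm (dl Y) (dl X) B) + dl (brk a b X Y)) B"
    unfolding fun_app dl_mult[OF X Y] dl_mult[OF Y X] unfolding dl_def fun_app
    using B c l by (simp add: io_brk[OF X Y] lin_add[OF l(1)] lin_add[OF l(2)] lin_smult[OF l(1)] lin_smult[OF l(2)] distrib_left mult.assoc[symmetric])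
next
  assume X: "X \<in> GLd a" and Y: "Y \<in> GLd b"
  fix B assume "B \<notin> UU.Bil"
  then show "UU.tm (dl X) (dl Y) B = 0" "((\<lambda>B. \<omega> a b * UU.tm (dl Y) (dl X) B) + dl (brk a b X Y)) B = 0"
    by (simp_all add: UU.tm_def' fun_app dl_def UU.pt_off)
qed

text \<open>For this action the comultiplication of \<open>x\<close> is the image of the tensor of
  two units. By \<open>dl_brk\<close> the relations act by zero.\<close>

lemma tens_frep: "frep (\<lambda>c z B. c * z B) GL UU.TT {0} (\<lambda>X. UU.tm (dl X))"
proof
  fix a b :: complex and z w :: "('v env, 'v env) tensor" and X
  show "(\<lambda>B. a * (z + w) B) = (\<lambda>B. a * z B) + (\<lambda>B. a * w B)" by (simp add: fun_eq_iff fun_app distrib_left)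
  show "(\<lambda>B. (a + b) * z B) = (\<lambda>B. a * z B) + (\<lambda>B. b * z B)" by (simp add: fun_eq_iff fun_app distrib_right)
  show "(\<lambda>B. a * (b * z B)) = (\<lambda>B. a * b * z B)" by (simp add: mult.assoc)
  show "(\<lambda>B. 1 * z B) = z" by simp
  show "z + w \<in> UU.TT" if "z \<in> UU.TT" "w \<in> UU.TT" using that by (rule UU.TT_add)
  show "(\<lambda>B. a * z B) \<in> UU.TT" if "z \<in> UU.TT" using that by (rule UU.TT_smult)
  show "UU.tm (dl X) z \<in> UU.TT" if "X \<in> GL" "z \<in> UU.TT" using that by (intro UU.tm_closed dl_TT)
  show "UU.tm (dl X) (z + w) = UU.tm (dl X) z + UU.tm (dl X) w" if "X \<in> GL" "z \<in> UU.TT" "w \<in> UU.TT"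
    using that by (intro UU.tm_add2 dl_TT)
  show "UU.tm (dl X) (\<lambda>B. a * z B) = (\<lambda>B. a * UU.tm (dl X) z B)" if "X \<in> GL" "z \<in> UU.TT"
    using that by (intro UU.tm_smult2 dl_TT)
  show "UU.tm (dl X) z \<in> {0}" if "X \<in> GL" "z \<in> {0}" using that UU.tm_zero2[OF dl_TT] by simp
  show "(\<lambda>B. a * z B) \<in> {0}" if "z \<in> {0}" using that by (simp add: fun_eq_iff fun_app)
qed simp_all

interpretation DR: frep "\<lambda>c z B. c * z B" GL UU.TT "{0}" "\<lambda>X. UU.tm (dl X)"
  by (rule tens_frep)

lemma DR_I: "x \<in> I \<Longrightarrow> z \<in> UU.TT \<Longrightarrow> DR.act x z = 0"
proof -
  assume x: "x \<in> I" and z: "z \<in> UU.TT"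
  have "DR.act x z \<in> {0}"
  proof (rule DR.act_kill[OF rels_CF _ x[unfolded env_ideal_def] z])
    fix x z assume x: "x \<in> env_relations \<omega> scale V" and z: "z \<in> UU.TT"
    from x consider (add) X Y where "x = gen (\<lambda>v. X v + Y v) - gen X - gen Y" "X \<in> GL" "Y \<in> GL"
      | (scale) c X where "x = gen (\<lambda>v. scale c (X v)) - sc c (gen X)" "X \<in> GL"
      | (brk) X Y \<alpha> \<beta> where "x = rel \<alpha> \<beta> X Y" "X \<in> GLd \<alpha>" "Y \<in> GLd \<beta>"
      unfolding rels_eq by blast
    then show "DR.act x z \<in> {0}"
    proof cases
      case add
      then show ?thesis unfolding add(1) DR.act_minus DR.act_gen by (simp add: dl_add UU.tm_add1)
    next
      case scale
      then show ?thesis unfolding scale(1) DR.act_minus DR.act_gen DR.act_sc by (simp add: dl_scale UU.tm_smult1)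
    next
      case brk
      note X = GLd_GL[OF brk(2)] and Y = GLd_GL[OF brk(3)]
      have "DR.act x z = UU.tm (dl X) (UU.tm (dl Y) z) - (\<lambda>B. \<omega> \<alpha> \<beta> * UU.tm (dl Y) (UU.tm (dl X) z) B) - UU.tm (dl (brk \<alpha> \<beta> X Y)) z"
        unfolding brk(1) rel_def DR.act_minus DR.act_sc by (simp add: DR.act_mult CF_gen X Y z DR.act_gen)
      also have "UU.tm (dl X) (UU.tm (dl Y) z) = UU.tm (UU.tm (dl X) (dl Y)) z" by (rule UU.tm_assoc[OF dl_TT[OF X] dl_TT[OF Y] z, symmetric])
      also have "UU.tm (dl Y) (UU.tm (dl X) z) = UU.tm (UU.tm (dl Y) (dl X)) z" by (rule UU.tm_assoc[OF dl_TT[OF Y] dl_TT[OF X] z, symmetric])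
      finally show ?thesis unfolding dl_brk[OF brk(2,3)] UU.tm_add1 UU.tm_smult1 by simp
    qed
  qed
  then show ?thesis by simp
qed

text \<open>An element acts as left multiplication by its value on the unit tensor. This is what
  makes the comultiplication multiplicative.\<close>

lemma DR_tm: "x \<in> PF \<Longrightarrow> z \<in> UU.TT \<Longrightarrow> DR.act x z = UU.tm (DR.act x (UU.pt \<one>\<^bsub>U\<^esub> \<one>\<^bsub>U\<^esub>)) z"
proof (induction rule: CF_induct)
  case (single w c)
  have "set Xs \<subseteq> GL \<Longrightarrow> foldr (\<lambda>X. UU.tm (dl X)) Xs z = UU.tm (foldr (\<lambda>X. UU.tm (dl X)) Xs (UU.pt \<one>\<^bsub>U\<^esub> \<one>\<^bsub>U\<^esub>)) z" for Xs
  proof (induction Xs)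
    case Nil
    then show ?case using tm_one_l[OF single(2)] by simp
  next
    case (Cons X Xs)
    then show ?case using UU.tm_assoc[OF dl_TT DR.foldr_C single(2), of X Xs "UU.pt \<one>\<^bsub>U\<^esub> \<one>\<^bsub>U\<^esub>"] by simp
  qed
  then show ?case using single by (simp add: DR.act_single UU.tm_smult1)
qed (simp_all add: DR.act_zero DR.act_add UU.tm_zero1 UU.tm_add1)

text \<open>The structure maps are specified over \<open>env_alg\<close>, before the Hopf structure
  is attached. Tensor constructions depend only on the algebra operations and the grading, which are
  the same in both records.\<close>

lemma tensor_alg_env: "tensor_alg \<omega> (env_alg \<omega> scale V) (env_alg \<omega> scale V) = tensor_alg \<omega> U U"
  and pure_tensor_env: "pure_tensor (env_alg \<omega> scale V) (env_alg \<omega> scale V) = UU.pt"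
proof -
  have b: "bilin (env_alg \<omega> scale V) (env_alg \<omega> scale V) = UU.Bil" by (simp add: bilin_def env_sel0)
  show p: "pure_tensor (env_alg \<omega> scale V) (env_alg \<omega> scale V) = UU.pt" by (simp add: fun_eq_iff pure_tensor_def b)
  have h: "hdecomp (env_alg \<omega> scale V) = hdecomp U" by (simp add: fun_eq_iff hdecomp_def finsum_def finprod_def env_sel0)
  have hp: "hpart (env_alg \<omega> scale V) = hpart U" by (simp add: fun_eq_iff hpart_def h)
  have hs: "hsupp (env_alg \<omega> scale V) = hsupp U" by (simp add: fun_eq_iff hsupp_def hp env_sel0)
  have t: "tensor_sums (env_alg \<omega> scale V) (env_alg \<omega> scale V) = tensor_sums U U" by (simp add: fun_eq_iff tensor_sums_def p)
  show "tensor_alg \<omega> (env_alg \<omega> scale V) (env_alg \<omega> scale V) = tensor_alg \<omega> U U"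
    by (simp add: tensor_alg_def tensor_sub_def t p tensor_mult_def[abs_def] b hp hs env_sel0 cong: if_cong)
qed

lemma alg_hom_env: "alg_hom (env_alg \<omega> scale V) N D = alg_hom U N D"
  by (simp add: alg_hom_def ring_hom_def env_sel0)

text \<open>The choice operator returns some map with the stated properties, so existence suffices.
  The witness \<open>D\<close> lets a representative act on the unit tensor and is independent of
  the representative by \<open>DR_I\<close>.\<close>

lemma com_spec: "alg_hom U (tensor_alg \<omega> U U) (comult U) \<and> (\<forall>X\<in>GL. comult U (io X) = dl X)"
proof -
  define D where "D = (\<lambda>u. DR.act (SOME x. x \<in> u) (UU.pt \<one>\<^bsub>U\<^esub> \<one>\<^bsub>U\<^esub>))"
  have o: "UU.pt \<one>\<^bsub>U\<^esub> \<one>\<^bsub>U\<^esub> \<in> UU.TT" by simp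
  have Dcl: "D (cl x) = DR.act x (UU.pt \<one>\<^bsub>U\<^esub> \<one>\<^bsub>U\<^esub>)" if x: "x \<in> PF" for x
    using DR_I[OF conjunct2[OF some_cl[OF x]] o] by (simp add: D_def DR.act_minus)
  have D1: "D \<one>\<^bsub>U\<^esub> = UU.pt \<one>\<^bsub>U\<^esub> \<one>\<^bsub>U\<^esub>" using Dcl[OF CF_one] by (simp add: DR.act_one flip: U_one)
  have D: "D x \<in> UU.TT" "D (c \<odot>\<^bsub>U\<^esub> x) = (\<lambda>B. c * D x B)" if x: "x \<in> carrier U" for x c
  proof -
    obtain a where a: "a \<in> PF" "x = cl a" using x by (rule U_cases)
    show "D x \<in> UU.TT" "D (c \<odot>\<^bsub>U\<^esub> x) = (\<lambda>B. c * D x B)"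
      using a by (simp_all add: Dcl DR.act_C[OF _ o] cl_sc CF_sc DR.act_sc)
  qed
  have D2: "D (x \<oplus>\<^bsub>U\<^esub> y) = D x + D y" "D (x \<otimes>\<^bsub>U\<^esub> y) = UU.tm (D x) (D y)" if x: "x \<in> carrier U" and y: "y \<in> carrier U" for x y
  proof -
    obtain a where a: "a \<in> PF" "x = cl a" using x by (rule U_cases)
    obtain b where b: "b \<in> PF" "y = cl b" using y by (rule U_cases)
    show "D (x \<oplus>\<^bsub>U\<^esub> y) = D x + D y" using a b by (simp add: cl_add CF_add Dcl DR.act_add)
    show "D (x \<otimes>\<^bsub>U\<^esub> y) = UU.tm (D x) (D y)"
      using a b DR_tm[OF a(1) DR.act_C[OF b(1) o]] by (simp add: cl_mult CF_mult Dcl DR.act_mult[OF _ _ o])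
  qed
  have "alg_hom U (tensor_alg \<omega> U U) D"
    using D D1 D2 by (simp add: alg_hom_def ring_hom_def tensor_alg_def Pi_def)
  moreover have "D (io X) = dl X" if "X \<in> GL" for X
    unfolding io_def Dcl[OF CF_gen[OF that]] DR.act_gen by (rule tm_one_r[OF dl_TT[OF that]])
  ultimately have ex: "\<exists>\<Delta>. alg_hom U (tensor_alg \<omega> U U) \<Delta> \<and> (\<forall>X\<in>GL. \<Delta> (io X) = dl X)" by blast
  have "comult U = env_comult \<omega> scale V" by (simp add: env_def graded.defs hopf.defs)
  also have "\<dots> = (SOME \<Delta>. alg_hom U (tensor_alg \<omega> U U) \<Delta> \<and> (\<forall>X\<in>GL. \<Delta> (io X) = dl X))"
    unfolding env_comult_def Let_def tensor_alg_env pure_tensor_env env_incl_io dl_def alg_hom_env env_sel0 ..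
  finally have "comult U = (SOME \<Delta>. alg_hom U (tensor_alg \<omega> U U) \<Delta> \<and> (\<forall>X\<in>GL. \<Delta> (io X) = dl X))" .
  then show ?thesis using someI_ex[OF ex] by simp
qed

end

section \<open>Multiplication by primitive tensors\<close>

context grtens
begin

text \<open>A tensor of degree \<alpha> tests forms only on homogeneous pairs of total degree
  \<alpha>; this sharpens \<open>TT_cong\<close> where scalars depend on that total.\<close>

lemma ts_eq: "\<lbrakk>z \<in> tensor_sums M M {(u, v). \<exists>\<beta>. u \<in> grade M \<beta> \<and> v \<in> grade M (\<alpha> - \<beta>)}; B \<in> Bil; C \<in> Bil;
    \<And>a b x y. x \<in> grade M a \<Longrightarrow> y \<in> grade M b \<Longrightarrow> a + b = \<alpha> \<Longrightarrow> B x y = C x y\<rbrakk> \<Longrightarrow> z B = z C"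
  by (induction rule: ts_induct) (auto simp: fun_app)

lemma prim_form: "\<lbrakk>\<xi> \<in> carrier M; B \<in> Bil\<rbrakk> \<Longrightarrow> (\<lambda>u v. B (\<xi> \<otimes> u) v + B (wt c u) (\<xi> \<otimes> v)) \<in> Bil"
  "\<lbrakk>\<xi> \<in> carrier M; B \<in> Bil\<rbrakk> \<Longrightarrow> (\<lambda>u v. B (u \<otimes> \<xi>) (wt c v) + B u (v \<otimes> \<xi>)) \<in> Bil"
proof -
  assume x: "\<xi> \<in> carrier M" and B: "B \<in> Bil"
  note l = bilin1[OF B] bilin2[OF B]
  show "(\<lambda>u v. B (\<xi> \<otimes> u) v + B (wt c u) (\<xi> \<otimes> v)) \<in> Bil"
    by (rule bilinI; rule lin_plus) (simp_all add: l lin_lmult[OF l(1) x] lin_wt[OF l(1)] lin_lmult[OF l(2) x] x)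
  show "(\<lambda>u v. B (u \<otimes> \<xi>) (wt c v) + B u (v \<otimes> \<xi>)) \<in> Bil"
    by (rule bilinI; rule lin_plus) (simp_all add: l lin_rmult[OF l(1) x] lin_wt[OF l(2)] lin_rmult[OF l(2) x] x)
qed

text \<open>Multiplication is turned into a change of the form. In the second term \<xi> passes the
  first leg, and the factor is put there as a weight, so that the formula holds without homogeneity
  of the legs.\<close>

lemma tm_prim_l: "\<lbrakk>z \<in> TT; \<xi> \<in> grade M d; B \<in> Bil\<rbrakk> \<Longrightarrow>
    tm (pt \<xi> \<one> + pt \<one> \<xi>) z B = z (\<lambda>u v. B (\<xi> \<otimes> u) v + B (wt (\<omega> d) u) (\<xi> \<otimes> v))"
proof (induction rule: TT_induct)
  case zero
  then show ?case by (subst tm_zero2) (auto simp: fun_app)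
next
  case (pt \<alpha> \<beta> x y)
  note c = grade_carrier[OF pt(1)] grade_carrier[OF pt(2)] grade_carrier[OF pt(3)]
  have 1: "tm (pt \<xi> \<one>) (pt x y) = pt (\<xi> \<otimes> x) y" by (subst tm_pt[OF c(3) grade_one pt(1) c(2)]) (simp add: c)
  have 2: "tm (pt \<one> \<xi>) (pt x y) = pt (\<omega> d \<alpha> \<odot> x) (\<xi> \<otimes> y)" by (subst tm_pt[OF one_closed pt(3,1) c(2)]) (simp add: c)
  show ?case unfolding tm_add1 1 2 unfolding fun_app using pt prim_form(1)[OF c(3) pt(4)] by (simp add: wt_hom)
next
  case (add z w)
  define D where "D = pt \<xi> \<one> + pt \<one> \<xi>"
  have "D \<in> TT" unfolding D_def using add by auto
  then show ?case using add unfolding D_def[symmetric] by (subst tm_add2) (simp_all add: fun_app)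
qed

text \<open>Here \<xi> passes the second leg in the first term. The factor arises on the first leg
  and is moved to the second by bilinearity, where it becomes a weight.\<close>

lemma tm_prim_r: "\<lbrakk>z \<in> TT; \<xi> \<in> grade M d; B \<in> Bil\<rbrakk> \<Longrightarrow>
    tm z (pt \<xi> \<one> + pt \<one> \<xi>) B = z (\<lambda>u v. B (u \<otimes> \<xi>) (wt (\<lambda>\<beta>. \<omega> \<beta> d) v) + B u (v \<otimes> \<xi>))"
proof (induction rule: TT_induct)
  case zero
  then show ?case by (subst tm_zero1) (simp add: fun_app)
next
  case (pt \<alpha> \<beta> x y)
  note c = grade_carrier[OF pt(1)] grade_carrier[OF pt(2)] grade_carrier[OF pt(3)]
  have 1: "tm (pt x y) (pt \<xi> \<one>) = pt (\<omega> \<beta> d \<odot> (x \<otimes> \<xi>)) y" by (subst tm_pt[OF c(1) pt(2,3) one_closed]) (simp add: c)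
  have 2: "tm (pt x y) (pt \<one> \<xi>) = pt x (y \<otimes> \<xi>)" by (subst tm_pt[OF c(1) pt(2) grade_one c(3)]) (simp add: c)
  have "B (\<omega> \<beta> d \<odot> (x \<otimes> \<xi>)) y = B (x \<otimes> \<xi>) (\<omega> \<beta> d \<odot> y)"
    using c lin_smult[OF bilin1[OF pt(4) c(2)]] lin_smult[OF bilin2[OF pt(4)]] by simp
  then have "tm (pt x y) (pt \<xi> \<one> + pt \<one> \<xi>) B = B (x \<otimes> \<xi>) (\<omega> \<beta> d \<odot> y) + B x (y \<otimes> \<xi>)"
    using c pt by (subst tm_add2) (auto simp: 1 2 fun_app)
  then show ?case using pt prim_form(2)[OF c(3) pt(4), of "\<lambda>\<beta>. \<omega> \<beta> d"] by (simp add: wt_hom)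
qed (simp add: tm_add1 fun_app)

lemma ts_prim: "\<lbrakk>z \<in> tensor_sums M M {(u, v). \<exists>\<beta>. u \<in> grade M \<beta> \<and> v \<in> grade M (\<alpha> - \<beta>)}; \<xi> \<in> grade M d\<rbrakk> \<Longrightarrow>
    tm (pt \<xi> \<one> + pt \<one> \<xi>) z \<in> tensor_sums M M {(u, v). \<exists>\<beta>. u \<in> grade M \<beta> \<and> v \<in> grade M (d + \<alpha> - \<beta>)}"
proof (induction rule: ts_induct)
  case zero
  then have "pt \<xi> \<one> + pt \<one> \<xi> \<in> TT" by auto
  then show ?case by (simp add: tm_zero2 ts_zero)
next
  case (pt x y z)
  let ?R = "{(u, v). \<exists>\<beta>. u \<in> grade M \<beta> \<and> v \<in> grade M (d + \<alpha> - \<beta>)}"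
  obtain \<beta> where x: "x \<in> grade M \<beta>" and y: "y \<in> grade M (\<alpha> - \<beta>)" using pt(1) by auto
  note c = grade_carrier[OF x] grade_carrier[OF y] grade_carrier[OF pt(4)]
  have zT: "z \<in> TT" using pt(2) unfolding tensor_sub_def by (rule ts_mono[rotated]) auto
  have 1: "tm (pt \<xi> \<one>) (pt x y) = pt (\<xi> \<otimes> x) y" by (subst tm_pt[OF c(3) grade_one x c(2)]) (simp add: c)
  have 2: "tm (pt \<one> \<xi>) (pt x y) = pt (\<omega> d \<beta> \<odot> x) (\<xi> \<otimes> y)" by (subst tm_pt[OF one_closed pt(4) x c(2)]) (simp add: c)
  have "(\<xi> \<otimes> x, y) \<in> ?R" using grade_mult[OF pt(4) x] y by (auto intro!: exI[of _ "d + \<beta>"])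
  moreover have "(\<omega> d \<beta> \<odot> x, \<xi> \<otimes> y) \<in> ?R"
    using grade_sm[OF x] grade_mult[OF pt(4) y] by (auto intro!: exI[of _ \<beta>] simp: algebra_simps)
  ultimately have "tm (pt \<xi> \<one> + pt \<one> \<xi>) (pt x y) \<in> tensor_sums M M ?R" unfolding tm_add1 1 2 by (intro ts_add ts_pt)
  moreover have "tm (pt \<xi> \<one> + pt \<one> \<xi>) (pt x y + z) = tm (pt \<xi> \<one> + pt \<one> \<xi>) (pt x y) + tm (pt \<xi> \<one> + pt \<one> \<xi>) z"
    by (rule tm_add2) (use c zT in auto)
  ultimately show ?case using pt by (simp add: ts_add)
qed

text \<open>Since \<omega> is multiplicative in its second argument, the weights of the two legs
  multiply to the weight of the total degree.\<close>

lemma ts_wt: "\<lbrakk>z \<in> tensor_sums M M {(u, v). \<exists>\<beta>. u \<in> grade M \<beta> \<and> v \<in> grade M (\<alpha> - \<beta>)}; B \<in> Bil\<rbrakk> \<Longrightarrow>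
    z (\<lambda>x y. B (wt (\<omega> d) x) (wt (\<omega> d) y)) = \<omega> d \<alpha> * z B"
proof -
  assume z: "z \<in> tensor_sums M M {(u, v). \<exists>\<beta>. u \<in> grade M \<beta> \<and> v \<in> grade M (\<alpha> - \<beta>)}" and B: "B \<in> Bil"
  have zT: "z \<in> TT" using z unfolding tensor_sub_def by (rule ts_mono[rotated]) auto
  have "z (\<lambda>x y. B (wt (\<omega> d) x) (wt (\<omega> d) y)) = z (\<lambda>x y. \<omega> d \<alpha> * B x y)"
  proof (rule ts_eq[OF z _ bilin_times[OF B]])
    show "(\<lambda>x y. B (wt (\<omega> d) x) (wt (\<omega> d) y)) \<in> Bil"
      by (rule bilinI) (simp_all add: lin_wt[OF bilin1[OF B]] lin_wt[OF bilin2[OF B]])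
    fix a b x y assume xy: "x \<in> grade M a" "y \<in> grade M b" "a + b = \<alpha>"
    note c = grade_carrier[OF xy(1)] grade_carrier[OF xy(2)]
    show "B (wt (\<omega> d) x) (wt (\<omega> d) y) = \<omega> d \<alpha> * B x y"
      using c xy lin_smult[OF bilin1[OF B]] lin_smult[OF bilin2[OF B]] by (auto simp: wt_hom om_add)
  qed
  then show ?thesis using TT_times[OF zT B] by simp
qed

end

context gvs
begin

lemma com_TT: "x \<in> carrier U \<Longrightarrow> comult U x \<in> UU.TT"
  and com_add: "x \<in> carrier U \<Longrightarrow> y \<in> carrier U \<Longrightarrow> comult U (x \<oplus>\<^bsub>U\<^esub> y) = comult U x + comult U y"
  and com_sm: "x \<in> carrier U \<Longrightarrow> comult U (c \<odot>\<^bsub>U\<^esub> x) = (\<lambda>B. c * comult U x B)"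
  and com_mult: "x \<in> carrier U \<Longrightarrow> y \<in> carrier U \<Longrightarrow> comult U (x \<otimes>\<^bsub>U\<^esub> y) = UU.tm (comult U x) (comult U y)"
  and com_one: "comult U \<one>\<^bsub>U\<^esub> = UU.pt \<one>\<^bsub>U\<^esub> \<one>\<^bsub>U\<^esub>"
  and com_io: "X \<in> GL \<Longrightarrow> comult U (io X) = dl X"
  using com_spec by (auto simp: alg_hom_def ring_hom_def tensor_alg_def)

lemma com_X: "\<lbrakk>X \<in> GLd d; u \<in> carrier U; B \<in> UU.Bil\<rbrakk> \<Longrightarrow>
    comult U (io X \<otimes>\<^bsub>U\<^esub> u) B = comult U u (\<lambda>x y. B (io X \<otimes>\<^bsub>U\<^esub> x) y + B (UU.wt (\<omega> d) x) (io X \<otimes>\<^bsub>U\<^esub> y))"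
  unfolding com_mult[OF io_carrier[OF GLd_GL]] com_io[OF GLd_GL] dl_def
  by (rule UU.tm_prim_l[OF com_TT io_grade])

lemma com_Xr: "\<lbrakk>X \<in> GLd d; u \<in> carrier U; B \<in> UU.Bil\<rbrakk> \<Longrightarrow>
    comult U (u \<otimes>\<^bsub>U\<^esub> io X) B = comult U u (\<lambda>x y. B (x \<otimes>\<^bsub>U\<^esub> io X) (UU.wt (\<lambda>\<beta>. \<omega> \<beta> d) y) + B x (y \<otimes>\<^bsub>U\<^esub> io X))"
  unfolding com_mult[OF _ io_carrier[OF GLd_GL]] com_io[OF GLd_GL] dl_def
  by (rule UU.tm_prim_r[OF com_TT io_grade])

lemma com_grade: "u \<in> grade U \<alpha> \<Longrightarrow> comult U u \<in> tensor_sums U U {(x, y). \<exists>\<beta>. x \<in> grade U \<beta> \<and> y \<in> grade U (\<alpha> - \<beta>)}"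
proof (induction rule: U_grade_induct)
  case (zero \<alpha>)
  then show ?case using com_sm[OF UU.one_closed, of 0] UU.ts_zero by (simp add: zero_fun_def)
next
  case one
  show ?case unfolding com_one by (rule UU.ts_pt) (auto intro!: exI[of _ 0])
next
  case (step X d \<alpha> x)
  then show ?case
    using UU.ts_prim[OF step.IH io_grade[OF step(1)]]
    by (simp add: com_mult com_io GLd_GL UU.grade_carrier dl_def)
next
  case (add \<alpha> x y)
  then show ?case by (simp add: com_add UU.grade_carrier UU.ts_add)
next
  case (sm \<alpha> c x)
  have "z \<in> tensor_sums U U {(x, y). \<exists>\<beta>. x \<in> grade U \<beta> \<and> y \<in> grade U (\<alpha> - \<beta>)} \<Longrightarrow>
     (\<lambda>B. c * z B) \<in> tensor_sums U U {(x, y). \<exists>\<beta>. x \<in> grade U \<beta> \<and> y \<in> grade U (\<alpha> - \<beta>)}" for z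
  proof (induction rule: UU.ts_induct)
    case zero
    then show ?case using UU.ts_zero by (simp add: zero_fun_def)
  next
    case (pt x y z)
    have "(\<lambda>B. c * (UU.pt x y + z) B) = UU.pt (c \<odot>\<^bsub>U\<^esub> x) y + (\<lambda>B. c * z B)"
      using pt(1) by (auto simp: fun_app distrib_left UU.pt_sm1 UU.grade_carrier)
    moreover have "UU.pt (c \<odot>\<^bsub>U\<^esub> x) y \<in> tensor_sums U U {(x, y). \<exists>\<beta>. x \<in> grade U \<beta> \<and> y \<in> grade U (\<alpha> - \<beta>)}"
      by (rule UU.ts_pt) (use pt(1) in \<open>auto intro: UU.grade_sm\<close>)
    ultimately show ?case using pt(3) by (simp add: UU.ts_add)
  qed
  then show ?case using sm com_sm[OF UU.grade_carrier[OF sm(1)]] by simp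
qed

lemma com_wt: "\<lbrakk>u \<in> carrier U; B \<in> UU.Bil\<rbrakk> \<Longrightarrow>
    comult U (UU.wt (\<omega> d) u) B = comult U u (\<lambda>x y. B (UU.wt (\<omega> d) x) (UU.wt (\<omega> d) y))"
proof (induction rule: UU.hom_induct)
  case (hom \<alpha> u)
  then show ?case using UU.ts_wt[OF com_grade[OF hom(1)] hom(2), of d]
    by (simp add: UU.wt_hom com_sm UU.grade_carrier)
qed (simp add: UU.wt_add com_add fun_app)

subsection \<open>The counit\<close>

lemma counit_frep: "frep (*) GL (UNIV :: complex set) {0} (\<lambda>X z. 0)"
  by unfold_locales (simp_all add: algebra_simps)

interpretation ER: frep "(*)" GL "UNIV :: complex set" "{0}" "\<lambda>X z. 0"
  by (rule counit_frep)

lemma ER_I: "x \<in> I \<Longrightarrow> ER.act x w = 0"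
proof -
  assume x: "x \<in> I"
  have "ER.act x w \<in> {0}"
  proof (rule ER.act_kill[OF rels_CF _ x[unfolded env_ideal_def] UNIV_I])
    fix x w assume x: "x \<in> env_relations \<omega> scale V"
    from x consider (add) X Y where "x = gen (\<lambda>v. X v + Y v) - gen X - gen Y" "X \<in> GL" "Y \<in> GL"
      | (scale) c X where "x = gen (\<lambda>v. scale c (X v)) - sc c (gen X)" "X \<in> GL"
      | (brk) X Y \<alpha> \<beta> where "x = rel \<alpha> \<beta> X Y" "X \<in> GLd \<alpha>" "Y \<in> GLd \<beta>"
      unfolding rels_eq by blast
    then show "ER.act x w \<in> {0}"
    proof cases
      case brk
      note X = GLd_GL[OF brk(2)] and Y = GLd_GL[OF brk(3)]
      then show ?thesis unfolding brk(1) rel_def ER.act_minus ER.act_sc by (simp add: ER.act_mult CF_gen ER.act_gen)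
    qed (simp_all add: ER.act_minus ER.act_gen ER.act_sc)
  qed
  then show ?thesis by simp
qed

lemma cou_spec: "alg_hom U complex_alg (counit U) \<and> (\<forall>X\<in>GL. counit U (io X) = 0)"
proof -
  define D where "D = (\<lambda>u. ER.act (SOME x. x \<in> u) 1)"
  have Dcl: "D (cl x) = ER.act x 1" if x: "x \<in> PF" for x
    using ER_I[OF conjunct2[OF some_cl[OF x]]] by (simp add: D_def ER.act_minus)
  have D1: "D \<one>\<^bsub>U\<^esub> = 1" using Dcl[OF CF_one] by (simp add: ER.act_one flip: U_one)
  have D: "D (c \<odot>\<^bsub>U\<^esub> x) = c * D x" if x: "x \<in> carrier U" for x c
  proof -
    obtain a where a: "a \<in> PF" "x = cl a" using x by (rule U_cases)
    show ?thesis using a by (simp add: Dcl cl_sc CF_sc ER.act_sc)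
  qed
  have D2: "D (x \<oplus>\<^bsub>U\<^esub> y) = D x + D y" "D (x \<otimes>\<^bsub>U\<^esub> y) = D x * D y" if x: "x \<in> carrier U" and y: "y \<in> carrier U" for x y
  proof -
    obtain a where a: "a \<in> PF" "x = cl a" using x by (rule U_cases)
    obtain b where b: "b \<in> PF" "y = cl b" using y by (rule U_cases)
    show "D (x \<oplus>\<^bsub>U\<^esub> y) = D x + D y" using a b by (simp add: cl_add CF_add Dcl ER.act_add)
    show "D (x \<otimes>\<^bsub>U\<^esub> y) = D x * D y"
      using a b ER.act_sc2[OF a(1), of 1 "ER.act b 1"] by (simp add: cl_mult CF_mult Dcl ER.act_mult)
  qed
  have "alg_hom U complex_alg D"
    using D D1 D2 by (simp add: alg_hom_def ring_hom_def complex_alg_def)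
  moreover have "D (io X) = 0" if "X \<in> GL" for X
    unfolding io_def Dcl[OF CF_gen[OF that]] ER.act_gen ..
  ultimately have ex: "\<exists>\<epsilon>. alg_hom U complex_alg \<epsilon> \<and> (\<forall>X\<in>GL. \<epsilon> (io X) = 0)" by blast
  have "counit U = env_counit \<omega> scale V" by (simp add: env_def graded.defs hopf.defs)
  also have "\<dots> = (SOME \<epsilon>. alg_hom U complex_alg \<epsilon> \<and> (\<forall>X\<in>GL. \<epsilon> (io X) = 0))"
    unfolding env_counit_def env_incl_io alg_hom_env ..
  finally have "counit U = (SOME \<epsilon>. alg_hom U complex_alg \<epsilon> \<and> (\<forall>X\<in>GL. \<epsilon> (io X) = 0))" .
  then show ?thesis using someI_ex[OF ex] by simp
qed

lemma cou_lin: "lin U (counit U)"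
  and cou_mult: "x \<in> carrier U \<Longrightarrow> y \<in> carrier U \<Longrightarrow> counit U (x \<otimes>\<^bsub>U\<^esub> y) = counit U x * counit U y"
  and cou_one: "counit U \<one>\<^bsub>U\<^esub> = 1"
  and cou_io: "X \<in> GL \<Longrightarrow> counit U (io X) = 0"
  using cou_spec by (auto simp: alg_hom_def ring_hom_def complex_alg_def lin_def)

lemma cou_X: "X \<in> GL \<Longrightarrow> u \<in> carrier U \<Longrightarrow> counit U (io X \<otimes>\<^bsub>U\<^esub> u) = 0"
  by (simp add: cou_mult cou_io)

lemma cou_grade: "u \<in> grade U \<alpha> \<Longrightarrow> \<alpha> \<noteq> 0 \<Longrightarrow> counit U u = 0"
proof (induction rule: U_grade_induct)
  case (zero \<alpha>)
  then show ?case by (simp add: UU.lin_0[OF cou_lin])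
qed (auto simp: cou_X GLd_GL UU.grade_carrier lin_add[OF cou_lin] lin_smult[OF cou_lin])

lemma cou_wt: "u \<in> carrier U \<Longrightarrow> counit U (UU.wt (\<omega> d) u) = counit U u"
proof (induction rule: UU.hom_induct)
  case (hom \<alpha> u)
  then show ?case using cou_grade[OF hom] by (cases "\<alpha> = 0") (simp_all add: UU.wt_hom lin_smult[OF cou_lin] UU.grade_carrier)
qed (simp add: UU.wt_add lin_add[OF cou_lin])

text \<open>In the induction step the co-unit annihilates the term in which \<open>X\<close> acts on
  the first leg, and it ignores the weight in the other term because it lives in degree 0. What
  remains is the claim for the form \<open>f\<close> precomposed with left multiplication by
  \<open>X\<close>, which is why \<open>f\<close> is general.\<close>

lemma cou_l: "u \<in> carrier U \<Longrightarrow> lin U f \<Longrightarrow> comult U u (\<lambda>y z. counit U y * f z) = f u"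
proof (induction arbitrary: f rule: U_induct)
  case one
  then show ?case by (simp add: com_one bilin_prod cou_lin cou_one)
next
  case (step X d \<alpha> x)
  note x = UU.grade_carrier[OF step(2)] and X = GLd_GL[OF step(1)]
  have B: "(\<lambda>y z. counit U y * f z) \<in> UU.Bil" by (rule bilin_prod[OF cou_lin step.prems])
  have f: "lin U (\<lambda>z. f (io X \<otimes>\<^bsub>U\<^esub> z))" by (rule UU.lin_lmult[OF step.prems io_carrier[OF X]])
  have "comult U (io X \<otimes>\<^bsub>U\<^esub> x) (\<lambda>y z. counit U y * f z) = comult U x (\<lambda>y z. counit U y * f (io X \<otimes>\<^bsub>U\<^esub> z))"
    unfolding com_X[OF step(1) x B]
    by (rule UU.TT_cong[OF com_TT[OF x] UU.prim_form(1)[OF io_carrier[OF X] B] bilin_prod[OF cou_lin f]])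
      (simp add: cou_X X UU.grade_carrier cou_wt)
  then show ?case using step.IH[OF f] by simp
qed (simp_all add: com_add com_sm fun_app lin_add lin_smult)

lemma cou_r: "u \<in> carrier U \<Longrightarrow> lin U f \<Longrightarrow> comult U u (\<lambda>y z. f y * counit U z) = f u"
proof (induction arbitrary: f rule: U_induct)
  case one
  then show ?case by (simp add: com_one bilin_prod cou_lin cou_one)
next
  case (step X d \<alpha> x)
  note x = UU.grade_carrier[OF step(2)] and X = GLd_GL[OF step(1)]
  have B: "(\<lambda>y z. f y * counit U z) \<in> UU.Bil" by (rule bilin_prod[OF step.prems cou_lin])
  have f: "lin U (\<lambda>z. f (io X \<otimes>\<^bsub>U\<^esub> z))" by (rule UU.lin_lmult[OF step.prems io_carrier[OF X]])
  have "comult U (io X \<otimes>\<^bsub>U\<^esub> x) (\<lambda>y z. f y * counit U z) = comult U x (\<lambda>y z. f (io X \<otimes>\<^bsub>U\<^esub> y) * counit U z)"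
    unfolding com_X[OF step(1) x B]
    by (rule UU.TT_cong[OF com_TT[OF x] UU.prim_form(1)[OF io_carrier[OF X] B] bilin_prod[OF f cou_lin]])
      (simp add: cou_X X UU.grade_carrier)
  then show ?case using step.IH[OF f] by simp
qed (simp_all add: com_add com_sm fun_app lin_add lin_smult)

subsection \<open>Coassociativity\<close>

lemma triD: "trilin U B \<Longrightarrow> z \<in> carrier U \<Longrightarrow> (\<lambda>x y. B x y z) \<in> UU.Bil" "trilin U B \<Longrightarrow> x \<in> carrier U \<Longrightarrow> B x \<in> UU.Bil"
  by (auto simp: trilin_def)

lemma tri_lin: "trilin U B \<Longrightarrow> y \<in> carrier U \<Longrightarrow> z \<in> carrier U \<Longrightarrow> lin U (\<lambda>x. B x y z)"
  "trilin U B \<Longrightarrow> x \<in> carrier U \<Longrightarrow> z \<in> carrier U \<Longrightarrow> lin U (\<lambda>y. B x y z)"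
  "trilin U B \<Longrightarrow> x \<in> carrier U \<Longrightarrow> y \<in> carrier U \<Longrightarrow> lin U (\<lambda>z. B x y z)"
  using bilin1[OF triD(1)] bilin2[OF triD(1)] bilin2[OF triD(2)] by blast+

lemma triI: "\<lbrakk>\<And>y z. y \<in> carrier U \<Longrightarrow> z \<in> carrier U \<Longrightarrow> lin U (\<lambda>x. B x y z);
  \<And>x z. x \<in> carrier U \<Longrightarrow> z \<in> carrier U \<Longrightarrow> lin U (\<lambda>y. B x y z);
  \<And>x y. x \<in> carrier U \<Longrightarrow> y \<in> carrier U \<Longrightarrow> lin U (\<lambda>z. B x y z)\<rbrakk> \<Longrightarrow> trilin U B"
  unfolding trilin_def by (auto intro!: bilinI)

lemma com_lin: "lin U (\<lambda>x. comult U x B)"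
  by (simp add: lin_def com_add com_sm fun_app)

lemma tri_Bil1: "trilin U B \<Longrightarrow> (\<lambda>y z. comult U y (\<lambda>u v. B u v z)) \<in> UU.Bil"
proof (rule bilinI)
  fix y assume B: "trilin U B" and y: "y \<in> carrier U"
  show "lin U (\<lambda>z. comult U y (\<lambda>u v. B u v z))"
    unfolding lin_def
  proof (intro conjI ballI allI)
    fix z w c assume z: "z \<in> carrier U"
    have "comult U y (\<lambda>u v. B u v (c \<odot>\<^bsub>U\<^esub> z)) = comult U y (\<lambda>u v. c * B u v z)"
      by (rule UU.TT_cong[OF com_TT[OF y] triD(1)[OF B] bilin_times[OF triD(1)[OF B]]])
        (auto simp: z UU.grade_carrier lin_smult[OF tri_lin(3)[OF B]])
    then show "comult U y (\<lambda>u v. B u v (c \<odot>\<^bsub>U\<^esub> z)) = c * comult U y (\<lambda>u v. B u v z)"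
      using UU.TT_times[OF com_TT[OF y] triD(1)[OF B z]] by simp
    assume w: "w \<in> carrier U"
    have "comult U y (\<lambda>u v. B u v (z \<oplus>\<^bsub>U\<^esub> w)) = comult U y (\<lambda>u v. B u v z + B u v w)"
      by (rule UU.TT_cong[OF com_TT[OF y] triD(1)[OF B] bilin_plus[OF triD(1)[OF B] triD(1)[OF B]]])
        (auto simp: z w UU.grade_carrier lin_add[OF tri_lin(3)[OF B]])
    then show "comult U y (\<lambda>u v. B u v (z \<oplus>\<^bsub>U\<^esub> w)) = comult U y (\<lambda>u v. B u v z) + comult U y (\<lambda>u v. B u v w)"
      using UU.TT_plus[OF com_TT[OF y] triD(1)[OF B z] triD(1)[OF B w]] by simp
  qed
qed (rule com_lin)

lemma tri_Bil2: "trilin U B \<Longrightarrow> (\<lambda>y z. comult U z (B y)) \<in> UU.Bil"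
proof (rule bilinI)
  fix z assume B: "trilin U B" and z: "z \<in> carrier U"
  show "lin U (\<lambda>y. comult U z (B y))"
    unfolding lin_def
  proof (intro conjI ballI allI)
    fix y w c assume y: "y \<in> carrier U"
    have "comult U z (B (c \<odot>\<^bsub>U\<^esub> y)) = comult U z (\<lambda>u v. c * B y u v)"
      by (rule UU.TT_cong[OF com_TT[OF z] triD(2)[OF B] bilin_times[OF triD(2)[OF B]]])
        (auto simp: y UU.grade_carrier lin_smult[OF tri_lin(1)[OF B]])
    then show "comult U z (B (c \<odot>\<^bsub>U\<^esub> y)) = c * comult U z (B y)"
      using UU.TT_times[OF com_TT[OF z] triD(2)[OF B y]] by simp
    assume w: "w \<in> carrier U"
    have "comult U z (B (y \<oplus>\<^bsub>U\<^esub> w)) = comult U z (\<lambda>u v. B y u v + B w u v)"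
      by (rule UU.TT_cong[OF com_TT[OF z] triD(2)[OF B] bilin_plus[OF triD(2)[OF B] triD(2)[OF B]]])
        (auto simp: y w UU.grade_carrier lin_add[OF tri_lin(1)[OF B]])
    then show "comult U z (B (y \<oplus>\<^bsub>U\<^esub> w)) = comult U z (B y) + comult U z (B w)"
      using UU.TT_plus[OF com_TT[OF z] triD(2)[OF B y] triD(2)[OF B w]] by simp
  qed
qed (rule com_lin)

lemma coassoc: "u \<in> carrier U \<Longrightarrow> trilin U B \<Longrightarrow>
    comult U u (\<lambda>y z. comult U y (\<lambda>a b. B a b z)) = comult U u (\<lambda>y z. comult U z (B y))"
proof (induction arbitrary: B rule: U_induct)
  case one
  show ?case using tri_Bil1[OF one] tri_Bil2[OF one] triD(1)[OF one UU.one_closed] triD(2)[OF one UU.one_closed]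
    by (simp add: com_one)
next
  case (step X d \<alpha> x)
  let ?X = "io X" and ?s = "UU.wt (\<omega> d)"
  note x = UU.grade_carrier[OF step(2)] and X = io_carrier[OF GLd_GL[OF step(1)]] and B = step.prems
  \<comment> \<open>The effect on a trilinear form of the iterated co-product of \<open>X\<close>,
    with \<open>X\<close> in the first, second and third leg and weights on the legs that it passes.
    Both orders of splitting lead to this form.\<close>
  define B' where "B' = (\<lambda>a b w. B (?X \<otimes>\<^bsub>U\<^esub> a) b w + B (?s a) (?X \<otimes>\<^bsub>U\<^esub> b) w + B (?s a) (?s b) (?X \<otimes>\<^bsub>U\<^esub> w))"
  note l = tri_lin[OF B]
  have B': "trilin U B'" unfolding B'_def
    by (rule triI; intro lin_plus)
      (auto intro!: l UU.lin_lmult[where f = "\<lambda>x. B x _ _", OF l(1)] UU.lin_wt[where f = "\<lambda>x. B x _ _", OF l(1)]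
        UU.lin_lmult[where f = "\<lambda>x. B _ x _", OF l(2)] UU.lin_wt[where f = "\<lambda>x. B _ x _", OF l(2)]
        UU.lin_lmult[where f = "\<lambda>x. B _ _ x", OF l(3)] X)
  have 1: "comult U (?X \<otimes>\<^bsub>U\<^esub> y) (\<lambda>a b. B a b z) + comult U (?s y) (\<lambda>a b. B a b (?X \<otimes>\<^bsub>U\<^esub> z)) = comult U y (\<lambda>a b. B' a b z)"
    if y: "y \<in> carrier U" and z: "z \<in> carrier U" for y z
  proof -
    note Xz = UU.m_closed[OF X z]
    have b: "(\<lambda>a b. B (?s a) (?s b) (?X \<otimes>\<^bsub>U\<^esub> z)) \<in> UU.Bil"
      by (rule bilinI) (auto intro!: UU.lin_wt[where f = "\<lambda>x. B x _ _", OF l(1)] UU.lin_wt[where f = "\<lambda>x. B _ x _", OF l(2)] Xz)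
    show ?thesis unfolding com_X[OF step(1) y triD(1)[OF B z]] com_wt[OF y triD(1)[OF B Xz]] B'_def
      by (rule UU.TT_plus[OF com_TT[OF y] UU.prim_form(1)[OF X triD(1)[OF B z]] b, symmetric])
  qed
  have 2: "comult U z (B (?X \<otimes>\<^bsub>U\<^esub> y)) + comult U (?X \<otimes>\<^bsub>U\<^esub> z) (B (?s y)) = comult U z (B' y)"
    if y: "y \<in> carrier U" and z: "z \<in> carrier U" for y z
  proof -
    note Xy = UU.m_closed[OF X y] and sy = UU.wt_closed[OF y]
    have "comult U z (B (?X \<otimes>\<^bsub>U\<^esub> y)) + comult U (?X \<otimes>\<^bsub>U\<^esub> z) (B (?s y)) =
      comult U z (\<lambda>u v. B (?X \<otimes>\<^bsub>U\<^esub> y) u v + (B (?s y) (?X \<otimes>\<^bsub>U\<^esub> u) v + B (?s y) (?s u) (?X \<otimes>\<^bsub>U\<^esub> v)))"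
      unfolding com_X[OF step(1) z triD(2)[OF B sy]]
      by (rule UU.TT_plus[OF com_TT[OF z] triD(2)[OF B Xy] UU.prim_form(1)[OF X triD(2)[OF B sy]], symmetric])
    then show ?thesis by (simp add: B'_def add.assoc)
  qed
  have "comult U (?X \<otimes>\<^bsub>U\<^esub> x) (\<lambda>y z. comult U y (\<lambda>a b. B a b z)) = comult U x (\<lambda>y z. comult U y (\<lambda>a b. B' a b z))"
    unfolding com_X[OF step(1) x tri_Bil1[OF B]]
    by (rule UU.TT_cong[OF com_TT[OF x] UU.prim_form(1)[OF X tri_Bil1[OF B]] tri_Bil1[OF B']]) (rule 1; auto)
  moreover have "comult U (?X \<otimes>\<^bsub>U\<^esub> x) (\<lambda>y z. comult U z (B y)) = comult U x (\<lambda>y z. comult U z (B' y))"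
    unfolding com_X[OF step(1) x tri_Bil2[OF B]]
    by (rule UU.TT_cong[OF com_TT[OF x] UU.prim_form(1)[OF X tri_Bil2[OF B]] tri_Bil2[OF B']]) (rule 2; auto)
  ultimately show ?case using step.IH[OF B'] by simp
qed (simp_all add: com_add com_sm fun_app)

end

subsection \<open>The antipode\<close>

context gvs
begin

interpretation SI: grep \<omega> scale V n e \<gamma> "\<lambda>d X \<kappa> x. sc (- \<omega> d \<kappa>) (x * gen X)"
  by (rule SI_grep)

lemma Sum_any_PF: "(\<And>\<kappa>. f \<kappa> \<in> PF) \<Longrightarrow> Sum_any f \<in> PF"
  unfolding Sum_any.expand_set by (rule CF_sum)

lemma Sum_any_I: "(\<And>\<kappa>. f \<kappa> \<in> I) \<Longrightarrow> Sum_any f \<in> I"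
  unfolding Sum_any.expand_set by (rule I_sum)

lemma Sum_any_sc: "Sum_any (\<lambda>\<kappa>. sc c (f \<kappa>)) = sc c (Sum_any f)" if "finite {\<kappa>. f \<kappa> \<noteq> 0}"
proof -
  have "{\<kappa>. sc c (f \<kappa>) \<noteq> 0} \<subseteq> {\<kappa>. f \<kappa> \<noteq> 0}" by (auto simp: sc_zero)
  then have "Sum_any (\<lambda>\<kappa>. sc c (f \<kappa>)) = (\<Sum>\<kappa> | f \<kappa> \<noteq> 0. sc c (f \<kappa>))" by (rule Sum_any.expand_superset[OF that])
  also have "\<dots> = sc c (Sum_any f)" unfolding Sum_any.expand_set by (rule sc_sum[symmetric])
  finally show ?thesis .
qed

text \<open>The components \<open>SI.T\<close> of a representative are summed over their finite
  support; the indexing by degree serves only to supply the factors in the action.\<close>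

definition AS :: "'v env \<Rightarrow> 'v env" where
  "AS u = cl (Sum_any (SI.T (SOME x. x \<in> u)))"

lemma ST_PF: "x \<in> PF \<Longrightarrow> Sum_any (SI.T x) \<in> PF"
  by (intro Sum_any_PF hF_CF[OF SI.T_hF])

lemma AS_cl: "x \<in> PF \<Longrightarrow> AS (cl x) = cl (Sum_any (SI.T x))"
proof -
  assume x: "x \<in> PF"
  let ?y = "SOME y. y \<in> cl x"
  have y: "?y \<in> PF" "?y - x \<in> I" using some_cl[OF x] by blast+
  have "Sum_any (SI.T ?y) = Sum_any (\<lambda>\<kappa>. SI.T x \<kappa> + SI.T (?y - x) \<kappa>)" by (simp add: SI.T_minus)
  also have "\<dots> = Sum_any (SI.T x) + Sum_any (SI.T (?y - x))"
    by (rule Sum_any.distrib) (use SI.T_finite x y CF_minus in blast)+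
  finally have "Sum_any (SI.T ?y) - Sum_any (SI.T x) \<in> I" using Sum_any_I[OF SI.T_I[OF y(2)]] by simp
  then show ?thesis unfolding AS_def using cl_eq[OF ST_PF[OF y(1)] ST_PF[OF x]] by simp
qed

lemma AS_closed: "u \<in> carrier U \<Longrightarrow> AS u \<in> carrier U"
  by (auto elim!: U_cases simp: AS_cl cl_carrier ST_PF)

lemma AS_add: "u \<in> carrier U \<Longrightarrow> v \<in> carrier U \<Longrightarrow> AS (u \<oplus>\<^bsub>U\<^esub> v) = AS u \<oplus>\<^bsub>U\<^esub> AS v"
proof -
  assume u: "u \<in> carrier U" and v: "v \<in> carrier U"
  obtain x where x: "x \<in> PF" "u = cl x" using u by (rule U_cases)
  obtain y where y: "y \<in> PF" "v = cl y" using v by (rule U_cases)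
  have "Sum_any (SI.T (x + y)) = Sum_any (\<lambda>\<kappa>. SI.T x \<kappa> + SI.T y \<kappa>)" by (simp add: SI.T_add)
  also have "\<dots> = Sum_any (SI.T x) + Sum_any (SI.T y)"
    by (rule Sum_any.distrib) (use SI.T_finite x y in blast)+
  finally show ?thesis using x y by (simp add: cl_add CF_add AS_cl ST_PF)
qed

lemma AS_sm: "u \<in> carrier U \<Longrightarrow> AS (c \<odot>\<^bsub>U\<^esub> u) = c \<odot>\<^bsub>U\<^esub> AS u"
proof -
  assume u: "u \<in> carrier U"
  obtain x where x: "x \<in> PF" "u = cl x" using u by (rule U_cases)
  have "Sum_any (SI.T (sc c x)) = Sum_any (\<lambda>\<kappa>. sc c (SI.T x \<kappa>))" by (simp add: SI.T_sc)
  also have "\<dots> = sc c (Sum_any (SI.T x))" by (rule Sum_any_sc[OF SI.T_finite[OF x(1)]])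
  finally show ?thesis using x by (simp add: cl_sc CF_sc AS_cl ST_PF)
qed

lemma AS_hom: "x \<in> hF \<alpha> \<Longrightarrow> AS (cl x) = cl (SI.T x \<alpha>)"
proof -
  assume x: "x \<in> hF \<alpha>"
  note xC = hF_CF[OF x]
  let ?S = "insert \<alpha> {\<kappa>. SI.T x \<kappa> \<noteq> 0}"
  have f: "finite ?S" using SI.T_finite[OF xC] by simp
  have "Sum_any (SI.T x) = (\<Sum>\<kappa>\<in>?S. SI.T x \<kappa>)" by (rule Sum_any.expand_superset[OF f]) auto
  also have "\<dots> = SI.T x \<alpha> + (\<Sum>\<kappa>\<in>?S - {\<alpha>}. SI.T x \<kappa>)" by (rule sum.remove[OF f]) simp
  finally have "Sum_any (SI.T x) - SI.T x \<alpha> \<in> I" using I_sum[of "?S - {\<alpha>}" "SI.T x"] SI.T_conc[OF x] by simp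
  then show ?thesis unfolding AS_cl[OF xC] using cl_eq[OF ST_PF[OF xC] hF_CF[OF SI.T_hF[OF xC]]] by simp
qed

lemma AS_one: "AS \<one>\<^bsub>U\<^esub> = \<one>\<^bsub>U\<^esub>"
  using AS_hom[OF hF_one] by (simp add: SI.T_one U_one)

lemma AS_X: "X \<in> GLd d \<Longrightarrow> u \<in> grade U \<alpha> \<Longrightarrow> AS (io X \<otimes>\<^bsub>U\<^esub> u) = (- \<omega> d \<alpha>) \<odot>\<^bsub>U\<^esub> (AS u \<otimes>\<^bsub>U\<^esub> io X)"
proof -
  assume X: "X \<in> GLd d" and u: "u \<in> grade U \<alpha>"
  obtain x where x: "u = cl x" "x \<in> hF \<alpha>" using u by (auto simp: U_grade)
  note XC = CF_gen[OF GLd_GL[OF X]] and xC = hF_CF[OF x(2)]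
  note TC = hF_CF[OF SI.T_hF[OF xC, of \<alpha>]]
  have "AS (io X \<otimes>\<^bsub>U\<^esub> u) = cl (SI.T (gen X * x) (d + \<alpha>))"
    unfolding x(1) io_def cl_mult[OF XC xC] by (rule AS_hom[OF hF_mult[OF hF_gen[OF X] x(2)]])
  also have "\<dots> = cl (sc (- \<omega> d \<alpha>) (SI.T x \<alpha> * gen X))"
    using SI.T_gen[OF X xC, of "d + \<alpha>"]
    by (subst cl_eq) (simp_all add: CF_sc CF_mult TC XC hF_CF[OF SI.T_hF[OF CF_mult[OF XC xC]]])
  finally show ?thesis unfolding x(1) AS_hom[OF x(2)] io_def cl_mult[OF TC XC] cl_sc[OF CF_mult[OF TC XC]] .
qed

text \<open>Induction on the first factor. The scalars match because \<open>\<omega> d (\<alpha> +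
  \<beta>) * \<omega> \<alpha> \<beta> = \<omega> (d + \<alpha>) \<beta> * \<omega> d
  \<alpha>\<close>.\<close>

lemma AS_mult: "u \<in> grade U \<alpha> \<Longrightarrow> v \<in> grade U \<beta> \<Longrightarrow> AS (u \<otimes>\<^bsub>U\<^esub> v) = \<omega> \<alpha> \<beta> \<odot>\<^bsub>U\<^esub> (AS v \<otimes>\<^bsub>U\<^esub> AS u)"
proof (induction arbitrary: rule: U_grade_induct)
  case (zero \<alpha>)
  then show ?case using AS_sm[OF UU.one_closed, of 0] AS_closed UU.grade_carrier by simp
next
  case one
  then show ?case using AS_closed UU.grade_carrier by (simp add: AS_one)
next
  case (step X d \<alpha> u)
  note X = io_carrier[OF GLd_GL[OF step(1)]] and u = UU.grade_carrier[OF step(2)] and v = UU.grade_carrier[OF step.prems]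
  note S = AS_closed[OF u] AS_closed[OF v]
  have "AS (io X \<otimes>\<^bsub>U\<^esub> u \<otimes>\<^bsub>U\<^esub> v) = AS (io X \<otimes>\<^bsub>U\<^esub> (u \<otimes>\<^bsub>U\<^esub> v))" using X u v by (simp add: UU.m_assoc)
  also have "\<dots> = (- \<omega> d (\<alpha> + \<beta>)) \<odot>\<^bsub>U\<^esub> ((\<omega> \<alpha> \<beta> \<odot>\<^bsub>U\<^esub> (AS v \<otimes>\<^bsub>U\<^esub> AS u)) \<otimes>\<^bsub>U\<^esub> io X)"
    using AS_X[OF step(1) UU.grade_mult[OF step(2) step.prems]] step.IH[OF step.prems] by simp
  also have "\<dots> = (\<omega> (d + \<alpha>) \<beta> * - \<omega> d \<alpha>) \<odot>\<^bsub>U\<^esub> (AS v \<otimes>\<^bsub>U\<^esub> (AS u \<otimes>\<^bsub>U\<^esub> io X))"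
    using S X by (simp add: UU.sm_mult UU.m_assoc UU.sm_assoc[symmetric] om_add mult_ac)
  also have "\<dots> = \<omega> (d + \<alpha>) \<beta> \<odot>\<^bsub>U\<^esub> (AS v \<otimes>\<^bsub>U\<^esub> AS (io X \<otimes>\<^bsub>U\<^esub> u))"
    unfolding AS_X[OF step(1,2)] using S X by (simp add: UU.sm_mult flip: UU.sm_assoc)
  finally show ?case .
next
  case (add \<alpha> x y)
  note c = UU.grade_carrier[OF add(1)] UU.grade_carrier[OF add(2)] UU.grade_carrier[OF add.prems]
  then show ?case using add AS_closed
    by (simp add: UU.l_distr UU.r_distr AS_add UU.sm_add2)
next
  case (sm \<alpha> c x)
  note c = UU.grade_carrier[OF sm(1)] UU.grade_carrier[OF sm.prems]
  show ?case using sm c AS_closed[OF c(1)] AS_closed[OF c(2)]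
    by (simp add: UU.sm_mult AS_sm UU.sm_assoc[symmetric] mult.commute)
qed

text \<open>\<open>AS_X\<close> concerns homogeneous letters only, so \<open>X\<close> is written as
  the sum of its components and additivity is used.\<close>

lemma AS_io: "X \<in> GL \<Longrightarrow> AS (io X) = \<ominus>\<^bsub>U\<^esub> io X"
proof -
  assume X: "X \<in> GL"
  have h: "AS (io Y) = (- 1) \<odot>\<^bsub>U\<^esub> io Y" if Y: "Y \<in> GLd d" for Y d
    using AS_X[OF Y UU.grade_one] GLd_GL[OF Y] by (simp add: AS_one)
  have "(\<lambda>v. \<Sum>d\<in>S. hc d X v) \<in> GL \<and> AS (io (\<lambda>v. \<Sum>d\<in>S. hc d X v)) = (- 1) \<odot>\<^bsub>U\<^esub> io (\<lambda>v. \<Sum>d\<in>S. hc d X v)" if "finite S" for S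
    using that
  proof (induction S rule: finite_induct)
    case empty
    show ?case using h[OF GLd_zero] gl_zero by simp
  next
    case (insert d S)
    note hg = hc_GLd[OF X, of d]
    show ?case using insert h[OF hg] GLd_GL[OF hg]
      by (simp add: gl_plus io_add AS_add UU.sm_add2)
  qed
  from this[OF DD_finite] have "AS (io X) = (- 1) \<odot>\<^bsub>U\<^esub> io X" by (simp add: hc_sum[OF X])
  then show ?thesis using X by (simp add: UU.sm_minus)
qed

lemma a_inv_env: "x \<in> carrier U \<Longrightarrow> \<ominus>\<^bsub>env_alg \<omega> scale V\<^esub> x = \<ominus>\<^bsub>U\<^esub> x"
  by (simp add: a_inv_def m_inv_def env_sel0)

definition antipodal :: "('v env \<Rightarrow> 'v env) \<Rightarrow> bool" where
  "antipodal S \<longleftrightarrow> S \<in> carrier U \<rightarrow> carrier U \<and>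
       (\<forall>x\<in>carrier U. \<forall>y\<in>carrier U. S (x \<oplus>\<^bsub>U\<^esub> y) = S x \<oplus>\<^bsub>U\<^esub> S y) \<and>
       (\<forall>c. \<forall>x\<in>carrier U. S (c \<odot>\<^bsub>U\<^esub> x) = c \<odot>\<^bsub>U\<^esub> S x) \<and>
       S \<one>\<^bsub>U\<^esub> = \<one>\<^bsub>U\<^esub> \<and>
       (\<forall>\<alpha> \<beta>. \<forall>x\<in>grade U \<alpha>. \<forall>y\<in>grade U \<beta>. S (x \<otimes>\<^bsub>U\<^esub> y) = \<omega> \<alpha> \<beta> \<odot>\<^bsub>U\<^esub> (S y \<otimes>\<^bsub>U\<^esub> S x)) \<and>
       (\<forall>X\<in>GL. S (io X) = \<ominus>\<^bsub>U\<^esub> io X)"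

lemma S_spec: "antipodal (antipode U)"
proof -
  have "antipodal AS" unfolding antipodal_def
    by (intro conjI ballI allI funcsetI AS_closed AS_add AS_sm AS_one AS_mult AS_io)
  then have ex: "\<exists>S. antipodal S" by blast
  have i: "(\<forall>X\<in>GL. f X = \<ominus>\<^bsub>env_alg \<omega> scale V\<^esub> io X) = (\<forall>X\<in>GL. f X = \<ominus>\<^bsub>U\<^esub> io X)" for f
    by (simp add: a_inv_env)
  have "antipode U = env_antipode \<omega> scale V" by (simp add: env_def graded.defs hopf.defs)
  also have "\<dots> = (SOME S. antipodal S)"
    unfolding env_antipode_def Let_def env_incl_io i antipodal_def unfolding env_sel0 ..
  finally have "antipode U = (SOME S. antipodal S)" .
  then show ?thesis using someI_ex[OF ex] by simp
qed

abbreviation "S0 \<equiv> antipode U"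

lemma S_closed: "x \<in> carrier U \<Longrightarrow> S0 x \<in> carrier U"
  and S_add: "x \<in> carrier U \<Longrightarrow> y \<in> carrier U \<Longrightarrow> S0 (x \<oplus>\<^bsub>U\<^esub> y) = S0 x \<oplus>\<^bsub>U\<^esub> S0 y"
  and S_sm: "x \<in> carrier U \<Longrightarrow> S0 (c \<odot>\<^bsub>U\<^esub> x) = c \<odot>\<^bsub>U\<^esub> S0 x"
  and S_one: "S0 \<one>\<^bsub>U\<^esub> = \<one>\<^bsub>U\<^esub>"
  and S_mult: "x \<in> grade U \<alpha> \<Longrightarrow> y \<in> grade U \<beta> \<Longrightarrow> S0 (x \<otimes>\<^bsub>U\<^esub> y) = \<omega> \<alpha> \<beta> \<odot>\<^bsub>U\<^esub> (S0 y \<otimes>\<^bsub>U\<^esub> S0 x)"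
  and S_io: "X \<in> GL \<Longrightarrow> S0 (io X) = \<ominus>\<^bsub>U\<^esub> io X"
  using S_spec unfolding antipodal_def by blast+

lemma S_X: "X \<in> GLd d \<Longrightarrow> u \<in> grade U \<alpha> \<Longrightarrow> S0 (io X \<otimes>\<^bsub>U\<^esub> u) = (- \<omega> d \<alpha>) \<odot>\<^bsub>U\<^esub> (S0 u \<otimes>\<^bsub>U\<^esub> io X)"
proof -
  assume X: "X \<in> GLd d" and u: "u \<in> grade U \<alpha>"
  note c = GLd_GL[OF X] S_closed[OF UU.grade_carrier[OF u]]
  show ?thesis unfolding S_mult[OF io_grade[OF X] u] S_io[OF c(1)]
    using c by (simp flip: UU.sm_minus add: UU.sm_mult) (simp flip: UU.sm_assoc)
qed

lemma S_grade: "u \<in> grade U \<alpha> \<Longrightarrow> S0 u \<in> grade U \<alpha>"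
proof (induction rule: U_grade_induct)
  case (zero \<alpha>)
  then show ?case using S_sm[OF UU.one_closed, of 0] by (simp add: S_one)
next
  case (step X d \<alpha> x)
  then show ?case using UU.grade_sm[OF UU.grade_mult[OF step.IH io_grade[OF step(1)]]] by (simp add: S_X add.commute)
qed (auto simp: S_one S_add S_sm UU.grade_carrier intro: UU.grade_add UU.grade_sm)

text \<open>Reversing a product twice yields the factors \<open>\<omega> d \<alpha>\<close> and
  \<open>\<omega> \<alpha> d\<close>, which cancel, and two signs from \<open>X\<close>, which
  cancel as well.\<close>

lemma S_S: "u \<in> carrier U \<Longrightarrow> S0 (S0 u) = u"
proof (induction rule: U_induct)
  case one
  show ?case by (simp add: S_one)
next
  case (step X d \<alpha> x)
  note c = GLd_GL[OF step(1)] UU.grade_carrier[OF step(2)]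
  have "S0 (S0 (io X \<otimes>\<^bsub>U\<^esub> x)) = (- \<omega> d \<alpha>) \<odot>\<^bsub>U\<^esub> (\<omega> \<alpha> d \<odot>\<^bsub>U\<^esub> ((- 1) \<odot>\<^bsub>U\<^esub> (io X \<otimes>\<^bsub>U\<^esub> x)))"
    unfolding S_X[OF step(1,2)] using c step.IH S_closed[OF c(2)] S_closed[OF UU.m_closed[OF S_closed[OF c(2)] io_carrier[OF c(1)]]]
    by (simp add: S_sm S_mult[OF S_grade[OF step(2)] io_grade[OF step(1)]] S_io UU.sm_mult flip: UU.sm_minus)
  also have "\<dots> = (\<omega> d \<alpha> * \<omega> \<alpha> d) \<odot>\<^bsub>U\<^esub> (io X \<otimes>\<^bsub>U\<^esub> x)" using c by (simp del: om_swap_mult flip: UU.sm_assoc)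
  finally show ?case using c by simp
qed (simp_all add: S_add S_sm S_closed)

lemma S_cou: "u \<in> carrier U \<Longrightarrow> counit U (S0 u) = counit U u"
proof (induction rule: U_induct)
  case (step X d \<alpha> x)
  note c = GLd_GL[OF step(1)] UU.grade_carrier[OF step(2)]
  show ?case unfolding S_X[OF step(1,2)] using c S_closed[OF c(2)]
    by (simp add: cou_mult cou_io lin_smult[OF cou_lin])
qed (simp_all add: S_one S_add S_sm S_closed lin_add[OF cou_lin] lin_smult[OF cou_lin])

text \<open>The form of \<open>S_X\<close> without homogeneity of \<open>z\<close>: the factor is
  moved into the weight. This matches the weights produced by \<open>com_X\<close>.\<close>

lemma S_Xn: "X \<in> GLd d \<Longrightarrow> z \<in> carrier U \<Longrightarrow> S0 (io X \<otimes>\<^bsub>U\<^esub> z) = (- 1) \<odot>\<^bsub>U\<^esub> (S0 (UU.wt (\<omega> d) z) \<otimes>\<^bsub>U\<^esub> io X)"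
proof -
  assume X: "X \<in> GLd d" and "z \<in> carrier U"
  from this(2) show ?thesis
  proof (induction rule: UU.hom_induct)
    case (hom \<alpha> z)
    then show ?case using GLd_GL[OF X] S_closed UU.grade_carrier
      by (simp add: S_X[OF X] UU.wt_hom S_sm UU.sm_mult flip: UU.sm_assoc)
  next
    case (add y z)
    then show ?case using GLd_GL[OF X] S_closed
      by (simp add: UU.r_distr UU.l_distr S_add UU.wt_add UU.sm_add2)
  qed
qed

lemma lin_S: "lin U f \<Longrightarrow> lin U (\<lambda>x. f (S0 x))"
  by (simp add: lin_def S_add S_sm S_closed)

text \<open>With \<open>X\<close> in the first leg, \<open>S_Xn\<close> gives minus the term with
  \<open>X\<close> in the second leg, so the two terms of \<open>com_X\<close> cancel pointwise. The
  right side is 0 too, because the co-unit annihilates \<open>X\<close> times anything.\<close>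

lemma S_l: "u \<in> carrier U \<Longrightarrow> lin U f \<Longrightarrow> comult U u (\<lambda>y z. f (S0 y \<otimes>\<^bsub>U\<^esub> z)) = counit U u * f \<one>\<^bsub>U\<^esub>"
proof (induction rule: U_induct)
  case one
  have "(\<lambda>y z. f (S0 y \<otimes>\<^bsub>U\<^esub> z)) \<in> UU.Bil"
    by (rule bilinI) (auto intro!: lin_S[where f = "\<lambda>x. f (x \<otimes>\<^bsub>U\<^esub> _)"] UU.lin_rmult UU.lin_lmult one S_closed)
  then show ?case by (simp add: com_one S_one cou_one)
next
  case (step X d \<alpha> x)
  note X = GLd_GL[OF step(1)] and x = UU.grade_carrier[OF step(2)] and f = step.prems
  have B: "(\<lambda>y z. f (S0 y \<otimes>\<^bsub>U\<^esub> z)) \<in> UU.Bil"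
    by (rule bilinI) (auto intro!: lin_S[where f = "\<lambda>x. f (x \<otimes>\<^bsub>U\<^esub> _)"] UU.lin_rmult UU.lin_lmult f S_closed)
  have "comult U (io X \<otimes>\<^bsub>U\<^esub> x) (\<lambda>y z. f (S0 y \<otimes>\<^bsub>U\<^esub> z)) = comult U x (\<lambda>y z. 0)"
    unfolding com_X[OF step(1) x B]
  proof (rule UU.TT_cong[OF com_TT[OF x] UU.prim_form(1)[OF io_carrier[OF X] B] bilin_zero])
    fix a b y z assume "y \<in> grade U a" "z \<in> grade U b"
    then have y: "y \<in> carrier U" and z: "z \<in> carrier U" by auto
    let ?w = "S0 (UU.wt (\<omega> d) y) \<otimes>\<^bsub>U\<^esub> (io X \<otimes>\<^bsub>U\<^esub> z)"
    have "S0 (io X \<otimes>\<^bsub>U\<^esub> y) \<otimes>\<^bsub>U\<^esub> z = (- 1) \<odot>\<^bsub>U\<^esub> ?w"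
      using y z X S_closed by (simp add: S_Xn[OF step(1)] UU.sm_mult UU.m_assoc)
    then show "f (S0 (io X \<otimes>\<^bsub>U\<^esub> y) \<otimes>\<^bsub>U\<^esub> z) + f ?w = 0"
      using lin_smult[OF f, of ?w "- 1"] y z X S_closed by simp
  qed
  also have "\<dots> = 0" using UU.TT_times[OF com_TT[OF x] bilin_zero, of 0] by simp
  finally show ?case using cou_X[OF X x] by simp
qed (simp_all add: com_add com_sm fun_app lin_add[OF cou_lin] lin_smult[OF cou_lin] distrib_right)

text \<open>Here the cancellation is not pointwise. The induction hypothesis for \<open>f\<close>
  composed with left and with right multiplication by \<open>X\<close> gives
  \<open>counit U x * f (io X)\<close> twice, the second time with factor
  \<open>- \<omega> d \<alpha>\<close> from the weights. The sum vanishes because the co-unit of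
  \<open>x\<close> is zero unless \<alpha> = 0, where the factor is -1.\<close>

lemma S_r: "u \<in> carrier U \<Longrightarrow> lin U f \<Longrightarrow> comult U u (\<lambda>y z. f (y \<otimes>\<^bsub>U\<^esub> S0 z)) = counit U u * f \<one>\<^bsub>U\<^esub>"
proof (induction arbitrary: f rule: U_induct)
  case one
  have "(\<lambda>y z. f (y \<otimes>\<^bsub>U\<^esub> S0 z)) \<in> UU.Bil"
    by (rule bilinI) (auto intro!: lin_S[where f = "\<lambda>x. f (_ \<otimes>\<^bsub>U\<^esub> x)"] UU.lin_rmult UU.lin_lmult one S_closed)
  then show ?case by (simp add: com_one S_one cou_one)
next
  case (step X d \<alpha> x)
  note X = GLd_GL[OF step(1)] and x = UU.grade_carrier[OF step(2)] and f = step.prems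
  have BB: "(\<lambda>y z. g (y \<otimes>\<^bsub>U\<^esub> S0 z)) \<in> UU.Bil" if g: "lin U g" for g
    by (rule bilinI) (auto intro!: lin_S[where f = "\<lambda>x. g (_ \<otimes>\<^bsub>U\<^esub> x)"] UU.lin_rmult UU.lin_lmult g S_closed)
  have fl: "lin U (\<lambda>y. f (io X \<otimes>\<^bsub>U\<^esub> y))" and fr: "lin U (\<lambda>y. f (y \<otimes>\<^bsub>U\<^esub> io X))"
    using f X by (auto intro: UU.lin_lmult UU.lin_rmult)
  have W: "(\<lambda>y z. - 1 * f (UU.wt (\<omega> d) y \<otimes>\<^bsub>U\<^esub> S0 (UU.wt (\<omega> d) z) \<otimes>\<^bsub>U\<^esub> io X)) \<in> UU.Bil"
    by (rule bilin_times, rule bilinI)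
      (simp_all add: UU.lin_wt[OF bilin1[OF BB[OF fr]]] UU.lin_wt[OF bilin2[OF BB[OF fr]]])
  have "comult U (io X \<otimes>\<^bsub>U\<^esub> x) (\<lambda>y z. f (y \<otimes>\<^bsub>U\<^esub> S0 z)) =
     comult U x (\<lambda>y z. f (io X \<otimes>\<^bsub>U\<^esub> (y \<otimes>\<^bsub>U\<^esub> S0 z)) + - 1 * f (UU.wt (\<omega> d) y \<otimes>\<^bsub>U\<^esub> S0 (UU.wt (\<omega> d) z) \<otimes>\<^bsub>U\<^esub> io X))"
    unfolding com_X[OF step(1) x BB[OF f]]
  proof (rule UU.TT_cong[OF com_TT[OF x] UU.prim_form(1)[OF io_carrier[OF X] BB[OF f]] bilin_plus[OF BB[OF fl] W]])
    fix a b y z assume "y \<in> grade U a" "z \<in> grade U b"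
    then have y: "y \<in> carrier U" and z: "z \<in> carrier U" by auto
    let ?w = "UU.wt (\<omega> d) y \<otimes>\<^bsub>U\<^esub> S0 (UU.wt (\<omega> d) z) \<otimes>\<^bsub>U\<^esub> io X"
    have "UU.wt (\<omega> d) y \<otimes>\<^bsub>U\<^esub> S0 (io X \<otimes>\<^bsub>U\<^esub> z) = (- 1) \<odot>\<^bsub>U\<^esub> ?w"
      using y z X S_closed by (simp add: S_Xn[OF step(1)] UU.sm_mult UU.m_assoc)
    then show "f (io X \<otimes>\<^bsub>U\<^esub> y \<otimes>\<^bsub>U\<^esub> S0 z) + f (UU.wt (\<omega> d) y \<otimes>\<^bsub>U\<^esub> S0 (io X \<otimes>\<^bsub>U\<^esub> z)) = f (io X \<otimes>\<^bsub>U\<^esub> (y \<otimes>\<^bsub>U\<^esub> S0 z)) + - 1 * f ?w"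
      using lin_smult[OF f, of ?w "- 1"] y z X S_closed by (simp add: UU.m_assoc)
  qed
  also have "\<dots> = comult U x (\<lambda>y z. f (io X \<otimes>\<^bsub>U\<^esub> (y \<otimes>\<^bsub>U\<^esub> S0 z))) - comult U x (\<lambda>y z. f (UU.wt (\<omega> d) y \<otimes>\<^bsub>U\<^esub> S0 (UU.wt (\<omega> d) z) \<otimes>\<^bsub>U\<^esub> io X))"
    unfolding UU.TT_plus[OF com_TT[OF x] BB[OF fl] W]
    using UU.TT_times[OF com_TT[OF x] W, of "- 1"] by simp
  also have "\<dots> = counit U x * f (io X) - \<omega> d \<alpha> * (counit U x * f (io X))"
    using step.IH[OF fl] step.IH[OF fr] UU.ts_wt[OF com_grade[OF step(2)] BB[OF fr], of d] X by simp
  also have "\<dots> = 0" using cou_grade[OF step(2)] by (cases "\<alpha> = 0") simp_all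
  finally show ?case using cou_X[OF X x] by simp
qed (simp_all add: com_add com_sm fun_app lin_add[OF cou_lin] lin_smult[OF cou_lin] distrib_right)

text \<open>Stated by linearity and vanishing conditions so that the induction hypothesis applies to
  lambda terms: it is used for \<open>f\<close> composed with right multiplication by
  \<open>X\<close>, of degree \<phi> + d, and likewise for \<open>g\<close>. The antipode moves
  \<open>X\<close> to the right end, \<open>com_Xr\<close> distributes it over the legs, and
  \<open>com_X\<close> reassembles the result.\<close>

lemma S_com: "\<lbrakk>u \<in> carrier U; lin U f; \<And>\<alpha> x. x \<in> grade U \<alpha> \<Longrightarrow> \<alpha> \<noteq> - \<phi> \<Longrightarrow> f x = 0;
    lin U g; \<And>\<alpha> x. x \<in> grade U \<alpha> \<Longrightarrow> \<alpha> \<noteq> - \<psi> \<Longrightarrow> g x = 0\<rbrakk> \<Longrightarrow>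
  comult U (S0 u) (\<lambda>a b. f a * g b) = \<omega> \<psi> \<phi> * comult U u (\<lambda>a b. g (S0 a) * f (S0 b))"
proof (induction arbitrary: f g \<phi> \<psi> rule: U_induct)
  case one
  have "f \<one>\<^bsub>U\<^esub> * g \<one>\<^bsub>U\<^esub> = \<omega> \<psi> \<phi> * (g \<one>\<^bsub>U\<^esub> * f \<one>\<^bsub>U\<^esub>)"
    using one(2)[OF UU.grade_one] by (cases "\<phi> = 0") auto
  then show ?case using one by (simp add: com_one S_one bilin_prod lin_S)
next
  case (step X d \<alpha> x)
  note f = step.prems(1) and fv = step.prems(2) and g = step.prems(3) and gv = step.prems(4)
  note X = GLd_GL[OF step(1)] and x = UU.grade_carrier[OF step(2)]
  note Xc = io_carrier[OF X] and Sx = S_closed[OF x]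
  have fX: "lin U (\<lambda>a. f (a \<otimes>\<^bsub>U\<^esub> io X))" and gX: "lin U (\<lambda>a. g (a \<otimes>\<^bsub>U\<^esub> io X))"
    using f g Xc by (auto intro: UU.lin_rmult)
  have fXv: "f (y \<otimes>\<^bsub>U\<^esub> io X) = 0" if "y \<in> grade U a" "a \<noteq> - (\<phi> + d)" for a y
    using fv[OF UU.grade_mult[OF that(1) io_grade[OF step(1)]]] that(2) by (metis add_diff_cancel_right' diff_conv_add_uminus minus_add_distrib)
  have gXv: "g (y \<otimes>\<^bsub>U\<^esub> io X) = 0" if "y \<in> grade U a" "a \<noteq> - (\<psi> + d)" for a y
    using gv[OF UU.grade_mult[OF that(1) io_grade[OF step(1)]]] that(2) by (metis add_diff_cancel_right' diff_conv_add_uminus minus_add_distrib)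
  have Bf: "(\<lambda>a b. f (a \<otimes>\<^bsub>U\<^esub> io X) * (\<omega> (- \<psi>) d * g b)) \<in> UU.Bil" by (rule bilin_prod[OF fX lin_times[OF g]])
  have Bg: "(\<lambda>a b. f a * g (b \<otimes>\<^bsub>U\<^esub> io X)) \<in> UU.Bil" by (rule bilin_prod[OF f gX])
  have B0: "(\<lambda>a b. f a * g b) \<in> UU.Bil" by (rule bilin_prod[OF f g])
  have A: "(\<lambda>a b. g (S0 a) * f (S0 b \<otimes>\<^bsub>U\<^esub> io X)) \<in> UU.Bil" by (rule bilin_prod[OF lin_S[OF g] lin_S[OF fX]])
  have B: "(\<lambda>a b. g (S0 a \<otimes>\<^bsub>U\<^esub> io X) * f (S0 b)) \<in> UU.Bil" by (rule bilin_prod[OF lin_S[OF gX] lin_S[OF f]])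
  have R: "(\<lambda>a b. g (S0 a) * f (S0 b)) \<in> UU.Bil" by (rule bilin_prod[OF lin_S[OF g] lin_S[OF f]])
  let ?A = "comult U x (\<lambda>a b. g (S0 a) * f (S0 b \<otimes>\<^bsub>U\<^esub> io X))" and ?B = "comult U x (\<lambda>a b. g (S0 a \<otimes>\<^bsub>U\<^esub> io X) * f (S0 b))"
  have gw: "g (UU.wt (\<lambda>\<beta>. \<omega> \<beta> d) b) = \<omega> (- \<psi>) d * g b" if b: "b \<in> grade U k" for b k
    using gv[OF b] b by (cases "k = - \<psi>") (auto simp: UU.wt_hom lin_smult[OF g] UU.grade_carrier)
  have "comult U (S0 (io X \<otimes>\<^bsub>U\<^esub> x)) (\<lambda>a b. f a * g b) = - \<omega> d \<alpha> * comult U (S0 x \<otimes>\<^bsub>U\<^esub> io X) (\<lambda>a b. f a * g b)"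
    unfolding S_X[OF step(1,2)] com_sm[OF UU.m_closed[OF Sx Xc]] ..
  also have "comult U (S0 x \<otimes>\<^bsub>U\<^esub> io X) (\<lambda>a b. f a * g b) =
      comult U (S0 x) (\<lambda>a b. f (a \<otimes>\<^bsub>U\<^esub> io X) * (\<omega> (- \<psi>) d * g b) + f a * g (b \<otimes>\<^bsub>U\<^esub> io X))"
    unfolding com_Xr[OF step(1) Sx B0]
    by (rule UU.TT_cong[OF com_TT[OF Sx] UU.prim_form(2)[OF Xc B0] bilin_plus[OF Bf Bg]]) (simp add: gw)
  also have "\<dots> = comult U (S0 x) (\<lambda>a b. f (a \<otimes>\<^bsub>U\<^esub> io X) * (\<omega> (- \<psi>) d * g b)) + comult U (S0 x) (\<lambda>a b. f a * g (b \<otimes>\<^bsub>U\<^esub> io X))"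
    by (rule UU.TT_plus[OF com_TT[OF Sx] Bf Bg])
  also have "comult U (S0 x) (\<lambda>a b. f (a \<otimes>\<^bsub>U\<^esub> io X) * (\<omega> (- \<psi>) d * g b)) = \<omega> (- \<psi>) d * comult U (S0 x) (\<lambda>a b. f (a \<otimes>\<^bsub>U\<^esub> io X) * g b)"
    using UU.TT_times[OF com_TT[OF Sx] bilin_prod[OF fX g], of "\<omega> (- \<psi>) d"] by (simp add: mult_ac)
  also have "comult U (S0 x) (\<lambda>a b. f (a \<otimes>\<^bsub>U\<^esub> io X) * g b) = \<omega> \<psi> (\<phi> + d) * ?A"
    by (rule step.IH[OF fX fXv g gv])
  also have "comult U (S0 x) (\<lambda>a b. f a * g (b \<otimes>\<^bsub>U\<^esub> io X)) = \<omega> (\<psi> + d) \<phi> * ?B"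
    by (rule step.IH[OF f fv gX gXv])
  \<comment> \<open>The factor \<open>\<omega> (- \<psi>) d\<close> cancels the part
    \<open>\<omega> \<psi> d\<close> of \<open>\<omega> \<psi> (\<phi> + d)\<close>, and
    \<open>\<omega> \<psi> \<phi>\<close> splits off both terms.\<close>
  also have "- \<omega> d \<alpha> * (\<omega> (- \<psi>) d * (\<omega> \<psi> (\<phi> + d) * ?A) + \<omega> (\<psi> + d) \<phi> * ?B) = \<omega> \<psi> \<phi> * (- \<omega> d \<alpha> * ?A - \<omega> d \<alpha> * \<omega> d \<phi> * ?B)"
    by (simp add: om_add om_minus algebra_simps)
  also have "- \<omega> d \<alpha> * ?A - \<omega> d \<alpha> * \<omega> d \<phi> * ?B =
      comult U x (\<lambda>a b. - \<omega> d \<alpha> * (g (S0 a) * f (S0 b \<otimes>\<^bsub>U\<^esub> io X)) + - (\<omega> d \<alpha> * \<omega> d \<phi>) * (g (S0 a \<otimes>\<^bsub>U\<^esub> io X) * f (S0 b)))"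
    unfolding UU.TT_plus[OF com_TT[OF x] bilin_times[OF A] bilin_times[OF B]]
      UU.TT_times[OF com_TT[OF x] A] UU.TT_times[OF com_TT[OF x] B] by simp
  also have "\<dots> = comult U (io X \<otimes>\<^bsub>U\<^esub> x) (\<lambda>a b. g (S0 a) * f (S0 b))"
    unfolding com_X[OF step(1) x R]
  proof (rule UU.ts_eq[OF com_grade[OF step(2)] bilin_plus[OF bilin_times[OF A] bilin_times[OF B]] UU.prim_form(1)[OF Xc R]])
    fix i j a b assume a: "a \<in> grade U i" and b: "b \<in> grade U j" and ij: "i + j = \<alpha>"
    note ac = UU.grade_carrier[OF a] UU.grade_carrier[OF b]
    note SS = S_closed[OF ac(1)] S_closed[OF ac(2)]
    have e1: "g (S0 (io X \<otimes>\<^bsub>U\<^esub> a)) = - \<omega> d i * g (S0 a \<otimes>\<^bsub>U\<^esub> io X)" "f (S0 (io X \<otimes>\<^bsub>U\<^esub> b)) = - \<omega> d j * f (S0 b \<otimes>\<^bsub>U\<^esub> io X)"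
      using lin_smult[OF g, of "S0 a \<otimes>\<^bsub>U\<^esub> io X" "- \<omega> d i"] lin_smult[OF f, of "S0 b \<otimes>\<^bsub>U\<^esub> io X" "- \<omega> d j"] SS Xc
      by (simp_all add: S_X[OF step(1) a] S_X[OF step(1) b])
    have e2: "g (S0 (UU.wt (\<omega> d) a)) = \<omega> d i * g (S0 a)" using lin_smult[OF g SS(1)] ac by (simp add: UU.wt_hom[OF a] S_sm)
    have h1: "\<omega> d i * \<omega> d j = \<omega> d \<alpha>" using ij by (simp add: om_add flip: ij)
    \<comment> \<open>The factor \<open>f (S0 b)\<close> is nonzero only for
      \<open>j = - \<phi>\<close>, and then \<open>i = \<alpha> + \<phi>\<close>.\<close>
    have h2: "\<omega> d i * (g (S0 a \<otimes>\<^bsub>U\<^esub> io X) * f (S0 b)) = \<omega> d \<alpha> * \<omega> d \<phi> * (g (S0 a \<otimes>\<^bsub>U\<^esub> io X) * f (S0 b))"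
    proof (cases "j = - \<phi>")
      case True
      then have "\<omega> d \<alpha> * \<omega> d \<phi> = \<omega> d i" using ij by (simp add: om_add om_diff flip: ij)
      then show ?thesis by simp
    next
      case False
      then show ?thesis using fv[OF S_grade[OF b]] by simp
    qed
    have "g (S0 (io X \<otimes>\<^bsub>U\<^esub> a)) * f (S0 b) + g (S0 (UU.wt (\<omega> d) a)) * f (S0 (io X \<otimes>\<^bsub>U\<^esub> b)) =
        - (\<omega> d i * (g (S0 a \<otimes>\<^bsub>U\<^esub> io X) * f (S0 b))) - \<omega> d i * \<omega> d j * (g (S0 a) * f (S0 b \<otimes>\<^bsub>U\<^esub> io X))"
      unfolding e1 e2 by (simp add: algebra_simps)
    then show "- \<omega> d \<alpha> * (g (S0 a) * f (S0 b \<otimes>\<^bsub>U\<^esub> io X)) + - (\<omega> d \<alpha> * \<omega> d \<phi>) * (g (S0 a \<otimes>\<^bsub>U\<^esub> io X) * f (S0 b)) =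
       g (S0 (io X \<otimes>\<^bsub>U\<^esub> a)) * f (S0 b) + g (S0 (UU.wt (\<omega> d) a)) * f (S0 (io X \<otimes>\<^bsub>U\<^esub> b))"
      unfolding h1 h2 by simp
  qed
  finally show ?case .
next
  case (add x y)
  show ?case using add(1,2) add.IH(1)[OF add.prems] add.IH(2)[OF add.prems]
    by (simp add: com_add S_add S_closed fun_app distrib_left)
next
  case (sm c x)
  show ?case using sm(1) sm.IH[OF sm.prems] by (simp add: com_sm S_sm S_closed)
qed

sublocale UH: gr_hopf \<omega> "env \<omega> scale V"
proof
  fix x y B f g \<alpha> \<beta> \<phi> \<psi> and c :: complex
  show "comult U x \<in> UU.TT" if "x \<in> carrier U" using that by (rule com_TT)
  show "comult U (S0 x) (\<lambda>u v. f u * g v) = \<omega> \<psi> \<phi> * comult U x (\<lambda>u v. g (S0 u) * f (S0 v))"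
    if "x \<in> carrier U" "f \<in> dual_grade U \<phi>" "g \<in> dual_grade U \<psi>"
    using that by (intro S_com) (auto simp: dual_grade_def dual_space_def lin_def)
qed (fact com_add com_sm com_mult com_one com_grade cou_lin cou_mult cou_one cou_grade coassoc cou_l cou_r S_closed S_add S_sm S_grade S_mult S_cou S_l S_r)+

end

section \<open>Matrix coefficients\<close>

text \<open>Keeps \<open>{1..n}\<close> from being rewritten to \<open>{Suc 0..n}\<close>.\<close>

declare One_nat_def [simp del]

lemma sum_fun_app: "(sum f A) x = (\<Sum>a\<in>A. f a x)"
  by (induction A rule: infinite_finite_induct) (simp_all add: fun_app)

context gr_hopf
begin

text \<open>Uniqueness in the definite description: linear independence, expressed by
  \<open>ind\<close>, determines the coefficients at homogeneous \<open>x\<close>, the values of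
  \<omega> can be cancelled, and a functional is determined by its values on homogeneous
  elements.\<close>

lemma matrix_coeffs_eqI:
  assumes ind: "\<And>c c'. (\<Sum>b\<in>{1..n}. smul (c b) (e b)) = (\<Sum>b\<in>{1..n}. smul (c' b) (e b)) \<Longrightarrow> \<forall>b\<in>{1..n}. c b = (c' b :: complex)"
    and t: "\<And>a b. a \<in> {1..n} \<Longrightarrow> b \<in> {1..n} \<Longrightarrow> t b a \<in> FD" "\<And>a b. \<not> (a \<in> {1..n} \<and> b \<in> {1..n}) \<Longrightarrow> t b a = 0"
    and act: "\<And>a \<alpha> x. a \<in> {1..n} \<Longrightarrow> x \<in> grade U \<alpha> \<Longrightarrow> act x (e a) = (\<Sum>b\<in>{1..n}. smul (\<omega> \<alpha> (\<gamma> a) * t b a x) (e b))"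
  shows "matrix_coeffs \<omega> U n smul act e \<gamma> = t"
  unfolding matrix_coeffs_def H_simps
proof (rule the_equality)
  show "(\<forall>a b. if a \<in> {1..n} \<and> b \<in> {1..n} then t b a \<in> FD else t b a = 0) \<and>
      (\<forall>a\<in>{1..n}. \<forall>\<alpha>. \<forall>x\<in>grade U \<alpha>. act x (e a) = (\<Sum>b\<in>{1..n}. smul (\<omega> \<alpha> (\<gamma> a) * t b a x) (e b)))"
    using t act by simp
next
  fix s assume s: "(\<forall>a b. if a \<in> {1..n} \<and> b \<in> {1..n} then s b a \<in> FD else s b a = 0) \<and>
      (\<forall>a\<in>{1..n}. \<forall>\<alpha>. \<forall>x\<in>grade U \<alpha>. act x (e a) = (\<Sum>b\<in>{1..n}. smul (\<omega> \<alpha> (\<gamma> a) * s b a x) (e b)))"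
  show "s = t"
  proof (intro ext)
    fix b a x
    have "s b a = t b a"
    proof (cases "a \<in> {1..n} \<and> b \<in> {1..n}")
      case True
      then have a: "a \<in> {1..n}" and b: "b \<in> {1..n}" by auto
      have sF: "s b a \<in> FD" using s True by metis
      show ?thesis
      proof (rule dual_eqI[OF FD_dual[OF sF] FD_dual[OF t(1)[OF a b]]])
        fix \<alpha> y assume y: "y \<in> grade U \<alpha>"
        have "(\<Sum>b\<in>{1..n}. smul (\<omega> \<alpha> (\<gamma> a) * s b a y) (e b)) = (\<Sum>b\<in>{1..n}. smul (\<omega> \<alpha> (\<gamma> a) * t b a y) (e b))"
          using s a y act[OF a y] by metis
        then have "\<omega> \<alpha> (\<gamma> a) * s b a y = \<omega> \<alpha> (\<gamma> a) * t b a y" using ind[of "\<lambda>b. \<omega> \<alpha> (\<gamma> a) * s b a y" "\<lambda>b. \<omega> \<alpha> (\<gamma> a) * t b a y"] b by blast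
        then show "s b a y = t b a y" by simp
      qed
    next
      case False
      then show ?thesis using s t(2) by metis
    qed
    then show "s b a x = t b a x" by simp
  qed
qed

lemma sum_pt_sub: "finite C \<Longrightarrow> (\<And>c. c \<in> C \<Longrightarrow> f c \<in> Z) \<Longrightarrow> (\<And>c. c \<in> C \<Longrightarrow> g c \<in> Z) \<Longrightarrow>
    (\<Sum>c\<in>C. HH.pt (f c) (g c)) \<in> tensor_sub H H Z Z"
  unfolding tensor_sub_def
  by (induction C rule: finite_induct) (auto intro: HH.ts_zero HH.ts_add HH.ts_pt)

lemma sum_pt_ev: "finite C \<Longrightarrow> (\<And>c. c \<in> C \<Longrightarrow> f c \<in> Fh (\<phi> c)) \<Longrightarrow> (\<And>c. c \<in> C \<Longrightarrow> g c \<in> Fh (\<psi> c)) \<Longrightarrow> x \<in> carrier U \<Longrightarrow> y \<in> carrier U \<Longrightarrow>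
    (\<Sum>c\<in>C. HH.pt (f c) (g c)) (ev x y) = (\<Sum>c\<in>C. \<omega> (\<phi> c) (\<psi> c) * (f c x * g c y))"
  unfolding sum_fun_app by (rule sum.cong) (auto simp: ev_Bil pairing_hd Fh_hd)

end

context gvs
begin

section \<open>The natural action and its coordinates in the homogeneous basis\<close>

lemma nat_frep: "frep scale GL UNIV {0} (\<lambda>X. X)"
  by unfold_locales (simp_all add: gl_add gl_scale gl_0)

interpretation NR: frep scale GL UNIV "{0}" "\<lambda>X. X"
  by (rule nat_frep)

lemma NR_I: "x \<in> I \<Longrightarrow> NR.act x w = 0"
proof -
  assume x: "x \<in> I"
  have "NR.act x w \<in> {0}"
  proof (rule NR.act_kill[OF rels_CF _ x[unfolded env_ideal_def] UNIV_I])
    fix x w assume x: "x \<in> env_relations \<omega> scale V"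
    from x consider (add) X Y where "x = gen (\<lambda>v. X v + Y v) - gen X - gen Y" "X \<in> GL" "Y \<in> GL"
      | (scale) c X where "x = gen (\<lambda>v. scale c (X v)) - sc c (gen X)" "X \<in> GL"
      | (brk) X Y \<alpha> \<beta> where "x = rel \<alpha> \<beta> X Y" "X \<in> GLd \<alpha>" "Y \<in> GLd \<beta>"
      unfolding rels_eq by blast
    then show "NR.act x w \<in> {0}"
    proof cases
      case brk
      note X = GLd_GL[OF brk(2)] and Y = GLd_GL[OF brk(3)]
      then show ?thesis unfolding brk(1) rel_def NR.act_minus NR.act_sc by (simp add: NR.act_mult CF_gen NR.act_gen brk_def)
    qed (simp_all add: NR.act_minus NR.act_gen NR.act_sc)
  qed
  then show ?thesis by simp
qed

abbreviation "na \<equiv> nat_act scale"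

lemma na_cl: "x \<in> PF \<Longrightarrow> na (cl x) v = NR.act x v"
  using NR_I[OF conjunct2[OF some_cl], of x v] by (simp add: nat_act_def free_act_def NR.act_def[symmetric] NR.act_minus)

lemma na_add1: "x \<in> carrier U \<Longrightarrow> y \<in> carrier U \<Longrightarrow> na (x \<oplus>\<^bsub>U\<^esub> y) v = na x v + na y v"
  and na_mult: "x \<in> carrier U \<Longrightarrow> y \<in> carrier U \<Longrightarrow> na (x \<otimes>\<^bsub>U\<^esub> y) v = na x (na y v)"
proof -
  assume x: "x \<in> carrier U" and y: "y \<in> carrier U"
  obtain a where a: "a \<in> PF" "x = cl a" using x by (rule U_cases)
  obtain b where b: "b \<in> PF" "y = cl b" using y by (rule U_cases)
  show "na (x \<oplus>\<^bsub>U\<^esub> y) v = na x v + na y v" using a b by (simp add: cl_add CF_add na_cl NR.act_add)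
  show "na (x \<otimes>\<^bsub>U\<^esub> y) v = na x (na y v)" using a b by (simp add: cl_mult CF_mult na_cl NR.act_mult)
qed

lemma na_sm1: "x \<in> carrier U \<Longrightarrow> na (c \<odot>\<^bsub>U\<^esub> x) v = scale c (na x v)"
  and na_add2: "x \<in> carrier U \<Longrightarrow> na x (v + w) = na x v + na x w"
  and na_sc2: "x \<in> carrier U \<Longrightarrow> na x (scale c v) = scale c (na x v)"
proof -
  assume x: "x \<in> carrier U"
  obtain a where a: "a \<in> PF" "x = cl a" using x by (rule U_cases)
  show "na (c \<odot>\<^bsub>U\<^esub> x) v = scale c (na x v)" using a by (simp add: cl_sc CF_sc na_cl NR.act_sc)
  show "na x (v + w) = na x v + na x w" using a by (simp add: na_cl NR.act_add2)
  show "na x (scale c v) = scale c (na x v)" using a by (simp add: na_cl NR.act_sc2)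
qed

lemma na_one: "na \<one>\<^bsub>U\<^esub> v = v"
  by (simp add: U_one na_cl CF_one NR.act_one)

lemma na_io: "X \<in> GL \<Longrightarrow> na (io X) v = X v"
  by (simp add: io_def na_cl CF_gen NR.act_gen)

lemma na_sum: "x \<in> carrier U \<Longrightarrow> na x (\<Sum>c\<in>C. scale (k c) (f c)) = (\<Sum>c\<in>C. scale (k c) (na x (f c)))"
proof -
  assume x: "x \<in> carrier U"
  have "na x 0 = 0" using na_sc2[OF x, of 0 0] by simp
  then show ?thesis by (induction C rule: infinite_finite_induct) (simp_all add: na_add2 na_sc2 x)
qed

lemma na_grade: "x \<in> grade U \<alpha> \<Longrightarrow> v \<in> V \<beta> \<Longrightarrow> na x v \<in> V (\<alpha> + \<beta>)"
proof (induction rule: U_grade_induct)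
  case (zero \<alpha>)
  have "na \<zero>\<^bsub>U\<^esub> v = 0" using na_sm1[OF UU.one_closed, of 0 v] by simp
  then show ?case by (simp add: V_zero)
next
  case (step X d \<alpha> x)
  then show ?case using GLd_V[OF step(1) step.IH[OF step.prems]]
    by (simp add: na_mult GLd_GL UU.grade_carrier na_io add.assoc)
qed (simp_all add: na_one na_add1 na_sm1 UU.grade_carrier V_add V_scale)

abbreviation "db \<equiv> dual_basis scale n e"

lemma inj_e: "inj_on e {1..n}" and ind_e: "vs.independent (e ` {1..n})" and span_e: "v \<in> vs.span (e ` {1..n})"
  and e_V: "a \<in> {1..n} \<Longrightarrow> e a \<in> V (\<gamma> a)"
  using hb by (auto simp: homogeneous_basis_def)

lemma db_add: "db a (v + w) = db a v + db a w"
  and db_scale: "db a (scale c v) = c * db a v"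
  by (simp_all add: dual_basis_def vs.representation_add[OF ind_e span_e span_e] vs.representation_scale[OF ind_e span_e])

lemma db_0: "db a 0 = 0" using db_scale[of a 0 0] by simp

lemma db_sum: "db a (sum f C) = (\<Sum>c\<in>C. db a (f c))"
  by (induction C rule: infinite_finite_induct) (simp_all add: db_0 db_add)

lemma db_e: "a \<in> {1..n} \<Longrightarrow> b \<in> {1..n} \<Longrightarrow> db a (e b) = (if a = b then 1 else 0)"
  using vs.representation_basis[OF ind_e, of "e b"] inj_e by (auto simp: dual_basis_def inj_on_eq_iff)

lemma db_expand: "(\<Sum>b\<in>{1..n}. scale (db b v) (e b)) = v"
proof -
  have "(\<Sum>b\<in>{1..n}. scale (db b v) (e b)) = (\<Sum>w\<in>e ` {1..n}. scale (vs.representation (e ` {1..n}) v w) w)"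
    by (subst sum.reindex[OF inj_e]) (simp add: dual_basis_def)
  also have "\<dots> = v" by (rule vs.sum_representation_eq[OF ind_e span_e]) auto
  finally show ?thesis .
qed

lemma db_comb: "b \<in> {1..n} \<Longrightarrow> db b (\<Sum>a\<in>{1..n}. scale (c a) (e a)) = c b"
  unfolding db_sum db_scale by (simp add: db_e if_distrib cong: if_cong)

lemma db_vpart: "b \<in> {1..n} \<Longrightarrow> db b (vpart V \<beta> v) = (if \<gamma> b = \<beta> then db b v else 0)"
proof -
  assume b: "b \<in> {1..n}"
  have s: "vpart V \<beta> (sum f C) = (\<Sum>c\<in>C. vpart V \<beta> (f c))" for f :: "nat \<Rightarrow> 'v" and C
    by (induction C rule: infinite_finite_induct) (simp_all add: vpart_add)
  have "vpart V \<beta> v = vpart V \<beta> (\<Sum>a\<in>{1..n}. scale (db a v) (e a))" by (simp add: db_expand)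
  also have "\<dots> = (\<Sum>a\<in>{1..n}. scale (if \<gamma> a = \<beta> then db a v else 0) (e a))"
    unfolding s by (rule sum.cong) (auto simp: vpart_scale vpart_hom[OF e_V])
  finally show ?thesis using db_comb[OF b] by simp
qed

lemma db_hom: "b \<in> {1..n} \<Longrightarrow> v \<in> V \<beta> \<Longrightarrow> \<beta> \<noteq> \<gamma> b \<Longrightarrow> db b v = 0"
  using db_vpart[of b \<beta> v] by (simp add: vpart_hom)

definition F :: "nat \<Rightarrow> nat \<Rightarrow> 'v env \<Rightarrow> complex" where
  "F b a x = db b (na x (e a))"

lemma F_lin: "lin U (F b a)"
  by (simp add: lin_def F_def na_add1 na_sm1 db_add db_scale)

lemma F_hom: "a \<in> {1..n} \<Longrightarrow> b \<in> {1..n} \<Longrightarrow> x \<in> grade U \<alpha> \<Longrightarrow> \<alpha> \<noteq> \<gamma> b - \<gamma> a \<Longrightarrow> F b a x = 0"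
  unfolding F_def by (rule db_hom[OF _ na_grade[OF _ e_V]]) (auto simp: algebra_simps)

lemma F_mult: "x \<in> carrier U \<Longrightarrow> y \<in> carrier U \<Longrightarrow> F b a (x \<otimes>\<^bsub>U\<^esub> y) = (\<Sum>c\<in>{1..n}. F b c x * F c a y)"
proof -
  assume x: "x \<in> carrier U" and y: "y \<in> carrier U"
  have "na (x \<otimes>\<^bsub>U\<^esub> y) (e a) = na x (\<Sum>c\<in>{1..n}. scale (F c a y) (e c))" by (simp add: na_mult x y F_def db_expand)
  then show ?thesis by (simp add: na_sum[OF x] F_def db_sum db_scale mult.commute)
qed

lemma F_one: "a \<in> {1..n} \<Longrightarrow> b \<in> {1..n} \<Longrightarrow> F b a \<one>\<^bsub>U\<^esub> = (if a = b then 1 else 0)"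
  by (auto simp: F_def na_one db_e)

abbreviation "t \<equiv> coeff_t \<omega> scale V n e \<gamma>"
abbreviation "tbar \<equiv> coeff_tbar \<omega> scale V n e \<gamma>"

text \<open>For homogeneous \<open>x\<close> with \<open>F b a x \<noteq> 0\<close> the degree of \<open>x\<close> is \<open>\<gamma> b - \<gamma> a\<close>; the scalar is the inverse of
  \<open>\<omega> (deg x) (\<gamma> a)\<close>.\<close>

definition t0 :: "nat \<Rightarrow> nat \<Rightarrow> 'v env \<Rightarrow> complex" where
  "t0 b a = UH.rs (\<lambda>x. \<omega> (\<gamma> a - \<gamma> b) (\<gamma> a) * F b a x)"

text \<open>Finite rank is the matrix multiplication \<open>F_mult\<close>, with one term for each
  intermediate basis vector.\<close>

lemma t0_Fh: "a \<in> {1..n} \<Longrightarrow> b \<in> {1..n} \<Longrightarrow> t0 b a \<in> UH.Fh (\<gamma> a - \<gamma> b)"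
proof -
  assume a: "a \<in> {1..n}" and b: "b \<in> {1..n}"
  have "t0 b a \<in> UH.hg (\<gamma> a - \<gamma> b)" unfolding t0_def
    by (rule UH.rs_hd[OF lin_times[OF F_lin]]) (simp add: F_hom[OF a b])
  moreover have "UH.frank (t0 b a)"
    by (rule UH.frankI[where ps = "[1..<Suc n]" and a = "\<lambda>c x. \<omega> (\<gamma> a - \<gamma> b) (\<gamma> a) * F b c x" and b = "\<lambda>c. F c a"])
      (simp add: t0_def F_mult sum_distrib_left mult.assoc interv_sum_list_conv_sum_set_nat atLeastLessThanSuc_atLeastAtMost del: upt_Suc)
  ultimately show ?thesis by (simp add: UH.Fh_def)
qed

lemma t_eq: "t = (\<lambda>b a. if a \<in> {1..n} \<and> b \<in> {1..n} then t0 b a else 0)"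
  unfolding coeff_t_def
proof (rule UH.matrix_coeffs_eqI)
  fix c c' assume "(\<Sum>b\<in>{1..n}. scale (c b) (e b)) = (\<Sum>b\<in>{1..n}. scale (c' b) (e b))"
  then have "db b (\<Sum>b\<in>{1..n}. scale (c b) (e b)) = db b (\<Sum>b\<in>{1..n}. scale (c' b) (e b))" for b by simp
  note eq = this
  show "\<forall>b\<in>{1..n}. c b = c' b"
  proof
    fix b assume b: "b \<in> {1..n}"
    show "c b = c' b" using eq[of b] unfolding db_comb[OF b] .
  qed
next
  fix a \<alpha> x assume a: "a \<in> {1..n}" and x: "x \<in> grade U \<alpha>"
  have "(\<Sum>b\<in>{1..n}. scale (\<omega> \<alpha> (\<gamma> a) * (if a \<in> {1..n} \<and> b \<in> {1..n} then t0 b a else 0) x) (e b)) =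
      (\<Sum>b\<in>{1..n}. scale (db b (na x (e a))) (e b))"
  proof (rule sum.cong)
    fix b assume b: "b \<in> {1..n}"
    have "\<omega> \<alpha> (\<gamma> a) * (\<omega> (\<gamma> a - \<gamma> b) (\<gamma> a) * F b a x) = F b a x"
    proof (cases "\<alpha> = \<gamma> b - \<gamma> a")
      case True
      then have "\<omega> \<alpha> (\<gamma> a) * \<omega> (\<gamma> a - \<gamma> b) (\<gamma> a) = 1" by (simp flip: om_add)
      then show ?thesis by (simp flip: mult.assoc)
    next
      case False
      then show ?thesis using F_hom[OF a b x] by simp
    qed
    then show "scale (\<omega> \<alpha> (\<gamma> a) * (if a \<in> {1..n} \<and> b \<in> {1..n} then t0 b a else 0) x) (e b) = scale (db b (na x (e a))) (e b)"
      using a b UU.grade_carrier[OF x] by (simp add: t0_def F_def)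
  qed simp
  then show "na x (e a) = (\<Sum>b\<in>{1..n}. scale (\<omega> \<alpha> (\<gamma> a) * (if a \<in> {1..n} \<and> b \<in> {1..n} then t0 b a else 0) x) (e b))"
    by (simp add: db_expand)
qed (simp_all only: UH.Fh_FD[OF t0_Fh] if_True if_False simp_thms)

text \<open>The functional \<open>db a\<close> sees only the component of degree
  \<open>\<gamma> a\<close>, so the sum over the components of the vector collapses and its factor
  becomes constant.\<close>

lemma dual_act_hom: "a \<in> {1..n} \<Longrightarrow> x \<in> grade U \<alpha> \<Longrightarrow> dual_act \<omega> scale V x (db a) v = \<omega> \<alpha> (- \<gamma> a) * db a (na (S0 x) v)"
proof -
  assume a: "a \<in> {1..n}" and x: "x \<in> grade U \<alpha>"
  let ?g = "\<lambda>\<alpha> y. let w = na (S0 y) v in \<Sum>\<beta> | vpart V \<beta> w \<noteq> 0. \<omega> \<alpha> (- \<beta>) * db a (vpart V \<beta> w)"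
  have z: "S0 \<zero>\<^bsub>U\<^esub> = \<zero>\<^bsub>U\<^esub>" using S_sm[OF UU.one_closed, of 0] S_closed by simp
  have nz: "na \<zero>\<^bsub>U\<^esub> v = 0" using na_sm1[OF UU.one_closed, of 0 v] by simp
  have "dual_act \<omega> scale V x (db a) v = ?g \<alpha> x"
    unfolding dual_act_def Let_def[of U] by (rule UU.hsum_hom[OF _ x]) (simp add: z nz)
  also have "\<dots> = (\<Sum>\<beta> | vpart V \<beta> (na (S0 x) v) \<noteq> 0. if \<beta> = \<gamma> a then \<omega> \<alpha> (- \<gamma> a) * db a (na (S0 x) v) else 0)"
    unfolding Let_def by (rule sum.cong) (auto simp: db_vpart[OF a])
  also have "\<dots> = \<omega> \<alpha> (- \<gamma> a) * db a (na (S0 x) v)"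
    using db_vpart[OF a, of "\<gamma> a" "na (S0 x) v"] by (auto simp: vpart_finite db_0)
  finally show ?thesis .
qed

definition tb0 :: "nat \<Rightarrow> nat \<Rightarrow> 'v env \<Rightarrow> complex" where
  "tb0 b a = UH.rs (\<lambda>x. F a b (S0 x))"

lemma tb0_antipode: "antipode UH.H (t0 b a) = (\<lambda>x. \<omega> (\<gamma> a - \<gamma> b) (\<gamma> a) * tb0 a b x)"
  by (auto simp: UH.rs_def t0_def tb0_def S_closed)

text \<open>\<open>S_S\<close> leaves \<open>F b a\<close>, and the stated constant is inverse to
  the scalar in \<open>t0 b a\<close>.\<close>

lemma antipode_tb0: "antipode UH.H (tb0 a b) = (\<lambda>x. \<omega> (\<gamma> a) (\<gamma> a - \<gamma> b) * t0 b a x)"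
proof
  fix x
  have "\<omega> (\<gamma> a) (\<gamma> a - \<gamma> b) * \<omega> (\<gamma> a - \<gamma> b) (\<gamma> a) = 1" by simp
  then show "antipode UH.H (tb0 a b) x = \<omega> (\<gamma> a) (\<gamma> a - \<gamma> b) * t0 b a x"
    by (simp add: UH.rs_def t0_def tb0_def S_closed S_S del: om_swap_mult flip: mult.assoc)
qed

lemma tb0_Fh: "a \<in> {1..n} \<Longrightarrow> b \<in> {1..n} \<Longrightarrow> tb0 a b \<in> UH.Fh (\<gamma> a - \<gamma> b)"
proof -
  assume a: "a \<in> {1..n}" and b: "b \<in> {1..n}"
  have "tb0 a b = (\<lambda>x. inverse (\<omega> (\<gamma> a - \<gamma> b) (\<gamma> a)) * antipode UH.H (t0 b a) x)"
    unfolding tb0_antipode by (simp flip: mult.assoc)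
  then show ?thesis using UH.Fh_sm[OF UH.HS_Fh[OF t0_Fh[OF a b]]] by metis
qed

lemma tbar_eq: "tbar = (\<lambda>b a. if a \<in> {1..n} \<and> b \<in> {1..n} then tb0 b a else 0)"
  unfolding coeff_tbar_def
proof (rule UH.matrix_coeffs_eqI)
  have ev: "(\<Sum>b\<in>{1..n}. (\<lambda>v. c b * db b v)) (e a) = c a" if "a \<in> {1..n}" for c a
    using that unfolding sum_fun_app by (simp add: db_e if_distrib cong: if_cong)
  fix c c' assume eq: "(\<Sum>b\<in>{1..n}. (\<lambda>v. c b * db b v)) = (\<Sum>b\<in>{1..n}. (\<lambda>v. c' b * db b v))"
  show "\<forall>b\<in>{1..n}. c b = c' b"
  proof
    fix b assume b: "b \<in> {1..n}"
    show "c b = c' b" by (rule trans[OF trans[OF ev[OF b, symmetric] fun_cong[OF eq]] ev[OF b]])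
  qed
next
  fix a \<alpha> x assume a: "a \<in> {1..n}" and x: "x \<in> grade U \<alpha>"
  have "dual_act \<omega> scale V x (db a) v = (\<Sum>b\<in>{1..n}. \<omega> \<alpha> (- \<gamma> a) * (if a \<in> {1..n} \<and> b \<in> {1..n} then tb0 b a else 0) x * db b v)" for v
  proof -
    have "na (S0 x) v = na (S0 x) (\<Sum>b\<in>{1..n}. scale (db b v) (e b))" by (simp add: db_expand)
    also have "\<dots> = (\<Sum>b\<in>{1..n}. scale (db b v) (na (S0 x) (e b)))" by (rule na_sum) (use x in auto)
    finally have "db a (na (S0 x) v) = (\<Sum>b\<in>{1..n}. db b v * F a b (S0 x))" by (simp add: db_sum db_scale F_def)
    then have "dual_act \<omega> scale V x (db a) v = (\<Sum>b\<in>{1..n}. \<omega> \<alpha> (- \<gamma> a) * (db b v * F a b (S0 x)))"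
      unfolding dual_act_hom[OF a x] by (simp only: sum_distrib_left)
    also have "\<dots> = (\<Sum>b\<in>{1..n}. \<omega> \<alpha> (- \<gamma> a) * (if a \<in> {1..n} \<and> b \<in> {1..n} then tb0 b a else 0) x * db b v)"
      by (rule sum.cong) (use a UU.grade_carrier[OF x] in \<open>simp_all add: tb0_def\<close>)
    finally show ?thesis .
  qed
  then show "dual_act \<omega> scale V x (db a) = (\<Sum>b\<in>{1..n}. (\<lambda>v. \<omega> \<alpha> (- \<gamma> a) * (if a \<in> {1..n} \<and> b \<in> {1..n} then tb0 b a else 0) x * db b v))"
    by (simp add: fun_eq_iff sum_fun_app)
qed (simp_all only: UH.Fh_FD[OF tb0_Fh] if_True if_False simp_thms)

lemma comult_t0: "a \<in> {1..n} \<Longrightarrow> b \<in> {1..n} \<Longrightarrow> comult UH.H (t0 b a) = (\<Sum>c\<in>{1..n}. pure_tensor UH.H UH.H (t0 b c) (t0 c a))"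
proof (rule UH.comult_H_eqI)
  assume a: "a \<in> {1..n}" and b: "b \<in> {1..n}"
  show "(\<Sum>c\<in>{1..n}. pure_tensor UH.H UH.H (t0 b c) (t0 c a)) \<in> UH.HH.TT"
    by (rule UH.sum_pt_sub) (use UH.Fh_FD[OF t0_Fh] a b in auto)
  fix x y assume x: "x \<in> carrier U" and y: "y \<in> carrier U"
  \<comment> \<open>The factor of the pairing and the scalar of \<open>t0 b c\<close> combine to
    \<open>\<omega> (\<gamma> c - \<gamma> b) (\<gamma> a)\<close>, which together with the scalar
    of \<open>t0 c a\<close> gives that of \<open>t0 b a\<close>. Hence no scalars appear in the
    co-product.\<close>
  have w: "\<omega> (\<gamma> c - \<gamma> b) (\<gamma> a - \<gamma> c) * (\<omega> (\<gamma> c - \<gamma> b) (\<gamma> c) * \<omega> (\<gamma> a - \<gamma> c) (\<gamma> a)) = \<omega> (\<gamma> a - \<gamma> b) (\<gamma> a)" for c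
    by (simp add: om_diff field_simps)
  have "(\<Sum>c\<in>{1..n}. pure_tensor UH.H UH.H (t0 b c) (t0 c a)) (UH.ev x y) =
     (\<Sum>c\<in>{1..n}. \<omega> (\<gamma> c - \<gamma> b) (\<gamma> a - \<gamma> c) * (t0 b c x * t0 c a y))"
    by (rule UH.sum_pt_ev) (use t0_Fh a b x y in auto)
  also have "\<dots> = (\<Sum>c\<in>{1..n}. \<omega> (\<gamma> a - \<gamma> b) (\<gamma> a) * (F b c x * F c a y))"
  proof (rule sum.cong[OF refl])
    fix c
    show "\<omega> (\<gamma> c - \<gamma> b) (\<gamma> a - \<gamma> c) * (t0 b c x * t0 c a y) = \<omega> (\<gamma> a - \<gamma> b) (\<gamma> a) * (F b c x * F c a y)"
      unfolding w[of c, symmetric] by (simp add: t0_def x y mult_ac)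
  qed
  also have "\<dots> = t0 b a (x \<otimes>\<^bsub>U\<^esub> y)" using x y by (simp add: t0_def F_mult sum_distrib_left)
  finally show "(\<Sum>c\<in>{1..n}. pure_tensor UH.H UH.H (t0 b c) (t0 c a)) (UH.ev x y) = t0 b a (x \<otimes>\<^bsub>U\<^esub> y)" .
qed

text \<open>The antipode reverses the product of the arguments and the indices are transposed, so
  the order of matrix multiplication is restored. The factor of the reversal depends on the degrees
  of \<open>x\<close> and \<open>y\<close>, so homogeneous arguments are taken; where a term is
  nonzero it coincides with the constant from the pairing.\<close>

lemma comult_tb0: "a \<in> {1..n} \<Longrightarrow> b \<in> {1..n} \<Longrightarrow> comult UH.H (tb0 b a) = (\<Sum>c\<in>{1..n}. pure_tensor UH.H UH.H (tb0 b c) (tb0 c a))"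
proof (rule UH.comult_H_eqI)
  assume a: "a \<in> {1..n}" and b: "b \<in> {1..n}"
  show "(\<Sum>c\<in>{1..n}. pure_tensor UH.H UH.H (tb0 b c) (tb0 c a)) \<in> UH.HH.TT"
    by (rule UH.sum_pt_sub) (use UH.Fh_FD[OF tb0_Fh] a b in auto)
  fix x y assume x: "x \<in> carrier U" and y: "y \<in> carrier U"
  have l: "lin U (tb0 i j)" if "i \<in> {1..n}" "j \<in> {1..n}" for i j by (rule UH.Fh_lin[OF tb0_Fh[OF that]])
  have "(\<Sum>c\<in>{1..n}. pure_tensor UH.H UH.H (tb0 b c) (tb0 c a)) (UH.ev x y) =
     (\<Sum>c\<in>{1..n}. \<omega> (\<gamma> b - \<gamma> c) (\<gamma> c - \<gamma> a) * (tb0 b c x * tb0 c a y))"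
    by (rule UH.sum_pt_ev) (use tb0_Fh a b x y in auto)
  also have "\<dots> = tb0 b a (x \<otimes>\<^bsub>U\<^esub> y)"
  proof (rule UH.Bil_ext[OF _ _ _ x y])
    show "(\<lambda>x y. \<Sum>c\<in>{1..n}. \<omega> (\<gamma> b - \<gamma> c) (\<gamma> c - \<gamma> a) * (tb0 b c x * tb0 c a y)) \<in> UU.Bil"
    proof (rule bilinI; rule lin_sum; rule lin_times)
      show "lin U (\<lambda>x. tb0 b c x * tb0 c a y)" if "c \<in> {1..n}" for c y by (rule lin_times'[OF l[OF b that]])
      show "lin U (\<lambda>y. tb0 b c x * tb0 c a y)" if "c \<in> {1..n}" for c x by (rule lin_times[OF l[OF that a]])
    qed
    show "(\<lambda>x y. tb0 b a (x \<otimes>\<^bsub>U\<^esub> y)) \<in> UU.Bil"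
      by (rule bilinI) (auto intro: UU.lin_lmult UU.lin_rmult l a b)
    fix \<alpha> \<beta> x y assume x: "x \<in> grade U \<alpha>" and y: "y \<in> grade U \<beta>"
    note c = UU.grade_carrier[OF x] UU.grade_carrier[OF y]
    note SS = S_closed[OF c(1)] S_closed[OF c(2)]
    have "tb0 b a (x \<otimes>\<^bsub>U\<^esub> y) = \<omega> \<alpha> \<beta> * F a b (S0 y \<otimes>\<^bsub>U\<^esub> S0 x)"
      using c SS lin_smult[OF F_lin] by (simp add: tb0_def S_mult[OF x y])
    also have "\<dots> = (\<Sum>k\<in>{1..n}. \<omega> \<alpha> \<beta> * (F a k (S0 y) * F k b (S0 x)))" by (simp add: F_mult SS sum_distrib_left)
    also have "\<dots> = (\<Sum>k\<in>{1..n}. \<omega> (\<gamma> b - \<gamma> k) (\<gamma> k - \<gamma> a) * (tb0 b k x * tb0 k a y))"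
    proof (rule sum.cong)
      fix k assume k: "k \<in> {1..n}"
      show "\<omega> \<alpha> \<beta> * (F a k (S0 y) * F k b (S0 x)) = \<omega> (\<gamma> b - \<gamma> k) (\<gamma> k - \<gamma> a) * (tb0 b k x * tb0 k a y)"
      proof (cases "\<alpha> = \<gamma> k - \<gamma> b \<and> \<beta> = \<gamma> a - \<gamma> k")
        case True
        then have "\<omega> \<alpha> \<beta> = \<omega> (- (\<gamma> b - \<gamma> k)) (- (\<gamma> k - \<gamma> a))" by simp
        also have "\<dots> = \<omega> (\<gamma> b - \<gamma> k) (\<gamma> k - \<gamma> a)" by (simp only: om_minus inverse_inverse_eq)
        finally show ?thesis using c by (simp add: tb0_def)
      next
        case False
        then have "F a k (S0 y) * F k b (S0 x) = 0"
          using F_hom[OF k a S_grade[OF y]] F_hom[OF b k S_grade[OF x]] by auto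
        then show ?thesis using c by (simp add: tb0_def) (auto simp: mult.commute)
      qed
    qed simp
    finally show "(\<Sum>k\<in>{1..n}. \<omega> (\<gamma> b - \<gamma> k) (\<gamma> k - \<gamma> a) * (tb0 b k x * tb0 k a y)) = tb0 b a (x \<otimes>\<^bsub>U\<^esub> y)" ..
  qed
  finally show "(\<Sum>c\<in>{1..n}. pure_tensor UH.H UH.H (tb0 b c) (tb0 c a)) (UH.ev x y) = tb0 b a (x \<otimes>\<^bsub>U\<^esub> y)" .
qed

lemma gen_mono: "Z \<subseteq> Z' \<Longrightarrow> gen_subalgebra M Z \<subseteq> gen_subalgebra M Z'"
proof
  fix x assume "Z \<subseteq> Z'" "x \<in> gen_subalgebra M Z"
  from this(2,1) show "x \<in> gen_subalgebra M Z'"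
    by (induction rule: gen_subalgebra.induct) (auto intro: gen_subalgebra.intros)
qed

text \<open>The comultiplication maps each of \<open>X\<close>, \<open>Y\<close> and their union
  into its own tensor square. The antipode interchanges \<open>X\<close> and \<open>Y\<close> up to
  scalars, which is why the Hopf statement concerns the union.\<close>

lemma matrix_coeffs_hopf:
  assumes X: "X = {t b a |a b. a \<in> {1..n} \<and> b \<in> {1..n}}" and Y: "Y = {tbar b a |a b. a \<in> {1..n} \<and> b \<in> {1..n}}"
  shows "hopf_subalgebra \<omega> UH.H (gen_subalgebra UH.H (X \<union> Y))
    \<and> (\<forall>a\<in>{1..n}. \<forall>b\<in>{1..n}.
         comult UH.H (t b a) = (\<Sum>c\<in>{1..n}. pure_tensor UH.H UH.H (t b c) (t c a))
       \<and> comult UH.H (tbar b a) = (\<Sum>c\<in>{1..n}. pure_tensor UH.H UH.H (tbar b c) (tbar c a))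
       \<and> counit UH.H (t b a) = (if a = b then 1 else 0)
       \<and> counit UH.H (tbar b a) = (if a = b then 1 else 0)
       \<and> antipode UH.H (t b a) = \<omega> (\<gamma> a - \<gamma> b) (\<gamma> a) \<odot>\<^bsub>UH.H\<^esub> tbar a b
       \<and> antipode UH.H (tbar a b) = \<omega> (\<gamma> a) (\<gamma> a - \<gamma> b) \<odot>\<^bsub>UH.H\<^esub> t b a)
    \<and> gen_subalgebra UH.H X \<subseteq> gen_subalgebra UH.H (X \<union> Y) \<and> bi_subalgebra \<omega> UH.H (gen_subalgebra UH.H X)
    \<and> gen_subalgebra UH.H Y \<subseteq> gen_subalgebra UH.H (X \<union> Y) \<and> bi_subalgebra \<omega> UH.H (gen_subalgebra UH.H Y)
    \<and> (\<forall>r. comult UH.H ` product_span UH.H X r \<subseteq> tensor_sub UH.H UH.H (product_span UH.H X r) (product_span UH.H X r)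
         \<and> comult UH.H ` product_span UH.H Y r \<subseteq> tensor_sub UH.H UH.H (product_span UH.H Y r) (product_span UH.H Y r))"
proof -
  have te: "t b a = t0 b a" "tbar b a = tb0 b a" if "a \<in> {1..n}" "b \<in> {1..n}" for a b
    unfolding t_eq tbar_eq using that by simp_all
  have XF: "X \<subseteq> (\<Union>\<phi>. UH.Fh \<phi>)" and YF: "Y \<subseteq> (\<Union>\<phi>. UH.Fh \<phi>)"
  proof -
    show "X \<subseteq> (\<Union>\<phi>. UH.Fh \<phi>)"
    proof
      fix f assume "f \<in> X"
      then obtain a b where ab: "f = t b a" "a \<in> {1..n}" "b \<in> {1..n}" unfolding X by blast
      show "f \<in> (\<Union>\<phi>. UH.Fh \<phi>)" unfolding ab(1) te(1)[OF ab(2,3)] using t0_Fh[OF ab(2,3)] by blast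
    qed
    show "Y \<subseteq> (\<Union>\<phi>. UH.Fh \<phi>)"
    proof
      fix f assume "f \<in> Y"
      then obtain a b where ab: "f = tbar b a" "a \<in> {1..n}" "b \<in> {1..n}" unfolding Y by blast
      show "f \<in> (\<Union>\<phi>. UH.Fh \<phi>)" unfolding ab(1) te(2)[OF ab(2,3)] using tb0_Fh[OF ab(3,2)] by blast
    qed
  qed
  have com: "comult UH.H (t b a) = (\<Sum>c\<in>{1..n}. pure_tensor UH.H UH.H (t b c) (t c a))"
    "comult UH.H (tbar b a) = (\<Sum>c\<in>{1..n}. pure_tensor UH.H UH.H (tbar b c) (tbar c a))"
    if "a \<in> {1..n}" "b \<in> {1..n}" for a b
    unfolding te[OF that] comult_t0[OF that] comult_tb0[OF that] by (rule sum.cong; use te that in simp)+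
  have ant: "antipode UH.H (t b a) = \<omega> (\<gamma> a - \<gamma> b) (\<gamma> a) \<odot>\<^bsub>UH.H\<^esub> tbar a b"
    "antipode UH.H (tbar a b) = \<omega> (\<gamma> a) (\<gamma> a - \<gamma> b) \<odot>\<^bsub>UH.H\<^esub> t b a"
    if "a \<in> {1..n}" "b \<in> {1..n}" for a b
    unfolding te[OF that] te[OF that(2,1)] tb0_antipode antipode_tb0 by simp_all
  have cou: "counit UH.H (t b a) = (if a = b then 1 else 0)" "counit UH.H (tbar b a) = (if a = b then 1 else 0)"
    if "a \<in> {1..n}" "b \<in> {1..n}" for a b
    unfolding te[OF that] using that F_one by (auto simp: t0_def tb0_def S_one)
  have cX: "comult UH.H f \<in> tensor_sub UH.H UH.H X X" if f: "f \<in> X" for f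
  proof -
    obtain a b where ab: "f = t b a" "a \<in> {1..n}" "b \<in> {1..n}" using f X by blast
    show ?thesis unfolding ab(1) com(1)[OF ab(2,3)] by (rule UH.sum_pt_sub) (use ab X in blast)+
  qed
  have cY: "comult UH.H f \<in> tensor_sub UH.H UH.H Y Y" if f: "f \<in> Y" for f
  proof -
    obtain a b where ab: "f = tbar b a" "a \<in> {1..n}" "b \<in> {1..n}" using f Y by blast
    show ?thesis unfolding ab(1) com(2)[OF ab(2,3)] by (rule UH.sum_pt_sub) (use ab Y in blast)+
  qed
  have cXY: "comult UH.H f \<in> tensor_sub UH.H UH.H (X \<union> Y) (X \<union> Y)" if "f \<in> X \<union> Y" for f
  proof -
    have "comult UH.H f \<in> tensor_sub UH.H UH.H X X \<or> comult UH.H f \<in> tensor_sub UH.H UH.H Y Y" using that cX cY by blast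
    then show ?thesis unfolding tensor_sub_def
      using UH.HH.ts_mono[of "X \<times> X" "(X \<union> Y) \<times> (X \<union> Y)"] UH.HH.ts_mono[of "Y \<times> Y" "(X \<union> Y) \<times> (X \<union> Y)"] by blast
  qed
  have S: "antipode UH.H f \<in> gen_subalgebra UH.H (X \<union> Y)" if f: "f \<in> X \<union> Y" for f
  proof -
    consider a b where "f = t b a" "a \<in> {1..n}" "b \<in> {1..n}" | a b where "f = tbar a b" "a \<in> {1..n}" "b \<in> {1..n}"
      using f X Y by blast
    then show ?thesis
    proof cases
      case 1
      have "tbar a b \<in> X \<union> Y" using 1 Y by blast
      then show ?thesis unfolding 1(1) ant(1)[OF 1(2,3)] by (intro gen_subalgebra.smult gen_subalgebra.base)
    next
      case 2
      have "t b a \<in> X \<union> Y" using 2 X by blast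
      then show ?thesis unfolding 2(1) ant(2)[OF 2(2,3)] by (intro gen_subalgebra.smult gen_subalgebra.base)
    qed
  qed
  show ?thesis
    by (intro conjI ballI allI UH.gen_hopf_subalgebra[OF _ cXY S] UH.gen_bi_subalgebra[OF XF cX] UH.gen_bi_subalgebra[OF YF cY]
        UH.product_span_coideal[OF XF cX] UH.product_span_coideal[OF YF cY] com ant cou gen_mono)
      (use XF YF in auto)
qed

end

theorem lemma6p5:
  fixes \<omega> :: "'g::ab_group_add \<Rightarrow> 'g \<Rightarrow> complex"
    and scale :: "complex \<Rightarrow> 'v::ab_group_add \<Rightarrow> 'v"
    and V :: "'g \<Rightarrow> 'v set"
    and n :: nat
    and e :: "nat \<Rightarrow> 'v"
    and \<gamma> :: "nat \<Rightarrow> 'g"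
    and H :: "('g, 'v env \<Rightarrow> complex) hopf"
    and X Xbar :: "('v env \<Rightarrow> complex) set"
    and t tbar :: "nat \<Rightarrow> nat \<Rightarrow> 'v env \<Rightarrow> complex"
  assumes "commutative_factor \<omega>"
    and "graded_vector_space scale V"
    and "homogeneous_basis scale V n e \<gamma>"
    and H_def: "H = finite_dual \<omega> (env \<omega> scale V)"
    and t_def: "t = coeff_t \<omega> scale V n e \<gamma>"
    and tbar_def: "tbar = coeff_tbar \<omega> scale V n e \<gamma>"
    and X_def: "X = {t b a |a b. a \<in> {1..n} \<and> b \<in> {1..n}}"
    and Xbar_def: "Xbar = {tbar b a |a b. a \<in> {1..n} \<and> b \<in> {1..n}}"
  shows "hopf_subalgebra \<omega> H (gen_subalgebra H (X \<union> Xbar))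
    \<and> (\<forall>a\<in>{1..n}. \<forall>b\<in>{1..n}.
         comult H (t b a) = (\<Sum>c\<in>{1..n}. pure_tensor H H (t b c) (t c a))
       \<and> comult H (tbar b a) = (\<Sum>c\<in>{1..n}. pure_tensor H H (tbar b c) (tbar c a))
       \<and> counit H (t b a) = (if a = b then 1 else 0)
       \<and> counit H (tbar b a) = (if a = b then 1 else 0)
       \<and> antipode H (t b a) = \<omega> (\<gamma> a - \<gamma> b) (\<gamma> a) \<odot>\<^bsub>H\<^esub> tbar a b
       \<and> antipode H (tbar a b) = \<omega> (\<gamma> a) (\<gamma> a - \<gamma> b) \<odot>\<^bsub>H\<^esub> t b a)
    \<and> gen_subalgebra H X \<subseteq> gen_subalgebra H (X \<union> Xbar) \<and> bi_subalgebra \<omega> H (gen_subalgebra H X)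
    \<and> gen_subalgebra H Xbar \<subseteq> gen_subalgebra H (X \<union> Xbar) \<and> bi_subalgebra \<omega> H (gen_subalgebra H Xbar)
    \<and> (\<forall>r. comult H ` product_span H X r \<subseteq> tensor_sub H H (product_span H X r) (product_span H X r)
         \<and> comult H ` product_span H Xbar r \<subseteq> tensor_sub H H (product_span H Xbar r) (product_span H Xbar r))"
proof -
  interpret gvs \<omega> scale V n e \<gamma>
    by unfold_locales (fact assms(1-3))+
  show ?thesis
    unfolding H_def by (rule matrix_coeffs_hopf[OF X_def[unfolded t_def] Xbar_def[unfolded tbar_def], folded t_def tbar_def])
qed

end
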